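(* Let $d\ge 2$ and let $\phi:\mathbb{R}^d\to\mathbb{R}$ satisfy: (1) $\int_{\mathbb{R}^d}e^{-\phi}\,dx=1$ and $\int_{\mathbb{R}^d}x\,e^{-\phi(x)}\,dx=0$; (2) $\phi\in C^2(\mathbb{R}^d;\mathbb{R})$ and for every $\varepsilon>0$ there is a constant $C_\varepsilon$ such that $|D^2\phi(x)|\le\varepsilon|\nabla\phi(x)|^2+C_\varepsilon$ for all $x\in\mathbb{R}^d$; (3) the Poincaré inequality with (optimal) constant $C_P$: $\int_{\mathbb{R}^d}|f-\langle f\rangle|^2e^{-\phi}\,dx\le C_P\int_{\mathbb{R}^d}|\nabla f|^2e^{-\phi}\,dx$ for all $f\in C_c^\infty(\mathbb{R}^d;\mathbb{R})$. Then there are constants $C_K$ (Korn), $C_{PK}$ (Poincaré-Korn) and $C_{SPK}$ (strong Poincaré-Korn), with explicit bounds involving only $C_P$, $C_\phi$ and $C_\phi'$, such that for all vector fields $u\in H^1$: $$\inf_{R\in\mathcal{R}}\|D(u-R)\|^2=\|Du-\mathfrak{P}(Du)\|^2\le C_K\,\|D^su\|^2,$$ $$\inf_{R\in\mathcal{R}}\|u-\langle u\rangle-R\|^2=\|u-\langle u\rangle-\mathbb{P}(u)\|^2\le C_{PK}\,\|D^su\|^2,$$ $$\big\|\lfloor\nabla\phi\rceil\,\big(u-\langle u\rangle-\mathbb{P}(u)\big)\big\|^2\le C_{SPK}\,\|D^su\|^2.$$ Moreover, in the Gaussian case $\phi(x)=\frac12|x|^2+\frac d2\ln(2\pi)$,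 the optimal constants are $C_K=4$ and $C_{PK}=2$.
   Context: $|\cdot|$ is the Euclidean norm on $\mathbb{R}$, $\mathbb{R}^d$ and on the set $\mathfrak{M}$ of real $d\times d$ matrices (seen as vectors of $\mathbb{R}^{d^2}$). $\|\cdot\|$ is the norm of $L^2=L^2(e^{-\phi}dx)$ for functions with values in $\mathbb{R}$, $\mathbb{R}^d$ or $\mathfrak{M}$, i.e. $\|f\|^2=\int_{\mathbb{R}^d}|f|^2e^{-\phi}dx$. $\langle f\rangle=\int_{\mathbb{R}^d} f\,e^{-\phi}dx$ (componentwise). $H^1$ is the space of vector fields $u:\mathbb{R}^d\to\mathbb{R}^d$ with $u\in L^2$ and $Du\in L^2$. $Du=(\partial_ju_i)_{i,j}$, and $(D^su)_{ij}=\frac12(\partial_ju_i+\partial_iu_j)$ is its symmetric part. $\lfloor\nabla\phi\rceil:=\sqrt{1+|\nabla\phi|^2}$. $\mathfrak{M}^a$ is the space of skew-symmetric $d\times d$ real matrices and $\mathcal{R}=\{x\mapsto Ax: A\in\mathfrak{M}^a\}$ (infinitesimal rotations). $\mathbb{P}$ is the $L^2$-orthogonal projection of vector fields onto $\mathcal{R}$; $\mathfrak{P}$ is the $L^2$-orthogonal projection of matrix-valued functions onto the constant matrices in $\mathfrak{M}^a$. $C_\phi>8$ and $C_\phi'>C_\phi$ are constants (which exist by hypothesis (2)) such that for all $x\in\mathbb{R}^d$: $4\sqrt d\,|D^2\phi(x)|\le|\nabla\phi(x)|^2+C_\phi-1$ and $4|D^2\phi(x)|\le C_\phi^{-1/2}\big(|\nabla\phi(x)|^2+C_\phi'\big)$.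 *)

theory Defs
  imports "HOL-Analysis.Analysis"
begin

section \<open>Differential calculus on \<open>\<real>\<^sup>d\<close>\<close>

definition pd :: "'n::finite \<Rightarrow> (real^'n \<Rightarrow> real) \<Rightarrow> real^'n \<Rightarrow> real" where
  "pd i f x = frechet_derivative f (at x) (axis i 1)"

definition grad :: "(real^'n::finite \<Rightarrow> real) \<Rightarrow> real^'n \<Rightarrow> real^'n" where
  "grad f x = (\<chi> i. pd i f x)"

definition hess :: "(real^'n::finite \<Rightarrow> real) \<Rightarrow> real^'n \<Rightarrow> real^'n^'n" where
  "hess f x = (\<chi> i j. pd j (pd i f) x)"

primrec Ck :: "nat \<Rightarrow> (real^'n::finite \<Rightarrow> real) \<Rightarrow> bool" where
  "Ck 0 f \<longleftrightarrow> continuous_on UNIV f"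
| "Ck (Suc k) f \<longleftrightarrow> (\<forall>x. f differentiable (at x)) \<and> (\<forall>i. Ck k (pd i f))"

definition test_functions :: "(real^'n::finite \<Rightarrow> real) set" where
  "test_functions = {f. (\<forall>k. Ck k f) \<and> compact (closure {x. f x \<noteq> 0})}"

section \<open>The weighted space \<open>L\<^sup>2\<close>\<close>

definition gibbs :: "(real^'n::finite \<Rightarrow> real) \<Rightarrow> (real^'n) measure" where
  "gibbs \<phi> = density lborel (\<lambda>x. ennreal (exp (- \<phi> x)))"

text \<open>The squared norm is a nonnegative extended real, so that an inequality with a finite
  right-hand side also asserts that its left-hand side is finite.\<close>

definition L2sq :: "(real^'n::finite \<Rightarrow> real) \<Rightarrow> (real^'n \<Rightarrow> 'b::real_normed_vector) \<Rightarrow> ennreal" where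
  "L2sq \<phi> f = (\<integral>\<^sup>+x. ennreal ((norm (f x))\<^sup>2) \<partial>gibbs \<phi>)"

definition L2 :: "(real^'n::finite \<Rightarrow> real) \<Rightarrow> (real^'n \<Rightarrow> 'b::real_normed_vector) set" where
  "L2 \<phi> = {f. f \<in> borel_measurable borel \<and> L2sq \<phi> f < \<infinity>}"

definition mean :: "(real^'n::finite \<Rightarrow> real) \<Rightarrow> (real^'n \<Rightarrow> 'b::{banach,second_countable_topology}) \<Rightarrow> 'b" where
  "mean \<phi> f = (\<integral>x. f x \<partial>gibbs \<phi>)"

text \<open>Orthogonal projection onto \<open>V\<close>. It is used only for finite-dimensional spaces \<open>V\<close> of
  continuous functions, where it is unique as a function and not only up to null sets.\<close>

definition L2_proj ::
    "(real^'n::finite \<Rightarrow> real) \<Rightarrow> (real^'n \<Rightarrow> 'b::euclidean_space) set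
      \<Rightarrow> (real^'n \<Rightarrow> 'b) \<Rightarrow> real^'n \<Rightarrow> 'b" where
  "L2_proj \<phi> V f = (THE p. p \<in> V \<and> (\<forall>q\<in>V. (\<integral>x. (f x - p x) \<bullet> q x \<partial>gibbs \<phi>) = 0))"

definition skew :: "(real^'n^'n::finite) set" where
  "skew = {A. transpose A = - A}"

definition rotations :: "(real^'n::finite \<Rightarrow> real^'n) set" where
  "rotations = {(\<lambda>x. A *v x) | A. A \<in> skew}"

definition proj_rot :: "(real^'n::finite \<Rightarrow> real) \<Rightarrow> (real^'n \<Rightarrow> real^'n) \<Rightarrow> real^'n \<Rightarrow> real^'n" where
  "proj_rot \<phi> u = L2_proj \<phi> rotations u"

definition proj_skew ::
    "(real^'n::finite \<Rightarrow> real) \<Rightarrow> (real^'n \<Rightarrow> real^'n^'n) \<Rightarrow> real^'n \<Rightarrow> real^'n^'n" where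
  "proj_skew \<phi> M = L2_proj \<phi> {(\<lambda>x. A) | A. A \<in> skew} M"

section \<open>Weak derivatives and the weighted space \<open>H\<^sup>1\<close>\<close>

definition locally_integrable :: "(real^'n::finite \<Rightarrow> 'b::{banach,second_countable_topology}) \<Rightarrow> bool" where
  "locally_integrable f \<longleftrightarrow> (\<forall>K. compact K \<longrightarrow> set_integrable lborel K f)"

definition weak_jacobian :: "(real^'n::finite \<Rightarrow> real^'n) \<Rightarrow> (real^'n \<Rightarrow> real^'n^'n) \<Rightarrow> bool" where
  "weak_jacobian u G \<longleftrightarrow> locally_integrable u \<and> locally_integrable G \<and>
     (\<forall>\<psi>\<in>test_functions. \<forall>i j.
        (\<integral>x. u x $ i * pd j \<psi> x \<partial>lborel) = - (\<integral>x. G x $ i $ j * \<psi> x \<partial>lborel))"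

text \<open>The weak Jacobian matrix is unique up to null sets; \<open>weak_D u\<close> is one representative.
  It is only meaningful if \<open>u\<close> has a weak Jacobian matrix.\<close>

definition weak_D :: "(real^'n::finite \<Rightarrow> real^'n) \<Rightarrow> real^'n \<Rightarrow> real^'n^'n" where
  "weak_D u = (SOME G. weak_jacobian u G)"

definition weak_Ds :: "(real^'n::finite \<Rightarrow> real^'n) \<Rightarrow> real^'n \<Rightarrow> real^'n^'n" where
  "weak_Ds u x = (1/2) *\<^sub>R (weak_D u x + transpose (weak_D u x))"

definition H1 :: "(real^'n::finite \<Rightarrow> real) \<Rightarrow> (real^'n \<Rightarrow> real^'n) set" where
  "H1 \<phi> = {u. u \<in> L2 \<phi> \<and> (\<exists>G. weak_jacobian u G \<and> G \<in> L2 \<phi>)}"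

section \<open>Assumptions on the potential\<close>

definition normalized :: "(real^'n::finite \<Rightarrow> real) \<Rightarrow> bool" where
  "normalized \<phi> \<longleftrightarrow> has_bochner_integral lborel (\<lambda>x. exp (- \<phi> x)) 1 \<and>
     has_bochner_integral lborel (\<lambda>x. exp (- \<phi> x) *\<^sub>R x) 0"

definition regular_potential :: "(real^'n::finite \<Rightarrow> real) \<Rightarrow> bool" where
  "regular_potential \<phi> \<longleftrightarrow> Ck 2 \<phi> \<and>
     (\<forall>\<epsilon>>0. \<exists>C. \<forall>x. norm (hess \<phi> x) \<le> \<epsilon> * (norm (grad \<phi> x))\<^sup>2 + C)"

definition poincare :: "(real^'n::finite \<Rightarrow> real) \<Rightarrow> real \<Rightarrow> bool" where
  "poincare \<phi> C \<longleftrightarrow> (\<forall>f\<in>test_functions.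
     (\<integral>x. (f x - mean \<phi> f)\<^sup>2 \<partial>gibbs \<phi>) \<le> C * (\<integral>x. (norm (grad f x))\<^sup>2 \<partial>gibbs \<phi>))"

definition optimal :: "(real \<Rightarrow> bool) \<Rightarrow> real \<Rightarrow> bool" where
  "optimal P C \<longleftrightarrow> P C \<and> (\<forall>C'. P C' \<longrightarrow> C \<le> C')"

text \<open>\<open>C\<close> and \<open>C'\<close> are the constants $C_\phi$ and $C_\phi'$.\<close>

definition growth_constants :: "(real^'n::finite \<Rightarrow> real) \<Rightarrow> real \<Rightarrow> real \<Rightarrow> bool" where
  "growth_constants \<phi> C C' \<longleftrightarrow> 8 < C \<and> C < C' \<and>
     (\<forall>x. 4 * sqrt (real CARD('n)) * norm (hess \<phi> x) \<le> (norm (grad \<phi> x))\<^sup>2 + C - 1) \<and>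
     (\<forall>x. 4 * norm (hess \<phi> x) \<le> ((norm (grad \<phi> x))\<^sup>2 + C') / sqrt C)"

lemma growth_constants_exist:
  fixes \<phi> :: "real^'n::finite \<Rightarrow> real"
  assumes "regular_potential \<phi>"
  shows "\<exists>C C'. growth_constants \<phi> C C'"
proof -
  have growth: "\<exists>C. \<forall>x. norm (hess \<phi> x) \<le> \<epsilon> * (norm (grad \<phi> x))\<^sup>2 + C" if "\<epsilon> > 0" for \<epsilon>
    using assms that by (simp add: regular_potential_def)
  define s where "s = 4 * sqrt (real CARD('n))"
  have s: "s > 0" by (simp add: s_def)
  obtain A where A: "norm (hess \<phi> x) \<le> (1/s) * (norm (grad \<phi> x))\<^sup>2 + A" for x
    using growth[of "1/s"] s by auto
  define C where "C = max 9 (s * A + 1)"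
  have C: "C > 8" by (simp add: C_def)
  have first: "s * norm (hess \<phi> x) \<le> (norm (grad \<phi> x))\<^sup>2 + C - 1" for x
  proof -
    have "s * norm (hess \<phi> x) \<le> s * ((1/s) * (norm (grad \<phi> x))\<^sup>2 + A)"
      using A s by (intro mult_left_mono) auto
    also have "\<dots> = (norm (grad \<phi> x))\<^sup>2 + s * A"
      using s by (simp add: field_simps)
    finally show ?thesis by (simp add: C_def)
  qed
  define t where "t = 4 * sqrt C"
  have t: "t > 0" using C by (simp add: t_def)
  obtain B where B: "norm (hess \<phi> x) \<le> (1/t) * (norm (grad \<phi> x))\<^sup>2 + B" for x
    using growth[of "1/t"] t by auto
  define C' where "C' = max (C + 1) (t * B)"
  have second: "4 * norm (hess \<phi> x) \<le> ((norm (grad \<phi> x))\<^sup>2 + C') / sqrt C" for x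
  proof -
    have "t * norm (hess \<phi> x) \<le> t * ((1/t) * (norm (grad \<phi> x))\<^sup>2 + B)"
      using B t by (intro mult_left_mono) auto
    also have "\<dots> = (norm (grad \<phi> x))\<^sup>2 + t * B"
      using t by (simp add: field_simps)
    also have "\<dots> \<le> (norm (grad \<phi> x))\<^sup>2 + C'" by (simp add: C'_def)
    finally show ?thesis using C by (simp add: t_def field_simps)
  qed
  have "growth_constants \<phi> C C'"
    using C first second by (auto simp: growth_constants_def s_def C'_def)
  then show ?thesis by blast
qed

definition gaussian :: "real^'n::finite \<Rightarrow> real" where
  "gaussian x = (norm x)\<^sup>2 / 2 + real CARD('n) / 2 * ln (2 * pi)"

section \<open>Korn and Poincare-Korn inequalities\<close>

definition centred :: "(real^'n::finite \<Rightarrow> real) \<Rightarrow> (real^'n \<Rightarrow> real^'n) \<Rightarrow> real^'n \<Rightarrow> real^'n" where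
  "centred \<phi> u x = u x - mean \<phi> u - proj_rot \<phi> u x"

text \<open>The constant is required to be nonnegative because \<open>ennreal\<close> sends negative reals to \<open>0\<close>.\<close>

definition korn :: "(real^'n::finite \<Rightarrow> real) \<Rightarrow> real \<Rightarrow> bool" where
  "korn \<phi> C \<longleftrightarrow> 0 \<le> C \<and> (\<forall>u\<in>H1 \<phi>.
     L2sq \<phi> (\<lambda>x. weak_D u x - proj_skew \<phi> (weak_D u) x) \<le> ennreal C * L2sq \<phi> (weak_Ds u))"

definition poincare_korn :: "(real^'n::finite \<Rightarrow> real) \<Rightarrow> real \<Rightarrow> bool" where
  "poincare_korn \<phi> C \<longleftrightarrow> 0 \<le> C \<and> (\<forall>u\<in>H1 \<phi>.
     L2sq \<phi> (centred \<phi> u) \<le> ennreal C * L2sq \<phi> (weak_Ds u))"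

definition strong_poincare_korn :: "(real^'n::finite \<Rightarrow> real) \<Rightarrow> real \<Rightarrow> bool" where
  "strong_poincare_korn \<phi> C \<longleftrightarrow> 0 \<le> C \<and> (\<forall>u\<in>H1 \<phi>.
     L2sq \<phi> (\<lambda>x. sqrt (1 + (norm (grad \<phi> x))\<^sup>2) *\<^sub>R centred \<phi> u x)
       \<le> ennreal C * L2sq \<phi> (weak_Ds u))"

text \<open>
  Explicit dimension-free bounds on the three constants, in terms of the Poincare constant \<open>P\<close>,
  $C_\phi$ (\<open>C\<close>) and $C_\phi'$ (\<open>C'\<close>). Where they come from:

  \<^item> Integrating $\nabla\cdot(g^2 \nabla\phi)$ by parts and using
    $|\Delta\phi| \le \sqrt d\, |D^2\phi|$, the first growth condition gives
    $\|\sqrt{1+|\nabla\phi|^2}\, g\|^2 \le 8 \|\nabla g\|^2 + C_\phi \|g\|^2$.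

  \<^item> Let $a$ be the skew part and $s$ the symmetric part of $Du$, and let $h$ be the solution of
    $\nabla^*\nabla h = a - \langle a\rangle$. Since
    $\partial_k a_{ij} = \partial_j s_{ik} - \partial_i s_{jk}$, the number
    $\|a - \langle a\rangle\|^2$ is twice the inner product of $s$ with
    $(\sum_j \partial_j^*\partial_k h_{ij})_{i,k}$. The Bochner identity, the estimate above and
    the second growth condition bound the square of the norm of the latter by
    $(6 + \frac54 P C_\phi') \|a - \langle a\rangle\|^2$.

  \<^item> The second bound is the first one times the Poincare constant. The third one uses
    $\frac13 (C_\phi - 1) \|Ax\|^2 \ge |A|^2$, which follows from
    $\int (x\cdot e)\, \partial_e\phi\, e^{-\phi} = 1$ for unit vectors $e$.

  The numerical factors are rounded up.
\<close>

definition korn_bound :: "real \<Rightarrow> real \<Rightarrow> real \<Rightarrow> real" where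
  "korn_bound P C C' = 32 * (1 + P * C')"

definition poincare_korn_bound :: "real \<Rightarrow> real \<Rightarrow> real \<Rightarrow> real" where
  "poincare_korn_bound P C C' = P * korn_bound P C C'"

definition strong_poincare_korn_bound :: "real \<Rightarrow> real \<Rightarrow> real \<Rightarrow> real" where
  "strong_poincare_korn_bound P C C' = C * (1 + 4 * P) * korn_bound P C C'"

end

theory Submission
  imports Defs "HOL-Probability.Distributions"
begin

text \<open>Write \<open>L = \<Sum>\<^sub>k \<partial>\<^sub>k\<^sup>* \<partial>\<^sub>k\<close> in \<open>L\<^sup>2\<close> of the Gibbs measure. A square integrable \<open>g\<close> that is
  orthogonal to all \<open>L h\<close> with \<open>h\<close> a test function is constant (a Caccioppoli estimate for its
  mollifications), so these \<open>L h\<close> are dense in the functions of mean zero. Hence the skew part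
  \<open>a\<close> of a Jacobian matrix, minus its mean, can be estimated by duality against \<open>L h\<close> only, without
  solving an equation: the identity \<open>\<partial>\<^sub>k a\<^sub>i\<^sub>j = \<partial>\<^sub>j s\<^sub>i\<^sub>k - \<partial>\<^sub>i s\<^sub>j\<^sub>k\<close> moves the derivatives to the symmetric
  part \<open>s\<close> and to \<open>\<partial>\<^sub>j\<^sup>* \<partial>\<^sub>k h\<close>, and the Bochner identity and the growth conditions control the
  latter by \<open>L h\<close>.

  For the Gaussian measure, \<open>\<parallel>\<Sum>\<^sub>j \<partial>\<^sub>j\<^sup>* u\<^sub>j\<parallel>\<^sup>2 \<ge> 0\<close> reads \<open>2 \<parallel>s\<parallel>\<^sup>2 \<ge> \<parallel>D u\<parallel>\<^sup>2 - \<parallel>u\<parallel>\<^sup>2\<close>, and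
  \<open>\<parallel>D u\<parallel>\<^sup>2 \<ge> 2 \<parallel>u\<parallel>\<^sup>2\<close> if \<open>u\<close> is orthogonal to the affine fields. Together these give the constants
  \<open>4\<close> and \<open>2\<close>. Equality holds if \<open>u\<close> is quadratic and \<open>\<Sum>\<^sub>j \<partial>\<^sub>j\<^sup>* u\<^sub>j = 0\<close>.\<close>

section \<open>The Hilbert space of square integrable functions\<close>

text \<open>Two losses of smoothness shape the argument. Since \<phi> is only C^2, no regularity
  theory is at hand for a residual orthogonal to all \<open>LL h\<close>; its constancy has to come
  from an energy bound of size 1/R^2 on balls of radius R. And since \<open>w * v\<close> is no test
  function even if \<open>v\<close> is one, every weak identity has to be extended from test
  functions to C^1 functions before the weight can enter. Density of test functions in weighted H^1
  is not assumed anywhere: it rests on the Poincare inequality for weakly differentiable functions,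
  which itself is obtained by duality. The rotation closest to \<open>u\<close> and the skew matrix
  closest to the Jacobian differ in general. The strong inequality pays for their difference with a
  lower bound on the norm of a linear field, a consequence of integrating (a . x) against the
  gradient of \<phi> by parts. The condition 8 < C makes the Hessian term at most 5/7 of the second
  derivatives, so that it can be absorbed. One triple of constants has to lie below the bounds of
  all admissible pairs C, C'; it is an infimum over these pairs.\<close>

definition sq_int :: "'a measure \<Rightarrow> ('a \<Rightarrow> 'b::euclidean_space) \<Rightarrow> bool" where
  "sq_int M f \<longleftrightarrow> f \<in> borel_measurable M \<and> integrable M (\<lambda>x. (norm (f x))\<^sup>2)"

text \<open>Real-valued, hence 0 by default if the square is not integrable; every use is
  accompanied by \<open>sq_int\<close>. The passage to the extended real \<open>L2sq\<close> of the
  theorem happens only at the end.\<close>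

definition nsq :: "'a measure \<Rightarrow> ('a \<Rightarrow> 'b::euclidean_space) \<Rightarrow> real" where
  "nsq M f = (\<integral>x. (norm (f x))\<^sup>2 \<partial>M)"

definition ip :: "'a measure \<Rightarrow> ('a \<Rightarrow> 'b::euclidean_space) \<Rightarrow> ('a \<Rightarrow> 'b) \<Rightarrow> real" where
  "ip M f g = (\<integral>x. f x \<bullet> g x \<partial>M)"

lemma sq_int_measurable: "sq_int M f \<Longrightarrow> f \<in> borel_measurable M"
  by (simp add: sq_int_def)

lemma sq_int_integrable: "sq_int M f \<Longrightarrow> integrable M (\<lambda>x. (norm (f x))\<^sup>2)"
  by (simp add: sq_int_def)

lemma sq_int_zero [simp]: "sq_int M (\<lambda>x. 0)"
  by (simp add: sq_int_def)

lemma sq_int_scaleR: "sq_int M f \<Longrightarrow> sq_int M (\<lambda>x. c *\<^sub>R f x)"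
  unfolding sq_int_def by (auto simp: power_mult_distrib)

lemma norm_add_sq_le: "(norm (a + b))\<^sup>2 \<le> 2 * (norm a)\<^sup>2 + 2 * (norm (b::'b::real_inner))\<^sup>2"
proof -
  have "0 \<le> (norm (a - b))\<^sup>2" by simp
  then show ?thesis
    by (simp add: power2_norm_eq_inner inner_diff_left inner_diff_right inner_add_left inner_add_right inner_commute)
qed

lemma sq_int_add:
  assumes "sq_int M f" "sq_int M g"
  shows "sq_int M (\<lambda>x. f x + g x)"
proof -
  have [measurable]: "f \<in> borel_measurable M" "g \<in> borel_measurable M"
    using assms by (auto simp: sq_int_def)
  have "integrable M (\<lambda>x. 2 * (norm (f x))\<^sup>2 + 2 * (norm (g x))\<^sup>2)"
    using assms by (auto simp: sq_int_def)
  then have "integrable M (\<lambda>x. (norm (f x + g x))\<^sup>2)"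
    by (rule Bochner_Integration.integrable_bound) (auto simp: norm_add_sq_le)
  then show ?thesis by (simp add: sq_int_def)
qed

lemma sq_int_diff:
  assumes "sq_int M f" "sq_int M g"
  shows "sq_int M (\<lambda>x. f x - g x)"
  using sq_int_add[OF assms(1) sq_int_scaleR[OF assms(2), of "-1"]] by simp

lemma sq_int_sum:
  "(\<And>i. i \<in> I \<Longrightarrow> sq_int M (f i)) \<Longrightarrow> sq_int M (\<lambda>x. \<Sum>i\<in>I. f i x)"
  by (induction I rule: infinite_finite_induct) (auto intro!: sq_int_add)

lemma sq_int_bound:
  fixes f :: "'a \<Rightarrow> 'b::euclidean_space" and g :: "'a \<Rightarrow> 'c::euclidean_space"
  assumes "sq_int M g" "f \<in> borel_measurable M" "\<And>x. norm (f x) \<le> C * norm (g x)"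
  shows "sq_int M f"
proof -
  have "integrable M (\<lambda>x. C\<^sup>2 * (norm (g x))\<^sup>2)"
    using assms(1) by (simp add: sq_int_def)
  moreover have "(norm (f x))\<^sup>2 \<le> C\<^sup>2 * (norm (g x))\<^sup>2" for x
    using power_mono[OF assms(3)[of x], of 2] by (simp add: power_mult_distrib)
  ultimately have "integrable M (\<lambda>x. (norm (f x))\<^sup>2)"
    using assms(2) by (elim Bochner_Integration.integrable_bound) auto
  then show ?thesis using assms(2) by (simp add: sq_int_def)
qed

lemma sq_int_inner:
  assumes "sq_int M f" "sq_int M g"
  shows "integrable M (\<lambda>x. f x \<bullet> g x)"
proof -
  have [measurable]: "f \<in> borel_measurable M" "g \<in> borel_measurable M"
    using assms by (auto simp: sq_int_def)
  have int: "integrable M (\<lambda>x. (norm (f x))\<^sup>2 + (norm (g x))\<^sup>2)"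
    using assms by (auto simp: sq_int_def)
  have "\<bar>f x \<bullet> g x\<bar> \<le> (norm (f x))\<^sup>2 + (norm (g x))\<^sup>2" for x
  proof -
    have "\<bar>f x \<bullet> g x\<bar> \<le> norm (f x) * norm (g x)" by (rule Cauchy_Schwarz_ineq2)
    also have "\<dots> \<le> (norm (f x))\<^sup>2 + (norm (g x))\<^sup>2"
      using sum_squares_bound[of "norm (f x)" "norm (g x)"]
        mult_nonneg_nonneg[OF norm_ge_zero[of "f x"] norm_ge_zero[of "g x"]] by linarith
    finally show ?thesis .
  qed
  then show ?thesis
    by (intro Bochner_Integration.integrable_bound[OF int]) auto
qed

lemma sq_int_mult:
  fixes f g :: "'a \<Rightarrow> real"
  shows "sq_int M f \<Longrightarrow> sq_int M g \<Longrightarrow> integrable M (\<lambda>x. f x * g x)"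
  using sq_int_inner[of M f g] by simp

lemma sq_int_real_iff:
  "sq_int M f \<longleftrightarrow> f \<in> borel_measurable M \<and> integrable M (\<lambda>x. (f x)\<^sup>2)" for f :: "'a \<Rightarrow> real"
  by (simp add: sq_int_def)

lemma nsq_nonneg [simp]: "0 \<le> nsq M f"
  by (simp add: nsq_def)

lemma nsq_eq_ip: "nsq M f = ip M f f"
  by (simp add: nsq_def ip_def power2_norm_eq_inner)

lemma ip_commute: "ip M f g = ip M g f"
  by (simp add: ip_def inner_commute)

lemma ip_add_left:
  "sq_int M f \<Longrightarrow> sq_int M g \<Longrightarrow> sq_int M h \<Longrightarrow> ip M (\<lambda>x. f x + g x) h = ip M f h + ip M g h"
  by (simp add: ip_def inner_add_left sq_int_inner)

lemma ip_diff_left: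
  "sq_int M f \<Longrightarrow> sq_int M g \<Longrightarrow> sq_int M h \<Longrightarrow> ip M (\<lambda>x. f x - g x) h = ip M f h - ip M g h"
  by (simp add: ip_def inner_diff_left sq_int_inner)

lemma ip_scaleR_left: "ip M (\<lambda>x. c *\<^sub>R f x) h = c * ip M f h"
  by (simp add: ip_def)

lemma ip_add_right:
  "sq_int M f \<Longrightarrow> sq_int M g \<Longrightarrow> sq_int M h \<Longrightarrow> ip M h (\<lambda>x. f x + g x) = ip M h f + ip M h g"
  by (simp add: ip_def inner_add_right sq_int_inner)

lemma ip_diff_right:
  "sq_int M f \<Longrightarrow> sq_int M g \<Longrightarrow> sq_int M h \<Longrightarrow> ip M h (\<lambda>x. f x - g x) = ip M h f - ip M h g"
  by (simp add: ip_def inner_diff_right sq_int_inner)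

lemma ip_scaleR_right: "ip M h (\<lambda>x. c *\<^sub>R f x) = c * ip M h f"
  by (simp add: ip_def)

lemma ip_zero [simp]: "ip M h (\<lambda>x. 0) = 0" "ip M (\<lambda>x. 0) h = 0"
  by (simp_all add: ip_def)

lemma ip_sum_right:
  assumes "sq_int M h" "\<And>i. i \<in> I \<Longrightarrow> sq_int M (f i)"
  shows "ip M h (\<lambda>x. \<Sum>i\<in>I. f i x) = (\<Sum>i\<in>I. ip M h (f i))"
  using assms(2)
  by (induction I rule: infinite_finite_induct) (auto simp: ip_add_right assms(1) sq_int_sum)

lemma ip_sum_left:
  assumes "sq_int M h" "\<And>i. i \<in> I \<Longrightarrow> sq_int M (f i)"
  shows "ip M (\<lambda>x. \<Sum>i\<in>I. f i x) h = (\<Sum>i\<in>I. ip M (f i) h)"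
  using ip_sum_right[OF assms] by (simp add: ip_commute)

lemma nsq_add:
  assumes "sq_int M f" "sq_int M g"
  shows "nsq M (\<lambda>x. f x + g x) = nsq M f + 2 * ip M f g + nsq M g"
  using assms by (simp add: nsq_eq_ip ip_add_left ip_add_right sq_int_add ip_commute[of M g f])

lemma nsq_diff:
  assumes "sq_int M f" "sq_int M g"
  shows "nsq M (\<lambda>x. f x - g x) = nsq M f - 2 * ip M f g + nsq M g"
  using assms by (simp add: nsq_eq_ip ip_diff_left ip_diff_right sq_int_diff ip_commute[of M g f])

lemma nsq_scaleR: "nsq M (\<lambda>x. c *\<^sub>R f x) = c\<^sup>2 * nsq M f"
  by (simp add: nsq_eq_ip ip_scaleR_left ip_scaleR_right power2_eq_square)

lemma nsq_minus_commute: "nsq M (\<lambda>x. f x - g x) = nsq M (\<lambda>x. g x - f x)"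
  by (simp add: nsq_def norm_minus_commute)

lemma nsq_add_le:
  assumes "sq_int M f" "sq_int M g"
  shows "nsq M (\<lambda>x. f x + g x) \<le> 2 * nsq M f + 2 * nsq M g"
  using nsq_add[OF assms] nsq_diff[OF assms] nsq_nonneg[of M "\<lambda>x. f x - g x"] by linarith

lemma nsq_mono:
  assumes "sq_int M g" "\<And>x. norm (f x) \<le> norm (g x)"
  shows "nsq M f \<le> nsq M g"
  unfolding nsq_def using assms
  by (intro integral_mono') (auto simp: sq_int_def intro: power_mono)

text \<open>Nonpositivity of the discriminant. It is the common source of the Cauchy-Schwarz
  inequalities for \<open>ip\<close>, for finite sums of \<open>ip\<close> and for convolutions;
  with \<open>a = 0\<close> it yields the orthogonality of a minimal residual.\<close>

lemma quad_nonneg_imp: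
  fixes a b c :: real
  assumes "\<And>t. 0 \<le> a + 2 * t * b + t\<^sup>2 * c"
  shows "b\<^sup>2 \<le> a * c"
proof (cases "c = 0")
  case True
  have "b = 0"
  proof (rule ccontr)
    assume "b \<noteq> 0"
    then have "a + 2 * (- (a + 1) / (2 * b)) * b + (- (a + 1) / (2 * b))\<^sup>2 * c = -1"
      using True by (simp add: field_simps)
    then show False using assms[of "- (a + 1) / (2 * b)"] by linarith
  qed
  then show ?thesis using True by simp
next
  case False
  have "0 \<le> c"
  proof (rule ccontr)
    assume "\<not> 0 \<le> c"
    \<comment> \<open>Large enough that \<open>t * c\<close> outweighs
      \<open>\<bar>a\<bar> + 2 * \<bar>b\<bar>\<close>; the added 1 ensures
      \<open>t \<ge> 1\<close>, so that \<open>a \<le> t * \<bar>a\<bar>\<close>.\<close>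
    define t where "t = (\<bar>a\<bar> + 2 * \<bar>b\<bar> + 1) / (-c) + 1"
    have "0 \<le> (\<bar>a\<bar> + 2 * \<bar>b\<bar> + 1) / (-c)"
      using \<open>\<not> 0 \<le> c\<close> by (intro divide_nonneg_nonneg) auto
    then have t: "t \<ge> 1" by (simp add: t_def)
    have "a + 2 * t * b + t\<^sup>2 * c \<le> t * \<bar>a\<bar> + 2 * t * \<bar>b\<bar> + t * (t * c)"
    proof -
      have "a \<le> t * \<bar>a\<bar>" using t by (meson abs_ge_self abs_ge_zero mult_le_cancel_right1 order_trans not_le)
      moreover have "2 * t * b \<le> 2 * t * \<bar>b\<bar>" using t by (simp add: mult_left_mono)
      ultimately show ?thesis by (simp add: power2_eq_square)
    qed
    also have "\<dots> = t * (\<bar>a\<bar> + 2 * \<bar>b\<bar> + t * c)" by (simp add: algebra_simps)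
    also have "t * c = - (\<bar>a\<bar> + 2 * \<bar>b\<bar> + 1) + c"
      using False by (simp add: t_def field_simps)
    also have "t * (\<bar>a\<bar> + 2 * \<bar>b\<bar> + (- (\<bar>a\<bar> + 2 * \<bar>b\<bar> + 1) + c)) < 0"
      using t \<open>\<not> 0 \<le> c\<close> by (simp add: mult_pos_neg)
    finally show False using assms[of t] by linarith
  qed
  then have c: "c > 0" using False by simp
  have "a + 2 * (- b / c) * b + (- b / c)\<^sup>2 * c = (a * c - b\<^sup>2) / c"
    using c by (simp add: field_simps power2_eq_square)
  then have "0 \<le> (a * c - b\<^sup>2) / c" using assms[of "- b / c"] by simp
  then show ?thesis using c by (simp add: zero_le_divide_iff)
qed

lemma ip_Cauchy_Schwarz:
  assumes "sq_int M f" "sq_int M g"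
  shows "(ip M f g)\<^sup>2 \<le> nsq M f * nsq M g"
proof (rule quad_nonneg_imp)
  fix t :: real
  have "nsq M (\<lambda>x. f x + t *\<^sub>R g x) = nsq M f + 2 * t * ip M f g + t\<^sup>2 * nsq M g"
    using assms by (simp add: nsq_add sq_int_scaleR ip_scaleR_right nsq_scaleR)
  then show "0 \<le> nsq M f + 2 * t * ip M f g + t\<^sup>2 * nsq M g"
    by (metis nsq_nonneg)
qed

lemma ip_le:
  assumes "sq_int M f" "sq_int M g"
  shows "\<bar>ip M f g\<bar> \<le> sqrt (nsq M f) * sqrt (nsq M g)"
  using ip_Cauchy_Schwarz[OF assms]
  by (metis real_sqrt_abs real_sqrt_le_iff real_sqrt_mult)

lemma nsq_tendsto_ip:
  assumes f: "\<And>n::nat. sq_int M (f n)" "sq_int M F" and g: "sq_int M g"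
    and lim: "(\<lambda>n. nsq M (\<lambda>x. f n x - F x)) \<longlonglongrightarrow> 0"
  shows "(\<lambda>n. ip M (f n) g) \<longlonglongrightarrow> ip M F g"
proof -
  have "(\<lambda>n. sqrt (nsq M (\<lambda>x. f n x - F x)) * sqrt (nsq M g)) \<longlonglongrightarrow> sqrt 0 * sqrt (nsq M g)"
    by (intro tendsto_intros lim)
  then have "(\<lambda>n. sqrt (nsq M (\<lambda>x. f n x - F x)) * sqrt (nsq M g)) \<longlonglongrightarrow> 0" by simp
  then have "(\<lambda>n. ip M (\<lambda>x. f n x - F x) g) \<longlonglongrightarrow> 0"
    by (rule Lim_null_comparison[rotated])
      (auto intro!: always_eventually simp: ip_le sq_int_diff f g)
  then have "(\<lambda>n. ip M (f n) g - ip M F g) \<longlonglongrightarrow> 0"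
    by (simp add: ip_diff_left f g)
  then show ?thesis by (rule LIM_zero_cancel)
qed

lemma nsq_tendsto_nsq:
  assumes f: "\<And>n::nat. sq_int M (f n)" "sq_int M F"
    and lim: "(\<lambda>n. nsq M (\<lambda>x. f n x - F x)) \<longlonglongrightarrow> 0"
  shows "(\<lambda>n. nsq M (f n)) \<longlonglongrightarrow> nsq M F"
proof -
  have "nsq M (f n) = nsq M (\<lambda>x. f n x - F x) + 2 * ip M (f n) F - nsq M F" for n
    by (simp add: nsq_diff f)
  moreover have "(\<lambda>n. nsq M (\<lambda>x. f n x - F x) + 2 * ip M (f n) F - nsq M F)
      \<longlonglongrightarrow> 0 + 2 * ip M F F - nsq M F"
    by (intro tendsto_intros lim nsq_tendsto_ip f)
  ultimately show ?thesis by (simp add: nsq_eq_ip)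
qed

text \<open>Riesz-Fischer: a rapidly converging subsequence converges almost everywhere, and Fatou's
  lemma turns its pointwise limit into the limit of the whole sequence.\<close>

lemma sq_int_complete:
  fixes f :: "nat \<Rightarrow> 'a \<Rightarrow> 'b::euclidean_space"
  assumes f: "\<And>n. sq_int M (f n)"
    and Cauchy: "\<And>e. e > 0 \<Longrightarrow> \<exists>N. \<forall>m\<ge>N. \<forall>n\<ge>N. nsq M (\<lambda>x. f m x - f n x) \<le> e"
  obtains F where "sq_int M F" "(\<lambda>n. nsq M (\<lambda>x. f n x - F x)) \<longlonglongrightarrow> 0"
proof -
  have [measurable]: "f n \<in> borel_measurable M" for n
    using f by (rule sq_int_measurable)
  have "\<exists>N. \<forall>k. \<forall>m\<ge>N k. \<forall>n\<ge>N k. nsq M (\<lambda>x. f m x - f n x) \<le> (1/8)^k"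
    by (intro choice allI Cauchy) simp
  then obtain N where N: "\<And>k m n. m \<ge> N k \<Longrightarrow> n \<ge> N k \<Longrightarrow> nsq M (\<lambda>x. f m x - f n x) \<le> (1/8)^k"
    by blast
  \<comment> \<open>Partial sums make \<open>r\<close> dominate \<open>N k\<close> at the indices
    \<open>k\<close> and \<open>Suc k\<close> at once, so that both terms of the difference
    \<open>d k\<close> lie beyond \<open>N k\<close>.\<close>
  define r where "r k = (\<Sum>i\<le>k. N i) + k" for k
  have rN: "r k \<ge> N k" for k
    unfolding r_def using member_le_sum[of k "{..k}" N] by simp
  have rmono: "r k \<ge> k" for k by (simp add: r_def)
  have rSuc: "r (Suc k) \<ge> N k" for k
    using rN[of k] by (simp add: r_def)
  define d where "d k x = f (r (Suc k)) x - f (r k) x" for k x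
  have [measurable]: "d k \<in> borel_measurable M" for k unfolding d_def by measurable
  have d: "sq_int M (d k)" for k unfolding d_def by (intro sq_int_diff f)
  have dn: "nsq M (d k) \<le> (1/8)^k" for k unfolding d_def by (intro N rN rSuc)
  have nn: "(\<integral>\<^sup>+x. ennreal (4^k * (norm (d k x))\<^sup>2) \<partial>M) = ennreal (4^k * nsq M (d k))" for k
    using d[of k] by (subst nn_integral_eq_integral) (auto simp: sq_int_def nsq_def)
  \<comment> \<open>The weight 4^k still leaves the summable bound 2^-k, and a weighted term below 1
    means that the k-th increment is below 2^-k, which is what pointwise convergence needs.\<close>
  have "(\<integral>\<^sup>+x. (\<Sum>k. ennreal (4^k * (norm (d k x))\<^sup>2)) \<partial>M) = (\<Sum>k. ennreal (4^k * nsq M (d k)))"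
    by (subst nn_integral_suminf) (auto simp: nn)
  also have "\<dots> \<le> (\<Sum>k. ennreal ((1/2)^k))"
  proof (intro suminf_le allI summableI ennreal_leI)
    fix k show "4^k * nsq M (d k) \<le> (1/2)^k"
    proof -
      have "4^k * nsq M (d k) \<le> 4^k * (1/8)^k" by (intro mult_left_mono dn) simp
      also have "\<dots> = (1/2::real)^k" by (simp flip: power_mult_distrib)
      finally show ?thesis .
    qed
  qed
  also have "\<dots> = ennreal (\<Sum>k. (1/2)^k)"
    by (intro suminf_ennreal2) (auto intro: summable_geometric)
  also have "\<dots> < \<infinity>" by simp
  finally have "AE x in M. (\<Sum>k. ennreal (4^k * (norm (d k x))\<^sup>2)) \<noteq> \<infinity>"
    by (intro nn_integral_noteq_infinite) auto
  then have conv: "AE x in M. convergent (\<lambda>k. f (r k) x)"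
  proof eventually_elim
    case (elim x)
    then have "summable (\<lambda>k. 4^k * (norm (d k x))\<^sup>2)"
      by (intro summable_suminf_not_top) auto
    then have "(\<lambda>k. 4^k * (norm (d k x))\<^sup>2) \<longlonglongrightarrow> 0" by (rule summable_LIMSEQ_zero)
    then have ev: "\<forall>\<^sub>F k in sequentially. 4^k * (norm (d k x))\<^sup>2 < 1"
      by (rule order_tendstoD) simp
    have "\<forall>\<^sub>F k in sequentially. norm (d k x) \<le> (1/2)^k"
      using ev
    proof eventually_elim
      case (elim k)
      have "(norm (d k x))\<^sup>2 \<le> ((1/2)^k)\<^sup>2"
      proof -
        have "(4::real)^k = (2^k)\<^sup>2" by (simp add: power2_eq_square flip: power_mult_distrib)
        then show ?thesis using elim by (simp add: field_simps)
      qed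
      then show ?case by (rule power2_le_imp_le) simp
    qed
    then have "summable (\<lambda>k. d k x)"
      by (rule summable_comparison_test_ev) (simp add: summable_geometric)
    then have "convergent (\<lambda>n. \<Sum>k<n. d k x)" by (simp add: summable_iff_convergent)
    moreover have "(\<Sum>k<n. d k x) = f (r n) x - f (r 0) x" for n
      unfolding d_def by (rule sum_lessThan_telescope)
    ultimately have "convergent (\<lambda>n. f (r n) x - f (r 0) x)" by simp
    then have "convergent (\<lambda>n. (f (r n) x - f (r 0) x) + f (r 0) x)"
      by (intro convergent_add convergent_const)
    then show ?case by simp
  qed
  define F where "F x = lim (\<lambda>k. f (r k) x)" for x
  have [measurable]: "F \<in> borel_measurable M"
    unfolding F_def by (rule borel_measurable_lim_metric) measurable
  have limF: "AE x in M. (\<lambda>k. f (r k) x) \<longlonglongrightarrow> F x"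
    using conv by eventually_elim (simp add: F_def convergent_LIMSEQ_iff)
  \<comment> \<open>The limit is taken along \<open>r\<close> in the second slot only; the index
    \<open>n\<close> stays arbitrary, so convergence of the full sequence results.\<close>
  have fatou: "(\<integral>\<^sup>+x. ennreal ((norm (f n x - F x))\<^sup>2) \<partial>M) \<le> ennreal e"
    if "e > 0" and n: "\<And>k. k \<ge> N0 \<Longrightarrow> nsq M (\<lambda>x. f n x - f k x) \<le> e" for n e N0
  proof -
    have "(\<integral>\<^sup>+x. ennreal ((norm (f n x - F x))\<^sup>2) \<partial>M)
        = (\<integral>\<^sup>+x. liminf (\<lambda>k. ennreal ((norm (f n x - f (r k) x))\<^sup>2)) \<partial>M)"
    proof (rule nn_integral_cong_AE)
      show "AE x in M. ennreal ((norm (f n x - F x))\<^sup>2)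
            = liminf (\<lambda>k. ennreal ((norm (f n x - f (r k) x))\<^sup>2))"
        using limF
      proof eventually_elim
        case (elim x)
        have "(\<lambda>k. ennreal ((norm (f n x - f (r k) x))\<^sup>2)) \<longlonglongrightarrow> ennreal ((norm (f n x - F x))\<^sup>2)"
          by (intro tendsto_intros elim tendsto_ennrealI)
        then show ?case by (metis lim_imp_Liminf sequentially_bot)
      qed
    qed
    also have "\<dots> \<le> liminf (\<lambda>k. \<integral>\<^sup>+x. ennreal ((norm (f n x - f (r k) x))\<^sup>2) \<partial>M)"
      by (rule nn_integral_liminf) measurable
    also have "\<dots> = liminf (\<lambda>k. ennreal (nsq M (\<lambda>x. f n x - f (r k) x)))"
      using sq_int_integrable[OF sq_int_diff[OF f f]]
      by (simp add: nn_integral_eq_integral nsq_def)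
    also have "\<dots> \<le> limsup (\<lambda>k. ennreal (nsq M (\<lambda>x. f n x - f (r k) x)))"
      by (intro Liminf_le_Limsup) simp
    also have "\<dots> \<le> ennreal e"
    proof (rule Limsup_bounded)
      show "\<forall>\<^sub>F k in sequentially. ennreal (nsq M (\<lambda>x. f n x - f (r k) x)) \<le> ennreal e"
        unfolding eventually_sequentially using n rmono by (meson ennreal_leI order_trans)
    qed
    finally show ?thesis .
  qed
  have sqF: "sq_int M (\<lambda>x. f n x - F x)" "nsq M (\<lambda>x. f n x - F x) \<le> e"
    if "e > 0" and n: "\<And>k. k \<ge> N0 \<Longrightarrow> nsq M (\<lambda>x. f n x - f k x) \<le> e" for n e N0
  proof -
    note * = fatou[OF that]
    have "integrable M (\<lambda>x. (norm (f n x - F x))\<^sup>2)"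
      using * by (intro integrableI_nonneg) (auto simp: less_top[symmetric] top_unique)
    then show "sq_int M (\<lambda>x. f n x - F x)" by (simp add: sq_int_def)
    then have "(\<integral>\<^sup>+x. ennreal ((norm (f n x - F x))\<^sup>2) \<partial>M) = ennreal (nsq M (\<lambda>x. f n x - F x))"
      by (subst nn_integral_eq_integral) (auto simp: nsq_def sq_int_def)
    then show "nsq M (\<lambda>x. f n x - F x) \<le> e" using * \<open>e > 0\<close> by simp
  qed
  obtain N1 where N1: "\<And>m n. m \<ge> N1 \<Longrightarrow> n \<ge> N1 \<Longrightarrow> nsq M (\<lambda>x. f m x - f n x) \<le> 1"
    using Cauchy[of 1] by auto
  have "sq_int M (\<lambda>x. f N1 x - F x)" using sqF(1)[of 1 N1 N1] N1 by simp
  from sq_int_diff[OF f[of N1] this] have F: "sq_int M F" by simp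
  have "(\<lambda>n. nsq M (\<lambda>x. f n x - F x)) \<longlonglongrightarrow> 0"
  proof (rule LIMSEQ_I)
    fix e :: real assume "e > 0"
    then obtain N2 where "\<And>m n. m \<ge> N2 \<Longrightarrow> n \<ge> N2 \<Longrightarrow> nsq M (\<lambda>x. f m x - f n x) \<le> e / 2"
      using Cauchy[of "e/2"] by auto
    then have "nsq M (\<lambda>x. f n x - F x) \<le> e / 2" if "n \<ge> N2" for n
      using sqF(2)[of "e/2" N2 n] that \<open>e > 0\<close> by simp
    then show "\<exists>no. \<forall>n\<ge>no. norm (nsq M (\<lambda>x. f n x - F x) - 0) < e"
      using \<open>e > 0\<close> by (intro exI[of _ N2]) (force intro: le_less_trans)
  qed
  with F show thesis by (rule that)
qed

text \<open>\<open>E\<close> is a subspace that need not be closed, so the projection onto its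
  closure is described by its residual \<open>r\<close> and by elements of \<open>E\<close> that
  approximate \<open>f - r\<close>. A minimizing sequence is Cauchy by the parallelogram
  law.\<close>

lemma sq_int_projection:
  fixes f :: "'a \<Rightarrow> 'b::euclidean_space"
  assumes f: "sq_int M f" and E: "\<And>h. h \<in> E \<Longrightarrow> sq_int M h"
    and E0: "(\<lambda>x. 0) \<in> E"
    and Eadd: "\<And>h k. h \<in> E \<Longrightarrow> k \<in> E \<Longrightarrow> (\<lambda>x. h x + k x) \<in> E"
    and Escale: "\<And>h c. h \<in> E \<Longrightarrow> (\<lambda>x. c *\<^sub>R h x) \<in> E"
  obtains r h where "sq_int M r" "\<And>n::nat. h n \<in> E"
    "(\<lambda>n. nsq M (\<lambda>x. (f x - h n x) - r x)) \<longlonglongrightarrow> 0" "\<And>k. k \<in> E \<Longrightarrow> ip M r k = 0"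
proof -
  define d where "d = (INF h\<in>E. nsq M (\<lambda>x. f x - h x))"
  have bdd: "bdd_below ((\<lambda>h. nsq M (\<lambda>x. f x - h x)) ` E)"
    by (intro bdd_belowI2[of _ 0]) simp
  have d_le: "d \<le> nsq M (\<lambda>x. f x - h x)" if "h \<in> E" for h
    unfolding d_def by (rule cINF_lower[OF bdd that])
  have "\<exists>h\<in>E. nsq M (\<lambda>x. f x - h x) < d + e" if "e > 0" for e
    using that E0 bdd unfolding d_def by (subst cINF_less_iff[symmetric]) auto
  then have "\<exists>h. h \<in> E \<and> nsq M (\<lambda>x. f x - h x) < d + inverse (real (Suc n))" for n
    by (metis inverse_positive_iff_positive of_nat_0_less_iff zero_less_Suc)
  then obtain h where hE: "\<And>n. h n \<in> E"
    and h: "\<And>n. nsq M (\<lambda>x. f x - h n x) < d + inverse (real (Suc n))"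
    by metis
  have fh: "sq_int M (\<lambda>x. f x - h n x)" for n by (intro sq_int_diff f E hE)
  have par: "nsq M (\<lambda>x. (f x - h m x) - (f x - h n x)) \<le> 2 * inverse (real (Suc m)) + 2 * inverse (real (Suc n))" for m n
  proof -
    \<comment> \<open>The midpoint of two near-minimizers is a competitor too; this bounds the sum
      in the parallelogram law from below and hence the difference from above.\<close>
    have mid: "(\<lambda>x. (1/2) *\<^sub>R (h m x + h n x)) \<in> E" by (intro Escale Eadd hE)
    have eq: "nsq M (\<lambda>x. (f x - h m x) + (f x - h n x)) = 4 * nsq M (\<lambda>x. f x - (1/2) *\<^sub>R (h m x + h n x))"
    proof -
      have "(\<lambda>x. (f x - h m x) + (f x - h n x)) = (\<lambda>x. 2 *\<^sub>R (f x - (1/2) *\<^sub>R (h m x + h n x)))"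
        by (auto simp: fun_eq_iff algebra_simps scaleR_2)
      then show ?thesis by (simp only: nsq_scaleR) simp
    qed
    show ?thesis
      using d_le[OF mid] h[of m] h[of n] eq nsq_add[OF fh[of m] fh[of n]] nsq_diff[OF fh[of m] fh[of n]]
      by linarith
  qed
  have "\<exists>N. \<forall>m\<ge>N. \<forall>n\<ge>N. nsq M (\<lambda>x. (f x - h m x) - (f x - h n x)) \<le> e" if e: "e > 0" for e
  proof -
    obtain N where N: "inverse (real (Suc N)) < e / 4"
      using reals_Archimedean[of "e/4"] e by auto
    have "inverse (real (Suc m)) < e / 4" if "m \<ge> N" for m
    proof -
      have "inverse (real (Suc m)) \<le> inverse (real (Suc N))" using that by (simp add: le_imp_inverse_le)
      then show ?thesis using N by linarith
    qed
    note inv = this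
    have "nsq M (\<lambda>x. (f x - h m x) - (f x - h n x)) \<le> e" if "m \<ge> N" "n \<ge> N" for m n
      using par[of m n] inv[OF that(1)] inv[OF that(2)] by linarith
    then show ?thesis by blast
  qed
  then obtain r where r: "sq_int M r" and lim: "(\<lambda>n. nsq M (\<lambda>x. (f x - h n x) - r x)) \<longlonglongrightarrow> 0"
    using sq_int_complete[of M "\<lambda>n x. f x - h n x"] fh by blast
  have nr: "nsq M r \<le> d"
  proof (rule LIMSEQ_le)
    show "(\<lambda>n. nsq M (\<lambda>x. f x - h n x)) \<longlonglongrightarrow> nsq M r"
      by (rule nsq_tendsto_nsq[OF fh r lim])
    show "(\<lambda>n. d + inverse (real (Suc n))) \<longlonglongrightarrow> d"
      using LIMSEQ_inverse_real_of_nat_add[of d] by simp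
    show "\<exists>N. \<forall>n\<ge>N. nsq M (\<lambda>x. f x - h n x) \<le> d + inverse (real (Suc n))"
      using h less_imp_le by blast
  qed
  have "ip M r k = 0" if k: "k \<in> E" for k
  proof -
    \<comment> \<open>Moving the residual along \<open>k\<close> cannot bring its squared norm below
      \<open>d\<close>. The constant term of the quadratic cancels against
      \<open>nsq M r \<le> d\<close>, which forces the linear coefficient to vanish.\<close>
    have "0 \<le> 0 + 2 * t * ip M r k + t\<^sup>2 * nsq M k" for t
    proof -
      have sk: "sq_int M (\<lambda>x. t *\<^sub>R k x)" by (intro sq_int_scaleR E k)
      have "d \<le> nsq M (\<lambda>x. r x + t *\<^sub>R k x)"
      proof (rule LIMSEQ_le_const)
        have "(\<lambda>n. nsq M (\<lambda>x. ((f x - h n x) + t *\<^sub>R k x) - (r x + t *\<^sub>R k x))) \<longlonglongrightarrow> 0"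
          using lim by simp
        then show "(\<lambda>n. nsq M (\<lambda>x. (f x - h n x) + t *\<^sub>R k x)) \<longlonglongrightarrow> nsq M (\<lambda>x. r x + t *\<^sub>R k x)"
          by (intro nsq_tendsto_nsq sq_int_add fh sk r)
        have "d \<le> nsq M (\<lambda>x. (f x - h n x) + t *\<^sub>R k x)" for n
        proof -
          have "(\<lambda>x. h n x + (-t) *\<^sub>R k x) \<in> E" by (intro Eadd Escale hE k)
          from d_le[OF this] show ?thesis by (simp add: algebra_simps)
        qed
        then show "\<exists>N. \<forall>n\<ge>N. d \<le> nsq M (\<lambda>x. (f x - h n x) + t *\<^sub>R k x)" by blast
      qed
      also have "\<dots> = nsq M r + 2 * t * ip M r k + t\<^sup>2 * nsq M k"
        using r sk by (simp add: nsq_add ip_scaleR_right nsq_scaleR)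
      finally show ?thesis using nr by linarith
    qed
    from quad_nonneg_imp[OF this] show ?thesis by simp
  qed
  then show thesis using that r hE lim by blast
qed

section \<open>Partial derivatives\<close>

lemma pd_has_derivative: "(f has_derivative f') (at x) \<Longrightarrow> pd i f x = f' (axis i 1)"
  unfolding pd_def using frechet_derivative_at by metis

lemma differentiable_imp_has_derivative_grad:
  fixes f :: "real^'n::finite \<Rightarrow> real"
  assumes "f differentiable (at x)"
  shows "(f has_derivative (\<lambda>v. grad f x \<bullet> v)) (at x)"
proof -
  obtain D where D: "(f has_derivative D) (at x)"
    using assms by (auto simp: differentiable_def)
  then interpret bounded_linear D by (rule has_derivative_bounded_linear)
  have "D v = grad f x \<bullet> v" for v
  proof -
    have "v = (\<Sum>i\<in>UNIV. (v $ i) *\<^sub>R axis i 1)"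
      using basis_expansion[of v] by (simp add: scalar_mult_eq_scaleR)
    then have "D v = D (\<Sum>i\<in>UNIV. (v $ i) *\<^sub>R axis i 1)" by simp
    also have "\<dots> = (\<Sum>i\<in>UNIV. v $ i * pd i f x)"
      by (simp add: sum scaleR pd_has_derivative[OF D])
    finally show ?thesis by (simp add: inner_vec_def grad_def mult.commute)
  qed
  then have "D = (\<lambda>v. grad f x \<bullet> v)" by auto
  with D show ?thesis by simp
qed

lemma grad_nth [simp]: "grad f x $ i = pd i f x"
  by (simp add: grad_def)

lemma hess_nth [simp]: "hess f x $ i $ j = pd j (pd i f) x"
  by (simp add: hess_def)

lemma norm_grad_sq: "(norm (grad f x))\<^sup>2 = (\<Sum>i\<in>UNIV. (pd i f x)\<^sup>2)"
  unfolding power2_norm_eq_inner inner_vec_def by (simp add: power2_eq_square)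

lemma pd_const [simp]: "pd i (\<lambda>x. c) = (\<lambda>x. 0)"
  by (simp add: pd_def fun_eq_iff)

lemma pd_add:
  "f differentiable (at x) \<Longrightarrow> g differentiable (at x) \<Longrightarrow> pd i (\<lambda>x. f x + g x) x = pd i f x + pd i g x"
  by (subst pd_has_derivative[OF has_derivative_add[OF
        differentiable_imp_has_derivative_grad differentiable_imp_has_derivative_grad]])
     (auto simp: inner_axis)

lemma pd_diff:
  "f differentiable (at x) \<Longrightarrow> g differentiable (at x) \<Longrightarrow> pd i (\<lambda>x. f x - g x) x = pd i f x - pd i g x"
  by (subst pd_has_derivative[OF has_derivative_diff[OF
        differentiable_imp_has_derivative_grad differentiable_imp_has_derivative_grad]])
     (auto simp: inner_axis)

lemma pd_mult:
  "f differentiable (at x) \<Longrightarrow> g differentiable (at x) \<Longrightarrow>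
    pd i (\<lambda>x. f x * g x) x = pd i f x * g x + f x * pd i g x"
  by (subst pd_has_derivative[OF has_derivative_mult[OF
        differentiable_imp_has_derivative_grad differentiable_imp_has_derivative_grad]])
     (auto simp: inner_axis)

lemma pd_cmult: "f differentiable (at x) \<Longrightarrow> pd i (\<lambda>x. c * f x) x = c * pd i f x"
  by (subst pd_mult) auto

lemma pd_coord: "pd i (\<lambda>x. x $ j) x = (if i = j then 1 else 0)"
  by (subst pd_has_derivative[OF bounded_linear.has_derivative[OF bounded_linear_vec_nth has_derivative_ident]])
     (auto simp: axis_def)

lemma differentiable_coord: "(\<lambda>x. x $ j) differentiable (at (x::real^'n::finite))"
  using bounded_linear.has_derivative[OF bounded_linear_vec_nth has_derivative_ident]
  unfolding differentiable_def by blast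

lemma has_derivative_compose_real:
  assumes "f differentiable (at x)" "(F has_real_derivative D) (at (f x))"
  shows "((\<lambda>x. F (f x)) has_derivative (\<lambda>v. D * (grad f x \<bullet> v))) (at x)"
  using has_derivative_compose[OF differentiable_imp_has_derivative_grad[OF assms(1)]
      assms(2)[unfolded has_field_derivative_def]] by simp

lemma pd_compose_real:
  assumes "f differentiable (at x)" "(F has_real_derivative D) (at (f x))"
  shows "pd i (\<lambda>x. F (f x)) x = D * pd i f x"
  by (subst pd_has_derivative[OF has_derivative_compose_real[OF assms]]) (simp add: inner_axis)

lemma has_derivative_affine:
  fixes f :: "real^'n::finite \<Rightarrow> real"
  assumes "f differentiable (at (a + c *\<^sub>R x))"
  shows "((\<lambda>x. f (a + c *\<^sub>R x)) has_derivative (\<lambda>v. grad f (a + c *\<^sub>R x) \<bullet> (c *\<^sub>R v))) (at x)"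
proof (rule has_derivative_compose[of "\<lambda>x. a + c *\<^sub>R x" "\<lambda>v. c *\<^sub>R v" x UNIV f])
  show "((\<lambda>x. a + c *\<^sub>R x) has_derivative (*\<^sub>R) c) (at x)"
    by (auto intro!: derivative_eq_intros)
  show "(f has_derivative (\<bullet>) (grad f (a + c *\<^sub>R x))) (at (a + c *\<^sub>R x))"
    by (rule differentiable_imp_has_derivative_grad[OF assms])
qed

lemma pd_affine:
  fixes f :: "real^'n::finite \<Rightarrow> real"
  assumes "f differentiable (at (a + c *\<^sub>R x))"
  shows "pd i (\<lambda>x. f (a + c *\<^sub>R x)) x = c * pd i f (a + c *\<^sub>R x)"
  by (subst pd_has_derivative[OF has_derivative_affine[OF assms]]) (simp add: inner_axis)

lemma has_real_derivative_line:
  assumes "f differentiable (at (x + s *\<^sub>R axis i 1))"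
  shows "((\<lambda>s. f (x + s *\<^sub>R axis i 1)) has_real_derivative pd i f (x + s *\<^sub>R axis i 1)) (at s)"
proof -
  have "((\<lambda>s. x + s *\<^sub>R axis i 1) has_derivative (\<lambda>h. h *\<^sub>R axis i 1)) (at s)"
    by (auto intro!: derivative_eq_intros)
  from has_derivative_compose[OF this differentiable_imp_has_derivative_grad[OF assms]]
  show ?thesis
    by (simp add: has_field_derivative_def inner_axis mult.commute[of _ "pd i f _"])
qed

section \<open>The classes \<open>C\<^sup>k\<close>\<close>

lemma Ck_imp_continuous: "Ck k f \<Longrightarrow> continuous_on UNIV f"
  by (cases k) (auto intro!: differentiable_imp_continuous_on simp: differentiable_on_def
      intro: differentiable_at_withinI)

lemma Ck_SucD: "Ck (Suc k) f \<Longrightarrow> Ck k f"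
proof (induction k arbitrary: f)
  case 0
  then show ?case using Ck_imp_continuous[of "Suc 0" f] by simp
next
  case (Suc k)
  then show ?case by (metis Ck.simps(2))
qed

lemma Ck_mono: "Ck n f \<Longrightarrow> m \<le> n \<Longrightarrow> Ck m f"
  by (induction n rule: nat.induct) (auto simp: le_Suc_eq dest: Ck_SucD simp del: Ck.simps)

lemma Ck_pd: "Ck (Suc k) f \<Longrightarrow> Ck k (pd i f)"
  by simp

lemma Ck_const [simp]: "Ck k (\<lambda>x. c)"
  by (induction k arbitrary: c) auto

lemma Ck_add: "Ck k f \<Longrightarrow> Ck k g \<Longrightarrow> Ck k (\<lambda>x. f x + g x)"
proof (induction k arbitrary: f g)
  case (Suc k)
  have "pd i (\<lambda>x. f x + g x) = (\<lambda>x. pd i f x + pd i g x)" for i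
    using Suc.prems by (auto simp: pd_add)
  then show ?case using Suc by auto
qed (auto intro: continuous_intros)

lemma Ck_mult: "Ck k f \<Longrightarrow> Ck k g \<Longrightarrow> Ck k (\<lambda>x. f x * g x)"
proof (induction k arbitrary: f g)
  case (Suc k)
  have "pd i (\<lambda>x. f x * g x) = (\<lambda>x. pd i f x * g x + f x * pd i g x)" for i
    using Suc.prems by (auto simp: pd_mult)
  moreover have "Ck k f" "Ck k g" using Suc.prems Ck_SucD by blast+
  ultimately show ?case using Suc by (auto intro: Ck_add)
qed (auto intro: continuous_intros)

lemma Ck_cmult: "Ck k f \<Longrightarrow> Ck k (\<lambda>x. c * f x)"
  by (intro Ck_mult) auto

lemma Ck_minus: "Ck k f \<Longrightarrow> Ck k (\<lambda>x. - f x)"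
  using Ck_cmult[of k f "-1"] by simp

lemma Ck_diff: "Ck k f \<Longrightarrow> Ck k g \<Longrightarrow> Ck k (\<lambda>x. f x - g x)"
  using Ck_add[of k f "\<lambda>x. - g x"] Ck_minus by auto

lemma Ck_sum: "(\<And>i. i \<in> I \<Longrightarrow> Ck k (f i)) \<Longrightarrow> Ck k (\<lambda>x. \<Sum>i\<in>I. f i x)"
  by (induction I rule: infinite_finite_induct) (auto intro: Ck_add)

lemma Ck_power: "Ck k f \<Longrightarrow> Ck k (\<lambda>x. (f x) ^ n)"
  by (induction n) (auto intro: Ck_mult)

lemma Ck_coord: "Ck k (\<lambda>x. x $ j)"
proof (cases k)
  case (Suc m)
  have "pd i (\<lambda>x. x $ j) = (\<lambda>x. if i = j then 1 else 0)" for i :: 'a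
    by (auto simp: pd_coord)
  then show ?thesis using Suc by (auto simp: differentiable_coord)
qed (auto intro: continuous_intros)

lemma Ck_norm_sq: "Ck k (\<lambda>x::real^'n::finite. (norm x)\<^sup>2)"
  unfolding power2_norm_eq_inner inner_vec_def by (auto intro!: Ck_sum Ck_mult Ck_coord)

text \<open>Covers rescaling, with \<open>a = 0\<close>, and the reflection y to x - y of
  convolution kernels, with \<open>c = -1\<close>.\<close>

lemma Ck_affine: "Ck k f \<Longrightarrow> Ck k (\<lambda>x. f (a + c *\<^sub>R x))"
proof (induction k arbitrary: f)
  case 0
  then show ?case by (auto intro!: continuous_on_compose2[of UNIV f] continuous_intros)
next
  case (Suc k)
  then have "pd i (\<lambda>x. f (a + c *\<^sub>R x)) = (\<lambda>x. c * pd i f (a + c *\<^sub>R x))" for i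
    by (auto simp: pd_affine)
  moreover have "(\<lambda>x. f (a + c *\<^sub>R x)) differentiable (at x)" for x
    using has_derivative_affine[of f a c x] Suc.prems unfolding differentiable_def[where ?f="\<lambda>x. f (a + c *\<^sub>R x)"] by auto
  ultimately show ?case using Suc by (auto intro!: Ck_cmult)
qed

lemma Ck_exp: "Ck k f \<Longrightarrow> Ck k (\<lambda>x. exp (f x))"
proof (induction k arbitrary: f)
  case 0
  then show ?case by (auto intro!: continuous_intros)
next
  case (Suc k)
  then have "pd i (\<lambda>x. exp (f x)) = (\<lambda>x. exp (f x) * pd i f x)" for i
    by (auto intro!: pd_compose_real DERIV_exp)
  moreover have "(\<lambda>x. exp (f x)) differentiable (at x)" for x
    using has_derivative_compose_real[of f x exp "exp (f x)"] Suc.prems DERIV_exp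
    unfolding differentiable_def[where ?f="\<lambda>x. exp (f x)"] by auto
  moreover have "Ck k f" using Suc.prems Ck_SucD by blast
  ultimately show ?case using Suc by (auto intro!: Ck_mult)
qed

lemma pd_exp: "f differentiable (at x) \<Longrightarrow> pd i (\<lambda>x. exp (f x)) x = exp (f x) * pd i f x"
  by (rule pd_compose_real) (auto intro: DERIV_exp)

definition smooth :: "(real^'n::finite \<Rightarrow> real) \<Rightarrow> bool" where
  "smooth f \<longleftrightarrow> (\<forall>k. Ck k f)"

lemma smooth_Ck: "smooth f \<Longrightarrow> Ck k f"
  by (simp add: smooth_def)

lemma smooth_differentiable: "smooth f \<Longrightarrow> f differentiable (at x)"
  using smooth_Ck[of f "Suc 0"] by simp

lemma smooth_pd: "smooth f \<Longrightarrow> smooth (pd i f)"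
  unfolding smooth_def using Ck_pd by blast

lemma smooth_continuous: "smooth f \<Longrightarrow> continuous_on UNIV f"
  using smooth_Ck Ck_imp_continuous by blast

lemma smooth_intros:
  "smooth (\<lambda>x. c)"
  "smooth f \<Longrightarrow> smooth g \<Longrightarrow> smooth (\<lambda>x. f x + g x)"
  "smooth f \<Longrightarrow> smooth g \<Longrightarrow> smooth (\<lambda>x. f x - g x)"
  "smooth f \<Longrightarrow> smooth g \<Longrightarrow> smooth (\<lambda>x. f x * g x)"
  "smooth (\<lambda>x. x $ j)"
  "smooth f \<Longrightarrow> smooth (\<lambda>x. f (a + c *\<^sub>R x))"
  by (auto simp: smooth_def intro: Ck_add Ck_diff Ck_mult Ck_coord Ck_affine simp del: Ck.simps)

subsection \<open>Symmetry of second derivatives\<close>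

text \<open>Two applications of the mean value theorem. The left side is symmetric in
  \<open>i\<close> and \<open>j\<close>, the right side is not, and this is what makes mixed
  derivatives commute.\<close>

lemma second_difference:
  assumes "Ck 2 f" "0 < h"
  obtains s t where "0 < s" "s < h" "0 < t" "t < h"
    "f (x + h *\<^sub>R axis i 1 + h *\<^sub>R axis j 1) - f (x + h *\<^sub>R axis i 1) - f (x + h *\<^sub>R axis j 1) + f x
       = h * (h * pd j (pd i f) (x + s *\<^sub>R axis i 1 + t *\<^sub>R axis j 1))"
proof -
  have d: "f differentiable (at y)" "pd i f differentiable (at y)" for y
    using assms by (auto simp: numeral_2_eq_2)
  have g: "((\<lambda>s. f ((x + h *\<^sub>R axis j 1) + s *\<^sub>R axis i 1) - f (x + s *\<^sub>R axis i 1)) has_real_derivative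
      (pd i f ((x + h *\<^sub>R axis j 1) + s *\<^sub>R axis i 1) - pd i f (x + s *\<^sub>R axis i 1))) (at s)" for s
    by (intro DERIV_diff has_real_derivative_line d)
  obtain s where s: "0 < s" "s < h"
    "f ((x + h *\<^sub>R axis j 1) + h *\<^sub>R axis i 1) - f (x + h *\<^sub>R axis i 1)
      - (f ((x + h *\<^sub>R axis j 1) + 0 *\<^sub>R axis i 1) - f (x + 0 *\<^sub>R axis i 1))
      = (h - 0) * (pd i f ((x + h *\<^sub>R axis j 1) + s *\<^sub>R axis i 1) - pd i f (x + s *\<^sub>R axis i 1))"
    using MVT2[OF \<open>0 < h\<close> g] by blast
  have k: "((\<lambda>t. pd i f ((x + s *\<^sub>R axis i 1) + t *\<^sub>R axis j 1)) has_real_derivative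
      (pd j (pd i f) ((x + s *\<^sub>R axis i 1) + t *\<^sub>R axis j 1))) (at t)" for t
    by (intro has_real_derivative_line d)
  obtain t where t: "0 < t" "t < h"
    "pd i f ((x + s *\<^sub>R axis i 1) + h *\<^sub>R axis j 1) - pd i f ((x + s *\<^sub>R axis i 1) + 0 *\<^sub>R axis j 1)
      = (h - 0) * pd j (pd i f) ((x + s *\<^sub>R axis i 1) + t *\<^sub>R axis j 1)"
    using MVT2[OF \<open>0 < h\<close> k] by blast
  show thesis using s t by (intro that[of s t]) (simp_all add: algebra_simps)
qed

lemma pd_symmetric:
  fixes f :: "real^'n::finite \<Rightarrow> real"
  assumes "Ck 2 f"
  shows "pd i (pd j f) x = pd j (pd i f) x"
proof (rule ccontr)
  assume neq: "\<not> ?thesis"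
  define e where "e = \<bar>pd i (pd j f) x - pd j (pd i f) x\<bar> / 2"
  have e: "e > 0" using neq by (simp add: e_def)
  have cont: "isCont (pd j (pd i f)) x" "isCont (pd i (pd j f)) x"
    using assms by (auto simp: numeral_2_eq_2 continuous_on_eq_continuous_at)
  obtain d1 where d1: "d1 > 0"
    "\<And>y. dist y x < d1 \<Longrightarrow> dist (pd j (pd i f) y) (pd j (pd i f) x) < e"
    using cont(1) e unfolding continuous_at_eps_delta by metis
  obtain d2 where d2: "d2 > 0"
    "\<And>y. dist y x < d2 \<Longrightarrow> dist (pd i (pd j f) y) (pd i (pd j f) x) < e"
    using cont(2) e unfolding continuous_at_eps_delta by metis
  note d = d1(1) d2(1) d1(2) d2(2)
  \<comment> \<open>A square of side \<open>h\<close> has all its points within 2 h of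
    \<open>x\<close>, inside both neighbourhoods of continuity.\<close>
  define h where "h = min d1 d2 / 2"
  have h: "h > 0" "2 * h \<le> d1" "2 * h \<le> d2" using d by (auto simp: h_def)
  have dist: "dist (x + s *\<^sub>R axis k 1 + t *\<^sub>R axis l 1) x < 2 * h"
    if "0 < s" "s < h" "0 < t" "t < h" for s t and k l :: 'n
  proof -
    have "dist (x + s *\<^sub>R axis k 1 + t *\<^sub>R axis l 1) x = norm (s *\<^sub>R axis k 1 + t *\<^sub>R axis l (1::real))"
      by (simp add: dist_norm algebra_simps)
    also have "\<dots> \<le> norm (s *\<^sub>R axis k (1::real)) + norm (t *\<^sub>R axis l (1::real))" by (rule norm_triangle_ineq)
    also have "\<dots> = s + t" using that by (simp add: norm_axis_1)
    finally show ?thesis using that by linarith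
  qed
  obtain s t where st: "0 < s" "s < h" "0 < t" "t < h"
    "f (x + h *\<^sub>R axis i 1 + h *\<^sub>R axis j 1) - f (x + h *\<^sub>R axis i 1) - f (x + h *\<^sub>R axis j 1) + f x
       = h * (h * pd j (pd i f) (x + s *\<^sub>R axis i 1 + t *\<^sub>R axis j 1))"
    using second_difference[OF assms h(1)] by blast
  obtain s' t' where st': "0 < s'" "s' < h" "0 < t'" "t' < h"
    "f (x + h *\<^sub>R axis j 1 + h *\<^sub>R axis i 1) - f (x + h *\<^sub>R axis j 1) - f (x + h *\<^sub>R axis i 1) + f x
       = h * (h * pd i (pd j f) (x + s' *\<^sub>R axis j 1 + t' *\<^sub>R axis i 1))"
    using second_difference[OF assms h(1)] by blast
  have "h * (h * pd j (pd i f) (x + s *\<^sub>R axis i 1 + t *\<^sub>R axis j 1))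
      = h * (h * pd i (pd j f) (x + s' *\<^sub>R axis j 1 + t' *\<^sub>R axis i 1))"
    using st(5) st'(5) by (simp add: algebra_simps)
  then have "pd j (pd i f) (x + s *\<^sub>R axis i 1 + t *\<^sub>R axis j 1) = pd i (pd j f) (x + s' *\<^sub>R axis j 1 + t' *\<^sub>R axis i 1)"
    using h(1) by simp
  moreover have "dist (pd j (pd i f) (x + s *\<^sub>R axis i 1 + t *\<^sub>R axis j 1)) (pd j (pd i f) x) < e"
    using dist[OF st(1-4), of i j] h by (intro d) linarith
  moreover have "dist (pd i (pd j f) (x + s' *\<^sub>R axis j 1 + t' *\<^sub>R axis i 1)) (pd i (pd j f) x) < e"
    using dist[OF st'(1-4), of j i] h by (intro d) linarith
  ultimately show False unfolding e_def dist_real_def by (smt (verit) field_sum_of_halves)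
qed

section \<open>Functions of bounded support\<close>

text \<open>Stands in for compact support: in finite dimension the closure of a bounded set is
  compact, and a radius is easier to carry through products, sums and derivatives.\<close>

definition bsupp :: "(real^'n::finite \<Rightarrow> 'b::zero) \<Rightarrow> bool" where
  "bsupp f \<longleftrightarrow> (\<exists>r. \<forall>x. r < norm x \<longrightarrow> f x = 0)"

lemma bsuppE:
  assumes "bsupp f"
  obtains r where "0 < r" "\<And>x. r < norm x \<Longrightarrow> f x = 0"
proof -
  obtain r where "\<And>x. r < norm x \<Longrightarrow> f x = 0" using assms by (auto simp: bsupp_def)
  then show thesis by (intro that[of "max r 1"]) auto
qed

lemma bsupp_mult1: "bsupp f \<Longrightarrow> bsupp (\<lambda>x. f x * g x)" for g :: "_ \<Rightarrow> 'b::mult_zero"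
  unfolding bsupp_def by (metis mult_zero_left)

lemma bsupp_mult2: "bsupp f \<Longrightarrow> bsupp (\<lambda>x. g x * f x)" for g :: "_ \<Rightarrow> 'b::mult_zero"
  unfolding bsupp_def by (metis mult_zero_right)

lemma bsupp_zero [simp]: "bsupp (\<lambda>x. 0)"
  by (simp add: bsupp_def)

lemma bsupp_comp2: "bsupp f \<Longrightarrow> bsupp g \<Longrightarrow> h 0 0 = 0 \<Longrightarrow> bsupp (\<lambda>x. h (f x) (g x))"
  unfolding bsupp_def by (metis max_less_iff_conj)

lemma bsupp_add: "bsupp f \<Longrightarrow> bsupp g \<Longrightarrow> bsupp (\<lambda>x. f x + g x)" for g :: "_ \<Rightarrow> 'b::monoid_add"
  by (rule bsupp_comp2[of f g "(+)"]) auto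

lemma bsupp_sum: "(\<And>i. i \<in> I \<Longrightarrow> bsupp (f i)) \<Longrightarrow> bsupp (\<lambda>x. \<Sum>i\<in>I. f i x)"
  by (induction I rule: infinite_finite_induct) (auto intro: bsupp_add)

lemma pd_eq_0_outside:
  fixes f :: "real^'n::finite \<Rightarrow> real"
  assumes r: "\<And>x. r < norm x \<Longrightarrow> f x = 0" and x: "r < norm x"
  shows "pd i f x = 0"
proof -
  have "open {x::real^'n. r < norm x}" by (intro open_Collect_less continuous_intros)
  then have "(f has_derivative (\<lambda>v. 0)) (at x)"
    using has_derivative_transform_within_open[of "\<lambda>x. 0" "\<lambda>v. 0" x UNIV "{x. r < norm x}" f] x r by auto
  from pd_has_derivative[OF this] show ?thesis by simp
qed

lemma bsupp_pd: "bsupp f \<Longrightarrow> bsupp (pd i f)" for f :: "real^'n::finite \<Rightarrow> real"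
  unfolding bsupp_def using pd_eq_0_outside by metis

lemma test_functions_iff: "f \<in> test_functions \<longleftrightarrow> smooth f \<and> bsupp f"
proof -
  have "bounded {x. f x \<noteq> 0} \<longleftrightarrow> bsupp f"
    by (simp add: bounded_iff bsupp_def) (meson linorder_not_less)
  then show ?thesis by (simp add: test_functions_def smooth_def)
qed

lemma test_pd: "f \<in> test_functions \<Longrightarrow> pd i f \<in> test_functions"
  by (auto simp: test_functions_iff smooth_pd bsupp_pd)

lemma test_zero: "(\<lambda>x. 0) \<in> test_functions"
  by (auto simp: test_functions_iff smooth_intros)

lemma test_add: "f \<in> test_functions \<Longrightarrow> g \<in> test_functions \<Longrightarrow> (\<lambda>x. f x + g x) \<in> test_functions"
  by (auto simp: test_functions_iff smooth_intros bsupp_add)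

lemma test_mult: "f \<in> test_functions \<Longrightarrow> smooth g \<Longrightarrow> (\<lambda>x. f x * g x) \<in> test_functions"
  by (auto simp: test_functions_iff smooth_intros bsupp_mult1)

lemma test_cmult: "f \<in> test_functions \<Longrightarrow> (\<lambda>x. c * f x) \<in> test_functions"
  by (auto simp: test_functions_iff smooth_intros bsupp_mult2)

lemma continuous_bsupp_integrable:
  fixes f :: "real^'n::finite \<Rightarrow> 'b::{banach,second_countable_topology}"
  assumes "continuous_on UNIV f" "bsupp f"
  shows "integrable lborel f"
proof -
  obtain r where r: "\<And>x. r < norm x \<Longrightarrow> f x = 0" using bsuppE[OF assms(2)] by metis
  have "integrable lborel (\<lambda>x. indicator (cball 0 r) x *\<^sub>R f x)"
    using assms(1) by (intro borel_integrable_compact) (auto intro: continuous_on_subset)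
  also have "(\<lambda>x. indicator (cball 0 r) x *\<^sub>R f x) = f"
    using r by (auto simp: fun_eq_iff indicator_def not_le)
  finally show ?thesis .
qed

lemma continuous_bsupp_bounded:
  fixes f :: "real^'n::finite \<Rightarrow> real"
  assumes "continuous_on UNIV f" "bsupp f"
  obtains B where "0 < B" "\<And>x. \<bar>f x\<bar> \<le> B"
proof -
  obtain r where r: "\<And>x. r < norm x \<Longrightarrow> f x = 0" using bsuppE[OF assms(2)] by metis
  have "compact (f ` cball 0 r)"
    using assms(1) by (intro compact_continuous_image) (auto intro: continuous_on_subset)
  then obtain B where B: "0 < B" "\<And>x. x \<in> cball 0 r \<Longrightarrow> norm (f x) \<le> B"
    by (auto dest!: compact_imp_bounded simp: bounded_pos)
  have "\<bar>f x\<bar> \<le> B" for x using B r[of x] by (cases "r < norm x") auto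
  with B(1) show thesis by (rule that)
qed

lemma integral_lborel_translate:
  fixes f :: "real^'n::finite \<Rightarrow> 'b::{banach,second_countable_topology}"
  assumes "f \<in> borel_measurable borel"
  shows "(\<integral>x. f (x + a) \<partial>lborel) = (\<integral>x. f x \<partial>lborel)"
proof -
  have "(\<integral>x. f x \<partial>lborel) = (\<integral>x. f x \<partial>(distr lborel borel ((+) a)))"
    by (simp add: lborel_distr_plus)
  also have "\<dots> = (\<integral>x. f (a + x) \<partial>lborel)" using assms by (intro integral_distr) auto
  finally show ?thesis by (simp add: add.commute)
qed

text \<open>Translation invariance gives every difference quotient the integral 0, and dominated
  convergence passes this on to the derivative. All integrations by parts below reduce to this
  fact.\<close>

lemma integral_pd_eq_0:
  fixes f :: "real^'n::finite \<Rightarrow> real"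
  assumes C: "Ck 1 f" and supp: "bsupp f"
  shows "(\<integral>x. pd i f x \<partial>lborel) = 0"
proof -
  define e where "e = axis i (1::real)"
  have ne: "norm e = 1" by (simp add: e_def norm_axis_1)
  have cf: "continuous_on UNIV f" using C by (rule Ck_imp_continuous)
  have dif: "f differentiable (at x)" for x using C by simp
  have cp: "continuous_on UNIV (pd i f)" using C by simp
  have [measurable]: "f \<in> borel_measurable borel" "pd i f \<in> borel_measurable borel"
    using cf cp by (auto intro: borel_measurable_continuous_onI)
  obtain B where B: "0 < B" "\<And>x. \<bar>pd i f x\<bar> \<le> B"
    using continuous_bsupp_bounded[OF cp bsupp_pd[OF supp]] by blast
  obtain r where r: "0 < r" "\<And>x. r < norm x \<Longrightarrow> f x = 0" using bsuppE[OF supp] by metis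
  define t where "t n = inverse (real (Suc n))" for n
  have t: "0 < t n" "t n \<le> 1" for n by (auto simp: t_def inverse_le_1_iff)
  have t0: "t \<longlonglongrightarrow> 0" unfolding t_def by (rule LIMSEQ_inverse_real_of_nat)
  define q where "q n x = (f (x + t n *\<^sub>R e) - f x) / t n" for n x
  have q0: "(\<integral>x. q n x \<partial>lborel) = 0" for n
  proof -
    have "integrable lborel f" by (rule continuous_bsupp_integrable[OF cf supp])
    moreover have "integrable lborel (\<lambda>x. f (x + t n *\<^sub>R e))"
    proof (rule continuous_bsupp_integrable)
      show "continuous_on UNIV (\<lambda>x. f (x + t n *\<^sub>R e))"
        by (auto intro!: continuous_on_compose2[OF cf] continuous_intros)
      have "f (x + t n *\<^sub>R e) = 0" if "r + 1 < norm x" for x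
      proof (rule r)
        have "norm x \<le> norm (x + t n *\<^sub>R e) + norm (t n *\<^sub>R e)"
          using norm_triangle_ineq4[of "x + t n *\<^sub>R e" "t n *\<^sub>R e"] by simp
        then show "r < norm (x + t n *\<^sub>R e)" using that t[of n] ne by simp
      qed
      then show "bsupp (\<lambda>x. f (x + t n *\<^sub>R e))" by (auto simp: bsupp_def)
    qed
    ultimately show ?thesis by (simp add: q_def integral_lborel_translate)
  qed
  have "(\<lambda>n. \<integral>x. q n x \<partial>lborel) \<longlonglongrightarrow> (\<integral>x. pd i f x \<partial>lborel)"
  proof (rule integral_dominated_convergence)
    \<comment> \<open>The mean value theorem bounds the quotients by \<open>B\<close>; steps of
      length at most 1 keep their supports in the ball enlarged by 1.\<close>
    show "integrable lborel (\<lambda>x::real^'n. B * indicator (cball 0 (r+1)) x :: real)"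
      using emeasure_bounded_finite[of "cball (0::real^'n) (r+1)"]
      by (intro integrable_mult_right integrable_real_indicator) auto
    show "AE x in lborel. (\<lambda>n. q n x) \<longlonglongrightarrow> pd i f x"
    proof (rule AE_I2)
      fix x
      have "((\<lambda>s. f (x + s *\<^sub>R e)) has_real_derivative pd i f x) (at 0)"
        using has_real_derivative_line[of f x 0 i] dif by (simp add: e_def)
      then have *: "((\<lambda>h. (f (x + (0 + h) *\<^sub>R e) - f (x + 0 *\<^sub>R e)) / h) \<longlongrightarrow> pd i f x) (at 0)"
        by (rule DERIV_D)
      have "filterlim t (at 0) sequentially"
        using t0 t(1) unfolding filterlim_at by (auto simp: less_imp_neq[symmetric])
      from filterlim_compose[OF * this] show "(\<lambda>n. q n x) \<longlonglongrightarrow> pd i f x"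
        by (simp add: q_def)
    qed
    show "AE x in lborel. norm (q n x) \<le> B * indicator (cball 0 (r + 1)) x" for n
    proof (rule AE_I2)
      fix x
      have deriv: "((\<lambda>s. f (x + s *\<^sub>R e)) has_real_derivative pd i f (x + s *\<^sub>R e)) (at s)" for s
        unfolding e_def by (intro has_real_derivative_line dif)
      obtain s where "f (x + t n *\<^sub>R e) - f (x + 0 *\<^sub>R e) = (t n - 0) * pd i f (x + s *\<^sub>R e)"
        using MVT2[OF t(1) deriv] by blast
      then have "q n x = pd i f (x + s *\<^sub>R e)" using t(1)[of n] by (simp add: q_def)
      then have "\<bar>q n x\<bar> \<le> B" using B by simp
      moreover have "q n x = 0" if "norm x > r + 1"
      proof -
        have "norm x \<le> norm (x + t n *\<^sub>R e) + norm (t n *\<^sub>R e)"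
          using norm_triangle_ineq4[of "x + t n *\<^sub>R e" "t n *\<^sub>R e"] by simp
        then have "r < norm (x + t n *\<^sub>R e)" using that t[of n] ne by simp
        then show ?thesis using r(2)[of x] r(2)[of "x + t n *\<^sub>R e"] that by (simp add: q_def)
      qed
      ultimately show "norm (q n x) \<le> B * indicator (cball 0 (r + 1)) x"
        by (auto simp: indicator_def not_le)
    qed
  qed (auto simp: q_def)
  then show ?thesis by (simp add: q0 LIMSEQ_const_iff)
qed

section \<open>Bump functions\<close>

text \<open>The functions p(1/t) exp(-1/t), extended by 0. With a polynomial as parameter the family
  is closed under differentiation: p becomes X^2 (p - p'). That is why smoothness follows by an
  induction that generalizes over \<open>p\<close>.\<close>

definition flat :: "real poly \<Rightarrow> real \<Rightarrow> real" where
  "flat p t = (if 0 < t then poly p (1 / t) * exp (- (1 / t)) else 0)"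

lemma poly_exp_tendsto_0: "((\<lambda>s::real. poly p s * exp (- s)) \<longlongrightarrow> 0) at_top"
proof -
  have "((\<lambda>s. \<Sum>i\<le>degree p. coeff p i * (s ^ i / exp s)) \<longlongrightarrow> (\<Sum>i\<le>degree p. coeff p i * 0)) at_top"
    by (intro tendsto_intros tendsto_power_div_exp_0)
  moreover have "poly p s * exp (- s) = (\<Sum>i\<le>degree p. coeff p i * (s ^ i / exp s))" for s
    by (simp add: poly_altdef exp_minus sum_distrib_right divide_inverse mult.assoc)
  ultimately show ?thesis by simp
qed

lemma flat_has_derivative:
  "(flat p has_real_derivative flat ([:0,0,1:] * (p - pderiv p)) t) (at t)"
proof -
  consider "t > 0" | "t < 0" | "t = 0" by linarith
  then show ?thesis
  proof cases
    case 1
    have inv: "((\<lambda>t. 1 / t) has_real_derivative - (1 / t\<^sup>2)) (at t)"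
      using 1 by (auto intro!: derivative_eq_intros simp: power2_eq_square)
    have "((\<lambda>t. poly p (1 / t) * exp (- (1 / t))) has_real_derivative
        (poly (pderiv p) (1 / t) * - (1 / t\<^sup>2)) * exp (- (1 / t)) +
        (exp (- (1 / t)) * - (- (1 / t\<^sup>2))) * poly p (1 / t)) (at t)"
      by (intro DERIV_mult DERIV_chain2[OF poly_DERIV inv] DERIV_chain2[OF DERIV_exp] DERIV_minus inv)
    also have "(poly (pderiv p) (1 / t) * - (1 / t\<^sup>2)) * exp (- (1 / t)) +
        (exp (- (1 / t)) * - (- (1 / t\<^sup>2))) * poly p (1 / t) = flat ([:0,0,1:] * (p - pderiv p)) t"
      using 1 by (simp add: flat_def algebra_simps power2_eq_square)
    finally have "((\<lambda>t. poly p (1 / t) * exp (- (1 / t))) has_real_derivative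
        flat ([:0,0,1:] * (p - pderiv p)) t) (at t)" .
    moreover have "\<forall>\<^sub>F s in nhds t. poly p (1 / s) * exp (- (1 / s)) = flat p s"
      using eventually_nhds_in_open[of "{0<..}" t] 1 by (auto elim!: eventually_mono simp: flat_def)
    ultimately show ?thesis by (simp add: DERIV_cong_ev[of t t "\<lambda>t. poly p (1 / t) * exp (- (1 / t))" "flat p"])
  next
    case 2
    have "((\<lambda>t. 0) has_real_derivative 0) (at t)" by simp
    moreover have "\<forall>\<^sub>F s in nhds t. 0 = flat p s"
      using eventually_nhds_in_open[of "{..<0}" t] 2 by (auto elim!: eventually_mono simp: flat_def)
    ultimately have "(flat p has_real_derivative 0) (at t)"
      using DERIV_cong_ev[of t t "\<lambda>t. 0" "flat p" 0 0] by simp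
    then show ?thesis using 2 by (simp add: flat_def)
  next
    case 3
    have "((\<lambda>h. flat p h / h) \<longlongrightarrow> 0) (at_left 0)"
      by (rule tendsto_eventually) (auto simp: eventually_at_left_field flat_def intro: exI[of _ "-1"])
    moreover have "((\<lambda>h. flat p h / h) \<longlongrightarrow> 0) (at_right 0)"
    proof -
      \<comment> \<open>At the origin, dividing by \<open>h\<close> multiplies the polynomial in 1/h
        by its variable, which is \<open>pCons 0 p\<close>; the exponential still wins.\<close>
      have "((\<lambda>h. poly (pCons 0 p) (inverse h) * exp (- (inverse h))) \<longlongrightarrow> 0) (at_right 0)"
        by (rule filterlim_compose[OF poly_exp_tendsto_0 filterlim_inverse_at_top_right])
      moreover have "\<forall>\<^sub>F h in at_right 0.
          poly (pCons 0 p) (inverse h) * exp (- (inverse h)) = flat p h / h"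
        using eventually_at_right_less[of 0]
        by eventually_elim (simp add: flat_def inverse_eq_divide)
      ultimately show ?thesis using filterlim_cong[OF refl refl] by fast
    qed
    ultimately have "((\<lambda>h. flat p h / h) \<longlongrightarrow> 0) (at 0)"
      by (simp add: filterlim_split_at)
    then have "(flat p has_real_derivative 0) (at 0)"
      by (simp add: DERIV_def flat_def)
    then show ?thesis using 3 by (simp add: flat_def)
  qed
qed

lemma Ck_flat: "smooth g \<Longrightarrow> Ck k (\<lambda>x. flat p (g x))"
proof (induction k arbitrary: p)
  case 0
  have "continuous_on UNIV (flat p)"
    by (auto intro!: continuous_at_imp_continuous_on DERIV_isCont flat_has_derivative)
  then show ?case
    using smooth_continuous[OF 0] by (auto intro: continuous_on_compose2)
next
  case (Suc k)
  have d: "g differentiable (at x)" for x by (rule smooth_differentiable[OF Suc.prems])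
  have "pd i (\<lambda>x. flat p (g x)) = (\<lambda>x. flat ([:0,0,1:] * (p - pderiv p)) (g x) * pd i g x)" for i
    by (intro ext pd_compose_real[OF d flat_has_derivative])
  moreover have "(\<lambda>x. flat p (g x)) differentiable (at x)" for x
    using has_derivative_compose_real[OF d flat_has_derivative[of p "g x"]]
    unfolding differentiable_def by blast
  ultimately show ?case
    using Suc.IH[OF Suc.prems] smooth_Ck[OF smooth_pd[OF Suc.prems]] by (simp add: Ck_mult del: mult_pCons_left)
qed

definition bump :: "real^'n::finite \<Rightarrow> real" where
  "bump x = flat 1 (1 - (norm x)\<^sup>2)"

lemma bump_nonneg: "0 \<le> bump x"
  by (simp add: bump_def flat_def)

lemma bump_eq_0: "1 \<le> norm x \<Longrightarrow> bump x = 0"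
  using power_mono[of 1 "norm x" 2] by (simp add: bump_def flat_def not_less)

lemma bump_zero: "bump 0 = exp (-1)"
  by (simp add: bump_def flat_def)

lemma bump_le: "bump x \<le> exp (-1)"
proof (cases "norm x < 1")
  case True
  then have "0 < 1 - (norm x)\<^sup>2" by (simp add: abs_square_less_1)
  then have "1 \<le> 1 / (1 - (norm x)\<^sup>2)" by simp
  then show ?thesis using \<open>0 < 1 - (norm x)\<^sup>2\<close> by (simp add: bump_def flat_def)
next
  case False
  then show ?thesis by (simp add: bump_eq_0)
qed

lemma bump_ge:
  assumes "norm x \<le> 1 / 2"
  shows "exp (- (4 / 3)) \<le> bump x"
proof -
  have "(norm x)\<^sup>2 \<le> (1/2)\<^sup>2" using assms by (intro power_mono) auto
  then have *: "3 / 4 \<le> 1 - (norm x)\<^sup>2" by (simp add: power2_eq_square)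
  then have "1 / (1 - (norm x)\<^sup>2) \<le> 1 / (3/4)" by (intro divide_left_mono) auto
  then show ?thesis using * by (simp add: bump_def flat_def)
qed

lemma bump_minus: "bump (- x) = bump x"
  by (simp add: bump_def)

lemma bump_test: "bump \<in> test_functions"
proof -
  have "smooth (\<lambda>x::real^'n. 1 - (norm x)\<^sup>2)"
    unfolding smooth_def by (auto intro: Ck_diff Ck_norm_sq simp del: Ck.simps)
  from Ck_flat[OF this] have "smooth (bump :: real^'n \<Rightarrow> real)"
    unfolding bump_def[abs_def] smooth_def by blast
  moreover have "bsupp (bump :: real^'n \<Rightarrow> real)"
    unfolding bsupp_def using bump_eq_0 by (meson less_imp_le)
  ultimately show ?thesis by (simp add: test_functions_iff)
qed

lemma bump_scaled_test:
  assumes "0 < e"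
  shows "(\<lambda>x. bump ((1/e) *\<^sub>R x)) \<in> test_functions"
proof -
  have "smooth (\<lambda>x. bump (0 + (1/e) *\<^sub>R x))"
    using bump_test unfolding test_functions_iff by (intro smooth_intros) auto
  moreover have "bump ((1/e) *\<^sub>R x) = 0" if "e < norm x" for x :: "real^'n"
    using that assms by (intro bump_eq_0) (simp add: field_simps)
  then have "bsupp (\<lambda>x::real^'n. bump ((1/e) *\<^sub>R x))" unfolding bsupp_def by blast
  ultimately show ?thesis by (simp add: test_functions_iff)
qed

text \<open>The set where the two functions differ is open, and a nonempty open set has positive
  Lebesgue measure.\<close>

lemma continuous_AE_eq:
  fixes f g :: "real^'n::finite \<Rightarrow> 'b::real_normed_vector"
  assumes "continuous_on UNIV f" "continuous_on UNIV g" "AE x in lborel. f x = g x"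
  shows "f = g"
proof -
  have op: "open {x. f x \<noteq> g x}" using assms(1,2) by (intro open_Collect_neq)
  have "{x. f x \<noteq> g x} \<in> null_sets lborel"
    using assms(3) op by (subst (asm) AE_iff_null) auto
  then have "{x. f x \<noteq> g x} = {}"
    using op open_not_negligible[of "{x. f x \<noteq> g x}"] null_sets_completionI
    by (auto simp: negligible_iff_null_sets)
  then show ?thesis by auto
qed

lemma integral_continuous_pos:
  fixes f :: "real^'n::finite \<Rightarrow> real"
  assumes "continuous_on UNIV f" "integrable lborel f" "\<And>x. 0 \<le> f x" "0 < f a"
  shows "0 < (\<integral>x. f x \<partial>lborel)"
proof (rule ccontr)
  assume "\<not> ?thesis"
  moreover have "0 \<le> (\<integral>x. f x \<partial>lborel)" using assms(3) by simp
  ultimately have "(\<integral>x. f x \<partial>lborel) = 0" by linarith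
  then have "AE x in lborel. f x = 0"
    using integral_nonneg_eq_0_iff_AE[OF assms(2)] assms(3) by auto
  then have "f = (\<lambda>x. 0)" using assms(1) by (intro continuous_AE_eq) auto
  then show False using assms(4) by simp
qed

lemma test_continuous: "f \<in> test_functions \<Longrightarrow> continuous_on UNIV f"
  by (simp add: test_functions_iff smooth_continuous)

lemma test_integrable: "f \<in> test_functions \<Longrightarrow> integrable lborel f"
  by (auto simp: test_functions_iff intro: continuous_bsupp_integrable smooth_continuous)

lemma test_bounded:
  assumes "f \<in> test_functions"
  obtains B where "0 < B" "\<And>x. \<bar>f x\<bar> \<le> B"
  using assms continuous_bsupp_bounded[of f] by (auto simp: test_functions_iff smooth_continuous)

definition mollifier :: "real \<Rightarrow> real^'n::finite \<Rightarrow> real" where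
  "mollifier e x = bump ((1/e) *\<^sub>R x) / (\<integral>y. bump ((1/e) *\<^sub>R (y::real^'n)) \<partial>lborel)"

lemma
  assumes e: "0 < e"
  shows mollifier_test: "(mollifier e :: real^'n::finite \<Rightarrow> real) \<in> test_functions"
    and mollifier_nonneg: "0 \<le> mollifier e (x :: real^'n)"
    and mollifier_integral: "(\<integral>x. mollifier e (x :: real^'n) \<partial>lborel) = 1"
    and mollifier_eq_0: "e \<le> norm x \<Longrightarrow> mollifier e (x :: real^'n) = 0"
proof -
  define I where "I = (\<integral>y. bump ((1/e) *\<^sub>R (y::real^'n)) \<partial>lborel)"
  have I: "0 < I"
    unfolding I_def using bump_scaled_test[OF e]
    by (intro integral_continuous_pos[of _ 0] test_continuous test_integrable)
       (auto simp: bump_nonneg bump_zero)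
  have eq: "mollifier e = (\<lambda>x::real^'n. inverse I * bump ((1/e) *\<^sub>R x))"
    by (auto simp: mollifier_def I_def field_simps)
  show "(mollifier e :: real^'n \<Rightarrow> real) \<in> test_functions"
    unfolding eq using bump_scaled_test[OF e] by (rule test_cmult)
  show "0 \<le> mollifier e x" using I by (simp add: eq bump_nonneg)
  show "(\<integral>x. mollifier e (x :: real^'n) \<partial>lborel) = 1"
    using I unfolding eq by (simp add: I_def)
  show "mollifier e x = 0" if "e \<le> norm x"
    using that e by (simp add: eq bump_eq_0 field_simps)
qed

lemma mollifier_minus: "mollifier e (- x) = mollifier e x"
  by (simp add: mollifier_def bump_minus)

lemma mollifier_commute: "mollifier e (x - y) = mollifier e (y - x)"
  using mollifier_minus[of e "y - x"] by simp

lemma mollifier_integral_translate: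
  assumes "0 < e"
  shows "(\<integral>y. mollifier e (x - y :: real^'n::finite) \<partial>lborel) = 1"
proof -
  have "(\<integral>y. mollifier e (x - y) \<partial>lborel) = (\<integral>y. mollifier e (y + (- x)) \<partial>lborel)"
    by (subst mollifier_commute) simp
  also have "\<dots> = (\<integral>y. mollifier e (y :: real^'n) \<partial>lborel)"
    by (rule integral_lborel_translate[OF
          borel_measurable_continuous_onI[OF test_continuous[OF mollifier_test[OF assms]]]])
  finally show ?thesis using mollifier_integral[OF assms] by simp
qed

text \<open>Normalized to 1 at the origin but not equal to 1 on a ball. What takes the place of a
  plateau is the lower bound exp(-1/3) on half the ball together with the pointwise convergence to 1
  as the radius grows.\<close>

definition cutoff :: "real \<Rightarrow> real^'n::finite \<Rightarrow> real" where
  "cutoff r x = exp 1 * bump ((1/r) *\<^sub>R x)"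

lemma cutoff_test: "0 < r \<Longrightarrow> cutoff r \<in> test_functions"
  unfolding cutoff_def by (intro test_cmult bump_scaled_test)

lemma cutoff_bounds: "0 \<le> cutoff r x" "cutoff r x \<le> 1"
  using bump_le[of "(1/r) *\<^sub>R x"] bump_nonneg[of "(1/r) *\<^sub>R x"]
  by (auto simp: cutoff_def exp_minus field_simps)

lemma cutoff_eq_0: "0 < r \<Longrightarrow> r \<le> norm x \<Longrightarrow> cutoff r x = 0"
  by (simp add: cutoff_def bump_eq_0 field_simps)

lemma cutoff_ge: "0 < r \<Longrightarrow> norm x \<le> r / 2 \<Longrightarrow> exp (- (1 / 3)) \<le> cutoff r x"
proof -
  assume "0 < r" "norm x \<le> r / 2"
  then have "exp 1 * exp (- (4/3)) \<le> cutoff r x"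
    unfolding cutoff_def by (intro mult_left_mono bump_ge) (auto simp: field_simps)
  then show ?thesis by (simp flip: exp_add)
qed

lemma cutoff_tendsto: "(\<lambda>n. cutoff (real (Suc n)) x) \<longlonglongrightarrow> 1"
proof -
  have "(\<lambda>n. inverse (real (Suc n)) *\<^sub>R x) \<longlonglongrightarrow> 0 *\<^sub>R x"
    by (intro tendsto_intros LIMSEQ_inverse_real_of_nat)
  then have "(\<lambda>n. bump (inverse (real (Suc n)) *\<^sub>R x)) \<longlonglongrightarrow> bump (0 *\<^sub>R x)"
    by (rule continuous_on_tendsto_compose[OF test_continuous[OF bump_test]]) auto
  then have "(\<lambda>n. exp 1 * bump (inverse (real (Suc n)) *\<^sub>R x)) \<longlonglongrightarrow> exp 1 * bump (0 *\<^sub>R x)"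
    by (intro tendsto_intros)
  then show ?thesis by (simp add: cutoff_def bump_zero inverse_eq_divide exp_minus del: of_nat_Suc)
qed

text \<open>The chain rule produces the factor 1/r. It is essential for the energy estimate that
  \<open>K\<close> is the same for all radii.\<close>

lemma cutoff_pd_bound:
  obtains K where "0 < K" "\<And>r i x. 0 < r \<Longrightarrow> \<bar>pd i (cutoff r) (x::real^'n::finite)\<bar> \<le> K / r"
proof -
  have "\<exists>B. 0 < B \<and> (\<forall>x. \<bar>pd i bump (x::real^'n)\<bar> \<le> B)" for i
    using test_bounded[OF test_pd[OF bump_test]] by metis
  then obtain B where B: "\<And>i. 0 < B i" "\<And>i x. \<bar>pd i bump (x::real^'n)\<bar> \<le> B i" by metis
  define K where "K = exp 1 * (\<Sum>i\<in>UNIV. B i)"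
  have BK: "B i \<le> (\<Sum>i\<in>UNIV. B i)" for i
    using B(1) by (intro member_le_sum) (auto intro: less_imp_le)
  have "0 < K" unfolding K_def using B(1) by (auto intro!: sum_pos mult_pos_pos)
  moreover have "\<bar>pd i (cutoff r) x\<bar> \<le> K / r" if "0 < r" for r i and x :: "real^'n"
  proof -
    have d: "bump differentiable (at y)" for y :: "real^'n"
      using bump_test smooth_differentiable by (auto simp: test_functions_iff)
    have d': "(\<lambda>x. bump (0 + (1/r) *\<^sub>R x)) differentiable (at x)"
      using has_derivative_affine[OF d, of 0 "1/r" x] unfolding differentiable_def by blast
    have "pd i (\<lambda>x. exp 1 * bump (0 + (1/r) *\<^sub>R x)) x = exp 1 * ((1/r) * pd i bump (0 + (1/r) *\<^sub>R x))"
      by (subst pd_cmult[OF d']) (simp only: pd_affine[OF d])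
    then have "\<bar>pd i (cutoff r) x\<bar> = exp 1 * \<bar>pd i bump ((1/r) *\<^sub>R x)\<bar> / r"
      using that by (simp add: cutoff_def[abs_def] abs_mult)
    also have "\<dots> \<le> exp 1 * (\<Sum>i\<in>UNIV. B i) / r"
      using that B(2)[of i "(1/r) *\<^sub>R x"] BK[of i]
      by (intro divide_right_mono mult_left_mono) auto
    finally show ?thesis by (simp add: K_def)
  qed
  ultimately show thesis by (rule that)
qed

section \<open>Mollification\<close>

definition conv :: "(real^'n::finite \<Rightarrow> real) \<Rightarrow> (real^'n \<Rightarrow> real) \<Rightarrow> real^'n \<Rightarrow> real" where
  "conv k g x = (\<integral>y. k (x - y) * g y \<partial>lborel)"

lemma integrable_bounded_mult:
  fixes g h :: "'a \<Rightarrow> real"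
  assumes "integrable M g" "h \<in> borel_measurable M" "\<And>x. \<bar>h x\<bar> \<le> B"
  shows "integrable M (\<lambda>x. h x * g x)"
proof (rule Bochner_Integration.integrable_bound)
  show "integrable M (\<lambda>x. B * \<bar>g x\<bar>)" using assms(1) by auto
  have "\<bar>h x\<bar> * \<bar>g x\<bar> \<le> \<bar>B\<bar> * \<bar>g x\<bar>" for x
    using assms(3)[of x] by (intro mult_right_mono) auto
  then show "AE x in M. norm (h x * g x) \<le> norm (B * \<bar>g x\<bar>)" by (simp add: abs_mult)
qed (use assms in auto)

lemma conv_integrable:
  assumes "k \<in> test_functions" "integrable lborel g"
  shows "integrable lborel (\<lambda>y. k (x - y) * g y)"
proof -
  obtain B where "\<And>x. \<bar>k x\<bar> \<le> B" using test_bounded[OF assms(1)] by blast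
  moreover have "continuous_on UNIV (\<lambda>y. k (x - y))"
    by (rule continuous_on_compose2[OF test_continuous[OF assms(1)]]) (auto intro!: continuous_intros)
  ultimately show ?thesis
    using assms(2) by (intro integrable_bounded_mult[of _ _ _ B])
      (auto intro: borel_measurable_continuous_onI)
qed

lemma test_mean_value:
  assumes "f \<in> test_functions"
  obtains s where "0 < s" "s < 1" "f (z + v) - f z = grad f (z + s *\<^sub>R v) \<bullet> v"
proof -
  have d: "f differentiable (at x)" for x
    using assms by (simp add: test_functions_iff smooth_differentiable)
  have "((\<lambda>s. f (z + s *\<^sub>R v)) has_real_derivative (grad f (z + s *\<^sub>R v) \<bullet> v)) (at s)" for s
  proof -
    have "((\<lambda>s. z + s *\<^sub>R v) has_derivative (\<lambda>h. h *\<^sub>R v)) (at s)"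
      by (auto intro!: derivative_eq_intros)
    from has_derivative_compose[OF this differentiable_imp_has_derivative_grad[OF d]]
    show ?thesis by (simp add: has_field_derivative_def mult.commute[of _ "grad _ _ \<bullet> _"])
  qed
  from MVT2[OF zero_less_one this] obtain s where "0 < s" "s < 1"
    "f (z + 1 *\<^sub>R v) - f (z + 0 *\<^sub>R v) = (1 - 0) * (grad f (z + s *\<^sub>R v) \<bullet> v)" by blast
  then show thesis by (intro that[of s]) auto
qed

lemma test_grad_bounded:
  assumes "f \<in> test_functions"
  obtains B where "0 < B" "\<And>x. norm (grad f x) \<le> B"
proof -
  have "\<exists>B. 0 < B \<and> (\<forall>x. \<bar>pd i f x\<bar> \<le> B)" for i
    using test_bounded[OF test_pd[OF assms]] by metis
  then obtain B where B: "\<And>i. 0 < B i" "\<And>i x. \<bar>pd i f x\<bar> \<le> B i" by metis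
  have "norm (grad f x) \<le> (\<Sum>i\<in>UNIV. B i)" for x
  proof -
    have "norm (grad f x) \<le> (\<Sum>i\<in>UNIV. \<bar>grad f x $ i\<bar>)" by (rule norm_le_l1_cart)
    also have "\<dots> \<le> (\<Sum>i\<in>UNIV. B i)" using B(2) by (intro sum_mono) auto
    finally show ?thesis .
  qed
  moreover have "0 < (\<Sum>i\<in>UNIV. B i)" using B(1) by (auto intro!: sum_pos)
  ultimately show thesis using that by blast
qed

text \<open>The remainder is quadratic uniformly in the base point, because the first derivatives
  are globally Lipschitz. This allows convolutions to be differentiated without a limit
  theorem.\<close>

lemma test_taylor:
  assumes "f \<in> test_functions"
  obtains M where "0 < M" "\<And>z v. \<bar>f (z + v) - f z - grad f z \<bullet> v\<bar> \<le> M * (norm v)\<^sup>2"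
proof -
  have "\<exists>B. 0 < B \<and> (\<forall>x. norm (grad (pd i f) x) \<le> B)" for i
    using test_grad_bounded[OF test_pd[OF assms]] by metis
  then obtain B where B: "\<And>i. 0 < B i" "\<And>i x. norm (grad (pd i f) x) \<le> B i" by metis
  have lip: "\<bar>pd i f (z + w) - pd i f z\<bar> \<le> B i * norm w" for i z w
  proof -
    obtain s where "pd i f (z + w) - pd i f z = grad (pd i f) (z + s *\<^sub>R w) \<bullet> w"
      using test_mean_value[OF test_pd[OF assms]] by metis
    then have "\<bar>pd i f (z + w) - pd i f z\<bar> \<le> norm (grad (pd i f) (z + s *\<^sub>R w)) * norm w"
      using Cauchy_Schwarz_ineq2 by metis
    also have "\<dots> \<le> B i * norm w" by (intro mult_right_mono B) auto
    finally show ?thesis .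
  qed
  have "\<bar>f (z + v) - f z - grad f z \<bullet> v\<bar> \<le> (\<Sum>i\<in>UNIV. B i) * (norm v)\<^sup>2" for z v
  proof -
    obtain s where s: "0 < s" "s < 1" "f (z + v) - f z = grad f (z + s *\<^sub>R v) \<bullet> v"
      using test_mean_value[OF assms] by metis
    have "f (z + v) - f z - grad f z \<bullet> v = (\<Sum>i\<in>UNIV. (pd i f (z + s *\<^sub>R v) - pd i f z) * v $ i)"
      unfolding s(3) by (simp add: inner_vec_def sum_subtractf algebra_simps)
    also have "\<bar>\<dots>\<bar> \<le> (\<Sum>i\<in>UNIV. \<bar>(pd i f (z + s *\<^sub>R v) - pd i f z) * v $ i\<bar>)" by (rule sum_abs)
    also have "\<dots> \<le> (\<Sum>i\<in>UNIV. B i * (norm v)\<^sup>2)"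
    proof (rule sum_mono)
      fix i
      have "\<bar>(pd i f (z + s *\<^sub>R v) - pd i f z) * v $ i\<bar> \<le> (B i * norm (s *\<^sub>R v)) * norm v"
        unfolding abs_mult using B(1)[of i] by (intro mult_mono lip component_le_norm_cart) (auto intro!: mult_nonneg_nonneg)
      also have "\<dots> \<le> (B i * norm v) * norm v"
        using s B(1)[of i] mult_right_mono[of s 1 "norm v"] by (intro mult_right_mono mult_left_mono) auto
      finally show "\<bar>(pd i f (z + s *\<^sub>R v) - pd i f z) * v $ i\<bar> \<le> B i * (norm v)\<^sup>2"
        by (simp add: power2_eq_square mult.assoc)
    qed
    finally show ?thesis by (simp add: sum_distrib_right)
  qed
  moreover have "0 < (\<Sum>i\<in>UNIV. B i)" using B(1) by (auto intro!: sum_pos)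
  ultimately show thesis using that by blast
qed

text \<open>Integrating the uniform Taylor remainder of the kernel against the absolute value of
  \<open>g\<close> gives an error of order \<open>(norm v)\<^sup>2\<close>; of \<open>g\<close> only
  integrability enters.\<close>

lemma conv_has_derivative:
  fixes k :: "real^'n::finite \<Rightarrow> real"
  assumes k: "k \<in> test_functions" and g: "integrable lborel g"
  shows "(conv k g has_derivative (\<lambda>v. \<Sum>i\<in>UNIV. conv (pd i k) g x * v $ i)) (at x)"
proof -
  obtain M where M: "0 < M" "\<And>z v. \<bar>k (z + v) - k z - grad k z \<bullet> v\<bar> \<le> M * (norm v)\<^sup>2"
    using test_taylor[OF k] by blast
  define N where "N = (\<integral>y. \<bar>g y\<bar> \<partial>lborel)"
  have N: "0 \<le> N" by (simp add: N_def)
  note ik = conv_integrable[OF k g] and ip = conv_integrable[OF test_pd[OF k] g]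
  have est: "\<bar>conv k g (x + v) - conv k g x - (\<Sum>i\<in>UNIV. conv (pd i k) g x * v $ i)\<bar> \<le> M * N * (norm v)\<^sup>2" for v
  proof -
    have eq: "conv k g (x + v) - conv k g x - (\<Sum>i\<in>UNIV. conv (pd i k) g x * v $ i)
      = (\<integral>y. (k ((x - y) + v) - k (x - y) - grad k (x - y) \<bullet> v) * g y \<partial>lborel)"
    proof -
      have "(k ((x - y) + v) - k (x - y) - grad k (x - y) \<bullet> v) * g y
         = k ((x + v) - y) * g y - k (x - y) * g y - (\<Sum>i\<in>UNIV. (pd i k (x - y) * g y) * v $ i)" for y
        by (simp add: inner_vec_def algebra_simps sum_distrib_left)
      then show ?thesis
        by (simp add: conv_def ik ip Bochner_Integration.integral_sum)
    qed
    have int: "integrable lborel (\<lambda>y. (k ((x - y) + v) - k (x - y) - grad k (x - y) \<bullet> v) * g y)"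
    proof -
      have "(k ((x - y) + v) - k (x - y) - grad k (x - y) \<bullet> v) * g y
         = k ((x + v) - y) * g y - k (x - y) * g y - (\<Sum>i\<in>UNIV. (pd i k (x - y) * g y) * v $ i)" for y
        by (simp add: inner_vec_def algebra_simps sum_distrib_left)
      then show ?thesis by (simp add: ik ip)
    qed
    have "\<bar>\<integral>y. (k ((x - y) + v) - k (x - y) - grad k (x - y) \<bullet> v) * g y \<partial>lborel\<bar>
        \<le> (\<integral>y. \<bar>(k ((x - y) + v) - k (x - y) - grad k (x - y) \<bullet> v) * g y\<bar> \<partial>lborel)"
      using integral_abs_bound by blast
    also have "\<dots> \<le> (\<integral>y. (M * (norm v)\<^sup>2) * \<bar>g y\<bar> \<partial>lborel)"
    proof (intro integral_mono)
      show "integrable lborel (\<lambda>y. \<bar>(k ((x - y) + v) - k (x - y) - grad k (x - y) \<bullet> v) * g y\<bar>)"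
        using int by (rule integrable_abs)
    qed (use g M(2) in \<open>auto simp: abs_mult intro!: mult_right_mono\<close>)
    finally show ?thesis unfolding eq by (simp add: N_def mult_ac)
  qed
  show ?thesis
  proof (rule has_derivativeI_sandwich[of 1 _ _ _ _ "\<lambda>y. M * N * norm (y - x)"])
    show "bounded_linear (\<lambda>v. \<Sum>i\<in>UNIV. conv (pd i k) g x * v $ i)"
      by (intro bounded_linear_sum bounded_linear_const_mult bounded_linear_vec_nth)
    show "norm (conv k g y - conv k g x - (\<Sum>i\<in>UNIV. conv (pd i k) g x * (y - x) $ i)) / norm (y - x)
        \<le> M * N * norm (y - x)" if "y \<noteq> x" for y
      using est[of "y - x"] that by (simp add: divide_le_eq power2_eq_square mult.assoc)
    have "((\<lambda>y. M * N * norm (y - x)) \<longlongrightarrow> M * N * norm (x - x)) (at x)" by (intro tendsto_intros)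
    then show "((\<lambda>y. M * N * norm (y - x)) \<longlongrightarrow> 0) (at x)" by simp
  qed simp
qed

lemma pd_conv:
  "k \<in> test_functions \<Longrightarrow> integrable lborel g \<Longrightarrow> pd i (conv k g) = conv (pd i k) g"
  by (intro ext) (simp add: pd_has_derivative[OF conv_has_derivative] axis_def if_distrib cong: if_cong)

lemma smooth_conv:
  assumes "k \<in> test_functions" "integrable lborel g"
  shows "smooth (conv k g)"
proof -
  have "Ck n (conv k g)" for n using assms
  proof (induction n arbitrary: k)
    case 0
    have "continuous_on UNIV (conv k g)"
      using conv_has_derivative[OF 0] by (intro continuous_at_imp_continuous_on ballI has_derivative_continuous)
    then show ?case by simp
  next
    case (Suc n)
    then show ?case
      using conv_has_derivative[OF Suc.prems] by (auto simp: pd_conv test_pd differentiable_def)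
  qed
  then show ?thesis by (simp add: smooth_def)
qed

lemma integral_by_parts:
  assumes "Ck 1 f" "Ck 1 g" "bsupp f"
  shows "(\<integral>x. pd i f x * g x \<partial>lborel) = - (\<integral>x. f x * pd i g x \<partial>lborel)"
proof -
  have "(\<integral>x. pd i (\<lambda>x. f x * g x) x \<partial>lborel) = 0"
    using assms by (intro integral_pd_eq_0 Ck_mult bsupp_mult1)
  moreover have "pd i (\<lambda>x. f x * g x) x = pd i f x * g x + f x * pd i g x" for x
    using assms by (intro pd_mult) auto
  moreover have "integrable lborel (\<lambda>x. pd i f x * g x)" "integrable lborel (\<lambda>x. f x * pd i g x)"
    using assms Ck_imp_continuous[OF assms(1)] Ck_imp_continuous[OF assms(2)]
    by (auto intro!: continuous_bsupp_integrable continuous_intros bsupp_mult1 bsupp_pd)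
  ultimately show ?thesis by simp
qed

lemma pd_reflect:
  assumes "f differentiable (at (x - y))"
  shows "pd i (\<lambda>y. f (x - y)) y = - pd i f (x - y)"
  using pd_affine[of f x "-1" y] assms by simp

lemma Ck_reflect: "Ck k f \<Longrightarrow> Ck k (\<lambda>y. f (x - y))"
  using Ck_affine[of k f x "-1"] by simp

lemma test_reflect:
  assumes "f \<in> test_functions"
  shows "(\<lambda>y. f (x - y)) \<in> test_functions"
proof -
  obtain r where r: "0 < r" "\<And>x. r < norm x \<Longrightarrow> f x = 0"
    using assms bsuppE[of f] unfolding test_functions_iff by metis
  have "f (x - y) = 0" if "r + norm x < norm y" for y
    using that norm_triangle_ineq2[of y x] by (intro r) (simp add: norm_minus_commute)
  then have "bsupp (\<lambda>y. f (x - y))" unfolding bsupp_def by blast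
  then show ?thesis using assms by (auto simp: test_functions_iff smooth_def Ck_reflect simp del: Ck.simps)
qed

lemma conv_pd_right:
  assumes k: "k \<in> test_functions" and g: "Ck 1 g" "bsupp g"
  shows "conv (pd i k) g x = conv k (pd i g) x"
proof -
  have "(\<integral>y. pd i (\<lambda>y. k (x - y)) y * g y \<partial>lborel) = - (\<integral>y. k (x - y) * pd i g y \<partial>lborel)"
    using test_reflect[OF k] g by (intro integral_by_parts) (auto simp: test_functions_iff smooth_Ck simp del: Ck.simps)
  moreover have "pd i (\<lambda>y. k (x - y)) y = - pd i k (x - y)" for y
    using k by (intro pd_reflect) (simp add: test_functions_iff smooth_differentiable)
  ultimately show ?thesis by (simp add: conv_def)
qed

lemma conv_mollifier_bsupp:
  assumes "0 < e" "e \<le> 1" "\<And>x. r < norm x \<Longrightarrow> g x = 0" "r + 1 < norm x"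
  shows "conv (mollifier e) g x = 0"
proof -
  have "mollifier e (x - y) * g y = 0" for y
  proof (cases "r < norm y")
    case False
    then have "e \<le> norm (x - y)" using assms norm_triangle_ineq2[of x y] by linarith
    then show ?thesis using mollifier_eq_0[OF assms(1), of "x - y"] by simp
  qed (use assms in simp)
  then show ?thesis unfolding conv_def by (simp only: Bochner_Integration.integral_zero)
qed

lemma conv_mollifier_close:
  fixes g :: "real^'n::finite \<Rightarrow> real"
  assumes e: "0 < e" and g: "integrable lborel g" and \<eta>: "\<And>y. norm (x - y) \<le> e \<Longrightarrow> \<bar>g y - g x\<bar> \<le> \<eta>"
  shows "\<bar>conv (mollifier e) g x - g x\<bar> \<le> \<eta>"
proof -
  have mi: "integrable lborel (\<lambda>y. mollifier e (x - y))"
    by (intro test_integrable test_reflect mollifier_test e)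
  have int: "integrable lborel (\<lambda>y. mollifier e (x - y) * g y)"
    by (intro conv_integrable mollifier_test e g)
  have "conv (mollifier e) g x - g x = (\<integral>y. mollifier e (x - y) * g y - mollifier e (x - y) * g x \<partial>lborel)"
    using mi int by (simp add: conv_def mollifier_integral_translate[OF e])
  also have "\<bar>\<dots>\<bar> \<le> (\<integral>y. \<bar>mollifier e (x - y) * g y - mollifier e (x - y) * g x\<bar> \<partial>lborel)"
    using integral_abs_bound by blast
  also have "\<dots> \<le> (\<integral>y. mollifier e (x - y) * \<eta> \<partial>lborel)"
  proof (intro integral_mono)
    fix y
    have "\<bar>mollifier e (x - y) * g y - mollifier e (x - y) * g x\<bar> = mollifier e (x - y) * \<bar>g y - g x\<bar>"
      using mollifier_nonneg[OF e, of "x - y"] by (simp add: abs_mult flip: right_diff_distrib)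
    also have "\<dots> \<le> mollifier e (x - y) * \<eta>"
      using \<eta>[of y] mollifier_eq_0[OF e, of "x - y"] mollifier_nonneg[OF e, of "x - y"]
      by (cases "norm (x - y) \<le> e") (auto intro: mult_left_mono)
    finally show "\<bar>mollifier e (x - y) * g y - mollifier e (x - y) * g x\<bar> \<le> mollifier e (x - y) * \<eta>" .
  qed (use mi int in auto)
  also have "\<dots> = \<eta>" by (simp add: mollifier_integral_translate[OF e])
  finally show ?thesis .
qed

lemma bsupp_uniformly_continuous:
  fixes f :: "real^'n::finite \<Rightarrow> real"
  assumes "continuous_on UNIV f" "bsupp f" "0 < \<eta>"
  obtains d where "0 < d" "\<And>x y. norm (x - y) \<le> d \<Longrightarrow> \<bar>f y - f x\<bar> \<le> \<eta>"
proof -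
  obtain r where r: "0 < r" "\<And>x. r < norm x \<Longrightarrow> f x = 0" using bsuppE[OF assms(2)] by metis
  have "uniformly_continuous_on (cball 0 (r + 1)) f"
    using assms(1) by (intro compact_uniformly_continuous) (auto intro: continuous_on_subset)
  then obtain d where d: "0 < d"
    "\<And>x y. x \<in> cball 0 (r+1) \<Longrightarrow> y \<in> cball 0 (r+1) \<Longrightarrow> dist y x < d \<Longrightarrow> dist (f y) (f x) < \<eta>"
    unfolding uniformly_continuous_on_def using assms(3) by metis
  have "\<bar>f y - f x\<bar> \<le> \<eta>" if xy: "norm (x - y) \<le> min (d/2) 1" for x y
  proof (cases "x \<in> cball 0 (r+1) \<and> y \<in> cball 0 (r+1)")
    case True
    have "dist y x < d" using xy d(1) by (simp add: dist_norm norm_minus_commute)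
    then show ?thesis using d(2)[of x y] True by (simp add: dist_real_def)
  next
    case False
    then have "r < norm x \<and> r < norm y"
      using xy norm_triangle_ineq2[of x y] norm_triangle_ineq2[of y x] by (auto simp: norm_minus_commute)
    then show ?thesis using r(2) assms(3) by simp
  qed
  then show thesis using that[of "min (d/2) 1"] d(1) by simp
qed

lemma conv_mollifier_uniform:
  fixes g :: "real^'n::finite \<Rightarrow> real"
  assumes "continuous_on UNIV g" "bsupp g" "0 < \<eta>"
  obtains d where "0 < d" "\<And>e x. 0 < e \<Longrightarrow> e \<le> d \<Longrightarrow> \<bar>conv (mollifier e) g x - g x\<bar> \<le> \<eta>"
proof -
  obtain d where d: "0 < d" "\<And>x y. norm (x - y) \<le> d \<Longrightarrow> \<bar>g y - g x\<bar> \<le> \<eta>"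
    using bsupp_uniformly_continuous[OF assms] by blast
  show thesis
  proof (rule that[OF d(1)])
    show "\<bar>conv (mollifier e) g x - g x\<bar> \<le> \<eta>" if "0 < e" "e \<le> d" for e x
      using that d(2) by (intro conv_mollifier_close continuous_bsupp_integrable assms) auto
  qed
qed

lemma approx_C0:
  fixes g :: "real^'n::finite \<Rightarrow> real"
  assumes g: "continuous_on UNIV g" and r: "\<And>x. r < norm x \<Longrightarrow> g x = 0" and \<eta>: "0 < \<eta>"
  obtains \<psi> where "\<psi> \<in> test_functions" "\<And>x. r + 1 < norm x \<Longrightarrow> \<psi> x = 0" "\<And>x. \<bar>\<psi> x - g x\<bar> \<le> \<eta>"
proof -
  have supp: "bsupp g" using r by (auto simp: bsupp_def)
  obtain d where d: "0 < d" "\<And>e x. 0 < e \<Longrightarrow> e \<le> d \<Longrightarrow> \<bar>conv (mollifier e) g x - g x\<bar> \<le> \<eta>"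
    using conv_mollifier_uniform[OF g supp \<eta>] by blast
  define e where "e = min d 1"
  have e: "0 < e" "e \<le> d" "e \<le> 1" using d(1) by (auto simp: e_def)
  have z: "conv (mollifier e) g x = 0" if "r + 1 < norm x" for x
    using e r that by (intro conv_mollifier_bsupp[of _ r]) auto
  show thesis
  proof (rule that[of "conv (mollifier e) g"])
    show "conv (mollifier e) g \<in> test_functions"
      unfolding test_functions_iff using z
      by (auto intro!: smooth_conv mollifier_test e continuous_bsupp_integrable g supp simp: bsupp_def)
  qed (use z d e in auto)
qed

text \<open>Needed because the weight is only C^2: products with it leave the class of test
  functions, and weak identities reach them by uniform approximation of values and first derivatives
  on a common ball.\<close>

lemma approx_C1:
  fixes g :: "real^'n::finite \<Rightarrow> real"
  assumes g: "Ck 1 g" and r: "\<And>x. r < norm x \<Longrightarrow> g x = 0" and \<eta>: "0 < \<eta>"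
  obtains \<psi> where "\<psi> \<in> test_functions" "\<And>x. r + 1 < norm x \<Longrightarrow> \<psi> x = 0"
    "\<And>x. \<bar>\<psi> x - g x\<bar> \<le> \<eta>" "\<And>i x. \<bar>pd i \<psi> x - pd i g x\<bar> \<le> \<eta>"
proof -
  have supp: "bsupp g" using r by (auto simp: bsupp_def)
  have cg: "continuous_on UNIV g" and cp: "continuous_on UNIV (pd i g)" for i
    using Ck_imp_continuous[OF g] g by auto
  obtain d0 where d0: "0 < d0" "\<And>e x. 0 < e \<Longrightarrow> e \<le> d0 \<Longrightarrow> \<bar>conv (mollifier e) g x - g x\<bar> \<le> \<eta>"
    using conv_mollifier_uniform[OF cg supp \<eta>] by blast
  have "\<exists>d. 0 < d \<and> (\<forall>e x. 0 < e \<longrightarrow> e \<le> d \<longrightarrow> \<bar>conv (mollifier e) (pd i g) x - pd i g x\<bar> \<le> \<eta>)" for i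
    using conv_mollifier_uniform[OF cp bsupp_pd[OF supp] \<eta>] by metis
  then obtain d where d: "\<And>i. 0 < d i"
    "\<And>i e x. 0 < e \<Longrightarrow> e \<le> d i \<Longrightarrow> \<bar>conv (mollifier e) (pd i g) x - pd i g x\<bar> \<le> \<eta>" by metis
  define e where "e = min (min d0 1) (Min (range d))"
  have e: "0 < e" "e \<le> d0" "e \<le> 1" "e \<le> d i" for i
    using d0(1) d(1) by (auto simp: e_def min_le_iff_disj)
  have z: "conv (mollifier e) g x = 0" if "r + 1 < norm x" for x
    using e r that by (intro conv_mollifier_bsupp[of _ r]) auto
  have ig: "integrable lborel g" by (intro continuous_bsupp_integrable cg supp)
  have m: "mollifier e \<in> test_functions" by (intro mollifier_test e)
  show thesis
  proof (rule that[of "conv (mollifier e) g"])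
    show "conv (mollifier e) g \<in> test_functions"
      unfolding test_functions_iff using z
      by (auto intro!: smooth_conv m ig simp: bsupp_def)
    show "\<bar>pd i (conv (mollifier e) g) x - pd i g x\<bar> \<le> \<eta>" for i x
      using d(2)[OF e(1) e(4), of i x] by (simp add: pd_conv[OF m ig] conv_pd_right[OF m g supp])
  qed (use z d0 e in auto)
qed

lemma conv_nonneg:
  assumes "\<And>x. 0 \<le> k x" "\<And>x. 0 \<le> g x"
  shows "0 \<le> conv k g x"
  unfolding conv_def using assms by (intro integral_nonneg_AE) auto

lemma conv_fubini:
  fixes k :: "real^'n::finite \<Rightarrow> real"
  assumes k: "k \<in> test_functions" and g: "integrable lborel g" and h: "integrable lborel h"
  shows "(\<integral>x. conv k g x * h x \<partial>lborel) = (\<integral>y. g y * conv (\<lambda>z. k (- z)) h y \<partial>lborel)"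
    and "integrable lborel (\<lambda>x. conv k g x * h x)"
proof -
  have [measurable]: "g \<in> borel_measurable borel" "h \<in> borel_measurable borel" "k \<in> borel_measurable borel"
    using g h test_continuous[OF k] by (auto intro: borel_measurable_continuous_onI)
  obtain B where B: "\<And>x. \<bar>k x\<bar> \<le> B" using test_bounded[OF k] by metis
  have "integrable (lborel \<Otimes>\<^sub>M lborel) (\<lambda>(x, y). h x * g y)"
  proof (rule lborel_pair.Fubini_integrable)
    show "integrable lborel (\<lambda>x. \<integral>y. norm (case (x, y) of (x, y) \<Rightarrow> h x * g y) \<partial>lborel)"
      using h by (simp add: abs_mult)
    show "AE x in lborel. integrable lborel (\<lambda>y. case (x, y) of (x, y) \<Rightarrow> h x * g y)"
      using g by simp
  qed simp
  then have "integrable (lborel \<Otimes>\<^sub>M lborel) (\<lambda>p. k (fst p - snd p) * (case p of (x, y) \<Rightarrow> h x * g y))"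
    by (rule integrable_bounded_mult[where B = B]) (use B in auto)
  then have int: "integrable (lborel \<Otimes>\<^sub>M lborel) (\<lambda>(x, y). k (x - y) * g y * h x)"
    by (simp add: case_prod_unfold mult_ac)
  have "(\<integral>x. conv k g x * h x \<partial>lborel) = (\<integral>x. (\<integral>y. k (x - y) * g y * h x \<partial>lborel) \<partial>lborel)"
    by (simp add: conv_def)
  also have "\<dots> = (\<integral>y. (\<integral>x. k (x - y) * g y * h x \<partial>lborel) \<partial>lborel)"
    using lborel_pair.Fubini_integral[OF int] by simp
  also have "\<dots> = (\<integral>y. (\<integral>x. g y * (k (- (y - x)) * h x) \<partial>lborel) \<partial>lborel)"
    by (simp add: mult_ac)
  also have "\<dots> = (\<integral>y. g y * conv (\<lambda>z. k (- z)) h y \<partial>lborel)"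
    by (simp only: conv_def integral_mult_right_zero)
  finally show "(\<integral>x. conv k g x * h x \<partial>lborel) = (\<integral>y. g y * conv (\<lambda>z. k (- z)) h y \<partial>lborel)" .
  show "integrable lborel (\<lambda>x. conv k g x * h x)"
    using lborel_pair.integrable_fst[OF int] by (simp add: conv_def)
qed

text \<open>Fubini moves the mollifier from \<open>g\<close>, which is merely integrable, to the
  continuous \<open>h\<close>, where mollification converges uniformly.\<close>

lemma conv_mollifier_weak:
  fixes g :: "real^'n::finite \<Rightarrow> real"
  assumes "integrable lborel g" "continuous_on UNIV h" "bsupp h" "0 < \<eta>"
  obtains d where "0 < d" "\<And>e. 0 < e \<Longrightarrow> e \<le> d \<Longrightarrow>
    \<bar>(\<integral>x. conv (mollifier e) g x * h x \<partial>lborel) - (\<integral>x. g x * h x \<partial>lborel)\<bar> \<le> \<eta>"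
proof -
  \<comment> \<open>The added 1 keeps the divisor positive if \<open>g\<close> vanishes almost
    everywhere.\<close>
  define N where "N = (\<integral>x. \<bar>g x\<bar> \<partial>lborel) + 1"
  have "0 \<le> (\<integral>x. \<bar>g x\<bar> \<partial>lborel)" by simp
  then have N: "0 < N" unfolding N_def by linarith
  have hi: "integrable lborel h" by (rule continuous_bsupp_integrable[OF assms(2,3)])
  obtain d where d: "0 < d" "\<And>e x. 0 < e \<Longrightarrow> e \<le> d \<Longrightarrow> \<bar>conv (mollifier e) h x - h x\<bar> \<le> \<eta> / N"
    using conv_mollifier_uniform[OF assms(2,3), of "\<eta> / N"] assms(4) N by auto
  obtain B where B: "\<And>x. \<bar>h x\<bar> \<le> B" using continuous_bsupp_bounded[OF assms(2,3)] by metis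
  have igh: "integrable lborel (\<lambda>x. h x * g x)"
    using assms(1,2) B by (intro integrable_bounded_mult[where B = B]) (auto intro: borel_measurable_continuous_onI)
  have "\<bar>(\<integral>x. conv (mollifier e) g x * h x \<partial>lborel) - (\<integral>x. g x * h x \<partial>lborel)\<bar> \<le> \<eta>"
    if e: "0 < e" "e \<le> d" for e
  proof -
    have m: "(mollifier e :: real^'n \<Rightarrow> real) \<in> test_functions" by (rule mollifier_test[OF e(1)])
    have mm: "(\<lambda>z::real^'n. mollifier e (- z)) = mollifier e" by (simp add: mollifier_minus)
    define k where "k x = conv (mollifier e) h x - h x" for x
    have km: "k \<in> borel_measurable lborel"
      using smooth_continuous[OF smooth_conv[OF m hi]] assms(2) unfolding k_def
      by (auto intro!: borel_measurable_continuous_onI continuous_intros)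
    have kb: "\<bar>k x\<bar> \<le> \<eta> / N" for x using d(2)[OF e] by (simp add: k_def)
    have kg: "integrable lborel (\<lambda>x. k x * g x)"
      by (rule integrable_bounded_mult[OF assms(1) km kb])
    have "integrable lborel (\<lambda>x. k x * g x + h x * g x)" using kg igh by simp
    then have ic: "integrable lborel (\<lambda>x. g x * conv (mollifier e) h x)"
      by (simp add: k_def algebra_simps)
    have "(\<integral>x. conv (mollifier e) g x * h x \<partial>lborel) - (\<integral>x. g x * h x \<partial>lborel)
        = (\<integral>x. g x * conv (mollifier e) h x \<partial>lborel) - (\<integral>x. g x * h x \<partial>lborel)"
      using conv_fubini(1)[OF m assms(1) hi] by (simp add: mm)
    also have "\<dots> = (\<integral>x. k x * g x \<partial>lborel)"
      using ic igh by (simp add: k_def algebra_simps)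
    also have "\<bar>\<dots>\<bar> \<le> (\<integral>x. \<bar>k x * g x\<bar> \<partial>lborel)" using integral_abs_bound by blast
    also have "\<dots> \<le> (\<integral>x. (\<eta> / N) * \<bar>g x\<bar> \<partial>lborel)"
    proof (rule integral_mono)
      show "\<bar>k x * g x\<bar> \<le> (\<eta> / N) * \<bar>g x\<bar>" for x
        unfolding abs_mult by (intro mult_right_mono kb) simp
    qed (use kg assms(1) in auto)
    also have "\<dots> = (\<eta> / N) * (\<integral>x. \<bar>g x\<bar> \<partial>lborel)" by simp
    also have "\<dots> \<le> (\<eta> / N) * N"
      using assms(4) N by (intro mult_left_mono) (auto simp: N_def)
    finally show ?thesis using N by simp
  qed
  with d(1) show thesis by (rule that)
qed

text \<open>Moved to the other factor, the mollifier averages \<open>h\<close> and cannot exceed its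
  upper bound \<open>C\<close>. The factor \<open>h\<close> rather than a constant is there because
  Fubini asks for an integrable partner; later it is a multiple of the indicator of a ball.\<close>

lemma conv_mollifier_integral_le:
  fixes q h :: "real^'n::finite \<Rightarrow> real"
  assumes e: "0 < e" and q: "integrable lborel q" "\<And>x. 0 \<le> q x"
    and h: "integrable lborel h" "\<And>x. h x \<le> C"
  shows "(\<integral>x. conv (mollifier e) q x * h x \<partial>lborel) \<le> C * (\<integral>x. q x \<partial>lborel)"
proof -
  have m: "(mollifier e :: real^'n \<Rightarrow> real) \<in> test_functions" by (rule mollifier_test[OF e])
  have mm: "(\<lambda>z::real^'n. mollifier e (- z)) = mollifier e" by (simp add: mollifier_minus)
  have le: "conv (mollifier e) h x \<le> C" for x
  proof -
    have "conv (mollifier e) h x \<le> (\<integral>y. mollifier e (x - y) * C \<partial>lborel)"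
      unfolding conv_def
    proof (rule integral_mono)
      show "integrable lborel (\<lambda>y. mollifier e (x - y) * h y)" by (rule conv_integrable[OF m h(1)])
      show "integrable lborel (\<lambda>y. mollifier e (x - y) * C)"
        using test_integrable[OF test_reflect[OF m]] by simp
      show "mollifier e (x - y) * h y \<le> mollifier e (x - y) * C" for y
        by (intro mult_left_mono h(2) mollifier_nonneg e)
    qed
    then show ?thesis by (simp add: mollifier_integral_translate[OF e])
  qed
  have "(\<integral>x. conv (mollifier e) q x * h x \<partial>lborel) = (\<integral>x. q x * conv (mollifier e) h x \<partial>lborel)"
    using conv_fubini(1)[OF m q(1) h(1)] by (simp add: mm)
  also have "\<dots> \<le> (\<integral>x. q x * C \<partial>lborel)"
  proof (rule integral_mono)
    have "integrable lborel (\<lambda>x. conv (mollifier e) h x * q x)"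
      by (rule conv_fubini(2)[OF m h(1) q(1)])
    then show "integrable lborel (\<lambda>x. q x * conv (mollifier e) h x)" by (simp add: mult.commute)
  qed (use q le in \<open>auto intro: mult_left_mono\<close>)
  finally show ?thesis by (simp add: mult.commute)
qed

section \<open>The fundamental lemma of the calculus of variations\<close>

lemma loc_int_cball: "locally_integrable f \<Longrightarrow> integrable lborel (\<lambda>x. indicator (cball 0 r) x *\<^sub>R f x)"
  by (simp add: locally_integrable_def set_integrable_def)

lemma loc_int_measurable:
  assumes "locally_integrable f"
  shows "f \<in> borel_measurable borel"
proof (rule borel_measurable_LIMSEQ_metric)
  show "(\<lambda>x. indicator (cball 0 (real n)) x *\<^sub>R f x) \<in> borel_measurable borel" for n
    using loc_int_cball[OF assms, of "real n"] by (auto dest: borel_measurable_integrable)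
  fix x
  have "\<forall>\<^sub>F n in sequentially. indicator (cball 0 (real n)) x *\<^sub>R f x = f x"
    using eventually_ge_at_top[of "nat \<lceil>norm x\<rceil>"]
    by eventually_elim (simp add: nat_le_iff ceiling_le_iff)
  then show "(\<lambda>n. indicator (cball 0 (real n)) x *\<^sub>R f x) \<longlonglongrightarrow> f x" by (rule tendsto_eventually)
qed

lemma loc_int_mult:
  fixes f \<psi> :: "real^'n::finite \<Rightarrow> real"
  assumes f: "locally_integrable f" and \<psi>: "\<psi> \<in> borel_measurable borel"
    and r: "\<And>x. r < norm x \<Longrightarrow> \<psi> x = 0" and B: "\<And>x. \<bar>\<psi> x\<bar> \<le> B"
  shows "integrable lborel (\<lambda>x. f x * \<psi> x)"
proof -
  have "integrable lborel (\<lambda>x. \<psi> x * (indicator (cball 0 r) x *\<^sub>R f x))"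
    using \<psi> by (intro integrable_bounded_mult[OF loc_int_cball[OF f] _ B]) simp
  also have "(\<lambda>x. \<psi> x * (indicator (cball 0 r) x *\<^sub>R f x)) = (\<lambda>x. f x * \<psi> x)"
    using r by (auto simp: fun_eq_iff indicator_def not_le)
  finally show ?thesis .
qed

lemma loc_int_mult_continuous:
  fixes f \<psi> :: "real^'n::finite \<Rightarrow> real"
  assumes f: "locally_integrable f" and \<psi>: "continuous_on UNIV \<psi>" "bsupp \<psi>"
  shows "integrable lborel (\<lambda>x. f x * \<psi> x)"
proof -
  obtain B where "\<And>x. \<bar>\<psi> x\<bar> \<le> B" using continuous_bsupp_bounded[OF \<psi>] by metis
  moreover obtain r where "\<And>x. r < norm x \<Longrightarrow> \<psi> x = 0" using bsuppE[OF \<psi>(2)] by metis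
  ultimately show ?thesis
    using f \<psi>(1) by (intro loc_int_mult) (auto intro: borel_measurable_continuous_onI)
qed

lemma loc_int_approx:
  fixes f \<psi> \<psi>' :: "real^'n::finite \<Rightarrow> real"
  assumes f: "locally_integrable f" and c: "continuous_on UNIV \<psi>" "continuous_on UNIV \<psi>'"
    and r: "\<And>x. r < norm x \<Longrightarrow> \<psi> x = 0" "\<And>x. r < norm x \<Longrightarrow> \<psi>' x = 0"
    and \<eta>: "\<And>x. \<bar>\<psi>' x - \<psi> x\<bar> \<le> \<eta>"
  shows "\<bar>(\<integral>x. f x * \<psi>' x \<partial>lborel) - (\<integral>x. f x * \<psi> x \<partial>lborel)\<bar>
    \<le> \<eta> * (\<integral>x. \<bar>indicator (cball 0 r) x *\<^sub>R f x\<bar> \<partial>lborel)"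
proof -
  have b: "bsupp \<psi>" "bsupp \<psi>'" using r by (auto simp: bsupp_def)
  have i: "integrable lborel (\<lambda>x. f x * \<psi> x)" "integrable lborel (\<lambda>x. f x * \<psi>' x)"
    by (intro loc_int_mult_continuous f c b)+
  have "(\<integral>x. f x * \<psi>' x \<partial>lborel) - (\<integral>x. f x * \<psi> x \<partial>lborel) = (\<integral>x. f x * \<psi>' x - f x * \<psi> x \<partial>lborel)"
    using i by simp
  also have "\<bar>\<dots>\<bar> \<le> (\<integral>x. \<bar>f x * \<psi>' x - f x * \<psi> x\<bar> \<partial>lborel)" using integral_abs_bound by blast
  also have "\<dots> \<le> (\<integral>x. \<eta> * \<bar>indicator (cball 0 r) x *\<^sub>R f x\<bar> \<partial>lborel)"
  proof (intro integral_mono)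
    fix x
    have "\<bar>f x * \<psi>' x - f x * \<psi> x\<bar> = \<bar>f x\<bar> * \<bar>\<psi>' x - \<psi> x\<bar>"
      by (simp add: abs_mult flip: right_diff_distrib)
    also have "\<dots> \<le> \<eta> * \<bar>indicator (cball 0 r) x *\<^sub>R f x\<bar>"
      using r[of x] mult_left_mono[OF \<eta>[of x] abs_ge_zero[of "f x"]]
      by (cases "norm x \<le> r") (auto simp: mult.commute)
    finally show "\<bar>f x * \<psi>' x - f x * \<psi> x\<bar> \<le> \<eta> * \<bar>indicator (cball 0 r) x *\<^sub>R f x\<bar>" .
  qed (use i loc_int_cball[OF f] in \<open>auto intro!: integrable_abs\<close>)
  finally show ?thesis by simp
qed

lemma le_const_mult_eq_0:
  fixes a C :: real
  assumes "\<And>\<eta>. 0 < \<eta> \<Longrightarrow> \<bar>a\<bar> \<le> \<eta> * C"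
  shows "a = 0"
proof (rule ccontr)
  assume "a \<noteq> 0"
  define \<eta> where "\<eta> = \<bar>a\<bar> / (2 * (\<bar>C\<bar> + 1))"
  have "0 < \<eta>" using \<open>a \<noteq> 0\<close> by (simp add: \<eta>_def)
  then have "\<bar>a\<bar> \<le> \<eta> * C" by (rule assms)
  also have "\<dots> \<le> \<eta> * (\<bar>C\<bar> + 1)" using \<open>0 < \<eta>\<close> by (intro mult_left_mono) auto
  also have "\<dots> = \<bar>a\<bar> / 2" by (simp add: \<eta>_def field_simps)
  finally show False using \<open>a \<noteq> 0\<close> by simp
qed

lemma weak_eq_C0:
  fixes f \<psi> :: "real^'n::finite \<Rightarrow> real"
  assumes f: "locally_integrable f" and w: "\<And>\<psi>. \<psi> \<in> test_functions \<Longrightarrow> (\<integral>x. f x * \<psi> x \<partial>lborel) = 0"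
    and \<psi>: "continuous_on UNIV \<psi>" "bsupp \<psi>"
  shows "(\<integral>x. f x * \<psi> x \<partial>lborel) = 0"
proof -
  obtain r where r: "\<And>x. r < norm x \<Longrightarrow> \<psi> x = 0" using bsuppE[OF \<psi>(2)] by metis
  show ?thesis
  proof (rule le_const_mult_eq_0)
    fix \<eta> :: real assume "0 < \<eta>"
    then obtain \<psi>' where \<psi>': "\<psi>' \<in> test_functions" "\<And>x. r + 1 < norm x \<Longrightarrow> \<psi>' x = 0"
      "\<And>x. \<bar>\<psi>' x - \<psi> x\<bar> \<le> \<eta>"
      using approx_C0[OF \<psi>(1) r] by metis
    show "\<bar>\<integral>x. f x * \<psi> x \<partial>lborel\<bar> \<le> \<eta> * (\<integral>x. \<bar>indicator (cball 0 (r+1)) x *\<^sub>R f x\<bar> \<partial>lborel)"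
      using loc_int_approx[OF f \<psi>(1) test_continuous[OF \<psi>'(1)] _ \<psi>'(2) \<psi>'(3)] r w[OF \<psi>'(1)] by simp
  qed
qed

text \<open>Two derivative terms and one term of order zero, so that one statement serves the
  definition of weak derivatives and the equality of mixed weak derivatives. In each case one of the
  three functions is 0.\<close>

lemma weak_eq_C1:
  fixes f g h \<psi> :: "real^'n::finite \<Rightarrow> real"
  assumes f: "locally_integrable f" and g: "locally_integrable g" and h: "locally_integrable h"
    and w: "\<And>\<psi>. \<psi> \<in> test_functions \<Longrightarrow>
      (\<integral>x. f x * pd i \<psi> x \<partial>lborel) + (\<integral>x. g x * pd j \<psi> x \<partial>lborel) + (\<integral>x. h x * \<psi> x \<partial>lborel) = 0"
    and \<psi>: "Ck 1 \<psi>" "bsupp \<psi>"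
  shows "(\<integral>x. f x * pd i \<psi> x \<partial>lborel) + (\<integral>x. g x * pd j \<psi> x \<partial>lborel) + (\<integral>x. h x * \<psi> x \<partial>lborel) = 0"
proof -
  obtain r where r: "\<And>x. r < norm x \<Longrightarrow> \<psi> x = 0" using bsuppE[OF \<psi>(2)] by metis
  define N where "N f = (\<integral>x. \<bar>indicator (cball 0 (r+1)) x *\<^sub>R f x\<bar> \<partial>lborel)" for f :: "real^'n \<Rightarrow> real"
  have c: "continuous_on UNIV \<psi>" "continuous_on UNIV (pd i \<psi>)" for i
    using Ck_imp_continuous[OF \<psi>(1)] \<psi>(1) by auto
  show ?thesis
  proof (rule le_const_mult_eq_0)
    fix \<eta> :: real assume "0 < \<eta>"
    then obtain \<psi>' where \<psi>': "\<psi>' \<in> test_functions" "\<And>x. r + 1 < norm x \<Longrightarrow> \<psi>' x = 0"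
      "\<And>x. \<bar>\<psi>' x - \<psi> x\<bar> \<le> \<eta>" "\<And>i x. \<bar>pd i \<psi>' x - pd i \<psi> x\<bar> \<le> \<eta>"
      using approx_C1[OF \<psi>(1) r] by metis
    have r': "r + 1 < norm x \<Longrightarrow> \<psi> x = 0" for x using r[of x] by simp
    have pd0: "r + 1 < norm x \<Longrightarrow> pd i \<psi> x = 0" "r + 1 < norm x \<Longrightarrow> pd i \<psi>' x = 0" for i x
      using pd_eq_0_outside r' \<psi>'(2) by blast+
    have a: "\<bar>(\<integral>x. f x * pd k \<psi>' x \<partial>lborel) - (\<integral>x. f x * pd k \<psi> x \<partial>lborel)\<bar> \<le> \<eta> * N f"
      if "locally_integrable f" for f k
      unfolding N_def
      by (rule loc_int_approx[OF that c(2) test_continuous[OF test_pd[OF \<psi>'(1)]] pd0 \<psi>'(4)])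
    have "\<bar>(\<integral>x. h x * \<psi>' x \<partial>lborel) - (\<integral>x. h x * \<psi> x \<partial>lborel)\<bar> \<le> \<eta> * N h"
      unfolding N_def by (rule loc_int_approx[OF h c(1) test_continuous[OF \<psi>'(1)] r' \<psi>'(2) \<psi>'(3)])
    moreover note a[OF f, of i] a[OF g, of j] w[OF \<psi>'(1)]
    ultimately show "\<bar>(\<integral>x. f x * pd i \<psi> x \<partial>lborel) + (\<integral>x. g x * pd j \<psi> x \<partial>lborel) + (\<integral>x. h x * \<psi> x \<partial>lborel)\<bar>
        \<le> \<eta> * (N f + N g + N h)"
      unfolding ring_distribs by linarith
  qed
qed

text \<open>The tent functions max(0, 1 - n dist(x, K)) are continuous, lie between 0 and 1 and
  converge to the indicator of the closed set.\<close>

lemma integral_closed_eq_0: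
  fixes f :: "real^'n::finite \<Rightarrow> real"
  assumes f: "integrable lborel f"
    and w: "\<And>\<psi>. continuous_on UNIV \<psi> \<Longrightarrow> (\<And>x. \<bar>\<psi> x\<bar> \<le> 1) \<Longrightarrow> (\<integral>x. \<psi> x * f x \<partial>lborel) = 0"
    and K: "closed K"
  shows "(\<integral>x. indicator K x * f x \<partial>lborel) = 0"
\<comment> \<open>The distance to the empty set is 0 by convention, so the tents would be constantly
  1 there; this case is separate.\<close>
proof (cases "K = {}")
  case False
  define \<psi> where "\<psi> n x = max 0 (1 - real n * infdist x K)" for n x
  have c: "continuous_on UNIV (\<psi> n)" for n
    unfolding \<psi>_def by (intro continuous_intros)
  have b: "\<bar>\<psi> n x\<bar> \<le> 1" for n x
    using infdist_nonneg[of x K] by (auto simp: \<psi>_def)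
  have [measurable]: "f \<in> borel_measurable borel" "K \<in> sets borel" using f K by auto
  have "(\<lambda>n. \<integral>x. \<psi> n x * f x \<partial>lborel) \<longlonglongrightarrow> (\<integral>x. indicator K x * f x \<partial>lborel)"
  proof (rule integral_dominated_convergence)
    show "AE x in lborel. (\<lambda>n. \<psi> n x * f x) \<longlonglongrightarrow> indicator K x * f x"
    proof (intro AE_I2 tendsto_intros)
      fix x
      show "(\<lambda>n. \<psi> n x) \<longlonglongrightarrow> indicator K x"
      proof (cases "x \<in> K")
        case True
        then show ?thesis by (simp add: \<psi>_def)
      next
        case xK: False
        then have pos: "0 < infdist x K"
          using in_closed_iff_infdist_zero[OF K False] infdist_nonneg[of x K] by (metis less_le)
        obtain N where N: "1 / infdist x K < real N" using reals_Archimedean2 by blast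
        have "\<psi> n x = 0" if "n \<ge> N" for n
        proof -
          have "1 / infdist x K < real n" using N that by linarith
          then show ?thesis using pos by (simp add: \<psi>_def field_simps)
        qed
        then have "\<forall>\<^sub>F n in sequentially. \<psi> n x = indicator K x"
          using xK by (auto simp: eventually_sequentially)
        then show ?thesis by (rule tendsto_eventually)
      qed
    qed
    show "AE x in lborel. norm (\<psi> n x * f x) \<le> \<bar>f x\<bar>" for n
      using b[of n] by (auto simp: abs_mult intro!: AE_I2 mult_left_le_one_le)
    show "(\<lambda>x. \<psi> n x * f x) \<in> borel_measurable lborel" for n
      using borel_measurable_continuous_onI[OF c[of n]] by measurable
    show "(\<lambda>x. indicator K x * f x) \<in> borel_measurable lborel" by simp
  qed (use f in auto)
  then show ?thesis using w[OF c b] by (simp add: LIMSEQ_const_iff)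
qed simp

text \<open>Closed sets are stable under intersection and generate the Borel sets; by Dynkin's
  argument \<open>f\<close> has integral 0 over every Borel set.\<close>

lemma AE_eq_0_if_integral_continuous:
  fixes f :: "real^'n::finite \<Rightarrow> real"
  assumes f: "integrable lborel f"
    and w: "\<And>\<psi>. continuous_on UNIV \<psi> \<Longrightarrow> (\<And>x. \<bar>\<psi> x\<bar> \<le> 1) \<Longrightarrow> (\<integral>x. \<psi> x * f x \<partial>lborel) = 0"
  shows "AE x in lborel. f x = 0"
proof -
  have sb: "sets (borel :: (real^'n) measure) = sigma_sets UNIV (Collect closed)"
    by (subst borel_eq_closed) simp
  have si: "set_integrable lborel B f" if "B \<in> sets borel" for B
    using integrable_mult_indicator[of B lborel f] that f by (simp add: set_integrable_def)
  have sub: "Collect (closed :: (real^'n) set \<Rightarrow> bool) \<subseteq> Pow UNIV" by simp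
  have stable: "Int_stable (Collect (closed :: (real^'n) set \<Rightarrow> bool))" by (auto simp: Int_stable_def)
  have "(LINT x:A|lborel. f x) = 0" if "A \<in> sigma_sets UNIV (Collect closed)" for A :: "(real^'n) set"
    using stable sub that
  proof (induction rule: sigma_sets_induct_disjoint)
    case (basic A)
    then show ?case
      using integral_closed_eq_0[OF f w, of A] by (simp add: set_lebesgue_integral_def)
  next
    case empty
    show ?case by (simp add: set_lebesgue_integral_def)
  next
    case (compl A)
    then have [measurable]: "A \<in> sets borel" and IH: "(LINT x:A|lborel. f x) = 0" by (simp_all add: sb)
    have "(LINT x:(UNIV - A) \<union> A|lborel. f x) = (LINT x:UNIV - A|lborel. f x) + (LINT x:A|lborel. f x)"
      by (intro set_integral_Un si) auto
    moreover have "(LINT x:UNIV|lborel. f x) = 0"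
      using integral_closed_eq_0[OF f w, of UNIV] by (simp add: set_lebesgue_integral_def)
    ultimately show ?case using IH by (simp add: Un_absorb2 Compl_partition2 flip: Compl_eq_Diff_UNIV)
  next
    case (union A)
    then have dis: "disjoint_family A" and A: "range A \<subseteq> sigma_sets UNIV (Collect closed)"
      and IH: "\<And>i. (LINT x:A i|lborel. f x) = 0" by auto
    have [measurable]: "A i \<in> sets borel" for i using A by (auto simp: sb)
    have "(LINT x:(\<Union>i. A i)|lborel. f x) = (\<Sum>i. (LINT x:(A i)|lborel. f x))"
      using dis by (intro lebesgue_integral_countable_add si) (auto simp: disjoint_family_on_def)
    then show ?case by (simp add: IH)
  qed
  then have "AE x in lborel. f x = 0"
    using f by (intro density_unique_real) (auto simp: sb[symmetric] set_lebesgue_integral_def)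
  then show ?thesis .
qed

text \<open>Multiplication by a cutoff makes \<open>f\<close> integrable and turns every bounded
  continuous function into one of bounded support; the cutoffs then tend to 1. Countably many radii
  suffice, so the null sets can be united.\<close>

lemma fundamental_lemma:
  fixes f :: "real^'n::finite \<Rightarrow> real"
  assumes f: "locally_integrable f" and w: "\<And>\<psi>. \<psi> \<in> test_functions \<Longrightarrow> (\<integral>x. f x * \<psi> x \<partial>lborel) = 0"
  shows "AE x in lborel. f x = 0"
proof -
  have "AE x in lborel. cutoff (real (Suc n)) x * f x = 0" for n
  proof (rule AE_eq_0_if_integral_continuous)
    have t: "cutoff (real (Suc n)) \<in> test_functions" by (rule cutoff_test) simp
    note c = test_continuous[OF t]
    have b: "bsupp (cutoff (real (Suc n)))" using t unfolding test_functions_iff by blast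
    show "integrable lborel (\<lambda>x. cutoff (real (Suc n)) x * f x)"
      using loc_int_mult_continuous[OF f c b] by (simp add: mult.commute)
    fix \<psi> :: "real^'n \<Rightarrow> real" assume \<psi>: "continuous_on UNIV \<psi>"
    have "(\<integral>x. f x * (cutoff (real (Suc n)) x * \<psi> x) \<partial>lborel) = 0"
      using c b \<psi> by (intro weak_eq_C0[OF f w] continuous_intros bsupp_mult1)
    then show "(\<integral>x. \<psi> x * (cutoff (real (Suc n)) x * f x) \<partial>lborel) = 0" by (simp add: mult_ac)
  qed
  then have "AE x in lborel. \<forall>n. cutoff (real (Suc n)) x * f x = 0" by (simp only: AE_all_countable) blast
  then show ?thesis
  proof eventually_elim
    case (elim x)
    have "(\<lambda>n. cutoff (real (Suc n)) x * f x) \<longlonglongrightarrow> 1 * f x" by (intro tendsto_intros cutoff_tendsto)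
    moreover have "(\<lambda>n. cutoff (real (Suc n)) x * f x) = (\<lambda>n. 0)" using elim by blast
    ultimately show ?case by (simp add: LIMSEQ_const_iff del: of_nat_Suc)
  qed
qed

section \<open>Gibbs measures\<close>

lemma pd_minus: "f differentiable (at x) \<Longrightarrow> pd i (\<lambda>x. - f x) x = - pd i f x"
  using pd_cmult[of f x i "-1"] by simp

lemma continuous_uniformly_on_cball:
  fixes f :: "real^'n::finite \<Rightarrow> real"
  assumes "continuous_on UNIV f" "0 < \<omega>"
  obtains d where "0 < d" "\<And>x y. norm x \<le> R \<Longrightarrow> norm (x - y) \<le> d \<Longrightarrow> \<bar>f y - f x\<bar> \<le> \<omega>"
proof -
  have "uniformly_continuous_on (cball 0 (R + 1)) f"
    using assms(1) by (intro compact_uniformly_continuous) (auto intro: continuous_on_subset)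
  then obtain d where d: "0 < d"
    "\<And>x y. x \<in> cball 0 (R+1) \<Longrightarrow> y \<in> cball 0 (R+1) \<Longrightarrow> dist y x < d \<Longrightarrow> dist (f y) (f x) < \<omega>"
    unfolding uniformly_continuous_on_def using assms(2) by metis
  have "\<bar>f y - f x\<bar> \<le> \<omega>" if "norm x \<le> R" "norm (x - y) \<le> min (d/2) 1" for x y
    using that norm_triangle_ineq2[of y x] d(2)[of x y] d(1)
    by (simp add: dist_norm norm_minus_commute abs_minus_commute)
  then show thesis using that[of "min (d/2) 1"] d(1) by simp
qed

text \<open>The Poincare inequality and the centring of the measure come in later extensions of this
  locale. For the Gaussian both have to be proved, and their proofs already use the calculus
  developed here.\<close>

locale gibbs_potential =
  fixes \<phi> :: "real^'n::finite \<Rightarrow> real"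
  assumes C2: "Ck 2 \<phi>" and mass: "has_bochner_integral lborel (\<lambda>x. exp (- \<phi> x)) 1"
begin

abbreviation M where "M \<equiv> gibbs \<phi>"

definition w where "w x = exp (- \<phi> x)"

text \<open>The adjoint of \<open>pd j\<close> in \<open>L\<^sup>2\<close> of the Gibbs measure.\<close>

definition dstar where "dstar j f x = - pd j f x + f x * pd j \<phi> x"

definition LL where "LL h x = (\<Sum>k\<in>UNIV. dstar k (pd k h) x)"

lemma phi_C1: "Ck 1 \<phi>" "Ck 1 (pd i \<phi>)"
  using C2 Ck_mono[of 2 \<phi> 1] by (auto simp: numeral_2_eq_2)

lemma phi_differentiable: "\<phi> differentiable (at x)" "pd i \<phi> differentiable (at x)"
  using phi_C1 by auto

lemma phi_continuous: "continuous_on UNIV \<phi>" "continuous_on UNIV (pd i \<phi>)"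
  "continuous_on UNIV (pd j (pd i \<phi>))"
  using Ck_imp_continuous[OF phi_C1(1)] phi_C1 by auto

lemma w_pos [simp]: "0 < w x" "0 \<le> w x" "w x \<noteq> 0"
  by (auto simp: w_def)

lemma exp_phi: "exp (\<phi> x) = 1 / w x"
  by (simp add: w_def exp_minus field_simps)

lemma Ck_w: "k \<le> 2 \<Longrightarrow> Ck k w"
  unfolding w_def[abs_def] using Ck_exp[OF Ck_minus[OF C2]] Ck_mono by blast

lemma pd_w: "pd i w x = - w x * pd i \<phi> x"
  unfolding w_def[abs_def]
  by (subst pd_exp) (auto simp: pd_minus phi_differentiable)

lemma w_continuous: "continuous_on UNIV w"
  using Ck_w[of 0] by simp

lemma w_measurable [measurable]: "w \<in> borel_measurable borel"
  by (rule borel_measurable_continuous_onI[OF w_continuous])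

lemma phi_measurable [measurable]: "\<phi> \<in> borel_measurable borel" "pd i \<phi> \<in> borel_measurable borel"
  by (intro borel_measurable_continuous_onI phi_continuous)+

lemma w_integrable: "integrable lborel w" and w_integral: "(\<integral>x. w x \<partial>lborel) = 1"
  using mass by (auto simp: w_def[abs_def] has_bochner_integral_iff)

lemma M_eq: "M = density lborel (\<lambda>x. ennreal (w x))"
  by (simp add: gibbs_def w_def)

lemma sets_M [measurable_cong, simp]: "sets M = sets borel" and space_M [simp]: "space M = UNIV"
  by (simp_all add: gibbs_def)

lemma measurable_M [simp]: "f \<in> borel_measurable M \<longleftrightarrow> f \<in> borel_measurable borel"
  by (simp add: measurable_def)

lemma integrable_M:
  fixes f :: "real^'n \<Rightarrow> 'b::{banach,second_countable_topology}"
  shows "f \<in> borel_measurable borel \<Longrightarrow> integrable M f \<longleftrightarrow> integrable lborel (\<lambda>x. w x *\<^sub>R f x)"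
  unfolding M_eq by (intro integrable_density) auto

lemma integral_M:
  fixes f :: "real^'n \<Rightarrow> 'b::{banach,second_countable_topology}"
  shows "f \<in> borel_measurable borel \<Longrightarrow> (\<integral>x. f x \<partial>M) = (\<integral>x. w x *\<^sub>R f x \<partial>lborel)"
  unfolding M_eq by (intro integral_density) auto

lemma AE_M: "(AE x in M. P x) \<longleftrightarrow> (AE x in lborel. P x)"
  unfolding M_eq by (subst AE_density) auto

sublocale prob_space M
proof
  have "emeasure M (space M) = (\<integral>\<^sup>+x. ennreal (w x) \<partial>lborel)"
    by (simp add: M_eq emeasure_density)
  also have "\<dots> = ennreal (\<integral>x. w x \<partial>lborel)"
    by (rule nn_integral_eq_integral[OF w_integrable]) auto
  finally show "emeasure M (space M) = 1" by (simp add: w_integral)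
qed

lemma prob_UNIV [simp]: "measure M UNIV = 1"
  using prob_space by simp

lemma sq_int_imp_integrable: "sq_int M f \<Longrightarrow> integrable M f"
proof -
  assume f: "sq_int M f"
  have "norm (f x) \<le> 1 + (norm (f x))\<^sup>2" for x
  proof (cases "norm (f x) \<le> 1")
    case False
    then have "norm (f x) * 1 \<le> norm (f x) * norm (f x)" by (intro mult_left_mono) auto
    then show ?thesis by (simp add: power2_eq_square)
  qed (smt (verit) zero_le_power2)
  moreover have "integrable M (\<lambda>x. 1 + (norm (f x))\<^sup>2)" using f by (auto simp: sq_int_def)
  ultimately show ?thesis
    using f by (elim Bochner_Integration.integrable_bound) (auto simp: sq_int_def)
qed

lemma sq_int_const [simp]: "sq_int M (\<lambda>x. c)"
  by (simp add: sq_int_def)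

lemma continuous_bsupp_sq_int:
  fixes f :: "real^'n \<Rightarrow> 'b::euclidean_space"
  assumes "continuous_on UNIV f" "bsupp f"
  shows "sq_int M f"
proof -
  have m: "f \<in> borel_measurable borel" by (rule borel_measurable_continuous_onI[OF assms(1)])
  have "integrable lborel (\<lambda>x. w x *\<^sub>R (norm (f x))\<^sup>2)"
  proof (rule continuous_bsupp_integrable)
    show "continuous_on UNIV (\<lambda>x. w x *\<^sub>R (norm (f x))\<^sup>2)"
      by (intro continuous_intros w_continuous assms)
    show "bsupp (\<lambda>x. w x *\<^sub>R (norm (f x))\<^sup>2)"
      using assms(2) unfolding bsupp_def by fastforce
  qed
  then show ?thesis using m by (simp add: sq_int_def integrable_M)
qed

lemma test_sq_int: "f \<in> test_functions \<Longrightarrow> sq_int M f"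
  by (rule continuous_bsupp_sq_int) (auto simp: test_continuous test_functions_iff)

lemma Ck_dstar: "Ck (Suc k) f \<Longrightarrow> k \<le> 1 \<Longrightarrow> Ck k (dstar j f)"
  unfolding dstar_def[abs_def] using phi_C1(2)[of j] Ck_mono[of 1 "pd j \<phi>" k] Ck_SucD[of k f]
  by (intro Ck_add Ck_minus Ck_mult) auto

lemma bsupp_dstar: "bsupp f \<Longrightarrow> bsupp (dstar j f)" for f :: "real^'n \<Rightarrow> real"
  unfolding dstar_def[abs_def] by (intro bsupp_add bsupp_mult1 bsupp_comp2[OF bsupp_pd bsupp_pd, of f f "\<lambda>a b. - a"]) auto

lemma dstar_sq_int: "Ck 1 f \<Longrightarrow> bsupp f \<Longrightarrow> sq_int M (dstar j f)"
  using Ck_dstar[of 0 f] by (intro continuous_bsupp_sq_int bsupp_dstar) auto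

lemma test_Ck: "f \<in> test_functions \<Longrightarrow> Ck k f"
  by (simp add: test_functions_iff smooth_Ck)

lemma test_bsupp: "f \<in> test_functions \<Longrightarrow> bsupp f"
  by (simp add: test_functions_iff)

lemma test_differentiable: "f \<in> test_functions \<Longrightarrow> f differentiable (at x)"
  by (simp add: test_functions_iff smooth_differentiable)

lemma Ck_LL: "h \<in> test_functions \<Longrightarrow> Ck 1 (LL h)"
  unfolding LL_def[abs_def] by (intro Ck_sum Ck_dstar test_Ck test_pd) auto

lemma bsupp_LL: "h \<in> test_functions \<Longrightarrow> bsupp (LL h)"
  unfolding LL_def[abs_def] by (intro bsupp_sum bsupp_dstar test_bsupp test_pd)

lemma LL_sq_int: "h \<in> test_functions \<Longrightarrow> sq_int M (LL h)"
  using Ck_imp_continuous[OF Ck_LL] bsupp_LL by (intro continuous_bsupp_sq_int) auto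

lemma integrable_gw: "integrable M g \<Longrightarrow> integrable lborel (\<lambda>x. g x * w x)" for g :: "real^'n \<Rightarrow> real"
  using integrable_M[of g] borel_measurable_integrable[of M g] by (simp add: mult.commute)

lemma integral_gw: "g \<in> borel_measurable borel \<Longrightarrow> (\<integral>x. g x \<partial>M) = (\<integral>x. g x * w x \<partial>lborel)"
  for g :: "real^'n \<Rightarrow> real"
  using integral_M[of g] by (simp add: mult.commute)

section \<open>Square integrable harmonic functions are constant\<close>

text \<open>The algebra of a Caccioppoli estimate. The role of \<open>u\<close> is played by the
  weight, of \<open>a\<close> by the derivative of the mollified function, of \<open>b\<close> and
  \<open>c\<close> by the cutoff and its derivative, of \<open>r\<close> by the commutator error.
  Half of the energy survives; completing the square leaves the constants 5 and 2 for the
  rest.\<close>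

lemma absorb_ineq:
  fixes a b c G r u :: real
  assumes "0 < u"
  shows "1/2 * u * b\<^sup>2 * a\<^sup>2 - (5 * c\<^sup>2 * (u * G\<^sup>2) + 2 * b\<^sup>2 * (r\<^sup>2 / u)) \<le> (u * a - r) * (2 * b * c * G + b\<^sup>2 * a)"
proof -
  have "u * ((u * a - r) * (2 * b * c * G + b\<^sup>2 * a)
      - (1/2 * u * b\<^sup>2 * a\<^sup>2 - (5 * c\<^sup>2 * (u * G\<^sup>2) + 2 * b\<^sup>2 * (r\<^sup>2 / u))))
     = 1/2 * (u * a * b + 2 * u * c * G - b * r)\<^sup>2 + 3 * (u * c * G)\<^sup>2 + 3/2 * (b * r)\<^sup>2"
    using assms by (simp add: field_simps power2_eq_square)
  also have "\<dots> \<ge> 0" by simp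
  finally have "0 \<le> (u * a - r) * (2 * b * c * G + b\<^sup>2 * a)
      - (1/2 * u * b\<^sup>2 * a\<^sup>2 - (5 * c\<^sup>2 * (u * G\<^sup>2) + 2 * b\<^sup>2 * (r\<^sup>2 / u)))"
    using assms by (simp add: zero_le_mult_iff)
  then show ?thesis by linarith
qed

text \<open>The mollification of \<open>g w\<close> divided by \<open>w\<close>: with respect to it the equation
  \<open>L g = 0\<close> holds up to the divergence of a field that is small, because the equation is
  \<open>div (w \<nabla> g) = 0\<close>.\<close>

definition gmol where "gmol e g x = conv (mollifier e) (\<lambda>y. g y * w y) x * exp (\<phi> x)"

lemma Ck_exp_phi: "k \<le> 2 \<Longrightarrow> Ck k (\<lambda>x. exp (\<phi> x))"
  using Ck_exp[OF C2] Ck_mono by blast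

lemma Ck_gmol:
  assumes "0 < e" "integrable M g" "k \<le> 2"
  shows "Ck k (gmol e g)"
  unfolding gmol_def[abs_def] using assms
  by (intro Ck_mult Ck_exp_phi smooth_Ck smooth_conv mollifier_test integrable_gw) auto

text \<open>Cauchy-Schwarz between \<open>\<bar>g\<bar>\<close> and 1 for the measure with density
  \<open>mollifier e (x - y) * w y\<close>.\<close>

lemma conv_Cauchy_Schwarz:
  assumes e: "0 < e" and g: "sq_int M g"
  shows "(conv (mollifier e) (\<lambda>y. \<bar>g y\<bar> * w y) x)\<^sup>2
    \<le> conv (mollifier e) (\<lambda>y. (g y)\<^sup>2 * w y) x * conv (mollifier e) w x"
proof (rule quad_nonneg_imp)
  fix t :: real
  have m: "(mollifier e :: real^'n \<Rightarrow> real) \<in> test_functions" by (rule mollifier_test[OF e])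
  have "integrable M (\<lambda>x. \<bar>g x\<bar>)" using sq_int_imp_integrable[OF g] by simp
  note 1 = conv_integrable[OF m integrable_gw[OF this]]
  have "integrable M (\<lambda>x. (g x)\<^sup>2)" using sq_int_integrable[OF g] by simp
  note 2 = conv_integrable[OF m integrable_gw[OF this]]
  note 3 = conv_integrable[OF m w_integrable]
  have eq: "mollifier e (x - y) * (w y * (\<bar>g y\<bar> + t)\<^sup>2) = mollifier e (x - y) * ((g y)\<^sup>2 * w y)
      + 2 * t * (mollifier e (x - y) * (\<bar>g y\<bar> * w y)) + t\<^sup>2 * (mollifier e (x - y) * w y)" for y
    by (simp add: power2_eq_square algebra_simps)
  have "0 \<le> (\<integral>y. mollifier e (x - y) * (w y * (\<bar>g y\<bar> + t)\<^sup>2) \<partial>lborel)"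
    by (intro integral_nonneg_AE AE_I2 mult_nonneg_nonneg mollifier_nonneg e) auto
  also have "\<dots> = conv (mollifier e) (\<lambda>y. (g y)\<^sup>2 * w y) x
      + 2 * t * conv (mollifier e) (\<lambda>y. \<bar>g y\<bar> * w y) x + t\<^sup>2 * conv (mollifier e) w x"
    unfolding eq conv_def using 1 2 3 by simp
  finally show "0 \<le> conv (mollifier e) (\<lambda>y. (g y)\<^sup>2 * w y) x
      + 2 * t * conv (mollifier e) (\<lambda>y. \<bar>g y\<bar> * w y) x + t\<^sup>2 * conv (mollifier e) w x" .
qed

text \<open>A Caccioppoli estimate that survives the low regularity of the weight. Mollifying the
  equation div(w grad g) = 0 gives an exact divergence equation for a field \<open>V\<close> on the
  ball, and \<open>V\<close> differs from \<open>w\<close> times the gradient of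
  \<open>gmol e g\<close> only by a commutator, which is small if \<omega> bounds the oscillation of
  the first derivatives of \<phi>. The mollification scale \<open>d\<close> depends on
  \<open>R\<close> and \<omega>, the final bound does not depend on it.\<close>

lemma energy_estimate:
  assumes g: "sq_int M g" and harm: "\<And>h. h \<in> test_functions \<Longrightarrow> ip M g (LL h) = 0"
    and K: "\<And>r i x. 0 < r \<Longrightarrow> \<bar>pd i (cutoff r) (x::real^'n)\<bar> \<le> K / r"
    and R: "0 < R" and \<omega>: "0 < \<omega>"
  obtains d where "0 < d" "\<And>e k. 0 < e \<Longrightarrow> e \<le> d \<Longrightarrow>
     (\<integral>x. w x * (cutoff R x)\<^sup>2 * (pd k (gmol e g) x)\<^sup>2 \<partial>lborel)
       \<le> 2 * real CARD('n) * (10 * (K / R)\<^sup>2 + 4 * \<omega>\<^sup>2) * nsq M g"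
proof -
  \<comment> \<open>An oscillation of at most ln 2 means that the weight at most doubles within the
    mollification radius.\<close>
  obtain d0 where d0: "0 < d0" "\<And>x y. norm x \<le> R \<Longrightarrow> norm (x - y) \<le> d0 \<Longrightarrow> \<bar>\<phi> y - \<phi> x\<bar> \<le> ln 2"
    using continuous_uniformly_on_cball[OF phi_continuous(1), of "ln 2" R] by auto
  have "\<exists>d. 0 < d \<and> (\<forall>x y. norm x \<le> R \<longrightarrow> norm (x - y) \<le> d \<longrightarrow> \<bar>pd i \<phi> y - pd i \<phi> x\<bar> \<le> \<omega>)" for i
    using continuous_uniformly_on_cball[OF phi_continuous(2) \<omega>] by metis
  then obtain d' where d': "\<And>i. 0 < d' i"
    "\<And>i x y. norm x \<le> R \<Longrightarrow> norm (x - y) \<le> d' i \<Longrightarrow> \<bar>pd i \<phi> y - pd i \<phi> x\<bar> \<le> \<omega>" by metis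
  define d where "d = min (min d0 1) (Min (range d'))"
  have d: "0 < d" "d \<le> d0" "d \<le> 1" "d \<le> d' i" for i
    using d0(1) d'(1) by (auto simp: d_def min_le_iff_disj)
  have gm [measurable]: "g \<in> borel_measurable borel" using sq_int_measurable[OF g] by simp
  have gi: "integrable M g" by (rule sq_int_imp_integrable[OF g])
  define G where "G y = g y * w y" for y
  \<comment> \<open>The truncation makes this integrable on the whole space. Kernels of radius at
    most 1 centred in the ball of radius R do not see it.\<close>
  define F where "F k y = indicator (cball 0 (R + 1)) y * pd k \<phi> y * G y" for k y
  have Gi: "integrable lborel G" unfolding G_def by (rule integrable_gw[OF gi])
  have aGi: "integrable lborel (\<lambda>y. \<bar>g y\<bar> * w y)"
    using sq_int_imp_integrable[OF g] by (intro integrable_gw) simp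
  have qi: "integrable lborel (\<lambda>y. (g y)\<^sup>2 * w y)"
    using sq_int_integrable[OF g] by (intro integrable_gw) simp
  have q: "(\<integral>y. (g y)\<^sup>2 * w y \<partial>lborel) = nsq M g"
    unfolding nsq_def by (subst integral_gw) auto
  have Fi: "integrable lborel (F k)" for k
  proof -
    have "compact (pd k \<phi> ` cball 0 (R + 1))"
      using phi_continuous(2) by (intro compact_continuous_image) (auto intro: continuous_on_subset)
    from compact_imp_bounded[OF this] obtain B where "\<forall>v\<in>pd k \<phi> ` cball 0 (R+1). norm v \<le> B"
      unfolding bounded_iff by blast
    then have "\<bar>indicator (cball 0 (R + 1)) y * pd k \<phi> y\<bar> \<le> max B 0" for y
      by (cases "y \<in> cball 0 (R + 1)") (auto simp: le_max_iff_disj simp del: mem_cball mem_cball_0)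
    moreover have "(\<lambda>x. indicator (cball 0 (R + 1)) x * pd k \<phi> x) \<in> borel_measurable lborel"
      using borel_measurable_times[OF borel_measurable_indicator[OF borel_closed[OF closed_cball]] phi_measurable(2)]
      by simp
    ultimately show ?thesis unfolding F_def
      by (intro integrable_bounded_mult[OF Gi, where B = "max B 0"])
  qed
  define \<theta> where "\<theta> = (cutoff R :: real^'n \<Rightarrow> real)"
  have \<theta>t: "\<theta> \<in> test_functions" unfolding \<theta>_def by (rule cutoff_test[OF R])
  have \<theta>0: "\<theta> x = 0" if "R < norm x" for x :: "real^'n" unfolding \<theta>_def by (rule cutoff_eq_0[OF R]) (use that in simp)
  have \<theta>1: "0 \<le> \<theta> x" "\<theta> x \<le> 1" for x using cutoff_bounds by (auto simp: \<theta>_def)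
  have main: "(\<integral>x. w x * (\<theta> x)\<^sup>2 * (pd k (gmol e g) x)\<^sup>2 \<partial>lborel)
       \<le> 2 * real CARD('n) * (10 * (K / R)\<^sup>2 + 4 * \<omega>\<^sup>2) * nsq M g"
    if e: "0 < e" "e \<le> d" for e k
  proof -
    have m: "(mollifier e :: real^'n \<Rightarrow> real) \<in> test_functions" by (rule mollifier_test[OF e(1)])
    define Ge where "Ge = conv (mollifier e) G"
    define ge where "ge = gmol e g"
    define V where "V k x = pd k Ge x + conv (mollifier e) (F k) x" for k x
    define A where "A = conv (mollifier e) (\<lambda>y. \<bar>g y\<bar> * w y)"
    define Q where "Q = conv (mollifier e) (\<lambda>y. (g y)\<^sup>2 * w y)"
    have ge_eq: "ge = (\<lambda>x. Ge x * exp (\<phi> x))"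
      unfolding ge_def gmol_def[abs_def] Ge_def G_def[abs_def] ..
    have Gs: "smooth Ge" unfolding Ge_def by (rule smooth_conv[OF m Gi])
    have V_smooth: "smooth (V k)" for k
      unfolding V_def by (intro smooth_intros smooth_pd Gs smooth_conv m Fi)
    have ge1: "Ck 1 ge" unfolding ge_def by (rule Ck_gmol[OF e(1) gi]) simp
    have eps0: "mollifier e (x - y) = 0" if "d < norm (x - y)" for x y
      using mollifier_eq_0[OF e(1), of "x - y"] that e(2) by simp
    have pdeps0: "pd k (mollifier e) (x - y) = 0" if "d < norm (x - y)" for k and x y :: "real^'n"
    proof (rule pd_eq_0_outside[of e])
      show "mollifier e z = 0" if "e < norm z" for z :: "real^'n"
        by (rule mollifier_eq_0[OF e(1)]) (use that in simp)
    qed (use that e(2) in simp)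
    have harmV: "(\<Sum>k\<in>UNIV. pd k (V k) x) = 0" if x: "norm x \<le> R" for x
    proof -
      \<comment> \<open>The translated kernel is itself a test function, so orthogonality to
        \<open>LL h\<close> is the mollified equation at the point \<open>x\<close>.\<close>
      define h where "h y = mollifier e (x - y)" for y
      have h: "h \<in> test_functions" unfolding h_def by (rule test_reflect[OF m])
      have p1: "pd k h = (\<lambda>y. - pd k (mollifier e) (x - y))" for k
        unfolding h_def by (intro ext pd_reflect test_differentiable m)
      have p2: "pd k (pd k h) y = pd k (pd k (mollifier e)) (x - y)" for k y
      proof -
        have "(\<lambda>y. pd k (mollifier e) (x - y)) differentiable (at y)"
          using test_reflect[OF test_pd[OF m]] by (rule test_differentiable)
        then show ?thesis
          unfolding p1 by (simp add: pd_minus pd_reflect test_differentiable[OF test_pd[OF m]])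
      qed
      have F_eq: "pd k (mollifier e) (x - y) * pd k \<phi> y * G y = pd k (mollifier e) (x - y) * F k y" for k y
      proof (cases "d < norm (x - y)")
        case False
        then have "norm y \<le> R + 1" using x d(3) norm_triangle_ineq2[of y x] by (simp add: norm_minus_commute)
        then show ?thesis by (simp add: F_def)
      qed (simp add: pdeps0)
      have LLh: "LL h y * G y = - (\<Sum>k\<in>UNIV. pd k (pd k (mollifier e)) (x - y) * G y
          + pd k (mollifier e) (x - y) * F k y)" for y
        unfolding LL_def dstar_def p2 unfolding p1 sum_distrib_right sum_negf[symmetric] F_eq[symmetric]
        by (simp add: algebra_simps)
      note i1 = conv_integrable[OF test_pd[OF test_pd[OF m]] Gi]
      note i2 = conv_integrable[OF test_pd[OF m] Fi]
      have "0 = ip M g (LL h)" using harm[OF h] by simp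
      also have "\<dots> = (\<integral>y. LL h y * G y \<partial>lborel)"
        using sq_int_measurable[OF LL_sq_int[OF h]] unfolding ip_def
        by (subst integral_gw) (auto simp: G_def mult_ac)
      also have "\<dots> = - (\<Sum>k\<in>UNIV. conv (pd k (pd k (mollifier e))) G x + conv (pd k (mollifier e)) (F k) x)"
        unfolding LLh conv_def using i1 i2 by simp
      also have "\<dots> = - (\<Sum>k\<in>UNIV. pd k (V k) x)"
      proof (intro arg_cong[where f = uminus] sum.cong refl)
        fix k
        show "conv (pd k (pd k (mollifier e))) G x + conv (pd k (mollifier e)) (F k) x = pd k (V k) x"
          unfolding V_def Ge_def
          by (subst pd_add) (auto intro!: smooth_differentiable smooth_conv m Fi Gi test_pd
              simp: pd_conv[OF m Gi] pd_conv[OF m Fi] pd_conv[OF test_pd[OF m] Gi])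
      qed
      finally show ?thesis by simp
    qed
    \<comment> \<open>The usual choice, squared cutoff times solution; it has bounded support, hence
      the field \<open>V\<close> needs to be divergence free only on the ball.\<close>
    define \<eta> where "\<eta> x = (\<theta> x)\<^sup>2 * ge x" for x
    have \<eta>1: "Ck 1 \<eta>" unfolding \<eta>_def by (intro Ck_mult Ck_power ge1 test_Ck \<theta>t)
    have \<eta>0: "\<eta> x = 0" if "R < norm x" for x using \<theta>0[OF that] by (simp add: \<eta>_def)
    have \<eta>b: "bsupp \<eta>" using \<eta>0 by (auto simp: bsupp_def)
    have pd\<eta>: "pd k \<eta> x = 2 * \<theta> x * pd k \<theta> x * ge x + (\<theta> x)\<^sup>2 * pd k ge x" for k x
    proof -
      have d: "\<theta> differentiable (at x)" "ge differentiable (at x)"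
        using ge1 by (auto intro: test_differentiable \<theta>t)
      show ?thesis unfolding \<eta>_def power2_eq_square using d by (simp add: pd_mult algebra_simps)
    qed
    have cV: "continuous_on UNIV (V k)" "continuous_on UNIV (pd k (V k))" for k
      using V_smooth smooth_pd smooth_continuous by blast+
    have c\<eta>: "continuous_on UNIV \<eta>" "continuous_on UNIV (pd k \<eta>)" for k
      using \<eta>1 Ck_imp_continuous[OF \<eta>1] by auto
    have iV\<eta>: "integrable lborel (\<lambda>x. pd k \<eta> x * V k x)" for k
      by (intro continuous_bsupp_integrable continuous_intros cV c\<eta> bsupp_mult1 bsupp_pd \<eta>b)
    have zero: "(\<Sum>k\<in>UNIV. \<integral>x. pd k \<eta> x * V k x \<partial>lborel) = 0"
    proof -
      have "(\<Sum>k\<in>UNIV. \<integral>x. pd k \<eta> x * V k x \<partial>lborel) = - (\<Sum>k\<in>UNIV. \<integral>x. \<eta> x * pd k (V k) x \<partial>lborel)"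
        by (simp add: integral_by_parts[OF \<eta>1 smooth_Ck[OF V_smooth] \<eta>b] sum_negf)
      also have "(\<Sum>k\<in>UNIV. \<integral>x. \<eta> x * pd k (V k) x \<partial>lborel) = (\<integral>x. (\<Sum>k\<in>UNIV. \<eta> x * pd k (V k) x) \<partial>lborel)"
        by (intro Bochner_Integration.integral_sum[symmetric] continuous_bsupp_integrable continuous_intros cV c\<eta> bsupp_mult1 \<eta>b)
      also have "(\<lambda>x. \<Sum>k\<in>UNIV. \<eta> x * pd k (V k) x) = (\<lambda>x. 0)"
      proof
        fix x show "(\<Sum>k\<in>UNIV. \<eta> x * pd k (V k) x) = 0"
          using harmV[of x] \<eta>0[of x] by (cases "norm x \<le> R") (auto simp flip: sum_distrib_left)
      qed
      finally show ?thesis by simp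
    qed
    \<comment> \<open>The constants 5 and 2 of \<open>absorb_ineq\<close>, each multiplied by the 2
      from the doubling of the weight.\<close>
    define \<Omega> where "\<Omega> = 10 * (K / R)\<^sup>2 + 4 * \<omega>\<^sup>2"
    have \<Omega>: "0 \<le> \<Omega>" by (simp add: \<Omega>_def)
    have pointwise: "1/2 * (w x * (\<theta> x)\<^sup>2 * (pd k ge x)\<^sup>2) - Q x * (\<Omega> * indicator (cball 0 R) x) \<le> pd k \<eta> x * V k x"
      for k x
    proof (cases "norm x \<le> R")
      case False
      then have "pd k \<eta> x = 0" using pd_eq_0_outside[of R \<eta> x] \<eta>0 by simp
      then show ?thesis using False \<theta>0[of x] by simp
    next
      case x: True
      \<comment> \<open>The commutator of mollification with multiplication by the derivative of
        \<phi>; it measures how far \<open>V\<close> is from \<open>w x * pd k ge x\<close>.\<close>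
      define r where "r = Ge x * pd k \<phi> x - conv (mollifier e) (F k) x"
      have a: "w x * pd k ge x = pd k Ge x + Ge x * pd k \<phi> x"
      proof -
        have "(\<lambda>x. exp (\<phi> x)) differentiable (at x)" using Ck_exp_phi[of 1] by simp
        then have "pd k ge x = pd k Ge x * exp (\<phi> x) + Ge x * (exp (\<phi> x) * pd k \<phi> x)"
          unfolding ge_eq by (simp add: pd_mult smooth_differentiable[OF Gs] pd_exp phi_differentiable)
        then show ?thesis by (simp add: exp_phi field_simps)
      qed
      have Va: "V k x = w x * pd k ge x - r" by (simp add: a V_def r_def)
      have mG: "integrable lborel (\<lambda>y. mollifier e (x - y) * (\<bar>g y\<bar> * w y))"
        by (rule conv_integrable[OF m aGi])
      have GA: "\<bar>Ge x\<bar> \<le> A x"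
      proof -
        have "\<bar>Ge x\<bar> \<le> (\<integral>y. \<bar>mollifier e (x - y) * G y\<bar> \<partial>lborel)"
          unfolding Ge_def conv_def using integral_abs_bound by blast
        also have "\<dots> = A x"
          unfolding A_def conv_def by (simp add: abs_mult G_def abs_of_nonneg[OF mollifier_nonneg[OF e(1)]])
        finally show ?thesis .
      qed
      have rA: "\<bar>r\<bar> \<le> \<omega> * A x"
      proof -
        have i1: "integrable lborel (\<lambda>y. mollifier e (x - y) * G y * pd k \<phi> x)"
          using conv_integrable[OF m Gi] by simp
        have i2: "integrable lborel (\<lambda>y. mollifier e (x - y) * F k y)"
          by (rule conv_integrable[OF m Fi])
        have "r = (\<integral>y. mollifier e (x - y) * G y * pd k \<phi> x - mollifier e (x - y) * F k y \<partial>lborel)"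
          using i1 i2 by (simp add: r_def Ge_def conv_def)
        also have "\<bar>\<dots>\<bar> \<le> (\<integral>y. \<bar>mollifier e (x - y) * G y * pd k \<phi> x - mollifier e (x - y) * F k y\<bar> \<partial>lborel)"
          using integral_abs_bound by blast
        also have "\<dots> \<le> (\<integral>y. \<omega> * (mollifier e (x - y) * (\<bar>g y\<bar> * w y)) \<partial>lborel)"
        proof (rule integral_mono)
          fix y
          show "\<bar>mollifier e (x - y) * G y * pd k \<phi> x - mollifier e (x - y) * F k y\<bar>
             \<le> \<omega> * (mollifier e (x - y) * (\<bar>g y\<bar> * w y))"
          proof (cases "d < norm (x - y)")
            case True
            then show ?thesis by (simp add: eps0)
          next
            case False
            then have y: "norm (x - y) \<le> d" by simp
            then have "norm y \<le> R + 1" using x d(3) norm_triangle_ineq2[of y x] by (simp add: norm_minus_commute)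
            then have "mollifier e (x - y) * G y * pd k \<phi> x - mollifier e (x - y) * F k y
              = (mollifier e (x - y) * G y) * (pd k \<phi> x - pd k \<phi> y)"
              by (simp add: F_def algebra_simps)
            then have "\<bar>mollifier e (x - y) * G y * pd k \<phi> x - mollifier e (x - y) * F k y\<bar>
               = (mollifier e (x - y) * (\<bar>g y\<bar> * w y)) * \<bar>pd k \<phi> y - pd k \<phi> x\<bar>"
              using mollifier_nonneg[OF e(1), of "x - y"] by (simp add: abs_mult G_def abs_minus_commute)
            also have "\<dots> \<le> (mollifier e (x - y) * (\<bar>g y\<bar> * w y)) * \<omega>"
              using mollifier_nonneg[OF e(1), of "x - y"] d'(2)[OF x, of y k] y d(4)[of k]
              by (intro mult_left_mono) auto
            finally show ?thesis by (simp add: mult_ac)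
          qed
        qed (use i1 i2 mG in auto)
        also have "\<dots> = \<omega> * A x" by (simp add: A_def conv_def)
        finally show ?thesis .
      qed
      have A0: "0 \<le> A x" using GA by linarith
      have Q0: "0 \<le> Q x"
        unfolding Q_def using mollifier_nonneg[OF e(1)] by (intro conv_nonneg) auto
      \<comment> \<open>This is where dividing the mollified \<open>g w\<close> by \<open>w\<close>
        is harmless: \<open>conv_Cauchy_Schwarz\<close> produces the mollified weight, and that is
        at most twice the weight itself.\<close>
      have AQ: "(A x)\<^sup>2 / w x \<le> 2 * Q x"
      proof -
        have "conv (mollifier e) w x \<le> (\<integral>y. mollifier e (x - y) * (2 * w x) \<partial>lborel)"
          unfolding conv_def
        proof (rule integral_mono)
          show "integrable lborel (\<lambda>y. mollifier e (x - y) * w y)" by (rule conv_integrable[OF m w_integrable])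
          show "integrable lborel (\<lambda>y. mollifier e (x - y) * (2 * w x))"
            using test_integrable[OF test_reflect[OF m, of x]] by simp
          fix y
          show "mollifier e (x - y) * w y \<le> mollifier e (x - y) * (2 * w x)"
          proof (cases "d < norm (x - y)")
            case False
            then have "\<bar>\<phi> y - \<phi> x\<bar> \<le> ln 2" using d0(2)[OF x, of y] d(2) by simp
            then have "exp (- \<phi> y) \<le> exp (ln 2 - \<phi> x)" by simp
            then have "w y \<le> 2 * w x" by (simp add: w_def exp_diff exp_minus field_simps)
            then show ?thesis using mollifier_nonneg[OF e(1)] by (intro mult_left_mono) auto
          qed (simp add: eps0)
        qed
        also have "\<dots> = 2 * w x" using mollifier_integral_translate[OF e(1), of x] by simp
        finally have W: "conv (mollifier e) w x \<le> 2 * w x" .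
        have "(A x)\<^sup>2 \<le> Q x * conv (mollifier e) w x"
          unfolding A_def Q_def by (rule conv_Cauchy_Schwarz[OF e(1) g])
        also have "\<dots> \<le> Q x * (2 * w x)" by (intro mult_left_mono W Q0)
        finally show ?thesis by (simp add: divide_le_eq mult_ac)
      qed
      have t1: "w x * (ge x)\<^sup>2 \<le> 2 * Q x"
      proof -
        have "w x * (ge x)\<^sup>2 = (Ge x)\<^sup>2 / w x"
          unfolding ge_eq by (simp add: exp_phi power2_eq_square field_simps)
        also have "\<dots> \<le> (A x)\<^sup>2 / w x"
          using GA by (intro divide_right_mono) (auto simp: abs_le_square_iff[symmetric])
        finally show ?thesis using AQ by linarith
      qed
      have t2: "r\<^sup>2 / w x \<le> \<omega>\<^sup>2 * (2 * Q x)"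
      proof -
        have "r\<^sup>2 \<le> (\<omega> * A x)\<^sup>2" using rA A0 \<omega> by (subst abs_le_square_iff[symmetric]) auto
        then have "r\<^sup>2 / w x \<le> (\<omega> * A x)\<^sup>2 / w x" by (intro divide_right_mono) auto
        also have "\<dots> = \<omega>\<^sup>2 * ((A x)\<^sup>2 / w x)" by (simp add: power_mult_distrib)
        also have "\<dots> \<le> \<omega>\<^sup>2 * (2 * Q x)" by (intro mult_left_mono AQ) simp
        finally show ?thesis .
      qed
      have c: "(pd k \<theta> x)\<^sup>2 \<le> (K / R)\<^sup>2"
        using power_mono[OF K[OF R, of k x], of 2] by (simp add: \<theta>_def)
      have b: "(\<theta> x)\<^sup>2 \<le> 1" using \<theta>1[of x] by (simp add: abs_square_le_1)
      have "5 * (pd k \<theta> x)\<^sup>2 * (w x * (ge x)\<^sup>2) \<le> 5 * (K/R)\<^sup>2 * (2 * Q x)"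
        by (rule mult_mono[OF mult_left_mono[OF c] t1]) auto
      moreover have "2 * (\<theta> x)\<^sup>2 * (r\<^sup>2 / w x) \<le> 2 * 1 * (\<omega>\<^sup>2 * (2 * Q x))"
        by (rule mult_mono[OF mult_left_mono[OF b] t2]) auto
      moreover have "\<Omega> * Q x = 5 * (K/R)\<^sup>2 * (2 * Q x) + 2 * 1 * (\<omega>\<^sup>2 * (2 * Q x))"
        by (simp add: \<Omega>_def algebra_simps)
      moreover note absorb_ineq[OF w_pos(1)[of x], of "\<theta> x" "pd k ge x" "pd k \<theta> x" "ge x" r]
      ultimately show ?thesis using x unfolding Va pd\<eta> by (simp add: mult_ac)
    qed
    have cge: "continuous_on UNIV (pd k ge)" for k using ge1 by simp
    have i\<theta>: "integrable lborel (\<lambda>x. w x * (\<theta> x)\<^sup>2 * (pd k ge x)\<^sup>2)" for k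
    proof (rule continuous_bsupp_integrable)
      show "continuous_on UNIV (\<lambda>x. w x * (\<theta> x)\<^sup>2 * (pd k ge x)\<^sup>2)"
        by (intro continuous_intros w_continuous test_continuous \<theta>t cge)
      show "bsupp (\<lambda>x. w x * (\<theta> x)\<^sup>2 * (pd k ge x)\<^sup>2)" using \<theta>0 by (auto simp: bsupp_def)
    qed
    \<comment> \<open>A constant is not integrable on the whole space, so the bound is kept together
      with the indicator of the ball while Fubini is applied.\<close>
    define ind :: "real^'n \<Rightarrow> real" where "ind x = \<Omega> * indicator (cball 0 R) x" for x
    have indi: "integrable lborel ind"
      unfolding ind_def using emeasure_bounded_finite[of "cball (0::real^'n) R"]
      by (intro integrable_mult_right integrable_real_indicator) auto
    have ind_le: "ind x \<le> \<Omega>" for x using \<Omega> by (simp add: ind_def indicator_def)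
    have iQ: "integrable lborel (\<lambda>x. Q x * ind x)"
      unfolding Q_def by (rule conv_fubini(2)[OF m qi indi])
    have Qle: "(\<integral>x. Q x * ind x \<partial>lborel) \<le> \<Omega> * nsq M g"
      unfolding Q_def q[symmetric] by (rule conv_mollifier_integral_le[OF e(1) qi _ indi ind_le]) simp
    have each: "1/2 * (\<integral>x. w x * (\<theta> x)\<^sup>2 * (pd k ge x)\<^sup>2 \<partial>lborel) - \<Omega> * nsq M g
        \<le> (\<integral>x. pd k \<eta> x * V k x \<partial>lborel)" for k
    proof -
      have "(\<integral>x. 1/2 * (w x * (\<theta> x)\<^sup>2 * (pd k ge x)\<^sup>2) - Q x * ind x \<partial>lborel) \<le> (\<integral>x. pd k \<eta> x * V k x \<partial>lborel)"
        using pointwise by (intro integral_mono Bochner_Integration.integrable_diff integrable_mult_right i\<theta> iQ iV\<eta>) (simp add: ind_def)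
      then show ?thesis using Qle i\<theta>[of k] iQ by simp
    qed
    \<comment> \<open>Only the sum over \<open>k\<close> of the tested equation vanishes, so the
      errors of all directions add up; this is the factor \<open>CARD('n)\<close>. Nonnegativity
      then isolates one direction.\<close>
    have "(\<Sum>k\<in>UNIV. 1/2 * (\<integral>x. w x * (\<theta> x)\<^sup>2 * (pd k ge x)\<^sup>2 \<partial>lborel) - \<Omega> * nsq M g) \<le> 0"
      by (rule order_trans[OF sum_mono[OF each]]) (simp add: zero)
    then have "1/2 * (\<Sum>k\<in>UNIV. \<integral>x. w x * (\<theta> x)\<^sup>2 * (pd k ge x)\<^sup>2 \<partial>lborel) \<le> real CARD('n) * (\<Omega> * nsq M g)"
      by (simp add: sum_subtractf sum_divide_distrib[symmetric])
    moreover have "(\<integral>x. w x * (\<theta> x)\<^sup>2 * (pd k ge x)\<^sup>2 \<partial>lborel) \<le> (\<Sum>k\<in>UNIV. \<integral>x. w x * (\<theta> x)\<^sup>2 * (pd k ge x)\<^sup>2 \<partial>lborel)"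
      by (rule member_le_sum) auto
    ultimately have "(\<integral>x. w x * (\<theta> x)\<^sup>2 * (pd k ge x)\<^sup>2 \<partial>lborel) \<le> 2 * (real CARD('n) * (\<Omega> * nsq M g))"
      by linarith
    then show ?thesis unfolding ge_def \<Omega>_def by (simp only: mult.assoc)
  qed
  show thesis
    using main by (intro that[OF d(1)]) (auto simp: \<theta>_def)
qed

end

context gibbs_potential
begin

text \<open>On a compact set the reciprocal of the weight is bounded, so square integrability for
  the Gibbs measure gives local Lebesgue integrability, as weak derivatives require.\<close>

lemma sq_int_loc_int:
  fixes f :: "real^'n \<Rightarrow> 'b::euclidean_space"
  assumes "sq_int M f"
  shows "locally_integrable f"
  unfolding locally_integrable_def set_integrable_def
proof (intro allI impI)
  fix K :: "(real^'n) set" assume K: "compact K"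
  have [measurable]: "f \<in> borel_measurable borel" "K \<in> sets borel"
    using sq_int_measurable[OF assms] borel_compact[OF K] by auto
  have "compact ((\<lambda>x. exp (\<phi> x)) ` K)"
    using phi_continuous(1) K by (intro compact_continuous_image continuous_intros) (auto intro: continuous_on_subset)
  from compact_imp_bounded[OF this] obtain B where B: "\<forall>v\<in>(\<lambda>x. exp (\<phi> x)) ` K. norm v \<le> B"
      unfolding bounded_iff by blast
  have "integrable lborel (\<lambda>x. w x *\<^sub>R f x)"
    using sq_int_imp_integrable[OF assms] by (simp add: integrable_M)
  then have "integrable lborel (\<lambda>x. \<bar>B\<bar> * norm (w x *\<^sub>R f x))"
    by (intro integrable_mult_right integrable_norm)
  then show "integrable lborel (\<lambda>x. indicat_real K x *\<^sub>R f x)"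
  proof (rule Bochner_Integration.integrable_bound)
    show "AE x in lborel. norm (indicat_real K x *\<^sub>R f x) \<le> norm (\<bar>B\<bar> * norm (w x *\<^sub>R f x))"
    proof (rule AE_I2)
      fix x
      show "norm (indicat_real K x *\<^sub>R f x) \<le> norm (\<bar>B\<bar> * norm (w x *\<^sub>R f x))"
      proof (cases "x \<in> K")
        case True
        then have "1 / w x \<le> \<bar>B\<bar>" using B by (auto simp: exp_phi)
        then have "1 \<le> \<bar>B\<bar> * w x" by (simp add: divide_le_eq)
        then show ?thesis using True mult_right_mono[of 1 "\<bar>B\<bar> * w x" "norm (f x)"] by (simp add: abs_mult mult_ac)
      qed simp
    qed
  qed simp
qed

text \<open>A Liouville argument. With \<omega> = 1/R the energy on the ball of radius R is of order
  1/R^2, so the derivative tested against a fixed \<psi> is of order 1/R, and R is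
  arbitrary.\<close>

lemma harmonic_weak_pd:
  assumes g: "sq_int M g" and harm: "\<And>h. h \<in> test_functions \<Longrightarrow> ip M g (LL h) = 0"
    and \<psi>: "\<psi> \<in> test_functions"
  shows "(\<integral>x. g x * pd j \<psi> x \<partial>lborel) = 0"
proof -
  obtain K where K: "\<And>r i x. 0 < r \<Longrightarrow> \<bar>pd i (cutoff r) (x::real^'n)\<bar> \<le> K / r"
    using cutoff_pd_bound by metis
  obtain r where r: "0 < r" "\<And>x. r < norm x \<Longrightarrow> \<psi> x = 0"
    using bsuppE[OF test_bsupp[OF \<psi>]] by metis
  \<comment> \<open>The reciprocal of the lower bound of \<open>cutoff R\<close> on the half ball,
    which contains the support of \<psi> as soon as \<open>2 * r \<le> R\<close>.\<close>
  define c where "c = exp (1/3 :: real)"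
  define S where "S = c\<^sup>2 * (\<integral>x. (\<psi> x)\<^sup>2 / w x \<partial>lborel)"
  define C where "C = 2 * real CARD('n) * (10 * K\<^sup>2 + 4) * nsq M g"
  have gi: "integrable M g" by (rule sq_int_imp_integrable[OF g])
  have [measurable]: "\<psi> \<in> borel_measurable borel"
    using \<psi> by (auto intro: borel_measurable_continuous_onI test_continuous)
  have i\<psi>: "integrable lborel (\<lambda>x. (\<psi> x)\<^sup>2 / w x)"
  proof (rule continuous_bsupp_integrable)
    show "continuous_on UNIV (\<lambda>x. (\<psi> x)\<^sup>2 / w x)"
      by (intro continuous_intros test_continuous \<psi> w_continuous) simp
    show "bsupp (\<lambda>x. (\<psi> x)\<^sup>2 / w x)" using r by (auto simp: bsupp_def)
  qed
  have S0: "0 \<le> S" unfolding S_def by (intro mult_nonneg_nonneg integral_nonneg_AE) auto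
  have C0: "0 \<le> C" unfolding C_def by (intro mult_nonneg_nonneg) auto
  define I where "I = (\<integral>x. g x * pd j \<psi> x \<partial>lborel)"
  have est: "\<bar>I\<bar> \<le> (1 / R) * (1 + sqrt (C * S))" if R: "2 * r \<le> R" for R
  proof -
    have R0: "0 < R" using R r by linarith
    obtain d1 where d1: "0 < d1" "\<And>e k. 0 < e \<Longrightarrow> e \<le> d1 \<Longrightarrow>
       (\<integral>x. w x * (cutoff R x)\<^sup>2 * (pd k (gmol e g) x)\<^sup>2 \<partial>lborel)
       \<le> 2 * real CARD('n) * (10 * (K / R)\<^sup>2 + 4 * (1/R)\<^sup>2) * nsq M g"
      using energy_estimate[OF g harm K R0, of "1/R"] R0 by auto
    define h where "h x = exp (\<phi> x) * pd j \<psi> x" for x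
    have ch: "continuous_on UNIV h" unfolding h_def
      by (intro continuous_intros phi_continuous test_continuous test_pd \<psi>)
    have bh: "bsupp h" unfolding h_def by (intro bsupp_mult2 test_bsupp test_pd \<psi>)
    obtain d2 where d2: "0 < d2" "\<And>e. 0 < e \<Longrightarrow> e \<le> d2 \<Longrightarrow>
       \<bar>(\<integral>x. conv (mollifier e) (\<lambda>y. g y * w y) x * h x \<partial>lborel) - (\<integral>x. (g x * w x) * h x \<partial>lborel)\<bar> \<le> 1 / R"
      using conv_mollifier_weak[OF integrable_gw[OF gi] ch bh, of "1/R"] R0 by auto
    \<comment> \<open>The scale is chosen after R: small enough for the energy estimate and for
      replacing the integral of \<open>g\<close> by that of its mollification up to 1/R.\<close>
    define e where "e = min d1 d2"
    have e: "0 < e" "e \<le> d1" "e \<le> d2" using d1 d2 by (auto simp: e_def)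
    define ge where "ge = gmol e g"
    have ge1: "Ck 1 ge" unfolding ge_def by (rule Ck_gmol[OF e(1) gi]) simp
    define J where "J = (\<integral>x. pd j \<psi> x * ge x \<partial>lborel)"
    have JI: "\<bar>J - I\<bar> \<le> 1 / R"
    proof -
      have "J = (\<integral>x. conv (mollifier e) (\<lambda>y. g y * w y) x * h x \<partial>lborel)"
        by (simp add: J_def ge_def gmol_def h_def mult_ac)
      moreover have "I = (\<integral>x. (g x * w x) * h x \<partial>lborel)" by (simp add: I_def h_def exp_phi)
      ultimately show ?thesis using d2(2)[OF e(1) e(3)] by simp
    qed
    define \<theta> where "\<theta> = (cutoff R :: real^'n \<Rightarrow> real)"
    have \<theta>t: "\<theta> \<in> test_functions" unfolding \<theta>_def by (rule cutoff_test[OF R0])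
    have [measurable]: "\<theta> \<in> borel_measurable borel"
      using \<theta>t by (auto intro: borel_measurable_continuous_onI test_continuous)
    have \<theta>c: "1 / \<theta> x \<le> c" "0 < \<theta> x" if "norm x \<le> r" for x
    proof -
      have *: "exp (- (1/3)) \<le> \<theta> x" unfolding \<theta>_def using that R by (intro cutoff_ge R0) auto
      then show "0 < \<theta> x" using exp_gt_zero[of "- (1/3::real)"] by linarith
      then show "1 / \<theta> x \<le> c" using * unfolding c_def by (simp add: exp_minus field_simps)
    qed
    \<comment> \<open>Splitting off sqrt(w) times the cutoff puts the energy into \<open>f1\<close>;
      the quotient \<open>f2\<close> is harmless because the cutoff is bounded below where \<psi>
      does not vanish.\<close>
    define f1 where "f1 x = sqrt (w x) * \<theta> x * pd j ge x" for x
    define f2 where "f2 x = \<psi> x / (sqrt (w x) * \<theta> x)" for x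
    have f1: "sq_int lborel f1"
    proof -
      have "continuous_on UNIV (pd j ge)" using ge1 by simp
      then have c: "continuous_on UNIV f1" unfolding f1_def
        by (intro continuous_intros w_continuous test_continuous[OF \<theta>t])
      moreover have "bsupp (\<lambda>x. (f1 x)\<^sup>2)"
        unfolding f1_def power2_eq_square using test_bsupp[OF \<theta>t]
        by (intro bsupp_mult1 bsupp_mult2)
      ultimately show ?thesis unfolding sq_int_real_iff
        by (auto intro!: continuous_bsupp_integrable continuous_intros intro: borel_measurable_continuous_onI)
    qed
    have f1n: "nsq lborel f1 \<le> C / R\<^sup>2"
    proof -
      have "nsq lborel f1 = (\<integral>x. w x * (\<theta> x)\<^sup>2 * (pd j ge x)\<^sup>2 \<partial>lborel)"
        by (simp add: nsq_def f1_def power_mult_distrib)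
      also have "\<dots> \<le> 2 * real CARD('n) * (10 * (K / R)\<^sup>2 + 4 * (1/R)\<^sup>2) * nsq M g"
        unfolding \<theta>_def ge_def by (rule d1(2)[OF e(1) e(2)])
      also have "\<dots> = C / R\<^sup>2" using R0 by (simp add: C_def field_simps)
      finally show ?thesis .
    qed
    have f2le: "(f2 x)\<^sup>2 \<le> c\<^sup>2 * ((\<psi> x)\<^sup>2 / w x)" for x
    proof (cases "norm x \<le> r")
      case True
      have "(f2 x)\<^sup>2 = (1 / \<theta> x)\<^sup>2 * ((\<psi> x)\<^sup>2 / w x)"
        by (simp add: f2_def power_divide power_mult_distrib)
      also have "\<dots> \<le> c\<^sup>2 * ((\<psi> x)\<^sup>2 / w x)"
        using \<theta>c[OF True] by (intro mult_right_mono power_mono) auto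
      finally show ?thesis .
    qed (use r in \<open>simp add: f2_def\<close>)
    have if2: "integrable lborel (\<lambda>x. (f2 x)\<^sup>2)"
      by (rule Bochner_Integration.integrable_bound[OF integrable_mult_right[OF i\<psi>, of "c\<^sup>2"]])
         (use f2le in \<open>auto simp: f2_def\<close>)
    have "f2 \<in> borel_measurable borel" unfolding f2_def by measurable
    with if2 have f2: "sq_int lborel f2" by (simp add: sq_int_real_iff)
    have f2n: "nsq lborel f2 \<le> S"
      using integral_mono[OF if2 integrable_mult_right[OF i\<psi>, of "c\<^sup>2"] f2le]
      unfolding integral_mult_right_zero by (simp add: nsq_def S_def)
    have "J = - ip lborel f1 f2"
    proof -
      have "J = - (\<integral>x. \<psi> x * pd j ge x \<partial>lborel)"
        unfolding J_def by (intro integral_by_parts ge1 test_Ck test_bsupp \<psi>)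
      moreover have "\<psi> x * pd j ge x = f1 x \<bullet> f2 x" for x
      proof (cases "norm x \<le> r")
        case True
        then show ?thesis using \<theta>c(2)[OF True] by (simp add: f1_def f2_def)
      qed (use r in \<open>simp add: f2_def\<close>)
      ultimately show ?thesis by (simp add: ip_def)
    qed
    then have "\<bar>J\<bar> \<le> sqrt (nsq lborel f1) * sqrt (nsq lborel f2)"
      using ip_le[OF f1 f2] by simp
    also have "\<dots> \<le> sqrt (C / R\<^sup>2) * sqrt S"
      using f1n f2n C0 by (intro mult_mono) auto
    also have "\<dots> = (1 / R) * sqrt (C * S)"
      using R0 by (simp add: real_sqrt_divide real_sqrt_mult)
    finally show ?thesis using JI unfolding ring_distribs by linarith
  qed
  have "I = 0"
  proof (rule le_const_mult_eq_0)
    fix \<eta> :: real assume \<eta>: "0 < \<eta>"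
    define R where "R = max (2 * r) (1 / \<eta>)"
    have "1 / \<eta> \<le> R" "0 < R" using \<eta> r by (auto simp: R_def less_max_iff_disj)
    then have "1 / R \<le> \<eta>" using \<eta> by (simp add: field_simps)
    have "\<bar>I\<bar> \<le> (1 / R) * (1 + sqrt (C * S))" by (rule est) (simp add: R_def)
    also have "\<dots> \<le> \<eta> * (1 + sqrt (C * S))"
      using \<open>1 / R \<le> \<eta>\<close> S0 C0 by (intro mult_right_mono) auto
    finally show "\<bar>I\<bar> \<le> \<eta> * (1 + sqrt (C * S))" .
  qed
  then show ?thesis by (simp add: I_def)
qed

text \<open>A function with vanishing weak gradient is constant: its mollifications are.\<close>

lemma weak_pd_0_imp_const:
  fixes g :: "real^'n \<Rightarrow> real"
  assumes g: "locally_integrable g"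
    and w0: "\<And>\<psi> j. \<psi> \<in> test_functions \<Longrightarrow> (\<integral>x. g x * pd j \<psi> x \<partial>lborel) = 0"
  obtains c where "AE x in lborel. g x = c"
proof -
  define \<eta> where "\<eta> = (mollifier 1 :: real^'n \<Rightarrow> real)"
  have \<eta>: "\<eta> \<in> test_functions" "(\<integral>x. \<eta> x \<partial>lborel) = 1"
    by (simp_all add: \<eta>_def mollifier_test mollifier_integral)
  \<comment> \<open>If \<open>g\<close> is constant, pairing it with a function of integral 1
    returns that constant.\<close>
  define c where "c = (\<integral>x. g x * \<eta> x \<partial>lborel)"
  have key: "(\<integral>x. g x * \<psi> x \<partial>lborel) = c * (\<integral>x. \<psi> x \<partial>lborel)" if \<psi>: "\<psi> \<in> test_functions" for \<psi>
  proof -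
    obtain r1 where r1: "0 < r1" "\<And>x. r1 < norm x \<Longrightarrow> \<psi> x = 0"
      using bsuppE[OF test_bsupp[OF \<psi>]] by metis
    define r where "r = max r1 1"
    have r: "0 < r" "\<And>x. r < norm x \<Longrightarrow> \<psi> x = 0" "\<And>x. r < norm x \<Longrightarrow> \<eta> x = 0"
      using r1 by (auto simp: r_def \<eta>_def mollifier_eq_0)
    \<comment> \<open>\<open>conv\<close> needs a globally integrable function; the margin of 1
      around the ball of radius r hides the truncation from kernels with e at most 1.\<close>
    define gR where "gR x = indicator (cball 0 (r + 1)) x *\<^sub>R g x" for x
    have gR: "integrable lborel gR" unfolding gR_def by (rule loc_int_cball[OF g])
    have eq: "(\<integral>x. gR x * k x \<partial>lborel) = (\<integral>x. g x * k x \<partial>lborel)"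
      if "\<And>x. r < norm x \<Longrightarrow> k x = 0" for k
    proof (intro Bochner_Integration.integral_cong refl)
      show "gR x * k x = g x * k x" for x
        using that[of x] by (cases "norm x \<le> r") (auto simp: gR_def)
    qed
    have "(\<integral>x. g x * \<psi> x \<partial>lborel) - c * (\<integral>x. \<psi> x \<partial>lborel) = 0"
    proof (rule le_const_mult_eq_0)
      fix \<delta> :: real assume \<delta>: "0 < \<delta>"
      obtain d1 where d1: "0 < d1" "\<And>e. 0 < e \<Longrightarrow> e \<le> d1 \<Longrightarrow>
         \<bar>(\<integral>x. conv (mollifier e) gR x * \<psi> x \<partial>lborel) - (\<integral>x. gR x * \<psi> x \<partial>lborel)\<bar> \<le> \<delta>"
        using conv_mollifier_weak[OF gR test_continuous[OF \<psi>] test_bsupp[OF \<psi>] \<delta>] by blast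
      obtain d2 where d2: "0 < d2" "\<And>e. 0 < e \<Longrightarrow> e \<le> d2 \<Longrightarrow>
         \<bar>(\<integral>x. conv (mollifier e) gR x * \<eta> x \<partial>lborel) - (\<integral>x. gR x * \<eta> x \<partial>lborel)\<bar> \<le> \<delta>"
        using conv_mollifier_weak[OF gR test_continuous[OF \<eta>(1)] test_bsupp[OF \<eta>(1)] \<delta>] by blast
      define e where "e = min (min d1 d2) 1"
      have e: "0 < e" "e \<le> d1" "e \<le> d2" "e \<le> 1" using d1 d2 by (auto simp: e_def)
      have m: "(mollifier e :: real^'n \<Rightarrow> real) \<in> test_functions" by (rule mollifier_test[OF e(1)])
      have "(conv (mollifier e) gR has_derivative (\<lambda>v. 0)) (at x)" if x: "norm x \<le> r" for x
      proof -
        have "conv (pd i (mollifier e)) gR x = 0" for i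
        proof -
          have *: "pd i (mollifier e) (x - y) * gR y = - (g y * pd i (\<lambda>y. mollifier e (x - y)) y)" for y
          proof -
            have "pd i (mollifier e) (x - y) = 0" if "r + 1 < norm y"
            proof (rule pd_eq_0_outside[of e])
              show "e < norm (x - y)" using that x e(4) norm_triangle_ineq2[of y x] by (simp add: norm_minus_commute)
            qed (simp add: mollifier_eq_0[OF e(1)])
            then show ?thesis
              by (cases "norm y \<le> r + 1") (auto simp: gR_def pd_reflect test_differentiable[OF m])
          qed
          show ?thesis unfolding conv_def * using w0[OF test_reflect[OF m]] by simp
        qed
        then show ?thesis using conv_has_derivative[OF m gR, of x] by simp
      qed
      note hd = this
      have "\<exists>a. \<forall>x\<in>cball 0 r. conv (mollifier e) gR x = a"
      proof (rule has_derivative_zero_constant[OF convex_cball])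
        show "(conv (mollifier e) gR has_derivative (\<lambda>h. 0)) (at x within cball 0 r)" if "x \<in> cball 0 r" for x
          by (rule has_derivative_at_withinI[OF hd]) (use that in simp)
      qed
      then obtain a where a: "\<And>x. norm x \<le> r \<Longrightarrow> conv (mollifier e) gR x = a" by auto
      have A: "(\<integral>x. conv (mollifier e) gR x * k x \<partial>lborel) = a * (\<integral>x. k x \<partial>lborel)"
        if "\<And>x. r < norm x \<Longrightarrow> k x = 0" for k
      proof -
        have "conv (mollifier e) gR x * k x = a * k x" for x
          using that[of x] a[of x] by (cases "norm x \<le> r") auto
        then show ?thesis by (simp only: integral_mult_right_zero)
      qed
      define P where "P = (\<integral>x. \<psi> x \<partial>lborel)"
      have 1: "\<bar>a * P - (\<integral>x. g x * \<psi> x \<partial>lborel)\<bar> \<le> \<delta>"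
        using d1(2)[OF e(1) e(2)] A[OF r(2)] eq[OF r(2)] by (simp add: P_def)
      have 2: "\<bar>a - c\<bar> \<le> \<delta>"
        using d2(2)[OF e(1) e(3)] A[OF r(3)] eq[OF r(3)] \<eta>(2) by (simp add: c_def)
      have "\<bar>(a - c) * P\<bar> \<le> \<delta> * \<bar>P\<bar>" unfolding abs_mult by (intro mult_right_mono 2) simp
      then show "\<bar>(\<integral>x. g x * \<psi> x \<partial>lborel) - c * (\<integral>x. \<psi> x \<partial>lborel)\<bar> \<le> \<delta> * (1 + \<bar>(\<integral>x. \<psi> x \<partial>lborel)\<bar>)"
        using 1 unfolding P_def[symmetric] by (simp add: algebra_simps)
    qed
    then show ?thesis by simp
  qed
  have "locally_integrable (\<lambda>x. g x - c)"
    unfolding locally_integrable_def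
  proof (intro allI impI set_integral_diff(1))
    fix K :: "(real^'n) set" assume K: "compact K"
    show "set_integrable lborel K g" using g K by (simp add: locally_integrable_def)
    show "set_integrable lborel K (\<lambda>x. c)"
      unfolding set_integrable_def using K by (intro borel_integrable_compact) auto
  qed
  then have "AE x in lborel. g x - c = 0"
  proof (rule fundamental_lemma)
    fix \<psi> :: "real^'n \<Rightarrow> real" assume \<psi>: "\<psi> \<in> test_functions"
    have "integrable lborel (\<lambda>x. g x * \<psi> x)"
      by (intro loc_int_mult_continuous g test_continuous test_bsupp \<psi>)
    then show "(\<integral>x. (g x - c) * \<psi> x \<partial>lborel) = 0"
      using key[OF \<psi>] test_integrable[OF \<psi>] by (simp add: left_diff_distrib)
  qed
  then show thesis using that[of c] by simp
qed

lemma harmonic_imp_const: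
  assumes "sq_int M g" "\<And>h. h \<in> test_functions \<Longrightarrow> ip M g (LL h) = 0"
  obtains c where "AE x in M. g x = c"
  using weak_pd_0_imp_const[OF sq_int_loc_int[OF assms(1)] harmonic_weak_pd[OF assms]] by (auto simp: AE_M)

subsection \<open>Integration by parts\<close>

text \<open>The derivative of \<open>w * f * g\<close> has integral 0, and differentiating the
  weight accounts for the zero-order term of \<open>dstar\<close>. Bounded support of one factor
  suffices, so the other may be a constant.\<close>

lemma dstar_adjoint:
  assumes f: "Ck 1 f" and g: "Ck 1 g" and b: "bsupp f \<or> bsupp g"
  shows "ip M (dstar j f) g = ip M f (pd j g)"
proof -
  have cf: "continuous_on UNIV f" "continuous_on UNIV (pd j f)" and cg: "continuous_on UNIV g" "continuous_on UNIV (pd j g)"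
    using Ck_imp_continuous[OF f] Ck_imp_continuous[OF g] f g by auto
  have [measurable]: "f \<in> borel_measurable borel" "pd j f \<in> borel_measurable borel"
     "g \<in> borel_measurable borel" "pd j g \<in> borel_measurable borel"
    by (intro borel_measurable_continuous_onI cf cg)+
  have w1: "Ck 1 w" by (rule Ck_w) simp
  have d: "w differentiable (at x)" "f differentiable (at x)" "g differentiable (at x)" for x
    using w1 f g by auto
  have dw: "(\<lambda>x. w x * f x) differentiable (at x)" for x
    using Ck_mult[OF w1 f] by auto
  have bs: "bsupp (\<lambda>x. w x * f x * g x)" "bsupp (\<lambda>x. dstar j f x * g x * w x)" "bsupp (\<lambda>x. f x * pd j g x * w x)"
    using b by (auto simp: bsupp_mult1 bsupp_mult2 bsupp_dstar bsupp_pd)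
  have cd: "continuous_on UNIV (dstar j f)" using Ck_dstar[of 0 f j] f by simp
  have "(\<integral>x. pd j (\<lambda>x. w x * f x * g x) x \<partial>lborel) = 0"
    by (intro integral_pd_eq_0 Ck_mult w1 f g bs)
  moreover have "pd j (\<lambda>x. w x * f x * g x) x = f x * pd j g x * w x - dstar j f x * g x * w x" for x
    using d[of x] dw[of x] by (simp add: pd_mult pd_w dstar_def algebra_simps)
  moreover have "integrable lborel (\<lambda>x. f x * pd j g x * w x)" "integrable lborel (\<lambda>x. dstar j f x * g x * w x)"
    by (intro continuous_bsupp_integrable continuous_intros cf cg cd w_continuous bs)+
  moreover have [measurable]: "dstar j f \<in> borel_measurable borel"
    by (rule borel_measurable_continuous_onI[OF cd])
  ultimately show ?thesis by (simp add: ip_def integral_gw)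
qed

lemma integral_dstar: "Ck 1 f \<Longrightarrow> bsupp f \<Longrightarrow> (\<integral>x. dstar j f x \<partial>M) = 0"
  using dstar_adjoint[of f "\<lambda>x. 1" j] by (simp add: ip_def)

lemma ip_one: "ip M f (\<lambda>x. 1) = (\<integral>x. f x \<partial>M)" for f :: "real^'n \<Rightarrow> real"
  by (simp add: ip_def)

lemma integral_LL:
  assumes h: "h \<in> test_functions"
  shows "(\<integral>x. LL h x \<partial>M) = 0"
proof -
  note p = test_Ck[OF test_pd[OF h]] test_bsupp[OF test_pd[OF h]]
  show ?thesis
    unfolding LL_def using sq_int_imp_integrable[OF dstar_sq_int[OF p]] integral_dstar[OF p] by simp
qed

lemma LL_add: "f \<in> test_functions \<Longrightarrow> g \<in> test_functions \<Longrightarrow> LL (\<lambda>x. f x + g x) = (\<lambda>x. LL f x + LL g x)"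
proof
  fix x assume f: "f \<in> test_functions" and g: "g \<in> test_functions"
  have "pd k (\<lambda>x. f x + g x) = (\<lambda>x. pd k f x + pd k g x)" for k
    by (intro ext pd_add test_differentiable f g)
  then show "LL (\<lambda>x. f x + g x) x = LL f x + LL g x"
    by (simp add: LL_def dstar_def pd_add test_differentiable test_pd f g sum.distrib sum_subtractf algebra_simps)
qed

lemma LL_cmult: "f \<in> test_functions \<Longrightarrow> LL (\<lambda>x. c * f x) = (\<lambda>x. c * LL f x)"
proof
  fix x assume f: "f \<in> test_functions"
  have "pd k (\<lambda>x. c * f x) = (\<lambda>x. c * pd k f x)" for k
    by (intro ext pd_cmult test_differentiable f)
  then show "LL (\<lambda>x. c * f x) x = c * LL f x"
    by (simp add: LL_def dstar_def pd_cmult test_differentiable test_pd f sum_distrib_left algebra_simps)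
qed

lemma LL_zero: "LL (\<lambda>x. 0) = (\<lambda>x. 0)"
  by (simp add: LL_def dstar_def fun_eq_iff)

lemma nsq_cong_AE: "AE x in M. norm (f x) = norm (g x) \<Longrightarrow> f \<in> borel_measurable M \<Longrightarrow> g \<in> borel_measurable M \<Longrightarrow> nsq M f = nsq M g"
  unfolding nsq_def by (intro integral_cong_AE) auto

text \<open>The residual of the projection of \<open>f\<close> onto the span of the
  \<open>LL h\<close> is orthogonal to all of them, hence constant. Its mean is 0, since
  \<open>f\<close> and every \<open>LL h\<close> have mean 0, so it vanishes.\<close>

theorem LL_dense:
  fixes f :: "real^'n \<Rightarrow> real"
  assumes f: "sq_int M f" and mean: "(\<integral>x. f x \<partial>M) = 0"
  obtains h where "\<And>n::nat. h n \<in> test_functions" "(\<lambda>n. nsq M (\<lambda>x. LL (h n) x - f x)) \<longlonglongrightarrow> 0"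
proof -
  define E where "E = LL ` test_functions"
  have E: "sq_int M h" if "h \<in> E" for h using that by (auto simp: E_def LL_sq_int)
  have E0: "(\<lambda>x. 0) \<in> E" unfolding E_def using LL_zero test_zero by (metis image_eqI)
  have Eadd: "(\<lambda>x. h x + k x) \<in> E" if hk: "h \<in> E" "k \<in> E" for h k
  proof -
    obtain h' k' where "h' \<in> test_functions" "k' \<in> test_functions" "h = LL h'" "k = LL k'"
      using hk by (auto simp: E_def)
    then show ?thesis unfolding E_def
      by (intro image_eqI[where x = "\<lambda>x. h' x + k' x"] test_add) (auto simp: LL_add)
  qed
  have Escale: "(\<lambda>x. c *\<^sub>R h x) \<in> E" if hE: "h \<in> E" for h c
  proof -
    obtain h' where "h' \<in> test_functions" "h = LL h'" using hE by (auto simp: E_def)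
    then show ?thesis unfolding E_def
      by (intro image_eqI[where x = "\<lambda>x. c * h' x"] test_cmult) (auto simp: LL_cmult)
  qed
  obtain r k where r: "sq_int M r" and k: "\<And>n::nat. k n \<in> E"
    and lim: "(\<lambda>n. nsq M (\<lambda>x. (f x - k n x) - r x)) \<longlonglongrightarrow> 0" and orth: "\<And>k. k \<in> E \<Longrightarrow> ip M r k = 0"
  proof (rule sq_int_projection[of M f E])
    show "sq_int M f" by (rule f)
    show "sq_int M h" if "h \<in> E" for h by (rule E[OF that])
    show "(\<lambda>x. 0) \<in> E" by (rule E0)
    show "(\<lambda>x. h x + k x) \<in> E" if "h \<in> E" "k \<in> E" for h k by (rule Eadd[OF that])
    show "(\<lambda>x. c *\<^sub>R h x) \<in> E" if "h \<in> E" for h c by (rule Escale[OF that])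
    fix r k assume "sq_int M r" "\<And>n::nat. k n \<in> E"
      "(\<lambda>n. nsq M (\<lambda>x. (f x - k n x) - r x)) \<longlonglongrightarrow> 0" "\<And>k. k \<in> E \<Longrightarrow> ip M r k = 0"
    then show thesis by (rule that)
  qed
  have "\<forall>n. \<exists>h. h \<in> test_functions \<and> k n = LL h"
    using k by (auto simp: E_def)
  from choice[OF this] obtain h where "\<forall>n. h n \<in> test_functions \<and> k n = LL (h n)" ..
  then have h: "\<And>n. h n \<in> test_functions" "\<And>n. k n = LL (h n)" by auto
  obtain c where c: "AE x in M. r x = c"
    using harmonic_imp_const[OF r] orth by (auto simp: E_def)
  have "(\<lambda>n. ip M (\<lambda>x. f x - LL (h n) x) (\<lambda>x. 1)) \<longlonglongrightarrow> ip M r (\<lambda>x. 1)"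
    using lim by (intro nsq_tendsto_ip sq_int_diff f r LL_sq_int h sq_int_const) (simp add: h)
  moreover have "ip M (\<lambda>x. f x - LL (h n) x) (\<lambda>x. 1) = 0" for n
    using sq_int_imp_integrable[OF f] sq_int_imp_integrable[OF LL_sq_int[OF h(1)]]
    by (simp add: ip_one mean integral_LL[OF h(1)])
  ultimately have "(\<integral>x. r x \<partial>M) = 0" by (simp add: LIMSEQ_const_iff ip_one)
  moreover have "(\<integral>x. r x \<partial>M) = (\<integral>x. c \<partial>M)"
    using c sq_int_measurable[OF r] by (intro integral_cong_AE) auto
  ultimately have c0: "c = 0" by simp
  have "nsq M (\<lambda>x. LL (h n) x - f x) = nsq M (\<lambda>x. (f x - k n x) - r x)" for n
  proof (rule nsq_cong_AE)
    show "AE x in M. norm (LL (h n) x - f x) = norm (f x - k n x - r x)"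
      using c by eventually_elim (simp add: c0 h abs_minus_commute)
  qed (use sq_int_measurable[OF f] sq_int_measurable[OF r] sq_int_measurable[OF LL_sq_int[OF h(1)]] in \<open>auto simp: h\<close>)
  then have "(\<lambda>n. nsq M (\<lambda>x. LL (h n) x - f x)) \<longlonglongrightarrow> 0" using lim by simp
  then show thesis using that h by blast
qed

end

section \<open>Inequalities for finite sums, quadratic forms and traces\<close>

lemma sum_ip_Cauchy_Schwarz:
  assumes "\<And>i. i \<in> I \<Longrightarrow> sq_int M (f i)" "\<And>i. i \<in> I \<Longrightarrow> sq_int M (g i)"
  shows "(\<Sum>i\<in>I. ip M (f i) (g i))\<^sup>2 \<le> (\<Sum>i\<in>I. nsq M (f i)) * (\<Sum>i\<in>I. nsq M (g i))"
proof (rule quad_nonneg_imp)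
  fix t :: real
  have "(\<Sum>i\<in>I. nsq M (\<lambda>x. f i x + t *\<^sub>R g i x)) = (\<Sum>i\<in>I. nsq M (f i) + 2 * t * ip M (f i) (g i) + t\<^sup>2 * nsq M (g i))"
    using assms by (intro sum.cong refl) (simp add: nsq_add sq_int_scaleR ip_scaleR_right nsq_scaleR)
  also have "\<dots> = (\<Sum>i\<in>I. nsq M (f i)) + 2 * t * (\<Sum>i\<in>I. ip M (f i) (g i)) + t\<^sup>2 * (\<Sum>i\<in>I. nsq M (g i))"
    by (simp add: sum.distrib sum_distrib_left)
  finally show "0 \<le> (\<Sum>i\<in>I. nsq M (f i)) + 2 * t * (\<Sum>i\<in>I. ip M (f i) (g i)) + t\<^sup>2 * (\<Sum>i\<in>I. nsq M (g i))"
    by (metis sum_nonneg nsq_nonneg)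
qed

lemma ip_le_avg:
  assumes "sq_int M f" "sq_int M g"
  shows "2 * ip M f g \<le> nsq M f + nsq M g"
  using nsq_diff[OF assms] nsq_nonneg[of M "\<lambda>x. f x - g x"] by linarith

text \<open>The rank-one matrix with entries \<open>a j * a l\<close> has Frobenius norm equal to
  the sum of the squares.\<close>

lemma quadratic_form_le:
  fixes H :: "real^'n^'n::finite" and a :: "'n \<Rightarrow> real"
  shows "\<bar>\<Sum>j\<in>UNIV. \<Sum>l\<in>UNIV. a j * a l * H $ j $ l\<bar> \<le> norm H * (\<Sum>j\<in>UNIV. (a j)\<^sup>2)"
proof -
  define A :: "real^'n^'n" where "A = (\<chi> j l. a j * a l)"
  have "(norm A)\<^sup>2 = (\<Sum>j\<in>UNIV. \<Sum>l\<in>UNIV. (a j)\<^sup>2 * (a l)\<^sup>2)"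
    unfolding power2_norm_eq_inner by (simp add: A_def inner_vec_def power2_eq_square mult_ac)
  also have "\<dots> = (\<Sum>j\<in>UNIV. (a j)\<^sup>2)\<^sup>2"
    by (simp add: power2_eq_square[of "sum _ _"] sum_product)
  finally have "norm A = (\<Sum>j\<in>UNIV. (a j)\<^sup>2)"
    by (rule power2_eq_imp_eq) (auto intro: sum_nonneg)
  moreover have "(\<Sum>j\<in>UNIV. \<Sum>l\<in>UNIV. a j * a l * H $ j $ l) = A \<bullet> H"
    by (simp add: A_def inner_vec_def)
  ultimately show ?thesis using Cauchy_Schwarz_ineq2[of A H] by (simp add: mult.commute)
qed

text \<open>The trace is the inner product with the identity matrix, whose Frobenius norm is the
  square root of the dimension. The same factor stands in the first growth condition.\<close>

lemma trace_le:
  fixes H :: "real^'n^'n::finite"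
  shows "\<bar>\<Sum>k\<in>UNIV. H $ k $ k\<bar> \<le> sqrt (real CARD('n)) * norm H"
proof -
  define I :: "real^'n^'n" where "I = mat 1"
  have "(norm I)\<^sup>2 = real CARD('n)"
    unfolding power2_norm_eq_inner by (simp add: I_def inner_vec_def mat_def if_distrib[of "\<lambda>x. x * _"] cong: if_cong)
  then have "norm I = sqrt (real CARD('n))" by (simp add: real_sqrt_unique)
  moreover have "(\<Sum>k\<in>UNIV. H $ k $ k) = I \<bullet> H"
    by (simp add: I_def inner_vec_def mat_def if_distrib[of "\<lambda>x. x * _"] cong: if_cong)
  ultimately show ?thesis using Cauchy_Schwarz_ineq2[of I H] by simp
qed

context gibbs_potential
begin

lemma grad_continuous: "continuous_on UNIV (grad \<phi>)"
  unfolding grad_def[abs_def] by (intro continuous_on_vec_lambda phi_continuous)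

lemma hess_continuous: "continuous_on UNIV (hess \<phi>)"
  unfolding hess_def[abs_def] by (intro continuous_on_vec_lambda phi_continuous)

lemma grad_hess_measurable [measurable]:
  "grad \<phi> \<in> borel_measurable borel" "hess \<phi> \<in> borel_measurable borel"
  by (intro borel_measurable_continuous_onI grad_continuous hess_continuous)+

lemma continuous_bsupp_integrable_M:
  fixes f :: "real^'n \<Rightarrow> 'b::euclidean_space"
  shows "continuous_on UNIV f \<Longrightarrow> bsupp f \<Longrightarrow> integrable M f"
  by (rule sq_int_imp_integrable[OF continuous_bsupp_sq_int])

section \<open>The Bochner identity\<close>

text \<open>The commutator of \<open>pd j\<close> with \<open>dstar i\<close> is multiplication by a
  second derivative of \<phi>. Allowing two different functions lets the identity serve divergences
  of fields as well as \<open>LL\<close>.\<close>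

lemma bochner:
  assumes v: "v \<in> test_functions" and u: "u \<in> test_functions"
  shows "ip M (dstar i v) (dstar j u) = ip M (pd j v) (pd i u) + (\<integral>x. v x * u x * pd j (pd i \<phi>) x \<partial>M)"
proof -
  have d1: "Ck 1 (dstar i v)" by (intro Ck_dstar test_Ck v) simp
  have pdd: "pd j (dstar i v) x = dstar i (pd j v) x + v x * pd j (pd i \<phi>) x" for x
  proof -
    have "pd j (dstar i v) x = - pd j (pd i v) x + (pd j v x * pd i \<phi> x + v x * pd j (pd i \<phi>) x)"
      unfolding dstar_def[abs_def]
      using phi_differentiable test_differentiable[OF v] test_differentiable[OF test_pd[OF v]]
      by (subst pd_add) (simp_all add: pd_minus pd_mult)
    then show ?thesis using pd_symmetric[OF test_Ck[OF v], of i j x] by (simp add: dstar_def)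
  qed
  have s1: "sq_int M (dstar i (pd j v))" by (intro dstar_sq_int test_Ck test_bsupp test_pd v)
  have s2: "sq_int M (\<lambda>x. v x * pd j (pd i \<phi>) x)"
    by (intro continuous_bsupp_sq_int continuous_intros phi_continuous test_continuous[OF v] bsupp_mult1 test_bsupp v)
  have "ip M (dstar i v) (dstar j u) = ip M (dstar j u) (dstar i v)" by (rule ip_commute)
  also have "\<dots> = ip M u (pd j (dstar i v))"
    by (rule dstar_adjoint) (auto simp: test_Ck[OF u] d1 test_bsupp[OF u] simp del: Ck.simps One_nat_def)
  also have "pd j (dstar i v) = (\<lambda>x. dstar i (pd j v) x + v x * pd j (pd i \<phi>) x)" using pdd by auto
  also have "ip M u \<dots> = ip M u (dstar i (pd j v)) + ip M u (\<lambda>x. v x * pd j (pd i \<phi>) x)"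
    by (rule ip_add_right[OF s1 s2 test_sq_int[OF u]])
  also have "ip M u (dstar i (pd j v)) = ip M (pd j v) (pd i u)"
    unfolding ip_commute[of M u]
    by (rule dstar_adjoint) (auto simp: test_Ck[OF u] test_Ck[OF test_pd[OF v]] test_bsupp[OF u] simp del: Ck.simps One_nat_def)
  finally show ?thesis by (simp add: ip_def mult_ac)
qed

text \<open>Dominates the Hessian form of \<phi> on the field \<open>v\<close> in absolute value, as
  no sign of the Hessian is available.\<close>

definition JJ where "JJ v = (\<integral>x. norm (hess \<phi> x) * (\<Sum>j\<in>UNIV. (v j x)\<^sup>2) \<partial>M)" for v :: "'n \<Rightarrow> real^'n \<Rightarrow> real"

lemma hess_int:
  assumes "\<And>j. v j \<in> test_functions"
  shows "integrable M (\<lambda>x. v j x * v l x * pd l (pd j \<phi>) x)"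
    and "integrable M (\<lambda>x. norm (hess \<phi> x) * (v j x)\<^sup>2)"
proof -
  note c = test_continuous[OF assms] and b = test_bsupp[OF assms]
  show "integrable M (\<lambda>x. v j x * v l x * pd l (pd j \<phi>) x)"
    by (intro continuous_bsupp_integrable_M continuous_intros phi_continuous c bsupp_mult1 b)
  show "integrable M (\<lambda>x. norm (hess \<phi> x) * (v j x)\<^sup>2)"
    unfolding power2_eq_square
    by (intro continuous_bsupp_integrable_M continuous_intros hess_continuous c bsupp_mult2 b)
qed

lemma JJ_sum:
  assumes "\<And>j. v j \<in> test_functions"
  shows "JJ v = (\<Sum>j\<in>UNIV. \<integral>x. norm (hess \<phi> x) * (v j x)\<^sup>2 \<partial>M)"
  unfolding JJ_def sum_distrib_left using hess_int(2)[of v, OF assms] by simp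

lemma abs_hess_form_le:
  assumes v: "\<And>j. v j \<in> test_functions"
  shows "\<bar>\<Sum>j\<in>UNIV. \<Sum>l\<in>UNIV. \<integral>x. v j x * v l x * pd l (pd j \<phi>) x \<partial>M\<bar> \<le> JJ v"
proof -
  have "(\<Sum>j\<in>UNIV. \<Sum>l\<in>UNIV. \<integral>x. v j x * v l x * pd l (pd j \<phi>) x \<partial>M)
      = (\<integral>x. (\<Sum>j\<in>UNIV. \<Sum>l\<in>UNIV. v j x * v l x * hess \<phi> x $ j $ l) \<partial>M)"
    using hess_int(1)[of v, OF v] by simp
  also have "\<bar>\<dots>\<bar> \<le> (\<integral>x. \<bar>\<Sum>j\<in>UNIV. \<Sum>l\<in>UNIV. v j x * v l x * hess \<phi> x $ j $ l\<bar> \<partial>M)"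
    using integral_abs_bound by blast
  also have "\<dots> \<le> JJ v"
    unfolding JJ_def
  proof (rule integral_mono)
    show "integrable M (\<lambda>x. \<bar>\<Sum>j\<in>UNIV. \<Sum>l\<in>UNIV. v j x * v l x * hess \<phi> x $ j $ l\<bar>)"
      using hess_int(1)[of v, OF v] by simp
    show "integrable M (\<lambda>x. norm (hess \<phi> x) * (\<Sum>j\<in>UNIV. (v j x)\<^sup>2))"
      unfolding sum_distrib_left using hess_int(2)[of v, OF v] by simp
    show "\<bar>\<Sum>j\<in>UNIV. \<Sum>l\<in>UNIV. v j x * v l x * hess \<phi> x $ j $ l\<bar>
        \<le> norm (hess \<phi> x) * (\<Sum>j\<in>UNIV. (v j x)\<^sup>2)" for x
      by (rule quadratic_form_le)
  qed
  finally show ?thesis .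
qed

lemma nsq_divergence:
  assumes v: "\<And>j. v j \<in> test_functions"
  shows "nsq M (\<lambda>x. \<Sum>j\<in>UNIV. dstar j (v j) x)
    = (\<Sum>j\<in>UNIV. \<Sum>l\<in>UNIV. ip M (pd l (v j)) (pd j (v l)))
      + (\<Sum>j\<in>UNIV. \<Sum>l\<in>UNIV. \<integral>x. v j x * v l x * pd l (pd j \<phi>) x \<partial>M)"
proof -
  have s: "sq_int M (dstar j (v j))" for j by (intro dstar_sq_int test_Ck test_bsupp v)
  show ?thesis
    by (simp add: nsq_eq_ip ip_sum_left ip_sum_right s sq_int_sum bochner[OF v v] sum.distrib)
qed

text \<open>The cross terms pair the derivative matrix of \<open>v\<close> with its transpose, so
  they are at most its squared norm.\<close>

lemma nsq_divergence_le:
  assumes v: "\<And>j. v j \<in> test_functions"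
  shows "nsq M (\<lambda>x. \<Sum>j\<in>UNIV. dstar j (v j) x) \<le> (\<Sum>j\<in>UNIV. \<Sum>l\<in>UNIV. nsq M (pd l (v j))) + JJ v"
proof -
  have "2 * (\<Sum>j\<in>UNIV. \<Sum>l\<in>UNIV. ip M (pd l (v j)) (pd j (v l)))
     \<le> (\<Sum>j\<in>UNIV. \<Sum>l\<in>UNIV. nsq M (pd l (v j)) + nsq M (pd j (v l)))"
    unfolding sum_distrib_left by (intro sum_mono ip_le_avg test_sq_int test_pd v)
  also have "\<dots> = (\<Sum>j\<in>UNIV. \<Sum>l\<in>UNIV. nsq M (pd l (v j))) + (\<Sum>l\<in>UNIV. \<Sum>j\<in>UNIV. nsq M (pd j (v l)))"
    by (simp add: sum.distrib sum.swap[of "\<lambda>j l. nsq M (pd j (v l))"])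
  finally show ?thesis
    using nsq_divergence[of v] abs_hess_form_le[of v] v by auto
qed

text \<open>The squared norm of the Hessian matrix of \<open>h\<close>.\<close>

definition XX where "XX h = (\<Sum>k\<in>UNIV. \<Sum>l\<in>UNIV. nsq M (pd l (pd k h)))" for h :: "real^'n \<Rightarrow> real"

lemma nsq_LL:
  assumes h: "h \<in> test_functions"
  shows "nsq M (LL h) = XX h + (\<Sum>j\<in>UNIV. \<Sum>l\<in>UNIV. \<integral>x. pd j h x * pd l h x * pd l (pd j \<phi>) x \<partial>M)"
proof -
  have "pd j (pd l h) = pd l (pd j h)" for j l
    using pd_symmetric[OF test_Ck[OF h]] by auto
  then show ?thesis
    using nsq_divergence[of "\<lambda>j. pd j h"] test_pd[OF h]
    by (simp add: LL_def[abs_def] XX_def nsq_eq_ip)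
qed

lemma XX_le: "h \<in> test_functions \<Longrightarrow> XX h \<le> nsq M (LL h) + JJ (\<lambda>k. pd k h)"
  using nsq_LL[of h] abs_hess_form_le[of "\<lambda>j. pd j h"] test_pd[of h] by auto

lemma ip_LL:
  assumes h: "h \<in> test_functions" and g: "Ck 1 g"
  shows "ip M g (LL h) = (\<Sum>k\<in>UNIV. ip M (pd k g) (pd k h))"
proof -
  have p: "Ck 1 (pd k h)" "bsupp (pd k h)" for k by (intro test_Ck test_bsupp test_pd h)+
  have i: "integrable M (\<lambda>x. g x * dstar k (pd k h) x)" for k
    using Ck_imp_continuous[OF g] Ck_dstar[OF test_Ck[OF test_pd[OF h]], of 0 k k]
    by (intro continuous_bsupp_integrable_M continuous_intros bsupp_mult2 bsupp_dstar p) auto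
  have "ip M g (LL h) = (\<Sum>k\<in>UNIV. ip M g (dstar k (pd k h)))"
    using i by (simp add: ip_def LL_def sum_distrib_left)
  also have "\<dots> = (\<Sum>k\<in>UNIV. ip M (pd k g) (pd k h))"
    using dstar_adjoint[OF p(1) g] p(2) by (simp add: ip_commute)
  finally show ?thesis .
qed

section \<open>Consequences of the growth conditions\<close>

text \<open>The divergence of g^2 times the gradient of \<phi> consists of a term with the gradient
  of \<open>g\<close> and one with the Laplacian of \<phi>. Each is allowed a quarter of the left
  side; absorbing the resulting half doubles 4 and (C - 1)/4.\<close>

lemma grad_weight:
  assumes growth: "growth_constants \<phi> C C'" and g: "g \<in> test_functions"
  shows "(\<integral>x. (norm (grad \<phi> x))\<^sup>2 * (g x)\<^sup>2 \<partial>M) \<le> 8 * (\<Sum>k\<in>UNIV. nsq M (pd k g)) + (C - 1) / 2 * nsq M g"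
proof -
  have gr: "4 * sqrt (real CARD('n)) * norm (hess \<phi> x) \<le> (norm (grad \<phi> x))\<^sup>2 + C - 1" for x
    using growth by (simp add: growth_constants_def)
  define F where "F k x = (g x)\<^sup>2 * pd k \<phi> x" for k x
  have F: "Ck 1 (F k)" "bsupp (F k)" for k
    unfolding F_def power2_eq_square
    by (intro Ck_mult test_Ck[OF g] phi_C1 bsupp_mult1 test_bsupp[OF g])+
  have pF: "pd k (F k) x = 2 * g x * pd k g x * pd k \<phi> x + (g x)\<^sup>2 * pd k (pd k \<phi>) x" for k x
  proof -
    have "(\<lambda>x. g x * g x) differentiable (at x)"
      using Ck_mult[OF test_Ck[OF g, of 1] test_Ck[OF g, of 1]] by simp
    then show ?thesis
      unfolding F_def power2_eq_square
      by (simp add: pd_mult phi_differentiable test_differentiable[OF g] algebra_simps)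
  qed
  have i0: "integrable M (\<lambda>x. (pd k \<phi> x)\<^sup>2 * (g x)\<^sup>2)" for k
    by (intro continuous_bsupp_integrable_M continuous_intros phi_continuous test_continuous[OF g] bsupp_mult2)
       (use test_bsupp[OF g] in \<open>auto simp: power2_eq_square intro: bsupp_mult1\<close>)
  have iP: "integrable M (pd k (F k))" for k
    using F by (intro continuous_bsupp_integrable_M bsupp_pd) auto
  have ig: "integrable M (\<lambda>x. (g x)\<^sup>2)" "integrable M (\<lambda>x. (pd k g x)\<^sup>2)" for k
    using test_sq_int[OF g] test_sq_int[OF test_pd[OF g]] by (auto simp: sq_int_real_iff)
  have "(\<integral>x. (pd k \<phi> x)\<^sup>2 * (g x)\<^sup>2 \<partial>M) = (\<integral>x. pd k (F k) x \<partial>M)" for k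
  proof -
    \<comment> \<open>For this \<open>F k\<close> the zero-order term of the adjoint is exactly the
      integrand wanted, and the adjoint of anything of bounded support has mean 0.\<close>
    have "dstar k (F k) = (\<lambda>x. (pd k \<phi> x)\<^sup>2 * (g x)\<^sup>2 - pd k (F k) x)"
      by (auto simp: dstar_def F_def[of k] power2_eq_square mult_ac)
    then have "0 = (\<integral>x. (pd k \<phi> x)\<^sup>2 * (g x)\<^sup>2 - pd k (F k) x \<partial>M)" using integral_dstar[OF F, of k k] by simp
    then show ?thesis using i0 iP by simp
  qed
  then have eq: "(\<integral>x. (norm (grad \<phi> x))\<^sup>2 * (g x)\<^sup>2 \<partial>M) = (\<integral>x. (\<Sum>k\<in>UNIV. pd k (F k) x) \<partial>M)"
    using i0 iP by (simp add: norm_grad_sq sum_distrib_right)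
  define Y where "Y = (\<integral>x. (norm (grad \<phi> x))\<^sup>2 * (g x)\<^sup>2 \<partial>M)"
  have iY: "integrable M (\<lambda>x. (norm (grad \<phi> x))\<^sup>2 * (g x)\<^sup>2)"
    unfolding norm_grad_sq sum_distrib_right using i0 by simp
  have "(\<integral>x. (\<Sum>k\<in>UNIV. pd k (F k) x) \<partial>M)
     \<le> (\<integral>x. 1/2 * ((norm (grad \<phi> x))\<^sup>2 * (g x)\<^sup>2) + 4 * (\<Sum>k\<in>UNIV. (pd k g x)\<^sup>2) + (C - 1) / 4 * (g x)\<^sup>2 \<partial>M)"
  proof (rule integral_mono)
    fix x
    have "(\<Sum>k\<in>UNIV. 2 * g x * pd k g x * pd k \<phi> x) \<le> (\<Sum>k\<in>UNIV. 1/4 * ((pd k \<phi> x)\<^sup>2 * (g x)\<^sup>2) + 4 * (pd k g x)\<^sup>2)"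
    proof (rule sum_mono)
      fix k
      have "0 \<le> (1/2 * (pd k \<phi> x * g x) - 2 * pd k g x)\<^sup>2" by simp
      then show "2 * g x * pd k g x * pd k \<phi> x \<le> 1/4 * ((pd k \<phi> x)\<^sup>2 * (g x)\<^sup>2) + 4 * (pd k g x)\<^sup>2"
        by (simp add: power2_eq_square algebra_simps)
    qed
    also have "\<dots> = 1/4 * ((norm (grad \<phi> x))\<^sup>2 * (g x)\<^sup>2) + 4 * (\<Sum>k\<in>UNIV. (pd k g x)\<^sup>2)"
      by (simp add: sum.distrib norm_grad_sq sum_distrib_left sum_distrib_right)
    finally have 1: "(\<Sum>k\<in>UNIV. 2 * g x * pd k g x * pd k \<phi> x) \<le> \<dots>" .
    have "(\<Sum>k\<in>UNIV. pd k (pd k \<phi>) x) \<le> 1/4 * ((norm (grad \<phi> x))\<^sup>2 + C - 1)"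
      using trace_le[of "hess \<phi> x"] gr[of x] by simp
    then have "(\<Sum>k\<in>UNIV. pd k (pd k \<phi>) x) * (g x)\<^sup>2 \<le> (1/4 * ((norm (grad \<phi> x))\<^sup>2 + C - 1)) * (g x)\<^sup>2"
      by (intro mult_right_mono) auto
    then have 2: "(\<Sum>k\<in>UNIV. (g x)\<^sup>2 * pd k (pd k \<phi>) x) \<le> 1/4 * ((norm (grad \<phi> x))\<^sup>2 * (g x)\<^sup>2) + (C - 1) / 4 * (g x)\<^sup>2"
      by (simp add: sum_distrib_left[symmetric] sum_distrib_right[symmetric] algebra_simps diff_divide_distrib add_divide_distrib)
    show "(\<Sum>k\<in>UNIV. pd k (F k) x) \<le> 1/2 * ((norm (grad \<phi> x))\<^sup>2 * (g x)\<^sup>2) + 4 * (\<Sum>k\<in>UNIV. (pd k g x)\<^sup>2) + (C - 1) / 4 * (g x)\<^sup>2"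
      using 1 2 unfolding pF sum.distrib by linarith
  qed (use iP iY ig in auto)
  also have "\<dots> = 1/2 * Y + 4 * (\<Sum>k\<in>UNIV. nsq M (pd k g)) + (C - 1) / 4 * nsq M g"
    using iY ig by (simp add: Y_def nsq_def)
  finally show ?thesis using eq by (simp add: Y_def)
qed

text \<open>Combines the second growth condition with \<open>grad_weight\<close>. What matters is
  that the factor 5/7 in front of the derivatives is below 1, so that this term can be absorbed
  later.\<close>

lemma JJ_le:
  assumes growth: "growth_constants \<phi> C C'" and v: "\<And>j. v j \<in> test_functions"
  shows "JJ v \<le> 5/7 * (\<Sum>j\<in>UNIV. \<Sum>k\<in>UNIV. nsq M (pd k (v j))) + C' / 7 * (\<Sum>j\<in>UNIV. nsq M (v j))"
proof -
  have C: "8 < C" "C < C'" and gr: "4 * norm (hess \<phi> x) \<le> ((norm (grad \<phi> x))\<^sup>2 + C') / sqrt C" for x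
    using growth by (auto simp: growth_constants_def)
  \<comment> \<open>The square of 2.8 is 7.84, below 8. The resulting factor 1/(4 * 2.8) is 5/56,
    and 8 * 5/56 = 5/7.\<close>
  have "sqrt (2.8\<^sup>2) \<le> sqrt C" using C by (intro real_sqrt_le_mono) (simp add: power2_eq_square)
  then have sC: "2.8 \<le> sqrt C" by simp
  have h: "norm (hess \<phi> x) \<le> 5/56 * ((norm (grad \<phi> x))\<^sup>2 + C')" for x
  proof -
    have "((norm (grad \<phi> x))\<^sup>2 + C') / sqrt C \<le> ((norm (grad \<phi> x))\<^sup>2 + C') / 2.8"
      using C sC by (intro divide_left_mono) auto
    from order_trans[OF gr this] show ?thesis by simp
  qed
  have each: "(\<integral>x. norm (hess \<phi> x) * (v j x)\<^sup>2 \<partial>M) \<le> 5/7 * (\<Sum>k\<in>UNIV. nsq M (pd k (v j))) + C' / 7 * nsq M (v j)" for j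
  proof -
    have ig: "integrable M (\<lambda>x. (v j x)\<^sup>2)" using test_sq_int[OF v] by (simp add: sq_int_real_iff)
    have iY: "integrable M (\<lambda>x. (norm (grad \<phi> x))\<^sup>2 * (v j x)\<^sup>2)"
      by (intro continuous_bsupp_integrable_M continuous_intros grad_continuous test_continuous v bsupp_mult2)
         (use test_bsupp[OF v] in \<open>auto simp: power2_eq_square intro: bsupp_mult1\<close>)
    have "(\<integral>x. norm (hess \<phi> x) * (v j x)\<^sup>2 \<partial>M)
        \<le> (\<integral>x. 5/56 * ((norm (grad \<phi> x))\<^sup>2 * (v j x)\<^sup>2) + 5/56 * C' * (v j x)\<^sup>2 \<partial>M)"
    proof (rule integral_mono)
      show "norm (hess \<phi> x) * (v j x)\<^sup>2 \<le> 5/56 * ((norm (grad \<phi> x))\<^sup>2 * (v j x)\<^sup>2) + 5/56 * C' * (v j x)\<^sup>2" for x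
        using mult_right_mono[OF h[of x], of "(v j x)\<^sup>2"] by (simp add: algebra_simps)
    qed (use hess_int(2)[of v, OF v] ig iY in auto)
    also have "\<dots> = 5/56 * (\<integral>x. (norm (grad \<phi> x))\<^sup>2 * (v j x)\<^sup>2 \<partial>M) + 5/56 * C' * nsq M (v j)"
      using ig iY by (simp add: nsq_def)
    also have "\<dots> \<le> 5/56 * (8 * (\<Sum>k\<in>UNIV. nsq M (pd k (v j))) + (C - 1) / 2 * nsq M (v j)) + 5/56 * C' * nsq M (v j)"
      by (intro add_right_mono mult_left_mono grad_weight[OF growth v]) simp
    also have "\<dots> = 5/7 * (\<Sum>k\<in>UNIV. nsq M (pd k (v j))) + (5/56 * ((C - 1) / 2 + C')) * nsq M (v j)"
      by (simp add: algebra_simps)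
    \<comment> \<open>As C < C', the bracket is at most 3/2 C', and 15/112 is below 1/7.\<close>
    also have "(5/56 * ((C - 1) / 2 + C')) * nsq M (v j) \<le> (C' / 7) * nsq M (v j)"
      using C by (intro mult_right_mono) auto
    finally show ?thesis by simp
  qed
  show ?thesis
    unfolding JJ_sum[OF v] using sum_mono[of UNIV, OF each] by (simp add: sum.distrib sum_distrib_left)
qed

lemma mean_eq: "mean \<phi> f = (\<integral>x. f x \<partial>M)"
  by (simp add: mean_def)

lemma nsq_centre:
  fixes f :: "real^'n \<Rightarrow> real"
  assumes "sq_int M f"
  shows "nsq M (\<lambda>x. f x - (\<integral>y. f y \<partial>M)) = nsq M f - (\<integral>y. f y \<partial>M)\<^sup>2"
proof -
  have c: "nsq M (\<lambda>x. c) = c\<^sup>2" "ip M f (\<lambda>x. c) = c * (\<integral>y. f y \<partial>M)" for c :: real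
    by (simp_all add: nsq_def ip_def)
  show ?thesis using assms by (simp add: nsq_diff c power2_eq_square)
qed

end

section \<open>Consequences of the Poincare inequality for test functions\<close>

locale gibbs_poincare = gibbs_potential \<phi>
  for \<phi> :: "real^'n::finite \<Rightarrow> real" +
  fixes P :: real
  assumes PI: "poincare \<phi> P"
begin

lemma poincare_test:
  assumes "h \<in> test_functions"
  shows "nsq M (\<lambda>x. h x - (\<integral>y. h y \<partial>M)) \<le> P * (\<Sum>k\<in>UNIV. nsq M (pd k h))"
proof -
  have "integrable M (\<lambda>x. (pd k h x)\<^sup>2)" for k
    using test_sq_int[OF test_pd[OF assms]] by (simp add: sq_int_real_iff)
  then show ?thesis
    using PI[unfolded poincare_def, rule_format, OF assms] by (simp add: mean_eq norm_grad_sq nsq_def)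
qed

text \<open>A negative constant would force every test function to be constant almost everywhere,
  which \<open>bump\<close> is not.\<close>

lemma P_nonneg: "0 \<le> P"
proof (rule ccontr)
  assume neg: "\<not> 0 \<le> P"
  define b where "b = (bump :: real^'n \<Rightarrow> real)"
  have b: "b \<in> test_functions" by (simp add: b_def bump_test)
  define m where "m = (\<integral>y. b y \<partial>M)"
  have "P * (\<Sum>k\<in>UNIV. nsq M (pd k b)) \<le> 0"
    using neg by (intro mult_nonpos_nonneg sum_nonneg) auto
  then have "nsq M (\<lambda>x. b x - m) \<le> 0"
    using poincare_test[OF b] unfolding m_def[symmetric] by linarith
  then have "nsq M (\<lambda>x. b x - m) = 0" using nsq_nonneg[of M "\<lambda>x. b x - m"] by linarith
  moreover have "integrable M (\<lambda>x. (b x - m)\<^sup>2)"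
    using sq_int_diff[OF test_sq_int[OF b] sq_int_const] by (simp add: sq_int_real_iff)
  ultimately have "AE x in M. (b x - m)\<^sup>2 = 0"
    unfolding nsq_def by (subst (asm) integral_nonneg_eq_0_iff_AE) auto
  then have "AE x in lborel. b x = m" by (simp add: AE_M)
  then have eq: "b = (\<lambda>x. m)" by (intro continuous_AE_eq test_continuous[OF b]) auto
  obtain i :: 'n where True by simp
  have "b 0 = b (axis i 1)" unfolding eq ..
  moreover have "b (axis i 1) = 0" unfolding b_def by (rule bump_eq_0) (simp add: norm_axis_1)
  ultimately show False by (simp add: b_def bump_zero)
qed

text \<open>The gradient energy \<open>E\<close> is the pairing of \<open>h\<close> with
  \<open>LL h\<close>. As \<open>LL h\<close> has mean 0, \<open>h\<close> may be centred, and
  Cauchy-Schwarz with the Poincare inequality gives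
  \<open>E\<^sup>2 \<le> P * E * nsq M (LL h)\<close>.\<close>

lemma gradient_le_LL:
  assumes h: "h \<in> test_functions"
  shows "(\<Sum>k\<in>UNIV. nsq M (pd k h)) \<le> P * nsq M (LL h)"
proof -
  define E where "E = (\<Sum>k\<in>UNIV. nsq M (pd k h))"
  define m where "m = (\<integral>y. h y \<partial>M)"
  have E0: "0 \<le> E" unfolding E_def by (intro sum_nonneg) simp
  have s: "sq_int M (\<lambda>x. h x - m)" by (intro sq_int_diff test_sq_int h sq_int_const)
  have "E = ip M h (LL h)"
    by (simp add: E_def ip_LL[OF h test_Ck[OF h]] nsq_eq_ip)
  also have "\<dots> = ip M (\<lambda>x. h x - m) (LL h)"
    using ip_diff_left[OF test_sq_int[OF h] sq_int_const LL_sq_int[OF h], of m] integral_LL[OF h]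
    by (simp add: ip_def)
  finally have "E\<^sup>2 \<le> nsq M (\<lambda>x. h x - m) * nsq M (LL h)"
    using ip_Cauchy_Schwarz[OF s LL_sq_int[OF h]] by simp
  also have "\<dots> \<le> (P * E) * nsq M (LL h)"
    using poincare_test[OF h] by (intro mult_right_mono) (auto simp: m_def E_def)
  finally have "E * E \<le> E * (P * nsq M (LL h))" by (simp add: power2_eq_square mult_ac)
  then show ?thesis
    using E0 P_nonneg unfolding E_def[symmetric]
    by (cases "E = 0") auto
qed

text \<open>Write N for \<open>nsq M (LL h)\<close>. The system XX <= N + JJ, JJ <= 5/7 XX + P C' N
  / 7 yields XX <= (7/2 + P C'/2) N and JJ <= (5/2 + P C'/2) N, whose sum is the bound.\<close>

lemma second_order_bound:
  assumes growth: "growth_constants \<phi> C C'" and h: "h \<in> test_functions"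
  shows "XX h + JJ (\<lambda>k. pd k h) \<le> (6 + P * C') * nsq M (LL h)"
proof -
  have C': "0 < C'" using growth by (simp add: growth_constants_def)
  have "JJ (\<lambda>k. pd k h) \<le> 5/7 * XX h + C' / 7 * (\<Sum>k\<in>UNIV. nsq M (pd k h))"
    using JJ_le[OF growth, of "\<lambda>k. pd k h"] test_pd[OF h] by (simp add: XX_def)
  moreover have "C' / 7 * (\<Sum>k\<in>UNIV. nsq M (pd k h)) \<le> C' / 7 * (P * nsq M (LL h))"
    using C' by (intro mult_left_mono gradient_le_LL h) auto
  ultimately show ?thesis using XX_le[OF h] by (simp add: algebra_simps)
qed

end

context gibbs_potential
begin

text \<open>By density the \<open>LL (h i)\<close> may be driven to the \<open>f i\<close>
  themselves, which turns the hypothesis into N^2 <= K N for the sum N of the squared norms. A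
  family is needed because Korn's inequality couples the entries of the skew part and can be bounded
  only for all of them together.\<close>

lemma LL_dual_bound:
  assumes I: "finite I" and f: "\<And>i. i \<in> I \<Longrightarrow> sq_int M (f i)" "\<And>i. i \<in> I \<Longrightarrow> (\<integral>x. f i x \<partial>M) = 0"
    and K: "0 \<le> K"
    and bound: "\<And>h. (\<And>i. h i \<in> test_functions) \<Longrightarrow>
      (\<Sum>i\<in>I. ip M (f i) (LL (h i)))\<^sup>2 \<le> K * (\<Sum>i\<in>I. nsq M (LL (h i)))"
  shows "(\<Sum>i\<in>I. nsq M (f i)) \<le> K"
proof -
  have "\<exists>h. \<forall>i. (\<forall>n::nat. h i n \<in> test_functions) \<and>
      (i \<in> I \<longrightarrow> (\<lambda>n. nsq M (\<lambda>x. LL (h i n) x - f i x)) \<longlonglongrightarrow> 0)"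
  proof (intro choice allI)
    fix i
    show "\<exists>h. (\<forall>n::nat. h n \<in> test_functions) \<and> (i \<in> I \<longrightarrow> (\<lambda>n. nsq M (\<lambda>x. LL (h n) x - f i x)) \<longlonglongrightarrow> 0)"
    proof (cases "i \<in> I")
      case True
      show ?thesis
      proof (rule LL_dense[OF f(1)[OF True] f(2)[OF True]])
        fix h assume "\<And>n::nat. h n \<in> test_functions" "(\<lambda>n. nsq M (\<lambda>x. LL (h n) x - f i x)) \<longlonglongrightarrow> 0"
        then show ?thesis by (intro exI[of _ h]) simp
      qed
    next
      case False
      \<comment> \<open>Outside \<open>I\<close> any sequence will do; zero keeps the choice of
        sequences total.\<close>
      then show ?thesis using test_zero by (intro exI[of _ "\<lambda>n x. 0"]) auto
    qed
  qed
  then obtain h where h: "\<And>i n. h i n \<in> test_functions"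
    and lim: "\<And>i. i \<in> I \<Longrightarrow> (\<lambda>n. nsq M (\<lambda>x. LL (h i n) x - f i x)) \<longlonglongrightarrow> 0" by auto
  define N where "N = (\<Sum>i\<in>I. nsq M (f i))"
  have "(\<lambda>n. (\<Sum>i\<in>I. ip M (LL (h i n)) (f i))\<^sup>2) \<longlonglongrightarrow> (\<Sum>i\<in>I. ip M (f i) (f i))\<^sup>2"
    by (intro tendsto_intros nsq_tendsto_ip LL_sq_int h f lim)
  moreover have "(\<lambda>n. K * (\<Sum>i\<in>I. nsq M (LL (h i n)))) \<longlonglongrightarrow> K * (\<Sum>i\<in>I. nsq M (f i))"
    by (intro tendsto_intros nsq_tendsto_nsq LL_sq_int h f lim)
  moreover have "(\<Sum>i\<in>I. ip M (LL (h i n)) (f i))\<^sup>2 \<le> K * (\<Sum>i\<in>I. nsq M (LL (h i n)))" for n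
    using bound[of "\<lambda>i. h i n"] h by (simp add: ip_commute)
  ultimately have "N\<^sup>2 \<le> K * N"
    unfolding N_def nsq_eq_ip by (intro LIMSEQ_le) (auto simp: nsq_eq_ip)
  moreover have "0 \<le> N" unfolding N_def by (intro sum_nonneg) simp
  ultimately show ?thesis
    using K unfolding N_def[symmetric] power2_eq_square
    by (cases "N = 0") auto
qed

end

section \<open>Vector-valued functions by components\<close>

lemma norm_vec_sq: "(norm x)\<^sup>2 = (\<Sum>i\<in>UNIV. (norm (x $ i))\<^sup>2)" for x :: "'a::real_normed_vector ^ 'n::finite"
  by (simp add: norm_vec_def L2_set_def sum_nonneg)

lemma vec_nth_measurable [measurable]:
  fixes f :: "'a \<Rightarrow> 'b::euclidean_space ^ 'n::finite"
  shows "f \<in> borel_measurable M \<Longrightarrow> (\<lambda>x. f x $ i) \<in> borel_measurable M"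
  by (rule borel_measurable_continuous_on[OF continuous_on_component[OF continuous_on_id]]) simp

lemma sq_int_nth:
  fixes f :: "'a \<Rightarrow> 'b::euclidean_space ^ 'n::finite"
  assumes "sq_int M f"
  shows "sq_int M (\<lambda>x. f x $ i)"
  using sq_int_measurable[OF assms]
  by (intro sq_int_bound[OF assms, of _ 1]) (auto intro: Finite_Cartesian_Product.norm_nth_le)

lemma nsq_vec:
  fixes f :: "'a \<Rightarrow> 'b::euclidean_space ^ 'n::finite"
  assumes "sq_int M f"
  shows "nsq M f = (\<Sum>i\<in>UNIV. nsq M (\<lambda>x. f x $ i))"
  unfolding nsq_def norm_vec_sq
  using sq_int_integrable[OF sq_int_nth[OF assms]] by (intro Bochner_Integration.integral_sum) auto

lemma ip_vec:
  fixes f g :: "'a \<Rightarrow> 'b::euclidean_space ^ 'n::finite"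
  assumes "sq_int M f" "sq_int M g"
  shows "ip M f g = (\<Sum>i\<in>UNIV. ip M (\<lambda>x. f x $ i) (\<lambda>x. g x $ i))"
  unfolding ip_def inner_vec_def
  using sq_int_inner[OF sq_int_nth[OF assms(1)] sq_int_nth[OF assms(2)]]
  by (intro Bochner_Integration.integral_sum) auto

lemma sq_int_vec:
  fixes F :: "'n::finite \<Rightarrow> 'a \<Rightarrow> real"
  assumes "\<And>j. sq_int M (F j)"
  shows "sq_int M (\<lambda>x. \<chi> j. F j x)"
proof -
  have "sq_int M (\<lambda>x. F j x *\<^sub>R (axis j 1 :: real^'n))" for j
    using sq_int_measurable[OF assms[of j]]
    by (intro sq_int_bound[OF assms[of j], of _ 1]) (auto simp: norm_axis_1)
  then have "sq_int M (\<lambda>x. \<Sum>j\<in>UNIV. F j x *\<^sub>R (axis j 1 :: real^'n))" by (intro sq_int_sum)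
  moreover have "(\<Sum>j\<in>UNIV. F j x *\<^sub>R (axis j 1 :: real^'n)) = (\<chi> j. F j x)" for x
    using basis_expansion[of "\<chi> j. F j x"] by (simp add: scalar_mult_eq_scaleR)
  ultimately show ?thesis by simp
qed

context gibbs_potential
begin

section \<open>Weak derivatives\<close>

text \<open>Weak differentiability written with the adjoint in the Gibbs measure. The class of C^1
  functions of bounded support is stable under multiplication by the weight, which makes this form
  derivable from the Lebesgue form in \<open>weak_jacobian\<close>.\<close>

definition wpd where
  "wpd j f F \<longleftrightarrow> sq_int M f \<and> sq_int M F \<and>
    (\<forall>v. Ck 1 v \<longrightarrow> bsupp v \<longrightarrow> ip M F v = ip M f (dstar j v))" for f F :: "real^'n \<Rightarrow> real"

lemma wpd_sq_int: "wpd j f F \<Longrightarrow> sq_int M f" "wpd j f F \<Longrightarrow> sq_int M F"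
  by (auto simp: wpd_def)

lemma wpdD: "wpd j f F \<Longrightarrow> Ck 1 v \<Longrightarrow> bsupp v \<Longrightarrow> ip M F v = ip M f (dstar j v)"
  unfolding wpd_def by blast

lemma C1_sq_int: "Ck 1 v \<Longrightarrow> bsupp v \<Longrightarrow> sq_int M v"
  using Ck_imp_continuous continuous_bsupp_sq_int by blast

lemma wpd_diff: "wpd j f F \<Longrightarrow> wpd j g G \<Longrightarrow> wpd j (\<lambda>x. f x - g x) (\<lambda>x. F x - G x)"
  unfolding wpd_def by (simp add: sq_int_diff ip_diff_left C1_sq_int dstar_sq_int del: One_nat_def Ck.simps)

lemma wpd_C1: "Ck 1 f \<Longrightarrow> sq_int M f \<Longrightarrow> sq_int M (pd j f) \<Longrightarrow> wpd j f (pd j f)"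
  unfolding wpd_def using dstar_adjoint[of _ f j] ip_commute by metis

lemma wpd_test: "h \<in> test_functions \<Longrightarrow> wpd j h (pd j h)"
  by (intro wpd_C1 test_Ck test_sq_int test_pd)

lemma wpd_const: "wpd j (\<lambda>x. c) (\<lambda>x. 0)"
  using wpd_C1[of "\<lambda>x. c" j] by (simp del: One_nat_def Ck.simps add: Ck_const)

lemma wpd_LL:
  assumes f: "\<And>j. wpd j f (F j)" and h: "h \<in> test_functions"
  shows "ip M f (LL h) = (\<Sum>k\<in>UNIV. ip M (F k) (pd k h))"
proof -
  note p = test_Ck[OF test_pd[OF h]] test_bsupp[OF test_pd[OF h]]
  have "ip M f (LL h) = (\<Sum>k\<in>UNIV. ip M f (dstar k (pd k h)))"
    unfolding LL_def[abs_def] by (intro ip_sum_right wpd_sq_int(1)[OF f] dstar_sq_int p)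
  then show ?thesis using wpdD[OF f p] by simp
qed

text \<open>Differentiating \<open>w * v\<close> gives \<open>- w\<close> times
  \<open>dstar k v\<close>: this translates Lebesgue integrals against derivatives into the weighted
  adjoint.\<close>

lemma integral_pd_w:
  assumes f: "f \<in> borel_measurable borel" and v: "Ck 1 v"
  shows "(\<integral>x. f x * pd k (\<lambda>x. w x * v x) x \<partial>lborel) = - ip M f (dstar k v)"
proof -
  have w1: "Ck 1 w" by (rule Ck_w) simp
  have "pd k (\<lambda>x. w x * v x) x = - (w x * dstar k v x)" for x
    using w1 v by (simp add: pd_mult pd_w dstar_def algebra_simps)
  moreover have "dstar k v \<in> borel_measurable borel"
    using Ck_dstar[of 0 v k] v by (intro borel_measurable_continuous_onI) simp
  ultimately show ?thesis using f by (simp add: ip_def integral_gw mult_ac)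
qed

lemma integral_w:
  fixes f v :: "real^'n \<Rightarrow> real"
  assumes f: "f \<in> borel_measurable borel" and v: "v \<in> borel_measurable borel"
  shows "(\<integral>x. f x * (w x * v x) \<partial>lborel) = ip M f v"
  using assms by (simp add: ip_def integral_gw mult_ac)

lemma loc_int_zero: "locally_integrable (\<lambda>x::real^'n. 0::real)"
  by (simp add: locally_integrable_def set_integrable_def)

text \<open>The Lebesgue identity is tested with \<open>w * v\<close>. This product is only C^1,
  hence the detour through \<open>weak_eq_C1\<close>.\<close>

lemma wpd_jacobian:
  assumes J: "weak_jacobian u G" and u: "sq_int M u" and G: "sq_int M G"
  shows "wpd j (\<lambda>x. u x $ i) (\<lambda>x. G x $ i $ j)"
proof -
  have su: "sq_int M (\<lambda>x. u x $ i)" and sG: "sq_int M (\<lambda>x. G x $ i $ j)"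
    using sq_int_nth[OF u] sq_int_nth[OF sq_int_nth[OF G]] by auto
  have m: "(\<lambda>x. u x $ i) \<in> borel_measurable borel" "(\<lambda>x. G x $ i $ j) \<in> borel_measurable borel"
    using sq_int_measurable[OF su] sq_int_measurable[OF sG] by auto
  have "ip M (\<lambda>x. G x $ i $ j) v = ip M (\<lambda>x. u x $ i) (dstar j v)" if v: "Ck 1 v" "bsupp v" for v
  proof -
    have w1: "Ck 1 w" by (rule Ck_w) simp
    have "(\<integral>x. u x $ i * pd j (\<lambda>x. w x * v x) x \<partial>lborel) + (\<integral>x. 0 * pd j (\<lambda>x. w x * v x) x \<partial>lborel)
        + (\<integral>x. G x $ i $ j * (w x * v x) \<partial>lborel) = 0"
    proof (rule weak_eq_C1[OF sq_int_loc_int[OF su] loc_int_zero sq_int_loc_int[OF sG] _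
          Ck_mult[OF w1 v(1)] bsupp_mult2[OF v(2)]])
      fix \<psi> :: "real^'n \<Rightarrow> real" assume "\<psi> \<in> test_functions"
      then show "(\<integral>x. u x $ i * pd j \<psi> x \<partial>lborel) + (\<integral>x. 0 * pd j \<psi> x \<partial>lborel) + (\<integral>x. G x $ i $ j * \<psi> x \<partial>lborel) = 0"
        using J by (simp add: weak_jacobian_def)
    qed
    moreover have "v \<in> borel_measurable borel"
      using Ck_imp_continuous[OF v(1)] by (rule borel_measurable_continuous_onI)
    ultimately show ?thesis
      by (simp add: integral_pd_w[OF m(1) v(1)] integral_w[OF m(2)])
  qed
  then show ?thesis using su sG by (simp add: wpd_def)
qed

text \<open>The compatibility \<open>\<partial>\<^sub>k \<partial>\<^sub>j u = \<partial>\<^sub>j \<partial>\<^sub>k u\<close> in weak form.\<close>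

lemma weak_jacobian_compat:
  assumes J: "weak_jacobian u G" and G: "sq_int M G" and v: "Ck 1 v" "bsupp v"
  shows "ip M (\<lambda>x. G x $ i $ j) (dstar k v) = ip M (\<lambda>x. G x $ i $ k) (dstar j v)"
proof -
  have sG: "sq_int M (\<lambda>x. G x $ i $ j)" for j
    using sq_int_nth[OF sq_int_nth[OF G]] by auto
  have smG: "sq_int M (\<lambda>x. - (G x $ i $ k))"
    using sq_int_scaleR[OF sG[of k], of "-1"] by simp
  have m: "(\<lambda>x. G x $ i $ j) \<in> borel_measurable borel" for j
    using sq_int_measurable[OF sG] by auto
  have w1: "Ck 1 w" by (rule Ck_w) simp
  have "(\<integral>x. G x $ i $ j * pd k (\<lambda>x. w x * v x) x \<partial>lborel) + (\<integral>x. - (G x $ i $ k) * pd j (\<lambda>x. w x * v x) x \<partial>lborel)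
      + (\<integral>x. 0 * (w x * v x) \<partial>lborel) = 0"
  proof (rule weak_eq_C1[OF sq_int_loc_int[OF sG] sq_int_loc_int[OF smG] loc_int_zero _
        Ck_mult[OF w1 v(1)] bsupp_mult2[OF v(2)]])
    fix \<psi> :: "real^'n \<Rightarrow> real" assume \<psi>: "\<psi> \<in> test_functions"
    \<comment> \<open>Both sides are integrals of the i-th component of \<open>u\<close> against the
      same second derivative of \<psi>.\<close>
    have "pd j (pd k \<psi>) = pd k (pd j \<psi>)" using pd_symmetric[OF test_Ck[OF \<psi>]] by auto
    moreover have "(\<integral>x. u x $ i * pd j (pd k \<psi>) x \<partial>lborel) = - (\<integral>x. G x $ i $ j * pd k \<psi> x \<partial>lborel)"
      "(\<integral>x. u x $ i * pd k (pd j \<psi>) x \<partial>lborel) = - (\<integral>x. G x $ i $ k * pd j \<psi> x \<partial>lborel)"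
      using J test_pd[OF \<psi>] by (auto simp: weak_jacobian_def)
    ultimately show "(\<integral>x. G x $ i $ j * pd k \<psi> x \<partial>lborel) + (\<integral>x. - (G x $ i $ k) * pd j \<psi> x \<partial>lborel)
        + (\<integral>x. 0 * \<psi> x \<partial>lborel) = 0" by simp
  qed
  then show ?thesis by (simp add: integral_pd_w[OF m v(1)])
qed

lemma cutoff_nsq:
  "(\<lambda>n. nsq M (\<lambda>x. 1 - cutoff (real (Suc n)) x)) \<longlonglongrightarrow> 0"
  "(\<lambda>n. nsq M (pd j (cutoff (real (Suc n))))) \<longlonglongrightarrow> 0"
proof -
  have c: "cutoff (real (Suc n)) \<in> test_functions" for n by (rule cutoff_test) simp
  have [measurable]: "cutoff (real (Suc n)) \<in> borel_measurable borel" for n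
    by (intro borel_measurable_continuous_onI test_continuous c)
  have "(\<lambda>n. \<integral>x. (norm (1 - cutoff (real (Suc n)) x))\<^sup>2 \<partial>M) \<longlonglongrightarrow> (\<integral>x. 0 \<partial>M)"
  proof (rule integral_dominated_convergence)
    show "integrable M (\<lambda>x. 1::real)" by simp
    show "AE x in M. (\<lambda>n. (norm (1 - cutoff (real (Suc n)) x))\<^sup>2) \<longlonglongrightarrow> 0"
    proof (rule AE_I2)
      fix x
      have "(\<lambda>n. (norm (1 - cutoff (real (Suc n)) x))\<^sup>2) \<longlonglongrightarrow> (norm (1 - 1 :: real))\<^sup>2"
        by (intro tendsto_intros cutoff_tendsto)
      then show "(\<lambda>n. (norm (1 - cutoff (real (Suc n)) x))\<^sup>2) \<longlonglongrightarrow> 0" by simp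
    qed
    show "AE x in M. norm ((norm (1 - cutoff (real (Suc n)) x))\<^sup>2) \<le> 1" for n
    proof (rule AE_I2)
      fix x
      have "\<bar>1 - cutoff (real (Suc n)) x\<bar> \<le> 1" using cutoff_bounds[of "real (Suc n)" x] by linarith
      then show "norm ((norm (1 - cutoff (real (Suc n)) x))\<^sup>2) \<le> 1" by (simp add: abs_square_le_1)
    qed
    show "(\<lambda>x. (norm (1 - cutoff (real (Suc n)) x))\<^sup>2) \<in> borel_measurable M" for n by measurable
  qed auto
  then show "(\<lambda>n. nsq M (\<lambda>x. 1 - cutoff (real (Suc n)) x)) \<longlonglongrightarrow> 0" by (simp add: nsq_def)
  obtain K where K: "0 < K" "\<And>r i x. 0 < r \<Longrightarrow> \<bar>pd i (cutoff r) (x::real^'n)\<bar> \<le> K / r"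
    using cutoff_pd_bound by metis
  have le: "nsq M (pd j (cutoff (real (Suc n)))) \<le> (K * inverse (real (Suc n)))\<^sup>2" for n
  proof -
    have "nsq M (pd j (cutoff (real (Suc n)))) \<le> nsq M (\<lambda>x. K * inverse (real (Suc n)))"
      using K by (intro nsq_mono) (auto simp: divide_inverse)
    then show ?thesis by (simp add: nsq_def)
  qed
  have "(\<lambda>n. (K * inverse (real (Suc n)))\<^sup>2) \<longlonglongrightarrow> (K * 0)\<^sup>2"
    by (intro tendsto_intros LIMSEQ_inverse_real_of_nat)
  then have "(\<lambda>n. (K * inverse (real (Suc n)))\<^sup>2) \<longlonglongrightarrow> 0" by simp
  then show "(\<lambda>n. nsq M (pd j (cutoff (real (Suc n))))) \<longlonglongrightarrow> 0"
    by (rule tendsto_sandwich[rotated 2, OF tendsto_const]) (intro always_eventually allI le nsq_nonneg)+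
qed

lemma AE_eq_0_if_ip_test:
  fixes r :: "real^'n \<Rightarrow> real"
  assumes r: "sq_int M r" and "\<And>v. v \<in> test_functions \<Longrightarrow> ip M r v = 0"
  shows "AE x in M. r x = 0"
proof -
  have m: "r \<in> borel_measurable borel" using sq_int_measurable[OF r] by simp
  have "integrable lborel (\<lambda>x. r x * w x)" by (intro integrable_gw sq_int_imp_integrable r)
  then have "locally_integrable (\<lambda>x. r x * w x)"
    unfolding locally_integrable_def set_integrable_def
    by (auto intro!: integrable_mult_indicator[where 'b = real, simplified] borel_compact)
  then have "AE x in lborel. r x * w x = 0"
  proof (rule fundamental_lemma)
    fix v :: "real^'n \<Rightarrow> real" assume v: "v \<in> test_functions"
    have "v \<in> borel_measurable borel" using v by (intro borel_measurable_continuous_onI test_continuous)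
    then have "(\<integral>x. r x * (w x * v x) \<partial>lborel) = 0" using integral_w[OF m] assms(2)[OF v] by simp
    then show "(\<integral>x. r x * w x * v x \<partial>lborel) = 0" by (simp add: mult.assoc)
  qed
  then show ?thesis by (simp add: AE_M)
qed

end

context gibbs_poincare
begin

text \<open>Obtained by duality, with a family of one function, instead of by approximation.
  Approximation by test functions is itself deduced from this lemma below.\<close>

lemma poincare_wpd:
  assumes f: "\<And>j. wpd j f (F j)"
  shows "nsq M (\<lambda>x. f x - (\<integral>y. f y \<partial>M)) \<le> P * (\<Sum>j\<in>UNIV. nsq M (F j))"
proof -
  define m where "m = (\<integral>y. f y \<partial>M)"
  define S where "S = (\<Sum>j\<in>UNIV. nsq M (F j))"
  have sf: "sq_int M f" by (rule wpd_sq_int(1)[OF f])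
  have S0: "0 \<le> S" unfolding S_def by (intro sum_nonneg) simp
  have w0: "wpd j (\<lambda>x. f x - m) (F j)" for j using wpd_diff[OF f wpd_const] by simp
  have "(\<Sum>i\<in>{()}. nsq M (\<lambda>x. f x - m)) \<le> P * S"
  proof (rule LL_dual_bound)
    show "sq_int M (\<lambda>x. f x - m)" by (rule wpd_sq_int(1)[OF w0])
    show "(\<integral>x. f x - m \<partial>M) = 0" using sq_int_imp_integrable[OF sf] by (simp add: m_def)
    show "0 \<le> P * S" using P_nonneg S0 by simp
    fix h :: "unit \<Rightarrow> real^'n \<Rightarrow> real" assume h: "\<And>i. h i \<in> test_functions"
    define k where "k = h ()"
    have k: "k \<in> test_functions" unfolding k_def by (rule h)
    have "(ip M (\<lambda>x. f x - m) (LL k))\<^sup>2 = (\<Sum>j\<in>UNIV. ip M (F j) (pd j k))\<^sup>2"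
      by (simp add: wpd_LL[OF w0 k])
    also have "\<dots> \<le> S * (\<Sum>j\<in>UNIV. nsq M (pd j k))"
      unfolding S_def by (intro sum_ip_Cauchy_Schwarz wpd_sq_int(2)[OF f] test_sq_int test_pd k)
    also have "\<dots> \<le> S * (P * nsq M (LL k))" by (intro mult_left_mono gradient_le_LL k S0)
    finally show "(\<Sum>i\<in>{()}. ip M (\<lambda>x. f x - m) (LL (h i)))\<^sup>2 \<le> P * S * (\<Sum>i\<in>{()}. nsq M (LL (h i)))"
      by (simp add: k_def mult_ac)
  qed simp
  then show ?thesis by (simp add: m_def S_def)
qed

text \<open>The weak gradient is projected onto gradients of test functions. The residual is again
  the weak gradient of some \<open>Q\<close>, and being orthogonal to all test gradients it makes
  \<open>Q\<close> harmonic, hence constant; so the residual is 0. Gradients do not see constants,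
  which is why the uncontrolled numbers \<open>a n\<close> appear.\<close>

lemma H1_approx_mod_const:
  assumes f: "\<And>j. wpd j f (F j)"
  obtains h a where "\<And>n::nat. h n \<in> test_functions"
    "(\<lambda>n. nsq M (\<lambda>x. h n x + a n - f x)) \<longlonglongrightarrow> 0"
    "\<And>j. (\<lambda>n. nsq M (\<lambda>x. pd j (h n) x - F j x)) \<longlonglongrightarrow> 0"
proof -
  define E where "E = grad ` (test_functions :: (real^'n \<Rightarrow> real) set)"
  define Fv :: "real^'n \<Rightarrow> real^'n" where "Fv x = (\<chi> j. F j x)" for x
  have sFv: "sq_int M Fv" unfolding Fv_def by (intro sq_int_vec wpd_sq_int(2)[OF f])
  have sgrad: "sq_int M (grad h)" if "h \<in> test_functions" for h
    unfolding grad_def[abs_def] using that by (intro sq_int_vec test_sq_int test_pd)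
  obtain r k where r: "sq_int M r" and k: "\<And>n::nat. k n \<in> E"
    and lim: "(\<lambda>n. nsq M (\<lambda>x. (Fv x - k n x) - r x)) \<longlonglongrightarrow> 0" and orth: "\<And>k. k \<in> E \<Longrightarrow> ip M r k = 0"
  proof (rule sq_int_projection[of M Fv E])
    show "sq_int M Fv" by (rule sFv)
    show "sq_int M h" if "h \<in> E" for h using that sgrad by (auto simp: E_def)
    have "grad (\<lambda>x::real^'n. 0) = (\<lambda>x. 0)" by (simp add: grad_def fun_eq_iff vec_eq_iff)
    then show "(\<lambda>x. 0) \<in> E" unfolding E_def using test_zero by (metis image_eqI)
    show "(\<lambda>x. h x + k x) \<in> E" if hk: "h \<in> E" "k \<in> E" for h k
    proof -
      obtain h' k' where *: "h' \<in> test_functions" "k' \<in> test_functions" "h = grad h'" "k = grad k'"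
        using hk by (auto simp: E_def)
      then have "grad (\<lambda>x. h' x + k' x) = (\<lambda>x. h x + k x)"
        by (simp add: fun_eq_iff vec_eq_iff pd_add test_differentiable)
      then show ?thesis unfolding E_def using test_add[OF *(1,2)] by (metis image_eqI)
    qed
    show "(\<lambda>x. c *\<^sub>R h x) \<in> E" if hE: "h \<in> E" for h c
    proof -
      obtain h' where *: "h' \<in> test_functions" "h = grad h'" using hE by (auto simp: E_def)
      then have "grad (\<lambda>x. c * h' x) = (\<lambda>x. c *\<^sub>R h x)"
        by (simp add: fun_eq_iff vec_eq_iff pd_cmult test_differentiable)
      then show ?thesis unfolding E_def using test_cmult[OF *(1)] by (metis image_eqI)
    qed
    fix r k assume "sq_int M r" "\<And>n::nat. k n \<in> E"
      "(\<lambda>n. nsq M (\<lambda>x. (Fv x - k n x) - r x)) \<longlonglongrightarrow> 0" "\<And>k. k \<in> E \<Longrightarrow> ip M r k = 0"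
    then show thesis by (rule that)
  qed
  have "\<forall>n. \<exists>h. h \<in> test_functions \<and> k n = grad h"
    using k by (auto simp: E_def)
  from choice[OF this] obtain h where "\<forall>n. h n \<in> test_functions \<and> k n = grad (h n)" ..
  then have h: "\<And>n. h n \<in> test_functions" "\<And>n. k n = grad (h n)" by auto
  define R where "R j n x = F j x - pd j (h n) x" for j n x
  have sR: "sq_int M (R j n)" for j n
    unfolding R_def by (intro sq_int_diff wpd_sq_int(2)[OF f] test_sq_int test_pd h)
  have srj: "sq_int M (\<lambda>x. r x $ j)" for j by (rule sq_int_nth[OF r])
  have limR: "(\<lambda>n. nsq M (\<lambda>x. R j n x - r x $ j)) \<longlonglongrightarrow> 0" for j
  proof (rule tendsto_sandwich[OF _ _ tendsto_const lim])
    show "\<forall>\<^sub>F n in sequentially. nsq M (\<lambda>x. R j n x - r x $ j) \<le> nsq M (\<lambda>x. (Fv x - k n x) - r x)"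
    proof (intro always_eventually allI)
      fix n
      have s: "sq_int M (\<lambda>x. (Fv x - k n x) - r x)"
        using sgrad[OF h(1)] by (intro sq_int_diff sFv r) (simp add: h)
      have "nsq M (\<lambda>x. ((Fv x - k n x) - r x) $ j) \<le> nsq M (\<lambda>x. (Fv x - k n x) - r x)"
        by (intro nsq_mono[OF s] Finite_Cartesian_Product.norm_nth_le)
      then show "nsq M (\<lambda>x. R j n x - r x $ j) \<le> nsq M (\<lambda>x. (Fv x - k n x) - r x)"
        by (simp add: R_def Fv_def h)
    qed
  qed (intro always_eventually allI nsq_nonneg)
  define d where "d n x = f x - h n x" for n x
  \<comment> \<open>Centring is what the Poincare inequality asks for: the gradients
    \<open>R j n\<close> converge, so the centred remainders form a Cauchy sequence although the
    remainders themselves may drift by constants.\<close>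
  define q where "q n x = d n x - (\<integral>y. d n y \<partial>M)" for n x
  have wd: "wpd j (d n) (R j n)" for j n
    unfolding d_def R_def by (intro wpd_diff f wpd_test h)
  have wq: "wpd j (q n) (R j n)" for j n
    unfolding q_def using wpd_diff[OF wd wpd_const] by simp
  have sq: "sq_int M (q n)" for n by (rule wpd_sq_int(1)[OF wq])
  have di: "integrable M (d n)" for n by (intro sq_int_imp_integrable wpd_sq_int(1)[OF wd])
  have q0: "(\<integral>x. q n x \<partial>M) = 0" for n unfolding q_def using di by simp
  have diffle: "nsq M (\<lambda>x. q m x - q n x) \<le> P * (\<Sum>j\<in>UNIV. nsq M (\<lambda>x. R j m x - R j n x))" for m n
    using poincare_wpd[of "\<lambda>x. q m x - q n x" "\<lambda>j x. R j m x - R j n x"] wpd_diff[OF wq wq]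
      sq_int_imp_integrable[OF sq] by (simp add: q0)
  have "\<exists>N. \<forall>m\<ge>N. \<forall>n\<ge>N. nsq M (\<lambda>x. q m x - q n x) \<le> e" if e: "e > 0" for e
  proof -
    define s where "s n = (\<Sum>j\<in>UNIV. nsq M (\<lambda>x. R j n x - r x $ j))" for n
    have "s \<longlonglongrightarrow> (\<Sum>j\<in>(UNIV::'n set). 0)" unfolding s_def by (intro tendsto_sum limR)
    then have "s \<longlonglongrightarrow> 0" by simp
    then have "(\<lambda>n. P * (4 * s n)) \<longlonglongrightarrow> P * (4 * 0)" by (intro tendsto_intros)
    then have "\<forall>\<^sub>F n in sequentially. P * (4 * s n) < e" using e by (intro order_tendstoD(2)) auto
    then obtain N where N: "\<And>n. n \<ge> N \<Longrightarrow> P * (4 * s n) < e" by (auto simp: eventually_sequentially)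
    have "nsq M (\<lambda>x. q m x - q n x) \<le> e" if "m \<ge> N" "n \<ge> N" for m n
    proof -
      have "nsq M (\<lambda>x. R j m x - R j n x) \<le> 2 * nsq M (\<lambda>x. R j m x - r x $ j) + 2 * nsq M (\<lambda>x. R j n x - r x $ j)" for j
      proof -
        have "nsq M (\<lambda>x. (R j m x - r x $ j) + (r x $ j - R j n x))
            \<le> 2 * nsq M (\<lambda>x. R j m x - r x $ j) + 2 * nsq M (\<lambda>x. r x $ j - R j n x)"
          by (intro nsq_add_le sq_int_diff sR srj)
        then show ?thesis using nsq_minus_commute[of M "R j n" "\<lambda>x. r x $ j"] by simp
      qed
      then have "(\<Sum>j\<in>UNIV. nsq M (\<lambda>x. R j m x - R j n x)) \<le> 2 * s m + 2 * s n"
        unfolding s_def sum_distrib_left sum.distrib[symmetric] by (intro sum_mono)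
      then have "P * (\<Sum>j\<in>UNIV. nsq M (\<lambda>x. R j m x - R j n x)) \<le> P * (2 * s m + 2 * s n)"
        by (intro mult_left_mono P_nonneg)
      then show ?thesis using diffle[of m n] N[OF that(1)] N[OF that(2)] by (simp add: algebra_simps)
    qed
    then show ?thesis by blast
  qed
  then obtain Q where Q: "sq_int M Q" and limQ: "(\<lambda>n. nsq M (\<lambda>x. q n x - Q x)) \<longlonglongrightarrow> 0"
    using sq_int_complete[of M q] sq by blast
  have weakQ: "ip M (\<lambda>x. r x $ j) v = ip M Q (dstar j v)" if v: "Ck 1 v" "bsupp v" for j v
  proof (rule LIMSEQ_unique)
    show "(\<lambda>n. ip M (R j n) v) \<longlonglongrightarrow> ip M (\<lambda>x. r x $ j) v"
      by (intro nsq_tendsto_ip sR srj C1_sq_int v limR)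
    have "(\<lambda>n. ip M (q n) (dstar j v)) \<longlonglongrightarrow> ip M Q (dstar j v)"
      by (intro nsq_tendsto_ip sq Q dstar_sq_int v limQ)
    then show "(\<lambda>n. ip M (R j n) v) \<longlonglongrightarrow> ip M Q (dstar j v)"
      by (simp add: wpdD[OF wq v])
  qed
  have wQ: "wpd j Q (\<lambda>x. r x $ j)" for j
    unfolding wpd_def using Q srj weakQ by blast
  have "ip M Q (LL g) = 0" if g: "g \<in> test_functions" for g
  proof -
    have "ip M Q (LL g) = ip M r (grad g)"
      by (simp add: wpd_LL[OF wQ g] ip_vec[OF r sgrad[OF g]])
    then show ?thesis using orth[of "grad g"] g by (simp add: E_def)
  qed
  then obtain c where c: "AE x in M. Q x = c" using harmonic_imp_const[OF Q] by blast
  have "(\<lambda>n. ip M (q n) (\<lambda>x. 1)) \<longlonglongrightarrow> ip M Q (\<lambda>x. 1)"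
    by (intro nsq_tendsto_ip sq Q sq_int_const limQ)
  then have "(\<integral>x. Q x \<partial>M) = 0" by (simp add: ip_one q0 LIMSEQ_const_iff)
  moreover have "(\<integral>x. Q x \<partial>M) = (\<integral>x. c \<partial>M)"
    using c sq_int_measurable[OF Q] by (intro integral_cong_AE) auto
  ultimately have c0: "c = 0" by simp
  have r0: "AE x in M. r x $ j = 0" for j
  proof (rule AE_eq_0_if_ip_test[OF srj])
    fix v :: "real^'n \<Rightarrow> real" assume v: "v \<in> test_functions"
    have "ip M (\<lambda>x. r x $ j) v = ip M Q (dstar j v)" by (intro weakQ test_Ck test_bsupp v)
    also have "\<dots> = (\<integral>x. 0 \<partial>M)"
      unfolding ip_def using c sq_int_measurable[OF Q]
        sq_int_measurable[OF dstar_sq_int[OF test_Ck[OF v] test_bsupp[OF v]]]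
      by (intro integral_cong_AE) (auto simp: c0 elim!: eventually_mono)
    finally show "ip M (\<lambda>x. r x $ j) v = 0" by simp
  qed
  show thesis
  proof (rule that[of h "\<lambda>n. (\<integral>y. d n y \<partial>M)"])
    show "h n \<in> test_functions" for n by (rule h)
    have "nsq M (\<lambda>x. h n x + (\<integral>y. d n y \<partial>M) - f x) = nsq M (\<lambda>x. q n x - Q x)" for n
    proof (rule nsq_cong_AE)
      show "AE x in M. norm (h n x + (\<integral>y. d n y \<partial>M) - f x) = norm (q n x - Q x)"
        using c by eventually_elim (simp add: q_def c0 d_def)
      show "(\<lambda>x. q n x - Q x) \<in> borel_measurable M"
        by (intro sq_int_measurable sq_int_diff sq Q)
      show "(\<lambda>x. h n x + (\<integral>y. d n y \<partial>M) - f x) \<in> borel_measurable M"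
        by (intro sq_int_measurable sq_int_diff sq_int_add test_sq_int h sq_int_const wpd_sq_int(1)[OF f])
    qed
    then show "(\<lambda>n. nsq M (\<lambda>x. h n x + (\<integral>y. d n y \<partial>M) - f x)) \<longlonglongrightarrow> 0" using limQ by simp
    fix j
    have "nsq M (\<lambda>x. pd j (h n) x - F j x) = nsq M (\<lambda>x. R j n x - r x $ j)" for n
    proof (rule nsq_cong_AE)
      show "AE x in M. norm (pd j (h n) x - F j x) = norm (R j n x - r x $ j)"
        using r0[of j] by eventually_elim (simp add: R_def)
      show "(\<lambda>x. R j n x - r x $ j) \<in> borel_measurable M"
        by (intro sq_int_measurable sq_int_diff sR srj)
      show "(\<lambda>x. pd j (h n) x - F j x) \<in> borel_measurable M"
        by (intro sq_int_measurable sq_int_diff test_sq_int test_pd h wpd_sq_int(2)[OF f])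
    qed
    then show "(\<lambda>n. nsq M (\<lambda>x. pd j (h n) x - F j x)) \<longlonglongrightarrow> 0" using limR by simp
  qed
qed

text \<open>The constants left over in \<open>H1_approx_mod_const\<close> are replaced by multiples
  of cutoffs. These are close to 1 with small gradient in the norm, because the measure is
  finite.\<close>

lemma H1_approx:
  assumes f: "\<And>j. wpd j f (F j)"
  obtains h where "\<And>n::nat. h n \<in> test_functions"
    "(\<lambda>n. nsq M (\<lambda>x. h n x - f x)) \<longlonglongrightarrow> 0"
    "\<And>j. (\<lambda>n. nsq M (\<lambda>x. pd j (h n) x - F j x)) \<longlonglongrightarrow> 0"
proof -
  obtain g a where g: "\<And>n::nat. g n \<in> test_functions"
    and lim: "(\<lambda>n. nsq M (\<lambda>x. g n x + a n - f x)) \<longlonglongrightarrow> 0"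
    and limj: "\<And>j. (\<lambda>n. nsq M (\<lambda>x. pd j (g n) x - F j x)) \<longlonglongrightarrow> 0"
    by (rule H1_approx_mod_const[OF f]) blast
  define c where "c n = (cutoff (real (Suc n)) :: real^'n \<Rightarrow> real)" for n
  have c: "c n \<in> test_functions" for n unfolding c_def by (rule cutoff_test) simp
  define t where "t n = nsq M (\<lambda>x. 1 - c n x) + (\<Sum>j\<in>UNIV. nsq M (pd j (c n)))" for n
  have "t \<longlonglongrightarrow> 0 + (\<Sum>j\<in>(UNIV::'n set). 0)"
    unfolding t_def c_def by (intro tendsto_add tendsto_sum cutoff_nsq)
  then have t: "t \<longlonglongrightarrow> 0" by simp
  have tb: "0 \<le> t n" "nsq M (\<lambda>x. 1 - c n x) \<le> t n" "nsq M (pd j (c n)) \<le> t n" for n j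
  proof -
    have "nsq M (pd j (c n)) \<le> (\<Sum>j\<in>UNIV. nsq M (pd j (c n)))" by (rule member_le_sum) auto
    moreover have "0 \<le> (\<Sum>j\<in>UNIV. nsq M (pd j (c n)))" by (intro sum_nonneg) simp
    moreover have "0 \<le> nsq M (\<lambda>x. 1 - c n x)" by simp
    ultimately show "0 \<le> t n" "nsq M (\<lambda>x. 1 - c n x) \<le> t n" "nsq M (pd j (c n)) \<le> t n"
      unfolding t_def by linarith+
  qed
  \<comment> \<open>The radius may depend on \<open>n\<close>: however large \<open>a n\<close> is,
    a late enough cutoff makes the error small.\<close>
  have "\<forall>n. \<exists>m. (a n)\<^sup>2 * t m \<le> inverse (real (Suc n))"
  proof
    fix n
    have "(\<lambda>m. (a n)\<^sup>2 * t m) \<longlonglongrightarrow> (a n)\<^sup>2 * 0" by (intro tendsto_intros t)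
    then have "\<forall>\<^sub>F m in sequentially. (a n)\<^sup>2 * t m < inverse (real (Suc n))"
      by (rule order_tendstoD) simp
    then show "\<exists>m. (a n)\<^sup>2 * t m \<le> inverse (real (Suc n))"
      by (meson eventually_sequentially less_imp_le order_refl)
  qed
  from choice[OF this] obtain m where m: "\<And>n. (a n)\<^sup>2 * t (m n) \<le> inverse (real (Suc n))" by blast
  define h where "h n x = g n x + a n * c (m n) x" for n x
  have h: "h n \<in> test_functions" for n unfolding h_def by (intro test_add test_cmult g c)
  have lim2: "(\<lambda>n. 2 * s n + 2 * inverse (real (Suc n))) \<longlonglongrightarrow> 0" if "s \<longlonglongrightarrow> 0" for s
  proof -
    have "(\<lambda>n. 2 * s n + 2 * inverse (real (Suc n))) \<longlonglongrightarrow> 2 * 0 + 2 * 0"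
      by (intro tendsto_intros that LIMSEQ_inverse_real_of_nat)
    then show ?thesis by simp
  qed
  have sf: "sq_int M f" "sq_int M (F j)" for j using wpd_sq_int[OF f] by auto
  show thesis
  proof (rule that[of h])
    show "h n \<in> test_functions" for n by (rule h)
    show "(\<lambda>n. nsq M (\<lambda>x. h n x - f x)) \<longlonglongrightarrow> 0"
    proof (rule tendsto_sandwich[OF _ _ tendsto_const lim2[OF lim]])
      show "\<forall>\<^sub>F n in sequentially. nsq M (\<lambda>x. h n x - f x)
          \<le> 2 * nsq M (\<lambda>x. g n x + a n - f x) + 2 * inverse (real (Suc n))"
      proof (intro always_eventually allI)
        fix n
        have "nsq M (\<lambda>x. (g n x + a n - f x) + (- a n) *\<^sub>R (1 - c (m n) x))
            \<le> 2 * nsq M (\<lambda>x. g n x + a n - f x) + 2 * nsq M (\<lambda>x. (- a n) *\<^sub>R (1 - c (m n) x))"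
          by (intro nsq_add_le sq_int_diff sq_int_add sq_int_scaleR test_sq_int g c sf sq_int_const)
        moreover have "nsq M (\<lambda>x. (- a n) *\<^sub>R (1 - c (m n) x)) \<le> inverse (real (Suc n))"
          unfolding nsq_scaleR using mult_left_mono[OF tb(2)[of "m n"], of "(a n)\<^sup>2"] m[of n] by simp
        ultimately show "nsq M (\<lambda>x. h n x - f x) \<le> 2 * nsq M (\<lambda>x. g n x + a n - f x) + 2 * inverse (real (Suc n))"
          by (simp add: h_def algebra_simps)
      qed
    qed (intro always_eventually allI nsq_nonneg)
    show "(\<lambda>n. nsq M (\<lambda>x. pd j (h n) x - F j x)) \<longlonglongrightarrow> 0" for j
    proof (rule tendsto_sandwich[OF _ _ tendsto_const lim2[OF limj]])
      show "\<forall>\<^sub>F n in sequentially. nsq M (\<lambda>x. pd j (h n) x - F j x)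
          \<le> 2 * nsq M (\<lambda>x. pd j (g n) x - F j x) + 2 * inverse (real (Suc n))"
      proof (intro always_eventually allI)
        fix n
        have "pd j (h n) x = pd j (g n) x + a n * pd j (c (m n)) x" for x
          unfolding h_def using test_differentiable[OF g] test_differentiable[OF c] test_differentiable[OF test_cmult[OF c]]
          by (simp add: pd_add pd_cmult)
        moreover have "nsq M (\<lambda>x. (pd j (g n) x - F j x) + a n *\<^sub>R pd j (c (m n)) x)
            \<le> 2 * nsq M (\<lambda>x. pd j (g n) x - F j x) + 2 * nsq M (\<lambda>x. a n *\<^sub>R pd j (c (m n)) x)"
          by (intro nsq_add_le sq_int_diff sq_int_scaleR test_sq_int test_pd g c sf)
        moreover have "nsq M (\<lambda>x. a n *\<^sub>R pd j (c (m n)) x) \<le> inverse (real (Suc n))"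
          unfolding nsq_scaleR using mult_left_mono[OF tb(3)[of j "m n"], of "(a n)\<^sup>2"] m[of n] by simp
        ultimately show "nsq M (\<lambda>x. pd j (h n) x - F j x) \<le> 2 * nsq M (\<lambda>x. pd j (g n) x - F j x) + 2 * inverse (real (Suc n))"
          by (simp add: algebra_simps)
      qed
    qed (intro always_eventually allI nsq_nonneg)
  qed
qed

lemma sq_int_nn_integral_le:
  fixes f :: "real^'n \<Rightarrow> real"
  assumes f: "f \<in> borel_measurable borel" and b: "(\<integral>\<^sup>+x. ennreal ((f x)\<^sup>2) \<partial>M) \<le> ennreal B" "0 \<le> B"
  shows "sq_int M f" "nsq M f \<le> B"
proof -
  have "integrable M (\<lambda>x. (f x)\<^sup>2)"
    using b f by (intro integrableI_nonneg) (auto intro: le_less_trans)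
  then show *: "sq_int M f" using f by (simp add: sq_int_real_iff)
  then have "(\<integral>\<^sup>+x. ennreal ((f x)\<^sup>2) \<partial>M) = ennreal (nsq M f)"
    by (subst nn_integral_eq_integral) (auto simp: nsq_def sq_int_real_iff)
  then show "nsq M f \<le> B" using b by simp
qed

text \<open>The weight is unbounded, so convergence of the approximants in norm says nothing about
  the weighted norms. The weight is therefore cut at height \<open>N\<close>, the approximation is
  carried out for fixed \<open>N\<close>, and Fatou's lemma removes the cut.\<close>

lemma grad_weight_wpd:
  assumes growth: "growth_constants \<phi> C C'" and f: "\<And>j. wpd j f (F j)"
  shows "sq_int M (\<lambda>x. norm (grad \<phi> x) * f x)"
    and "nsq M (\<lambda>x. norm (grad \<phi> x) * f x) \<le> 8 * (\<Sum>k\<in>UNIV. nsq M (F k)) + (C - 1) / 2 * nsq M f"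
proof -
  define B where "B = 8 * (\<Sum>k\<in>UNIV. nsq M (F k)) + (C - 1) / 2 * nsq M f"
  have C: "8 < C" using growth by (simp add: growth_constants_def)
  have B: "0 \<le> B" unfolding B_def using C by (intro add_nonneg_nonneg mult_nonneg_nonneg sum_nonneg) auto
  have sf: "sq_int M f" "sq_int M (F j)" for j using wpd_sq_int[OF f] by auto
  have [measurable]: "f \<in> borel_measurable borel" using sq_int_measurable[OF sf(1)] by simp
  obtain h where h: "\<And>n::nat. h n \<in> test_functions"
    and lim: "(\<lambda>n. nsq M (\<lambda>x. h n x - f x)) \<longlonglongrightarrow> 0"
    and limj: "\<And>j. (\<lambda>n. nsq M (\<lambda>x. pd j (h n) x - F j x)) \<longlonglongrightarrow> 0"
    by (rule H1_approx[OF f]) blast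
  have hm [measurable]: "h n \<in> borel_measurable borel" for n
    by (intro borel_measurable_continuous_onI test_continuous h)
  define b where "b N x = min (norm (grad \<phi> x)) (real N)" for N x
  have b: "0 \<le> b N x" "b N x \<le> real N" "b N x \<le> norm (grad \<phi> x)" for N x by (auto simp: b_def)
  have bm [measurable]: "b N \<in> borel_measurable borel" for N unfolding b_def by measurable
  have sb: "sq_int M (\<lambda>x. b N x * g x)" if "sq_int M g" for N and g :: "real^'n \<Rightarrow> real"
    using b that sq_int_measurable[OF that]
    by (intro sq_int_bound[OF that, of _ "real N"]) (auto simp: abs_mult intro!: mult_right_mono)
  have le: "nsq M (\<lambda>x. b N x * f x) \<le> B" for N
  proof (rule LIMSEQ_le)
    show "(\<lambda>n. nsq M (\<lambda>x. b N x * h n x)) \<longlonglongrightarrow> nsq M (\<lambda>x. b N x * f x)"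
    proof (intro nsq_tendsto_nsq sb sf test_sq_int h)
      show "(\<lambda>n. nsq M (\<lambda>x. b N x * h n x - b N x * f x)) \<longlonglongrightarrow> 0"
      proof (rule tendsto_sandwich[OF _ _ tendsto_const])
        show "\<forall>\<^sub>F n in sequentially. nsq M (\<lambda>x. b N x * h n x - b N x * f x) \<le> (real N)\<^sup>2 * nsq M (\<lambda>x. h n x - f x)"
        proof (intro always_eventually allI)
          fix n
          have "nsq M (\<lambda>x. b N x * (h n x - f x)) \<le> nsq M (\<lambda>x. real N *\<^sub>R (h n x - f x))"
            using b by (intro nsq_mono sq_int_scaleR sq_int_diff test_sq_int h sf)
              (auto simp: abs_mult intro!: mult_right_mono)
          then show "nsq M (\<lambda>x. b N x * h n x - b N x * f x) \<le> (real N)\<^sup>2 * nsq M (\<lambda>x. h n x - f x)"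
            by (simp only: nsq_scaleR right_diff_distrib)
        qed
        have "(\<lambda>n. (real N)\<^sup>2 * nsq M (\<lambda>x. h n x - f x)) \<longlonglongrightarrow> (real N)\<^sup>2 * 0" by (intro tendsto_intros lim)
        then show "(\<lambda>n. (real N)\<^sup>2 * nsq M (\<lambda>x. h n x - f x)) \<longlonglongrightarrow> 0" by simp
      qed (intro always_eventually allI nsq_nonneg)
    qed
    show "(\<lambda>n. 8 * (\<Sum>k\<in>UNIV. nsq M (pd k (h n))) + (C - 1) / 2 * nsq M (h n)) \<longlonglongrightarrow> B"
      unfolding B_def
      by (intro tendsto_intros nsq_tendsto_nsq[OF test_sq_int[OF h] sf(1) lim]
          nsq_tendsto_nsq[OF test_sq_int[OF test_pd[OF h]] sf(2) limj])
    have "nsq M (\<lambda>x. b N x * h n x) \<le> 8 * (\<Sum>k\<in>UNIV. nsq M (pd k (h n))) + (C - 1) / 2 * nsq M (h n)" for n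
    proof -
      have s: "sq_int M (\<lambda>x. norm (grad \<phi> x) * h n x)"
        by (intro continuous_bsupp_sq_int continuous_intros grad_continuous test_continuous h bsupp_mult2 test_bsupp)
      have "nsq M (\<lambda>x. b N x * h n x) \<le> nsq M (\<lambda>x. norm (grad \<phi> x) * h n x)"
        using b by (intro nsq_mono[OF s]) (auto simp: abs_mult intro!: mult_right_mono)
      also have "\<dots> \<le> 8 * (\<Sum>k\<in>UNIV. nsq M (pd k (h n))) + (C - 1) / 2 * nsq M (h n)"
        using grad_weight[OF growth h[of n]] by (simp add: nsq_def power_mult_distrib)
      finally show ?thesis .
    qed
    then show "\<exists>N'. \<forall>n\<ge>N'. nsq M (\<lambda>x. b N x * h n x) \<le> 8 * (\<Sum>k\<in>UNIV. nsq M (pd k (h n))) + (C - 1) / 2 * nsq M (h n)"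
      by blast
  qed
  have "(\<integral>\<^sup>+x. ennreal ((norm (grad \<phi> x) * f x)\<^sup>2) \<partial>M) \<le> ennreal B"
  proof -
    have "(\<integral>\<^sup>+x. ennreal ((norm (grad \<phi> x) * f x)\<^sup>2) \<partial>M)
        = (\<integral>\<^sup>+x. liminf (\<lambda>N. ennreal ((b N x * f x)\<^sup>2)) \<partial>M)"
    proof (intro nn_integral_cong)
      fix x
      obtain N0 where N0: "norm (grad \<phi> x) \<le> real N0" using real_arch_simple by blast
      have "b N x = norm (grad \<phi> x)" if "N \<ge> N0" for N
      proof -
        have "norm (grad \<phi> x) \<le> real N" using N0 that by linarith
        then show ?thesis by (simp add: b_def)
      qed
      then have "\<forall>\<^sub>F N in sequentially. ennreal ((b N x * f x)\<^sup>2) = ennreal ((norm (grad \<phi> x) * f x)\<^sup>2)"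
        unfolding eventually_sequentially by (intro exI[of _ N0]) simp
      then have "(\<lambda>N. ennreal ((b N x * f x)\<^sup>2)) \<longlonglongrightarrow> ennreal ((norm (grad \<phi> x) * f x)\<^sup>2)"
        by (rule tendsto_eventually)
      then show "ennreal ((norm (grad \<phi> x) * f x)\<^sup>2) = liminf (\<lambda>N. ennreal ((b N x * f x)\<^sup>2))"
        by (metis lim_imp_Liminf sequentially_bot)
    qed
    also have "\<dots> \<le> liminf (\<lambda>N. \<integral>\<^sup>+x. ennreal ((b N x * f x)\<^sup>2) \<partial>M)"
      by (rule nn_integral_liminf) measurable
    also have "\<dots> = liminf (\<lambda>N. ennreal (nsq M (\<lambda>x. b N x * f x)))"
      using sq_int_integrable[OF sb[OF sf(1)]] by (simp add: nn_integral_eq_integral nsq_def)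
    also have "\<dots> \<le> limsup (\<lambda>N. ennreal (nsq M (\<lambda>x. b N x * f x)))"
      by (intro Liminf_le_Limsup) simp
    also have "\<dots> \<le> ennreal B"
      by (rule Limsup_bounded) (auto intro!: always_eventually ennreal_leI le)
    finally show ?thesis .
  qed
  from sq_int_nn_integral_le[OF _ this B]
  show "sq_int M (\<lambda>x. norm (grad \<phi> x) * f x)"
    "nsq M (\<lambda>x. norm (grad \<phi> x) * f x) \<le> 8 * (\<Sum>k\<in>UNIV. nsq M (F k)) + (C - 1) / 2 * nsq M f"
    by (auto simp: B_def)
qed

end

section \<open>Symmetric and skew matrices\<close>

definition skew_part :: "real^'n^'n::finite \<Rightarrow> real^'n^'n" where
  "skew_part A = (1/2) *\<^sub>R (A - transpose A)"

definition sym_part :: "real^'n^'n::finite \<Rightarrow> real^'n^'n" where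
  "sym_part A = (1/2) *\<^sub>R (A + transpose A)"

lemma skew_part_nth: "skew_part A $ i $ j = (A $ i $ j - A $ j $ i) / 2"
  by (simp add: skew_part_def transpose_def)

lemma sym_part_nth: "sym_part A $ i $ j = (A $ i $ j + A $ j $ i) / 2"
  by (simp add: sym_part_def transpose_def)

lemma skew_iff: "A \<in> skew \<longleftrightarrow> (\<forall>i j. A $ j $ i = - A $ i $ j)"
  by (auto simp: skew_def transpose_def vec_eq_iff)

lemma skewI: "(\<And>i j. A $ j $ i = - A $ i $ j) \<Longrightarrow> A \<in> skew"
  unfolding skew_iff by blast

lemma skewD: "A \<in> skew \<Longrightarrow> A $ j $ i = - A $ i $ j"
  unfolding skew_iff by blast

lemma skew_part_skew: "skew_part A \<in> skew"
  by (rule skewI) (simp add: skew_part_nth field_simps)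

lemma sym_skew_orthogonal:
  assumes "B \<in> skew" shows "sym_part A \<bullet> B = 0"
proof -
  have "sym_part A \<bullet> B = (\<Sum>i\<in>UNIV. \<Sum>j\<in>UNIV. sym_part A $ i $ j * B $ i $ j)"
    by (simp add: inner_vec_def)
  also have "\<dots> = (\<Sum>i\<in>UNIV. \<Sum>j\<in>UNIV. sym_part A $ j $ i * B $ j $ i)" by (rule sum.swap)
  also have "\<dots> = (\<Sum>i\<in>UNIV. \<Sum>j\<in>UNIV. - (sym_part A $ i $ j * B $ i $ j))"
  proof (intro sum.cong refl)
    fix i j
    have "B $ j $ i = - B $ i $ j" by (rule skewD[OF assms])
    moreover have "sym_part A $ j $ i = sym_part A $ i $ j" by (simp add: sym_part_nth add.commute)
    ultimately show "sym_part A $ j $ i * B $ j $ i = - (sym_part A $ i $ j * B $ i $ j)"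
      by (simp only: mult_minus_right)
  qed
  also have "\<dots> = - (\<Sum>i\<in>UNIV. \<Sum>j\<in>UNIV. sym_part A $ i $ j * B $ i $ j)" by (simp add: sum_negf)
  also have "(\<Sum>i\<in>UNIV. \<Sum>j\<in>UNIV. sym_part A $ i $ j * B $ i $ j) = sym_part A \<bullet> B"
    by (simp add: inner_vec_def)
  finally show ?thesis by simp
qed

lemma sym_plus_skew: "sym_part A + skew_part A = A"
  by (simp add: vec_eq_iff sym_part_nth skew_part_nth field_simps)

lemma skew_add: "A \<in> skew \<Longrightarrow> B \<in> skew \<Longrightarrow> A + B \<in> skew"
proof (rule skewI)
  fix i j assume "A \<in> skew" "B \<in> skew"
  from this[THEN skewD, of j i] show "(A + B) $ j $ i = - (A + B) $ i $ j" by simp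
qed

lemma skew_diff: "A \<in> skew \<Longrightarrow> B \<in> skew \<Longrightarrow> A - B \<in> skew"
proof (rule skewI)
  fix i j assume "A \<in> skew" "B \<in> skew"
  from this[THEN skewD, of j i] show "(A - B) $ j $ i = - (A - B) $ i $ j" by simp
qed

lemma skew_scaleR: "A \<in> skew \<Longrightarrow> c *\<^sub>R A \<in> skew"
proof (rule skewI)
  fix i j assume "A \<in> skew"
  from skewD[OF this, of j i] show "(c *\<^sub>R A) $ j $ i = - (c *\<^sub>R A) $ i $ j" by simp
qed

lemma skew_zero: "0 \<in> skew"
  by (rule skewI) simp

lemma rotations_iff: "R \<in> rotations \<longleftrightarrow> (\<exists>A\<in>skew. R = (\<lambda>x. A *v x))"
  by (auto simp: rotations_def)

lemma matrix_vector_nth: "(A *v x) $ i = A $ i \<bullet> x" for A :: "real^'n^'m::finite"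
  by (simp add: matrix_vector_mult_def inner_vec_def)

lemma locally_integrable_nth:
  fixes f :: "real^'n::finite \<Rightarrow> 'b::euclidean_space ^ 'm::finite"
  assumes "locally_integrable f"
  shows "locally_integrable (\<lambda>x. f x $ i)"
  unfolding locally_integrable_def set_integrable_def
proof (intro allI impI)
  fix K :: "(real^'n) set" assume "compact K"
  then have "integrable lborel (\<lambda>x. indicat_real K x *\<^sub>R f x)"
    using assms by (simp add: locally_integrable_def set_integrable_def)
  from integrable_bounded_linear[OF bounded_linear_vec_nth[of i] this]
  show "integrable lborel (\<lambda>x. indicat_real K x *\<^sub>R f x $ i)" by simp
qed

lemma locally_integrable_diff:
  assumes "locally_integrable f" "locally_integrable g"
  shows "locally_integrable (\<lambda>x. f x - g x)"
  using assms unfolding locally_integrable_def by (auto intro: set_integral_diff)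

text \<open>The fundamental lemma applied to each entry of the difference; finitely many exceptional
  null sets are united.\<close>

lemma weak_jacobian_unique:
  fixes u :: "real^'n::finite \<Rightarrow> real^'n"
  assumes G: "weak_jacobian u G" and H: "weak_jacobian u H"
  shows "AE x in lborel. G x = H x"
proof -
  have "AE x in lborel. G x $ i $ j - H x $ i $ j = 0" for i j
  proof (rule fundamental_lemma)
    have l: "locally_integrable (\<lambda>x. G x $ i $ j)" "locally_integrable (\<lambda>x. H x $ i $ j)"
      using G H by (auto simp: weak_jacobian_def intro!: locally_integrable_nth)
    then show "locally_integrable (\<lambda>x. G x $ i $ j - H x $ i $ j)" by (rule locally_integrable_diff)
    fix \<psi> :: "real^'n \<Rightarrow> real" assume \<psi>: "\<psi> \<in> test_functions"
    then have b: "bsupp \<psi>" by (simp add: test_functions_iff)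
    have "(\<integral>x. G x $ i $ j * \<psi> x \<partial>lborel) = (\<integral>x. H x $ i $ j * \<psi> x \<partial>lborel)"
      using G H \<psi> by (simp add: weak_jacobian_def)
    then show "(\<integral>x. (G x $ i $ j - H x $ i $ j) * \<psi> x \<partial>lborel) = 0"
      using loc_int_mult_continuous[OF l(1) test_continuous[OF \<psi>] b]
        loc_int_mult_continuous[OF l(2) test_continuous[OF \<psi>] b]
      by (simp add: left_diff_distrib)
  qed
  then have "AE x in lborel. \<forall>i\<in>UNIV. \<forall>j\<in>UNIV. G x $ i $ j - H x $ i $ j = 0"
    by (intro AE_finite_allI finite)
  then show ?thesis by eventually_elim (simp add: vec_eq_iff)
qed

section \<open>Weak Jacobians in H^1 and orthogonal projections\<close>

context gibbs_potential
begin

lemma L2sq_eq: "sq_int M f \<Longrightarrow> L2sq \<phi> f = ennreal (nsq M f)"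
  unfolding L2sq_def nsq_def by (rule nn_integral_eq_integral) (auto simp: sq_int_def)

lemma L2_iff: "f \<in> L2 \<phi> \<longleftrightarrow> sq_int M f"
proof
  assume "f \<in> L2 \<phi>"
  then have "f \<in> borel_measurable borel" "(\<integral>\<^sup>+x. ennreal ((norm (f x))\<^sup>2) \<partial>M) < \<infinity>"
    by (auto simp: L2_def L2sq_def)
  then show "sq_int M f" unfolding sq_int_def by (auto intro!: integrableI_nonneg)
next
  assume f: "sq_int M f"
  then show "f \<in> L2 \<phi>" using L2sq_eq[OF f] sq_int_measurable[OF f] by (simp add: L2_def)
qed

text \<open>\<open>weak_D\<close> picks an arbitrary weak Jacobian, not necessarily the square
  integrable one that membership in \<open>H1\<close> provides. By uniqueness they agree almost
  everywhere, so the chosen one is square integrable too.\<close>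

lemma H1_weak_D:
  assumes "u \<in> H1 \<phi>"
  shows "sq_int M u" "weak_jacobian u (weak_D u)" "sq_int M (weak_D u)"
proof -
  obtain G where u: "u \<in> L2 \<phi>" and G: "weak_jacobian u G" "G \<in> L2 \<phi>"
    using assms by (auto simp: H1_def)
  show "sq_int M u" using u by (simp add: L2_iff)
  show J: "weak_jacobian u (weak_D u)" unfolding weak_D_def by (rule someI[of "weak_jacobian u", OF G(1)])
  have m: "weak_D u \<in> borel_measurable borel"
    using J by (intro loc_int_measurable) (simp add: weak_jacobian_def)
  have sG: "sq_int M G" using G by (simp add: L2_iff)
  have ae: "AE x in M. (norm (G x))\<^sup>2 = (norm (weak_D u x))\<^sup>2"
    using weak_jacobian_unique[OF G(1) J] unfolding AE_M by eventually_elim simp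
  have "integrable M (\<lambda>x. (norm (G x))\<^sup>2) \<longleftrightarrow> integrable M (\<lambda>x. (norm (weak_D u x))\<^sup>2)"
    using m sq_int_measurable[OF sG] by (intro integrable_cong_AE ae) auto
  then show "sq_int M (weak_D u)" using m sG by (simp add: sq_int_def)
qed

text \<open>The definiteness assumption \<open>def0\<close> excludes a second projection that
  differs on a null set only, so the definite description is legitimate. Orthogonality gives
  Pythagoras, and that identifies the infimum.\<close>

lemma L2_projI:
  fixes f :: "real^'n \<Rightarrow> 'b::euclidean_space"
  assumes f: "sq_int M f" and V: "\<And>v. v \<in> V \<Longrightarrow> sq_int M v"
    and Vd: "\<And>v v'. v \<in> V \<Longrightarrow> v' \<in> V \<Longrightarrow> (\<lambda>x. v x - v' x) \<in> V"
    and def0: "\<And>v. v \<in> V \<Longrightarrow> nsq M v = 0 \<Longrightarrow> v = (\<lambda>x. 0)"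
    and p: "p \<in> V" "\<And>q. q \<in> V \<Longrightarrow> ip M (\<lambda>x. f x - p x) q = 0"
  shows "L2_proj \<phi> V f = p"
    and "\<And>R. R \<in> V \<Longrightarrow> nsq M (\<lambda>x. f x - R x) = nsq M (\<lambda>x. f x - p x) + nsq M (\<lambda>x. p x - R x)"
    and "(INF R\<in>V. L2sq \<phi> (\<lambda>x. f x - R x)) = L2sq \<phi> (\<lambda>x. f x - p x)"
proof -
  show "L2_proj \<phi> V f = p"
    unfolding L2_proj_def
  proof (rule the_equality)
    show "p \<in> V \<and> (\<forall>q\<in>V. (\<integral>x. (f x - p x) \<bullet> q x \<partial>M) = 0)"
      using p by (simp add: ip_def)
    fix p' assume p': "p' \<in> V \<and> (\<forall>q\<in>V. (\<integral>x. (f x - p' x) \<bullet> q x \<partial>M) = 0)"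
    define d where "d x = p x - p' x" for x
    have d: "d \<in> V" unfolding d_def using p p' by (intro Vd) auto
    have "d = (\<lambda>x. (f x - p' x) - (f x - p x))" by (auto simp: d_def)
    then have "ip M d d = ip M (\<lambda>x. (f x - p' x) - (f x - p x)) d" by simp
    also have "\<dots> = ip M (\<lambda>x. f x - p' x) d - ip M (\<lambda>x. f x - p x) d"
      using p p' d by (intro ip_diff_left sq_int_diff f V) auto
    also have "\<dots> = 0" using p p' d by (simp add: ip_def)
    finally have "d = (\<lambda>x. 0)" using def0[OF d] by (simp add: nsq_eq_ip)
    then show "p' = p" by (auto simp: d_def fun_eq_iff)
  qed
  show pyth: "nsq M (\<lambda>x. f x - R x) = nsq M (\<lambda>x. f x - p x) + nsq M (\<lambda>x. p x - R x)" if R: "R \<in> V" for R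
  proof -
    have "nsq M (\<lambda>x. (f x - p x) + (p x - R x)) = nsq M (\<lambda>x. f x - p x)
        + 2 * ip M (\<lambda>x. f x - p x) (\<lambda>x. p x - R x) + nsq M (\<lambda>x. p x - R x)"
      by (intro nsq_add sq_int_diff f V p R)
    then show ?thesis using p(2)[OF Vd[OF p(1) R]] by simp
  qed
  show "(INF R\<in>V. L2sq \<phi> (\<lambda>x. f x - R x)) = L2sq \<phi> (\<lambda>x. f x - p x)"
  proof (rule antisym)
    show "(INF R\<in>V. L2sq \<phi> (\<lambda>x. f x - R x)) \<le> L2sq \<phi> (\<lambda>x. f x - p x)"
      by (rule INF_lower[OF p(1)])
    show "L2sq \<phi> (\<lambda>x. f x - p x) \<le> (INF R\<in>V. L2sq \<phi> (\<lambda>x. f x - R x))"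
    proof (rule INF_greatest)
      fix R assume R: "R \<in> V"
      have "L2sq \<phi> (\<lambda>x. f x - p x) = ennreal (nsq M (\<lambda>x. f x - p x))"
        by (intro L2sq_eq sq_int_diff f V p)
      also have "\<dots> \<le> ennreal (nsq M (\<lambda>x. f x - R x))"
        using pyth[OF R] nsq_nonneg[of M "\<lambda>x. p x - R x"] by (intro ennreal_leI) linarith
      also have "\<dots> = L2sq \<phi> (\<lambda>x. f x - R x)"
        by (intro L2sq_eq[symmetric] sq_int_diff f V R)
      finally show "L2sq \<phi> (\<lambda>x. f x - p x) \<le> L2sq \<phi> (\<lambda>x. f x - R x)" .
    qed
  qed
qed

lemma nsq_const: "nsq M (\<lambda>x. c) = (norm c)\<^sup>2"
  by (simp add: nsq_def)

lemma ip_const: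
  assumes "sq_int M f"
  shows "ip M f (\<lambda>x. c) = (\<integral>x. f x \<partial>M) \<bullet> c"
  unfolding ip_def using sq_int_imp_integrable[OF assms] by simp

text \<open>The mean matrix minus its skew part is symmetric, hence orthogonal to all skew matrices;
  so the projection is the skew part of the mean.\<close>

lemma
  fixes G :: "real^'n \<Rightarrow> real^'n^'n"
  assumes G: "sq_int M G"
  shows proj_skew_eq: "proj_skew \<phi> G = (\<lambda>x. skew_part (\<integral>y. G y \<partial>M))"
    and proj_skew_orth: "B \<in> skew \<Longrightarrow> ip M (\<lambda>x. G x - skew_part (\<integral>y. G y \<partial>M)) (\<lambda>x. B) = 0"
    and proj_skew_INF: "(INF B\<in>skew. L2sq \<phi> (\<lambda>x. G x - B)) = L2sq \<phi> (\<lambda>x. G x - skew_part (\<integral>y. G y \<partial>M))"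
proof -
  define m where "m = (\<integral>y. G y \<partial>M)"
  define V :: "(real^'n \<Rightarrow> real^'n^'n) set" where "V = {(\<lambda>x. A) | A. A \<in> skew}"
  have orth: "ip M (\<lambda>x. G x - skew_part m) (\<lambda>x. B) = 0" if "B \<in> skew" for B
  proof -
    have "ip M (\<lambda>x. G x - skew_part m) (\<lambda>x. B) = (m - skew_part m) \<bullet> B"
      using sq_int_imp_integrable[OF G]
      by (simp add: ip_const sq_int_diff G m_def)
    also have "m - skew_part m = sym_part m" by (metis sym_plus_skew add_diff_cancel)
    finally show ?thesis by (simp add: sym_skew_orthogonal[OF that])
  qed
  have P: "(\<lambda>x. skew_part m) \<in> V" by (auto simp: V_def skew_part_skew)
  have Vd: "(\<lambda>x. v x - v' x) \<in> V" if "v \<in> V" "v' \<in> V" for v v'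
    using that by (auto simp: V_def skew_diff)
  have V0: "v = (\<lambda>x. 0)" if v: "v \<in> V" "nsq M v = 0" for v
  proof -
    obtain A where "v = (\<lambda>x. A)" using v(1) unfolding V_def by blast
    then show ?thesis using v(2) by (simp add: nsq_const)
  qed
  have Vs: "sq_int M v" if "v \<in> V" for v using that unfolding V_def by (auto intro: sq_int_const)
  have Vo: "ip M (\<lambda>x. G x - skew_part m) q = 0" if q: "q \<in> V" for q
  proof -
    obtain A where "A \<in> skew" "q = (\<lambda>x. A)" using q unfolding V_def by blast
    then show ?thesis using orth by simp
  qed
  show "proj_skew \<phi> G = (\<lambda>x. skew_part (\<integral>y. G y \<partial>M))"
    unfolding proj_skew_def V_def[symmetric] m_def[symmetric] by (rule L2_projI(1)[OF G Vs Vd V0 P Vo])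
  show "B \<in> skew \<Longrightarrow> ip M (\<lambda>x. G x - skew_part (\<integral>y. G y \<partial>M)) (\<lambda>x. B) = 0"
    using orth by (simp add: m_def)
  have V: "V = (\<lambda>A x. A) ` skew" unfolding V_def by blast
  have "(INF R\<in>V. L2sq \<phi> (\<lambda>x. G x - R x)) = L2sq \<phi> (\<lambda>x. G x - skew_part m)"
    by (rule L2_projI(3)[OF G Vs Vd V0 P Vo])
  then show "(INF B\<in>skew. L2sq \<phi> (\<lambda>x. G x - B)) = L2sq \<phi> (\<lambda>x. G x - skew_part (\<integral>y. G y \<partial>M))"
    unfolding V image_image m_def .
qed

lemma matrix_sq_int:
  fixes G :: "real^'n \<Rightarrow> real^'n^'n"
  assumes "sq_int M G"
  shows "sq_int M (\<lambda>x. G x $ i $ j)"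
  using sq_int_nth[OF sq_int_nth[OF assms]] by simp

lemma nsq_matrix:
  fixes G :: "real^'n \<Rightarrow> real^'n^'n"
  assumes "sq_int M G"
  shows "nsq M G = (\<Sum>i\<in>UNIV. \<Sum>j\<in>UNIV. nsq M (\<lambda>x. G x $ i $ j))"
  using assms by (simp add: nsq_vec sq_int_nth)

lemma matrix_measurable:
  fixes G :: "real^'n \<Rightarrow> real^'n^'n"
  assumes [measurable]: "G \<in> borel_measurable borel"
  shows "(\<lambda>x. transpose (G x)) \<in> borel_measurable borel"
proof -
  have "continuous_on UNIV (transpose :: real^'n^'n \<Rightarrow> real^'n^'n)"
    unfolding transpose_def[abs_def] by (intro continuous_intros)
  from borel_measurable_continuous_on[OF this assms] show ?thesis .
qed

lemma
  fixes G :: "real^'n \<Rightarrow> real^'n^'n"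
  assumes "sq_int M G"
  shows sym_sq_int: "sq_int M (\<lambda>x. sym_part (G x))" and skew_sq_int: "sq_int M (\<lambda>x. skew_part (G x))"
proof -
  have nt: "norm (transpose A) = norm A" for A :: "real^'n^'n"
  proof -
    have "(norm (transpose A))\<^sup>2 = (norm A)\<^sup>2"
      unfolding norm_vec_sq by (subst sum.swap) (simp add: transpose_def)
    then show ?thesis by simp
  qed
  have "sq_int M (\<lambda>x. transpose (G x))"
    using sq_int_measurable[OF assms] nt by (intro sq_int_bound[OF assms, of _ 1]) (auto intro: matrix_measurable)
  then show "sq_int M (\<lambda>x. sym_part (G x))" "sq_int M (\<lambda>x. skew_part (G x))"
    unfolding sym_part_def skew_part_def using assms
    by (auto intro!: sq_int_scaleR sq_int_add sq_int_diff)
qed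

lemma weak_Ds_eq: "weak_Ds u = (\<lambda>x. sym_part (weak_D u x))"
  by (simp add: weak_Ds_def sym_part_def fun_eq_iff)

end

section \<open>The Korn inequality\<close>

context gibbs_poincare
begin

text \<open>For fixed i and k the sum over j is the adjoint divergence of the field with components
  \<open>pd k (h i j)\<close>. Summed over k, the bounds of \<open>nsq_divergence_le\<close> regroup
  into \<open>XX\<close> and \<open>JJ\<close> of each \<open>h i j\<close>.\<close>

lemma divergence_bound:
  assumes growth: "growth_constants \<phi> C C'" and h: "\<And>i j. h i j \<in> test_functions"
  shows "(\<Sum>i\<in>UNIV. \<Sum>k\<in>UNIV. nsq M (\<lambda>x. \<Sum>j\<in>UNIV. dstar j (pd k (h i j)) x))
    \<le> (6 + P * C') * (\<Sum>i\<in>UNIV. \<Sum>j\<in>UNIV. nsq M (LL (h i j)))"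
proof -
  define I where "I f = (\<integral>x. norm (hess \<phi> x) * (f x)\<^sup>2 \<partial>M)" for f :: "real^'n \<Rightarrow> real"
  have JJ: "JJ v = (\<Sum>j\<in>UNIV. I (v j))" if "\<And>j. v j \<in> test_functions" for v
    unfolding I_def by (rule JJ_sum[OF that])
  have "(\<Sum>k\<in>UNIV. nsq M (\<lambda>x. \<Sum>j\<in>UNIV. dstar j (pd k (h i j)) x))
      \<le> (\<Sum>j\<in>UNIV. (6 + P * C') * nsq M (LL (h i j)))" for i
  proof -
    have "(\<Sum>k\<in>UNIV. nsq M (\<lambda>x. \<Sum>j\<in>UNIV. dstar j (pd k (h i j)) x))
      \<le> (\<Sum>k\<in>UNIV. (\<Sum>j\<in>UNIV. \<Sum>l\<in>UNIV. nsq M (pd l (pd k (h i j)))) + (\<Sum>j\<in>UNIV. I (pd k (h i j))))"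
    proof (rule sum_mono)
      fix k
      have "(\<And>j. pd k (h i j) \<in> test_functions)" by (intro test_pd h)
      from nsq_divergence_le[of "\<lambda>j. pd k (h i j)", OF this] JJ[of "\<lambda>j. pd k (h i j)", OF this]
      show "nsq M (\<lambda>x. \<Sum>j\<in>UNIV. dstar j (pd k (h i j)) x)
        \<le> (\<Sum>j\<in>UNIV. \<Sum>l\<in>UNIV. nsq M (pd l (pd k (h i j)))) + (\<Sum>j\<in>UNIV. I (pd k (h i j)))" by simp
    qed
    also have "\<dots> = (\<Sum>j\<in>UNIV. XX (h i j) + (\<Sum>k\<in>UNIV. I (pd k (h i j))))"
      unfolding XX_def sum.distrib
      by (intro arg_cong2[where f = "(+)"] sum.swap)
    also have "\<dots> = (\<Sum>j\<in>UNIV. XX (h i j) + JJ (\<lambda>k. pd k (h i j)))"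
      using JJ[of "\<lambda>k. pd k (h i _)"] test_pd[OF h] by (intro sum.cong refl) (simp add: JJ)
    also have "\<dots> \<le> (\<Sum>j\<in>UNIV. (6 + P * C') * nsq M (LL (h i j)))"
      by (intro sum_mono second_order_bound[OF growth h])
    finally show ?thesis .
  qed
  from sum_mono[of UNIV, OF this] show ?thesis by (simp add: sum_distrib_left)
qed

text \<open>Written in the entries of \<open>G\<close> there are six terms;
  \<open>weak_jacobian_compat\<close> matches two pairs across the equation and cancels the
  third.\<close>

lemma skew_sym_identity:
  assumes J: "weak_jacobian u G" and G: "sq_int M G" and v: "Ck 1 v" "bsupp v"
  shows "ip M (\<lambda>x. skew_part (G x) $ i $ j) (dstar k v)
    = ip M (\<lambda>x. sym_part (G x) $ i $ k) (dstar j v) - ip M (\<lambda>x. sym_part (G x) $ j $ k) (dstar i v)"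
proof -
  note sG = matrix_sq_int[OF G]
  note d = dstar_sq_int[OF v]
  have sk: "ip M (\<lambda>x. skew_part (G x) $ i $ j) h = 1/2 * (ip M (\<lambda>x. G x $ i $ j) h - ip M (\<lambda>x. G x $ j $ i) h)"
    if "sq_int M h" for i j h
    using ip_scaleR_left[of M "1/2" "\<lambda>x. G x $ i $ j - G x $ j $ i" h] ip_diff_left[OF sG sG that, of i j j i]
    by (simp add: skew_part_nth)
  have sy: "ip M (\<lambda>x. sym_part (G x) $ i $ j) h = 1/2 * (ip M (\<lambda>x. G x $ i $ j) h + ip M (\<lambda>x. G x $ j $ i) h)"
    if "sq_int M h" for i j h
    using ip_scaleR_left[of M "1/2" "\<lambda>x. G x $ i $ j + G x $ j $ i" h] ip_add_left[OF sG sG that, of i j j i]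
    by (simp add: sym_part_nth)
  show ?thesis
    unfolding sk[OF d] sy[OF d]
    using weak_jacobian_compat[OF J G v, of i j k] weak_jacobian_compat[OF J G v, of j i k]
      weak_jacobian_compat[OF J G v, of k j i] by (simp add: algebra_simps)
qed

text \<open>Duality with one test function for each entry of the skew part.
  \<open>skew_sym_identity\<close> turns the pairing into pairings of the symmetric part with
  adjoint divergences, which \<open>divergence_bound\<close> controls.\<close>

lemma skew_part_bound:
  assumes growth: "growth_constants \<phi> C C'" and J: "weak_jacobian u G" and G: "sq_int M G"
  shows "nsq M (\<lambda>x. skew_part (G x) - (\<integral>y. skew_part (G y) \<partial>M))
    \<le> 4 * (6 + P * C') * nsq M (\<lambda>x. sym_part (G x))"
proof -
  define S where "S = nsq M (\<lambda>x. sym_part (G x))"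
  define a where "a i j x = skew_part (G x) $ i $ j" for i j x
  define s where "s i j x = sym_part (G x) $ i $ j" for i j x
  define m where "m = (\<integral>y. skew_part (G y) \<partial>M)"
  have sa: "sq_int M (a i j)" for i j unfolding a_def by (rule matrix_sq_int[OF skew_sq_int[OF G]])
  have ss: "sq_int M (s i j)" for i j unfolding s_def by (rule matrix_sq_int[OF sym_sq_int[OF G]])
  have S: "S = (\<Sum>i\<in>UNIV. \<Sum>j\<in>UNIV. nsq M (s i j))"
    unfolding S_def s_def by (rule nsq_matrix[OF sym_sq_int[OF G]])
  define \<kappa> where "\<kappa> = 6 + P * C'"
  have \<kappa>: "0 \<le> \<kappa>" using growth P_nonneg by (simp add: \<kappa>_def growth_constants_def)
  have m: "m $ i $ j = (\<integral>x. a i j x \<partial>M)" for i j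
  proof -
    have i: "integrable M (\<lambda>y. skew_part (G y))" by (intro sq_int_imp_integrable skew_sq_int G)
    have "m $ i = (\<integral>y. skew_part (G y) $ i \<partial>M)"
      unfolding m_def by (rule integral_bounded_linear[OF bounded_linear_vec_nth i, symmetric])
    also have "\<dots> $ j = (\<integral>y. skew_part (G y) $ i $ j \<partial>M)"
      by (rule integral_bounded_linear[OF bounded_linear_vec_nth
            integrable_bounded_linear[OF bounded_linear_vec_nth i], symmetric])
    finally show ?thesis by (simp add: a_def)
  qed
  have "(\<Sum>p\<in>UNIV. nsq M (\<lambda>x. a (fst p) (snd p) x - m $ fst p $ snd p)) \<le> 4 * \<kappa> * S"
  proof (rule LL_dual_bound)
    show "finite (UNIV :: ('n \<times> 'n) set)" by simp
    show "sq_int M (\<lambda>x. a (fst p) (snd p) x - m $ fst p $ snd p)" for p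
      by (intro sq_int_diff sa sq_int_const)
    show "(\<integral>x. a (fst p) (snd p) x - m $ fst p $ snd p \<partial>M) = 0" for p
      using sq_int_imp_integrable[OF sa] by (simp add: m)
    show "0 \<le> 4 * \<kappa> * S" using \<kappa> by (simp add: S_def)
    fix h' :: "'n \<times> 'n \<Rightarrow> real^'n \<Rightarrow> real" assume h': "\<And>p. h' p \<in> test_functions"
    define h where "h i j = h' (i, j)" for i j
    have h: "h i j \<in> test_functions" for i j unfolding h_def by (rule h')
    note ph = test_Ck[OF test_pd[OF h]] test_bsupp[OF test_pd[OF h]]
    define F where "F = (\<Sum>i\<in>UNIV. \<Sum>j\<in>UNIV. nsq M (LL (h i j)))"
    define T where "T i k x = (\<Sum>j\<in>UNIV. dstar j (pd k (h i j)) x)" for i k x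
    \<comment> \<open>The second term of the identity is summed over the first index of
      \<open>h\<close> instead of the second; its bound is the one for \<open>T\<close> with the
      indices of \<open>h\<close> exchanged.\<close>
    define T' where "T' j k x = (\<Sum>i\<in>UNIV. dstar i (pd k (h i j)) x)" for j k x
    have sT: "sq_int M (T i k)" "sq_int M (T' i k)" for i k
      unfolding T_def T'_def by (intro sq_int_sum dstar_sq_int ph)+
    have T: "(\<Sum>i\<in>UNIV. \<Sum>k\<in>UNIV. nsq M (T i k)) \<le> \<kappa> * F"
      unfolding T_def \<kappa>_def F_def by (rule divergence_bound[OF growth h])
    have T': "(\<Sum>j\<in>UNIV. \<Sum>k\<in>UNIV. nsq M (T' j k)) \<le> \<kappa> * F"
    proof -
      have "(\<Sum>j\<in>UNIV. \<Sum>k\<in>UNIV. nsq M (T' j k)) \<le> \<kappa> * (\<Sum>j\<in>UNIV. \<Sum>i\<in>UNIV. nsq M (LL (h i j)))"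
        unfolding T'_def \<kappa>_def using divergence_bound[OF growth, of "\<lambda>j i. h i j"] h by simp
      also have "(\<Sum>j\<in>UNIV. \<Sum>i\<in>UNIV. nsq M (LL (h i j))) = F" unfolding F_def by (rule sum.swap)
      finally show ?thesis .
    qed
    have each: "ip M (\<lambda>x. a i j x - m $ i $ j) (LL (h i j))
       = (\<Sum>k\<in>UNIV. ip M (s i k) (dstar j (pd k (h i j)))) - (\<Sum>k\<in>UNIV. ip M (s j k) (dstar i (pd k (h i j))))" for i j
    proof -
      have "ip M (\<lambda>x. a i j x - m $ i $ j) (LL (h i j)) = ip M (a i j) (LL (h i j))"
        using ip_diff_left[OF sa sq_int_const LL_sq_int[OF h], of i j "m $ i $ j" i j] integral_LL[OF h]
        by (simp add: ip_def)
      also have "\<dots> = (\<Sum>k\<in>UNIV. ip M (a i j) (dstar k (pd k (h i j))))"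
        unfolding LL_def[abs_def] by (intro ip_sum_right sa dstar_sq_int ph)
      also have "\<dots> = (\<Sum>k\<in>UNIV. ip M (s i k) (dstar j (pd k (h i j))) - ip M (s j k) (dstar i (pd k (h i j))))"
        unfolding a_def s_def by (intro sum.cong refl skew_sym_identity[OF J G] ph)
      finally show ?thesis by (simp add: sum_subtractf)
    qed
    define A where "A = (\<Sum>i\<in>UNIV. \<Sum>k\<in>UNIV. ip M (s i k) (T i k))"
    define B where "B = (\<Sum>j\<in>UNIV. \<Sum>k\<in>UNIV. ip M (s j k) (T' j k))"
    have AB: "(\<Sum>i\<in>UNIV. \<Sum>j\<in>UNIV. ip M (\<lambda>x. a i j x - m $ i $ j) (LL (h i j))) = A - B"
    proof -
      have "(\<Sum>i\<in>UNIV. \<Sum>j\<in>UNIV. \<Sum>k\<in>UNIV. ip M (s i k) (dstar j (pd k (h i j)))) = A"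
      proof -
        have "(\<Sum>j\<in>UNIV. \<Sum>k\<in>UNIV. ip M (s i k) (dstar j (pd k (h i j)))) = (\<Sum>k\<in>UNIV. ip M (s i k) (T i k))" for i
          unfolding T_def by (subst sum.swap) (intro sum.cong refl ip_sum_right[symmetric] ss dstar_sq_int ph)
        then show ?thesis by (simp add: A_def)
      qed
      moreover have "(\<Sum>i\<in>UNIV. \<Sum>j\<in>UNIV. \<Sum>k\<in>UNIV. ip M (s j k) (dstar i (pd k (h i j)))) = B"
      proof -
        have "(\<Sum>i\<in>UNIV. \<Sum>k\<in>UNIV. ip M (s j k) (dstar i (pd k (h i j)))) = (\<Sum>k\<in>UNIV. ip M (s j k) (T' j k))" for j
          unfolding T'_def by (subst sum.swap) (intro sum.cong refl ip_sum_right[symmetric] ss dstar_sq_int ph)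
        then show ?thesis unfolding B_def by (subst sum.swap) simp
      qed
      ultimately show ?thesis by (simp add: each sum_subtractf)
    qed
    \<comment> \<open>Each of the two squares is at most S \<kappa> F, which gives the factor
      4.\<close>
    have "(A - B)\<^sup>2 \<le> 2 * A\<^sup>2 + 2 * B\<^sup>2"
      using zero_le_power2[of "A + B"] by (simp add: power2_eq_square algebra_simps)
    moreover have cs: "(\<Sum>i\<in>UNIV. \<Sum>k\<in>UNIV. ip M (s i k) (t i k))\<^sup>2 \<le> S * (\<Sum>i\<in>UNIV. \<Sum>k\<in>UNIV. nsq M (t i k))"
      if "\<And>i k. sq_int M (t i k)" for t
      using sum_ip_Cauchy_Schwarz[of "UNIV \<times> UNIV" M "\<lambda>(i,k). s i k" "\<lambda>(i,k). t i k"] ss that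
      by (simp add: S sum.cartesian_product case_prod_unfold)
    moreover have "A\<^sup>2 \<le> S * (\<kappa> * F)"
      unfolding A_def using order_trans[OF cs[of T] mult_left_mono[OF T, of S]] sT by (simp add: S_def)
    moreover have "B\<^sup>2 \<le> S * (\<kappa> * F)"
      unfolding B_def using order_trans[OF cs[of T'] mult_left_mono[OF T', of S]] sT by (simp add: S_def)
    ultimately have "(\<Sum>i\<in>UNIV. \<Sum>j\<in>UNIV. ip M (\<lambda>x. a i j x - m $ i $ j) (LL (h i j)))\<^sup>2 \<le> 4 * \<kappa> * S * F"
      unfolding AB by (simp add: mult_ac)
    then show "(\<Sum>p\<in>UNIV. ip M (\<lambda>x. a (fst p) (snd p) x - m $ fst p $ snd p) (LL (h' p)))\<^sup>2
        \<le> 4 * \<kappa> * S * (\<Sum>p\<in>UNIV. nsq M (LL (h' p)))"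
      by (simp add: F_def h_def sum.cartesian_product case_prod_unfold UNIV_Times_UNIV[symmetric] del: UNIV_Times_UNIV)
  qed
  moreover have "nsq M (\<lambda>x. skew_part (G x) - m)
      = (\<Sum>p\<in>UNIV. nsq M (\<lambda>x. a (fst p) (snd p) x - m $ fst p $ snd p))"
    by (subst nsq_matrix[OF sq_int_diff[OF skew_sq_int[OF G] sq_int_const]])
       (simp add: a_def sum.cartesian_product case_prod_unfold UNIV_Times_UNIV[symmetric] del: UNIV_Times_UNIV)
  ultimately show ?thesis by (simp add: m_def S_def \<kappa>_def)
qed

lemma nsq_sym_skew:
  fixes G :: "real^'n \<Rightarrow> real^'n^'n"
  assumes G: "sq_int M G"
  shows "nsq M (\<lambda>x. G x - skew_part (\<integral>y. G y \<partial>M))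
    = nsq M (\<lambda>x. sym_part (G x)) + nsq M (\<lambda>x. skew_part (G x) - (\<integral>y. skew_part (G y) \<partial>M))"
proof -
  have i: "integrable M G" by (rule sq_int_imp_integrable[OF G])
  have bl: "bounded_linear (skew_part :: real^'n^'n \<Rightarrow> real^'n^'n)"
  proof -
    have "linear (skew_part :: real^'n^'n \<Rightarrow> real^'n^'n)"
      by (rule linearI) (simp_all add: vec_eq_iff skew_part_nth field_simps)
    then show ?thesis by (rule linear_conv_bounded_linear[THEN iffD1])
  qed
  have m: "skew_part (\<integral>y. G y \<partial>M) = (\<integral>y. skew_part (G y) \<partial>M)"
    by (rule integral_bounded_linear[OF bl i, symmetric])
  define m' where "m' = skew_part (\<integral>y. G y \<partial>M)"
  have eq: "(\<lambda>x. G x - m') = (\<lambda>x. sym_part (G x) + (skew_part (G x) - m'))"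
  proof
    fix x show "G x - m' = sym_part (G x) + (skew_part (G x) - m')"
      using sym_plus_skew[of "G x"] by (simp add: algebra_simps)
  qed
  have "nsq M (\<lambda>x. G x - m') = nsq M (\<lambda>x. sym_part (G x))
      + 2 * ip M (\<lambda>x. sym_part (G x)) (\<lambda>x. skew_part (G x) - m') + nsq M (\<lambda>x. skew_part (G x) - m')"
    unfolding eq by (rule nsq_add[OF sym_sq_int[OF G] sq_int_diff[OF skew_sq_int[OF G] sq_int_const]])
  moreover have "ip M (\<lambda>x. sym_part (G x)) (\<lambda>x. skew_part (G x) - m') = 0"
    unfolding ip_def m'_def by (simp add: sym_skew_orthogonal skew_diff skew_part_skew)
  ultimately show ?thesis by (simp add: m'_def m)
qed

text \<open>The symmetric part itself contributes 1, the skew part 4 (6 + P C'); the total 25 + 4 P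
  C' is rounded up.\<close>

lemma korn_estimate:
  assumes growth: "growth_constants \<phi> C C'" and J: "weak_jacobian u G" and G: "sq_int M G"
  shows "nsq M (\<lambda>x. G x - skew_part (\<integral>y. G y \<partial>M)) \<le> korn_bound P C C' * nsq M (\<lambda>x. sym_part (G x))"
proof -
  have PC: "0 \<le> P * C'" using growth P_nonneg by (simp add: growth_constants_def)
  have num: "1 + 4 * (6 + x) \<le> 32 * (1 + x)" if "0 \<le> x" for x :: real using that by simp
  have "nsq M (\<lambda>x. G x - skew_part (\<integral>y. G y \<partial>M)) \<le> (1 + 4 * (6 + P * C')) * nsq M (\<lambda>x. sym_part (G x))"
    using nsq_sym_skew[OF G] skew_part_bound[OF growth J G] by (simp add: algebra_simps)
  also have "\<dots> \<le> korn_bound P C C' * nsq M (\<lambda>x. sym_part (G x))"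
    unfolding korn_bound_def by (intro mult_right_mono num PC nsq_nonneg)
  finally show ?thesis .
qed

end

locale gibbs_centred = gibbs_poincare \<phi> P
  for \<phi> :: "real^'n::finite \<Rightarrow> real" and P +
  assumes centre: "has_bochner_integral lborel (\<lambda>x. exp (- \<phi> x) *\<^sub>R x) 0"
begin

section \<open>Moments\<close>

lemma id_integrable: "integrable M (\<lambda>x. x)" and id_mean: "(\<integral>x. x \<partial>M) = 0"
  using centre by (auto simp: integrable_M integral_M w_def has_bochner_integral_iff)

lemma coord_integrable: "integrable M (\<lambda>x. x $ i)" and coord_mean: "(\<integral>x. x $ i \<partial>M) = 0"
proof -
  show "integrable M (\<lambda>x. x $ i)"
    by (rule integrable_bounded_linear[OF bounded_linear_vec_nth id_integrable])
  have "(\<integral>x. x $ i \<partial>M) = (\<integral>x. x \<partial>M) $ i"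
    by (rule integral_bounded_linear[OF bounded_linear_vec_nth id_integrable])
  then show "(\<integral>x. x $ i \<partial>M) = 0" by (simp add: id_mean)
qed

text \<open>The Poincare inequality for truncated coordinates gives finite second moments.\<close>

lemma coord_sq_int: "sq_int M (\<lambda>x. x $ i)"
proof -
  obtain K where K: "0 < K" "\<And>r i x. 0 < r \<Longrightarrow> \<bar>pd i (cutoff r) (x::real^'n)\<bar> \<le> K / r"
    using cutoff_pd_bound by metis
  define c where "c n = (cutoff (real (Suc n)) :: real^'n \<Rightarrow> real)" for n
  have c: "c n \<in> test_functions" for n unfolding c_def by (rule cutoff_test) simp
  define f where "f n x = c n x * x $ i" for n x
  have f: "f n \<in> test_functions" for n unfolding f_def by (intro test_mult c smooth_intros)
  have [measurable]: "f n \<in> borel_measurable borel" for n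
    by (intro borel_measurable_continuous_onI test_continuous f)
  \<comment> \<open>On the support of the cutoff a coordinate is at most the radius, which cancels
    the decay of the cutoff's derivative; this term contributes K, the other one 1.\<close>
  have pdf: "\<bar>pd k (f n) x\<bar> \<le> K + 1" for k n x
  proof -
    have e: "pd k (f n) x = pd k (c n) x * x $ i + c n x * (if k = i then 1 else 0)"
      unfolding f_def by (subst pd_mult) (auto simp: test_differentiable[OF c] differentiable_coord pd_coord)
    have "\<bar>pd k (c n) x * x $ i\<bar> \<le> K"
    proof (cases "norm x \<le> real (Suc n)")
      case True
      have "\<bar>pd k (c n) x\<bar> * \<bar>x $ i\<bar> \<le> (K / real (Suc n)) * real (Suc n)"
        using K(1) order_trans[OF component_le_norm_cart True]
        by (intro mult_mono) (auto simp: c_def intro!: K(2))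
      then show ?thesis by (simp add: abs_mult)
    next
      case False
      have "pd k (c n) x = 0"
      proof (rule pd_eq_0_outside[of "real (Suc n)"])
        show "c n y = 0" if "real (Suc n) < norm y" for y
          unfolding c_def by (rule cutoff_eq_0) (use that in auto)
      qed (use False in simp)
      then show ?thesis using K(1) by simp
    qed
    moreover have "\<bar>c n x * (if k = i then 1 else 0)\<bar> \<le> 1"
      using cutoff_bounds[of "real (Suc n)" x] by (auto simp: c_def)
    ultimately show ?thesis unfolding e by linarith
  qed
  \<comment> \<open>The truncated coordinates are not centred. Their means are bounded by the first
    absolute moment, which is finite because the centring hypothesis includes integrability.\<close>
  define m where "m = (\<integral>x. \<bar>x $ i\<bar> \<partial>M)"
  define B where "B = P * (real CARD('n) * (K + 1)\<^sup>2) + m\<^sup>2"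
  have B0: "0 \<le> B" unfolding B_def using P_nonneg by (intro add_nonneg_nonneg mult_nonneg_nonneg) auto
  have nB: "nsq M (f n) \<le> B" for n
  proof -
    have "nsq M (pd k (f n)) \<le> (K + 1)\<^sup>2" for k
    proof -
      have "nsq M (pd k (f n)) \<le> nsq M (\<lambda>x. K + 1)"
        using pdf K(1) by (intro nsq_mono) auto
      then show ?thesis using K(1) by (simp add: nsq_const)
    qed
    then have "(\<Sum>k\<in>UNIV. nsq M (pd k (f n))) \<le> real CARD('n) * (K + 1)\<^sup>2"
      using sum_mono[of "UNIV::'n set" "\<lambda>k. nsq M (pd k (f n))" "\<lambda>k. (K+1)\<^sup>2"] by simp
    then have 1: "P * (\<Sum>k\<in>UNIV. nsq M (pd k (f n))) \<le> P * (real CARD('n) * (K + 1)\<^sup>2)"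
      using P_nonneg by (rule mult_left_mono)
    have "\<bar>\<integral>x. f n x \<partial>M\<bar> \<le> (\<integral>x. \<bar>f n x\<bar> \<partial>M)" using integral_abs_bound by blast
    also have "\<dots> \<le> m"
      unfolding m_def
    proof (rule integral_mono)
      show "\<bar>f n x\<bar> \<le> \<bar>x $ i\<bar>" for x
        using cutoff_bounds[of "real (Suc n)" x]
        by (auto simp: f_def c_def abs_mult intro!: mult_left_le_one_le)
    qed (use sq_int_imp_integrable[OF test_sq_int[OF f]] coord_integrable in auto)
    finally have "(\<integral>x. f n x \<partial>M)\<^sup>2 \<le> m\<^sup>2" by (metis abs_ge_zero power2_abs power_mono)
    then show ?thesis
      using poincare_test[OF f[of n]] 1 nsq_centre[OF test_sq_int[OF f[of n]]] unfolding B_def by linarith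
  qed
  have "(\<integral>\<^sup>+x. ennreal ((x $ i)\<^sup>2) \<partial>M) = (\<integral>\<^sup>+x. liminf (\<lambda>n. ennreal ((f n x)\<^sup>2)) \<partial>M)"
  proof (intro nn_integral_cong)
    fix x
    have "(\<lambda>n. ennreal ((f n x)\<^sup>2)) \<longlonglongrightarrow> ennreal ((1 * x $ i)\<^sup>2)"
      unfolding f_def c_def by (intro tendsto_ennrealI tendsto_intros cutoff_tendsto)
    then show "ennreal ((x $ i)\<^sup>2) = liminf (\<lambda>n. ennreal ((f n x)\<^sup>2))"
      by (metis lim_imp_Liminf sequentially_bot mult_1)
  qed
  also have "\<dots> \<le> liminf (\<lambda>n. \<integral>\<^sup>+x. ennreal ((f n x)\<^sup>2) \<partial>M)"
    by (rule nn_integral_liminf) measurable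
  also have "\<dots> = liminf (\<lambda>n. ennreal (nsq M (f n)))"
    using sq_int_integrable[OF test_sq_int[OF f]] by (simp add: nn_integral_eq_integral nsq_def)
  also have "\<dots> \<le> limsup (\<lambda>n. ennreal (nsq M (f n)))"
    by (intro Liminf_le_Limsup) simp
  also have "\<dots> \<le> ennreal B"
    by (rule Limsup_bounded) (intro always_eventually allI ennreal_leI nB)
  finally show ?thesis
    using B0 by (intro sq_int_nn_integral_le(1)[of _ B]) auto
qed

lemma linear_sq_int: "sq_int M (\<lambda>x. a \<bullet> x)"
proof -
  have "sq_int M (\<lambda>x. \<Sum>i\<in>UNIV. a $ i *\<^sub>R x $ i)"
    by (intro sq_int_sum sq_int_scaleR coord_sq_int)
  then show ?thesis by (simp add: inner_vec_def)
qed

lemma id_sq_int: "sq_int M (\<lambda>x. x)"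
  using sq_int_vec[of M "\<lambda>j x. x $ j"] coord_sq_int by simp

lemma linear_mean: "(\<integral>x. a \<bullet> x \<partial>M) = 0"
  unfolding inner_vec_def using coord_integrable coord_mean by simp

lemma wpd_linear: "wpd j (\<lambda>x. a \<bullet> x) (\<lambda>x. a $ j)"
proof -
  have C: "Ck k (\<lambda>x::real^'n. a \<bullet> x)" for k
    unfolding inner_vec_def inner_real_def by (intro Ck_sum Ck_cmult Ck_coord)
  have "pd j (\<lambda>x. a \<bullet> x) = (\<lambda>x. a $ j)"
    by (intro ext) (subst pd_has_derivative[of _ "\<lambda>v. a \<bullet> v"], auto intro!: derivative_eq_intros simp: inner_axis)
  then show ?thesis using wpd_C1[OF C linear_sq_int, of j] by simp
qed

lemma matrix_vector_sq_int: "sq_int M (\<lambda>x. A *v x)" for A :: "real^'n^'n"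
proof -
  have "(\<lambda>x. A *v x) = (\<lambda>x. \<chi> i. A $ i \<bullet> x)" by (simp add: fun_eq_iff vec_eq_iff matrix_vector_nth)
  then show ?thesis using sq_int_vec[of M "\<lambda>i x. A $ i \<bullet> x"] linear_sq_int by simp
qed

lemma nsq_matrix_vector: "nsq M (\<lambda>x. A *v x) = (\<Sum>i\<in>UNIV. nsq M (\<lambda>x. A $ i \<bullet> x))" for A :: "real^'n^'n"
  using nsq_vec[OF matrix_vector_sq_int] by (simp add: matrix_vector_nth)

text \<open>The weighted estimate applied to the constant function 1, whose derivatives
  vanish.\<close>

lemma grad_phi_bound:
  assumes growth: "growth_constants \<phi> C C'"
  shows "sq_int M (grad \<phi>)" "nsq M (grad \<phi>) \<le> (C - 1) / 2"
proof -
  have "wpd j (\<lambda>x. 1) (\<lambda>x. 0)" for j by (rule wpd_const)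
  note gw = grad_weight_wpd[OF growth this]
  show "sq_int M (grad \<phi>)"
    using gw(1) by (simp add: sq_int_def)
  show "nsq M (grad \<phi>) \<le> (C - 1) / 2"
    using gw(2) by (simp add: nsq_def)
qed

text \<open>Integration by parts against the constant 1, which has no bounded support: it is
  replaced by cutoffs. The term with their derivatives tends to 0, and the product of two square
  integrable functions is an integrable majorant for the other one.\<close>

lemma ip_linear_pd_phi:
  assumes sp: "sq_int M (pd j \<phi>)"
  shows "ip M (\<lambda>x. a \<bullet> x) (pd j \<phi>) = a $ j"
proof -
  define c where "c n = (cutoff (real (Suc n)) :: real^'n \<Rightarrow> real)" for n
  have c: "c n \<in> test_functions" for n unfolding c_def by (rule cutoff_test) simp
  have cb: "\<bar>c n x\<bar> \<le> 1" for n x using cutoff_bounds[of "real (Suc n)" x] by (simp add: c_def)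
  have [measurable]: "c n \<in> borel_measurable borel" for n
    by (intro borel_measurable_continuous_onI test_continuous c)
  have scp: "sq_int M (\<lambda>x. c n x * pd j \<phi> x)" for n
    using cb by (intro sq_int_bound[OF sp, of _ 1]) (auto simp: abs_mult intro: mult_left_le_one_le)
  have spc: "sq_int M (pd j (c n))" for n by (intro test_sq_int test_pd c)
  have eq: "a $ j * ip M (\<lambda>x. 1) (c n) = - ip M (\<lambda>x. a \<bullet> x) (pd j (c n)) + ip M (\<lambda>x. a \<bullet> x) (\<lambda>x. c n x * pd j \<phi> x)" for n
  proof -
    have "ip M (\<lambda>x. a $ j) (c n) = ip M (\<lambda>x. a \<bullet> x) (dstar j (c n))"
      by (rule wpdD[OF wpd_linear test_Ck[OF c] test_bsupp[OF c]])
    also have "dstar j (c n) = (\<lambda>x. c n x * pd j \<phi> x - pd j (c n) x)" by (auto simp: dstar_def)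
    also have "ip M (\<lambda>x. a \<bullet> x) \<dots> = ip M (\<lambda>x. a \<bullet> x) (\<lambda>x. c n x * pd j \<phi> x) - ip M (\<lambda>x. a \<bullet> x) (pd j (c n))"
      by (rule ip_diff_right[OF scp spc linear_sq_int])
    finally show ?thesis using ip_scaleR_left[of M "a $ j" "\<lambda>x. 1" "c n"] by simp
  qed
  have l1: "(\<lambda>n. ip M (c n) (\<lambda>x. 1)) \<longlonglongrightarrow> ip M (\<lambda>x. 1 :: real) (\<lambda>x. 1)"
  proof (rule nsq_tendsto_ip[OF test_sq_int[OF c] sq_int_const sq_int_const])
    show "(\<lambda>n. nsq M (\<lambda>x. c n x - 1)) \<longlonglongrightarrow> 0"
      using cutoff_nsq(1) unfolding c_def by (subst nsq_minus_commute)
  qed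
  have l2: "(\<lambda>n. ip M (pd j (c n)) (\<lambda>x. a \<bullet> x)) \<longlonglongrightarrow> ip M (\<lambda>x. 0) (\<lambda>x. a \<bullet> x)"
    using cutoff_nsq(2)[of j] by (intro nsq_tendsto_ip spc linear_sq_int) (auto simp: c_def simp del: of_nat_Suc)
  have l3: "(\<lambda>n. \<integral>x. (a \<bullet> x) \<bullet> (c n x * pd j \<phi> x) \<partial>M) \<longlonglongrightarrow> (\<integral>x. (a \<bullet> x) \<bullet> pd j \<phi> x \<partial>M)"
  proof (rule integral_dominated_convergence)
    show "integrable M (\<lambda>x. norm ((a \<bullet> x) * pd j \<phi> x))"
      using sq_int_mult[OF linear_sq_int[of a] sp] by (rule integrable_norm)
    show "AE x in M. (\<lambda>n. (a \<bullet> x) \<bullet> (c n x * pd j \<phi> x)) \<longlonglongrightarrow> (a \<bullet> x) \<bullet> pd j \<phi> x"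
    proof (rule AE_I2)
      fix x
      have "(\<lambda>n. (a \<bullet> x) * (c n x * pd j \<phi> x)) \<longlonglongrightarrow> (a \<bullet> x) * (1 * pd j \<phi> x)"
        unfolding c_def by (intro tendsto_intros cutoff_tendsto)
      then show "(\<lambda>n. (a \<bullet> x) \<bullet> (c n x * pd j \<phi> x)) \<longlonglongrightarrow> (a \<bullet> x) \<bullet> pd j \<phi> x" by simp
    qed
    show "AE x in M. norm ((a \<bullet> x) \<bullet> (c n x * pd j \<phi> x)) \<le> norm ((a \<bullet> x) * pd j \<phi> x)" for n
      using cb by (intro AE_I2) (auto simp: abs_mult intro!: mult_left_mono mult_left_le_one_le)
  qed auto
  have "(\<lambda>n. a $ j * ip M (\<lambda>x. 1) (c n)) \<longlonglongrightarrow> - 0 + ip M (\<lambda>x. a \<bullet> x) (pd j \<phi>)"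
    unfolding eq using l2 l3 by (intro tendsto_intros) (simp_all add: ip_commute[of M "\<lambda>x. a \<bullet> x"] ip_def inner_commute mult_ac)
  moreover have "(\<lambda>n. a $ j * ip M (\<lambda>x. 1) (c n)) \<longlonglongrightarrow> a $ j * 1"
    using l1 by (intro tendsto_intros) (simp add: ip_commute[of M "\<lambda>x. 1"] ip_def)
  ultimately show ?thesis using LIMSEQ_unique by fastforce
qed

text \<open>Pairing a . x with the derivative of \<phi> along \<open>a\<close> gives the square of
  the norm of \<open>a\<close>; Cauchy-Schwarz and the bound on the gradient of \<phi> then give the
  fourth power of this norm on the left and its square on the right.\<close>

lemma linear_coercive:
  assumes growth: "growth_constants \<phi> C C'"
  shows "(norm a)\<^sup>2 \<le> (C - 1) / 2 * nsq M (\<lambda>x. a \<bullet> x)"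
proof -
  note g = grad_phi_bound[OF growth]
  have sp: "sq_int M (pd j \<phi>)" for j using sq_int_nth[OF g(1), of j] by simp
  have sag: "sq_int M (\<lambda>x. \<Sum>j\<in>UNIV. a $ j *\<^sub>R pd j \<phi> x)" by (intro sq_int_sum sq_int_scaleR sp)
  have sng: "sq_int M (\<lambda>x. norm a *\<^sub>R grad \<phi> x)" by (intro sq_int_scaleR g)
  have eq: "(\<Sum>j\<in>UNIV. a $ j *\<^sub>R pd j \<phi> x) = a \<bullet> grad \<phi> x" for x by (simp add: inner_vec_def)
  have "(norm a)\<^sup>2 = (\<Sum>j\<in>UNIV. a $ j * ip M (\<lambda>x. a \<bullet> x) (pd j \<phi>))"
    unfolding ip_linear_pd_phi[OF sp] by (simp only: power2_norm_eq_inner inner_vec_def inner_real_def)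
  also have "\<dots> = ip M (\<lambda>x. a \<bullet> x) (\<lambda>x. \<Sum>j\<in>UNIV. a $ j *\<^sub>R pd j \<phi> x)"
    by (subst ip_sum_right[OF linear_sq_int sq_int_scaleR[OF sp]]) (simp only: ip_scaleR_right)
  finally have "((norm a)\<^sup>2)\<^sup>2 \<le> nsq M (\<lambda>x. a \<bullet> x) * nsq M (\<lambda>x. \<Sum>j\<in>UNIV. a $ j *\<^sub>R pd j \<phi> x)"
    using ip_Cauchy_Schwarz[OF linear_sq_int[of a] sag] by simp
  also have "nsq M (\<lambda>x. \<Sum>j\<in>UNIV. a $ j *\<^sub>R pd j \<phi> x) \<le> nsq M (\<lambda>x. norm a *\<^sub>R grad \<phi> x)"
    unfolding eq using Cauchy_Schwarz_ineq2[of a] by (intro nsq_mono[OF sng]) simp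
  then have "nsq M (\<lambda>x. a \<bullet> x) * nsq M (\<lambda>x. \<Sum>j\<in>UNIV. a $ j *\<^sub>R pd j \<phi> x)
      \<le> nsq M (\<lambda>x. a \<bullet> x) * ((norm a)\<^sup>2 * ((C - 1) / 2))"
    unfolding nsq_scaleR using mult_left_mono[OF g(2), of "(norm a)\<^sup>2"] by (intro mult_left_mono) auto
  finally have "(norm a)\<^sup>2 * (norm a)\<^sup>2 \<le> (norm a)\<^sup>2 * ((C - 1) / 2 * nsq M (\<lambda>x. a \<bullet> x))"
    by (simp add: power2_eq_square[of "(norm a)\<^sup>2"] mult_ac)
  then show ?thesis
  proof (cases "a = 0")
    case True
    then show ?thesis using growth by (simp add: growth_constants_def)
  next
    case False
    then have "0 < (norm a)\<^sup>2" by simp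
    then show ?thesis
      using \<open>(norm a)\<^sup>2 * (norm a)\<^sup>2 \<le> (norm a)\<^sup>2 * ((C - 1) / 2 * nsq M (\<lambda>x. a \<bullet> x))\<close>
      by (rule mult_left_le_imp_le[rotated])
  qed
qed

section \<open>The projection onto infinitesimal rotations\<close>

text \<open>Nondegeneracy of the second moments. The constant is a parameter because it comes from
  the growth conditions in general and equals 1 for the Gaussian.\<close>

definition coercive where
  "coercive c \<longleftrightarrow> 0 \<le> c \<and> (\<forall>A::real^'n^'n. (norm A)\<^sup>2 \<le> c * nsq M (\<lambda>x. A *v x))"

lemma coerciveI:
  assumes "0 \<le> c" "\<And>a. (norm a)\<^sup>2 \<le> c * nsq M (\<lambda>x. a \<bullet> x)"
  shows "coercive c"
  unfolding coercive_def norm_vec_sq[of "_ :: real^'n^'n"] nsq_matrix_vector sum_distrib_left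
  using assms by (auto intro!: sum_mono)

lemma growth_coercive: "growth_constants \<phi> C C' \<Longrightarrow> coercive ((C - 1) / 2)"
  using linear_coercive by (intro coerciveI) (auto simp: growth_constants_def)

lemma nsq_matrix_vector_le: "nsq M (\<lambda>x. A *v x) \<le> (norm A)\<^sup>2 * nsq M (\<lambda>x. x)" for A :: "real^'n^'n"
proof -
  have "nsq M (\<lambda>x. A $ i \<bullet> x) \<le> (norm (A $ i))\<^sup>2 * nsq M (\<lambda>x. x)" for i
  proof -
    have "nsq M (\<lambda>x. A $ i \<bullet> x) \<le> nsq M (\<lambda>x. norm (A $ i) *\<^sub>R x)"
      using Cauchy_Schwarz_ineq2[of "A $ i"] by (intro nsq_mono sq_int_scaleR id_sq_int) simp
    then show ?thesis by (simp only: nsq_scaleR)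
  qed
  then show ?thesis unfolding nsq_matrix_vector norm_vec_sq[of A] sum_distrib_right by (intro sum_mono)
qed

text \<open>The general projection only gives a residual and approximating rotations. Coercivity
  makes the matrices of these a Cauchy sequence, and the limit matrix is skew.\<close>

lemma rotation_projection_exists:
  assumes co: "coercive c" and f: "sq_int M f"
  obtains A where "A \<in> skew" "\<And>B. B \<in> skew \<Longrightarrow> ip M (\<lambda>x. f x - A *v x) (\<lambda>x. B *v x) = 0"
proof -
  have c0: "0 \<le> c" and cn: "(norm A)\<^sup>2 \<le> c * nsq M (\<lambda>x. A *v x)" for A :: "real^'n^'n"
    using co by (auto simp: coercive_def)
  obtain r k where r: "sq_int M r" and k: "\<And>n::nat. k n \<in> (rotations :: (real^'n \<Rightarrow> real^'n) set)"
    and lim: "(\<lambda>n. nsq M (\<lambda>x. (f x - k n x) - r x)) \<longlonglongrightarrow> 0"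
    and orth: "\<And>k. k \<in> rotations \<Longrightarrow> ip M r k = 0"
  proof (rule sq_int_projection[of M f "rotations :: (real^'n \<Rightarrow> real^'n) set"])
    show "sq_int M f" by (rule f)
    show "sq_int M h" if "h \<in> rotations" for h
      using that by (auto simp: rotations_iff intro: matrix_vector_sq_int)
    show "(\<lambda>x. 0) \<in> rotations"
      unfolding rotations_iff using skew_zero by (intro bexI[of _ 0]) auto
    show "(\<lambda>x. h x + k x) \<in> rotations" if hk: "h \<in> rotations" "k \<in> rotations" for h k :: "real^'n \<Rightarrow> real^'n"
    proof -
      obtain A B where AB: "A \<in> skew" "B \<in> skew" "h = (\<lambda>x. A *v x)" "k = (\<lambda>x. B *v x)"
        using hk unfolding rotations_iff by blast
      show ?thesis unfolding rotations_iff AB using skew_add[OF AB(1,2)]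
        by (intro bexI[of _ "A + B"]) (simp_all add: fun_eq_iff matrix_vector_mult_add_rdistrib)
    qed
    show "(\<lambda>x. c *\<^sub>R h x) \<in> rotations" if h: "h \<in> rotations" for h :: "real^'n \<Rightarrow> real^'n" and c
    proof -
      obtain A where A: "A \<in> skew" "h = (\<lambda>x. A *v x)" using h unfolding rotations_iff by blast
      show ?thesis unfolding rotations_iff A using skew_scaleR[OF A(1)]
        by (intro bexI[of _ "c *\<^sub>R A"]) (simp_all add: fun_eq_iff scaleR_matrix_vector_assoc)
    qed
    fix r k assume "sq_int M r" "\<And>n::nat. k n \<in> (rotations :: (real^'n \<Rightarrow> real^'n) set)"
      "(\<lambda>n. nsq M (\<lambda>x. (f x - k n x) - r x)) \<longlonglongrightarrow> 0" "\<And>k. k \<in> rotations \<Longrightarrow> ip M r k = 0"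
    then show thesis by (rule that)
  qed
  have "\<forall>n. \<exists>A. A \<in> skew \<and> k n = (\<lambda>x. A *v x)"
    using k unfolding rotations_iff by blast
  from choice[OF this] obtain A where "\<forall>n. A n \<in> skew \<and> k n = (\<lambda>x. A n *v x)" ..
  then have A: "\<And>n. A n \<in> skew" "\<And>n. k n = (\<lambda>x. A n *v x)" by auto
  define d where "d n = nsq M (\<lambda>x. (f x - A n *v x) - r x)" for n
  have d: "d \<longlonglongrightarrow> 0" unfolding d_def using lim by (simp add: A)
  have sd: "sq_int M (\<lambda>x. (f x - A n *v x) - r x)" for n
    by (intro sq_int_diff f r matrix_vector_sq_int)
  have bound: "(norm (A m - A n))\<^sup>2 \<le> c * (2 * d m + 2 * d n)" for m n
  proof -
    have "nsq M (\<lambda>x. ((f x - A n *v x) - r x) + (-1) *\<^sub>R ((f x - A m *v x) - r x)) \<le> 2 * d n + 2 * nsq M (\<lambda>x. (-1) *\<^sub>R ((f x - A m *v x) - r x))"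
      unfolding d_def by (intro nsq_add_le sq_int_scaleR sd)
    moreover have "((f x - A n *v x) - r x) + (-1) *\<^sub>R ((f x - A m *v x) - r x) = (A m - A n) *v x" for x
      by (simp add: matrix_vector_mult_diff_rdistrib)
    ultimately have "nsq M (\<lambda>x. (A m - A n) *v x) \<le> 2 * d n + 2 * d m"
      unfolding nsq_scaleR by (simp add: d_def)
    then have "c * nsq M (\<lambda>x. (A m - A n) *v x) \<le> c * (2 * d m + 2 * d n)"
      using c0 by (intro mult_left_mono) auto
    then show ?thesis using cn[of "A m - A n"] by linarith
  qed
  have "Cauchy A"
  proof (rule CauchyI)
    fix e :: real assume e: "0 < e"
    have "(\<lambda>n. c * (4 * d n)) \<longlonglongrightarrow> c * (4 * 0)" by (intro tendsto_intros d)
    then have "\<forall>\<^sub>F n in sequentially. c * (4 * d n) < e\<^sup>2" using e by (intro order_tendstoD(2)) auto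
    then obtain N where N: "\<And>n. n \<ge> N \<Longrightarrow> c * (4 * d n) < e\<^sup>2" by (auto simp: eventually_sequentially)
    have "norm (A m - A n) < e" if "m \<ge> N" "n \<ge> N" for m n
    proof -
      have "(norm (A m - A n))\<^sup>2 < e\<^sup>2"
        using bound[of m n] N[OF that(1)] N[OF that(2)] by (simp add: algebra_simps)
      then show ?thesis by (rule power2_less_imp_less) (use e in simp)
    qed
    then show "\<exists>N. \<forall>m\<ge>N. \<forall>n\<ge>N. norm (A m - A n) < e" by blast
  qed
  then obtain A' where A': "A \<longlonglongrightarrow> A'" using Cauchy_convergent convergent_def by blast
  have skew': "A' \<in> skew"
  proof (rule skewI)
    fix i j
    have 1: "(\<lambda>n. A n $ j $ i) \<longlonglongrightarrow> A' $ j $ i" by (intro tendsto_vec_nth A')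
    have "(\<lambda>n. - A n $ i $ j) \<longlonglongrightarrow> - A' $ i $ j" by (intro tendsto_minus tendsto_vec_nth A')
    moreover have "(\<lambda>n. A n $ j $ i) = (\<lambda>n. - A n $ i $ j)" using A(1) skewD by blast
    ultimately show "A' $ j $ i = - A' $ i $ j" using 1 LIMSEQ_unique by metis
  qed
  have limA: "(\<lambda>n. nsq M (\<lambda>x. (f x - A n *v x) - (f x - A' *v x))) \<longlonglongrightarrow> 0"
  proof (rule tendsto_sandwich[OF _ _ tendsto_const])
    have "(\<lambda>n. (norm (A n - A'))\<^sup>2 * nsq M (\<lambda>x. x)) \<longlonglongrightarrow> (norm (A' - A'))\<^sup>2 * nsq M (\<lambda>x. x)"
      by (intro tendsto_intros A')
    then show "(\<lambda>n. (norm (A n - A'))\<^sup>2 * nsq M (\<lambda>x. x)) \<longlonglongrightarrow> 0" by simp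
    have "nsq M (\<lambda>x. (f x - A n *v x) - (f x - A' *v x)) \<le> (norm (A n - A'))\<^sup>2 * nsq M (\<lambda>x. x)" for n
    proof -
      have "nsq M (\<lambda>x. (f x - A n *v x) - (f x - A' *v x)) = nsq M (\<lambda>x. (A' - A n) *v x)"
        by (simp add: matrix_vector_mult_diff_rdistrib)
      then show ?thesis using nsq_matrix_vector_le[of "A' - A n"] by (simp add: norm_minus_commute)
    qed
    then show "\<forall>\<^sub>F n in sequentially. nsq M (\<lambda>x. (f x - A n *v x) - (f x - A' *v x)) \<le> (norm (A n - A'))\<^sup>2 * nsq M (\<lambda>x. x)"
      by (intro always_eventually allI)
  qed (intro always_eventually allI nsq_nonneg)
  show thesis
  proof (rule that[OF skew'])
    fix B :: "real^'n^'n" assume B: "B \<in> skew"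
    note s = sq_int_diff[OF f matrix_vector_sq_int]
    have 1: "(\<lambda>n. ip M (\<lambda>x. f x - A n *v x) (\<lambda>x. B *v x)) \<longlonglongrightarrow> ip M (\<lambda>x. f x - A' *v x) (\<lambda>x. B *v x)"
      by (rule nsq_tendsto_ip[OF s s matrix_vector_sq_int limA])
    have 2: "(\<lambda>n. ip M (\<lambda>x. f x - A n *v x) (\<lambda>x. B *v x)) \<longlonglongrightarrow> ip M r (\<lambda>x. B *v x)"
      using d unfolding d_def by (rule nsq_tendsto_ip[OF s r matrix_vector_sq_int])
    have "ip M r (\<lambda>x. B *v x) = 0" using orth B unfolding rotations_iff by blast
    then show "ip M (\<lambda>x. f x - A' *v x) (\<lambda>x. B *v x) = 0" using LIMSEQ_unique[OF 1 2] by simp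
  qed
qed

text \<open>The centre of mass is 0, so constants are orthogonal to rotations; therefore the
  projection of \<open>u\<close>, as used in \<open>proj_rot\<close>, is also the one of
  \<open>u\<close> minus its mean.\<close>

lemma proj_rotE:
  assumes co: "coercive c" and u: "sq_int M u"
  obtains B where "B \<in> skew" "proj_rot \<phi> u = (\<lambda>x. B *v x)"
    "\<And>A. A \<in> skew \<Longrightarrow> nsq M (\<lambda>x. u x - mean \<phi> u - A *v x)
        = nsq M (\<lambda>x. u x - mean \<phi> u - B *v x) + nsq M (\<lambda>x. (B - A) *v x)"
    "(INF R\<in>rotations. L2sq \<phi> (\<lambda>x. u x - mean \<phi> u - R x)) = L2sq \<phi> (\<lambda>x. u x - mean \<phi> u - B *v x)"
proof -
  define m where "m = mean \<phi> u"
  obtain B where B: "B \<in> skew" and o: "\<And>A. A \<in> skew \<Longrightarrow> ip M (\<lambda>x. u x - B *v x) (\<lambda>x. A *v x) = 0"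
    using rotation_projection_exists[OF co u] by blast
  have om: "ip M (\<lambda>x. m) (\<lambda>x. A *v x) = 0" for A :: "real^'n^'n"
  proof -
    have "(\<integral>x. A *v x \<partial>M) = A *v (\<integral>x. x \<partial>M)"
      by (rule integral_bounded_linear[OF matrix_vector_mul_bounded_linear id_integrable])
    then show ?thesis using ip_const[OF matrix_vector_sq_int, of A m] by (simp add: ip_commute id_mean)
  qed
  have o': "ip M (\<lambda>x. (u x - m) - B *v x) (\<lambda>x. A *v x) = 0" if "A \<in> skew" for A
  proof -
    have "ip M (\<lambda>x. (u x - B *v x) - m) (\<lambda>x. A *v x) = 0"
      using ip_diff_left[OF sq_int_diff[OF u matrix_vector_sq_int] sq_int_const matrix_vector_sq_int, of B m A]
        o[OF that] om by simp
    then show ?thesis by (simp add: algebra_simps)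
  qed
  define V where "V = (rotations :: (real^'n \<Rightarrow> real^'n) set)"
  have Vs: "sq_int M v" if "v \<in> V" for v
    using that unfolding V_def rotations_iff by (auto intro: matrix_vector_sq_int)
  have Vd: "(\<lambda>x. v x - v' x) \<in> V" if vv: "v \<in> V" "v' \<in> V" for v v'
  proof -
    obtain A A' where AB: "A \<in> skew" "A' \<in> skew" "v = (\<lambda>x. A *v x)" "v' = (\<lambda>x. A' *v x)"
      using vv unfolding V_def rotations_iff by blast
    show ?thesis unfolding V_def rotations_iff AB using skew_diff[OF AB(1,2)]
      by (intro bexI[of _ "A - A'"]) (simp_all add: fun_eq_iff matrix_vector_mult_diff_rdistrib)
  qed
  have V0: "v = (\<lambda>x. 0)" if v: "v \<in> V" "nsq M v = 0" for v
  proof -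
    obtain A where A: "v = (\<lambda>x. A *v x)" using v(1) unfolding V_def rotations_iff by blast
    have "(norm A)\<^sup>2 \<le> c * nsq M (\<lambda>x. A *v x)" using co by (simp add: coercive_def)
    then have "(norm A)\<^sup>2 \<le> 0" using v(2) unfolding A by simp
    then show ?thesis by (simp add: A)
  qed
  have P: "(\<lambda>x. B *v x) \<in> V" unfolding V_def rotations_iff using B by blast
  have Vo: "ip M (\<lambda>x. u x - B *v x) q = 0" "ip M (\<lambda>x. (u x - m) - B *v x) q = 0" if q: "q \<in> V" for q
  proof -
    obtain A where A: "A \<in> skew" "q = (\<lambda>x. A *v x)" using q unfolding V_def rotations_iff by blast
    show "ip M (\<lambda>x. u x - B *v x) q = 0" "ip M (\<lambda>x. (u x - m) - B *v x) q = 0"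
      unfolding A(2) by (rule o[OF A(1)], rule o'[OF A(1)])
  qed
  have um: "sq_int M (\<lambda>x. u x - m)" by (intro sq_int_diff u sq_int_const)
  show thesis
  proof (rule that[OF B])
    show "proj_rot \<phi> u = (\<lambda>x. B *v x)"
      unfolding proj_rot_def V_def[symmetric] by (rule L2_projI(1)[OF u Vs Vd V0 P Vo(1)])
    show "nsq M (\<lambda>x. u x - mean \<phi> u - A *v x)
        = nsq M (\<lambda>x. u x - mean \<phi> u - B *v x) + nsq M (\<lambda>x. (B - A) *v x)" if A: "A \<in> skew" for A
    proof -
      have AV: "(\<lambda>x. A *v x) \<in> V" unfolding V_def rotations_iff using A by blast
      show ?thesis
        unfolding m_def[symmetric] matrix_vector_mult_diff_rdistrib
        by (rule L2_projI(2)[OF um Vs Vd V0 P Vo(2) AV])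
    qed
    show "(INF R\<in>rotations. L2sq \<phi> (\<lambda>x. u x - mean \<phi> u - R x)) = L2sq \<phi> (\<lambda>x. u x - mean \<phi> u - B *v x)"
      unfolding V_def[symmetric] m_def[symmetric] by (rule L2_projI(3)[OF um Vs Vd V0 P Vo(2)])
  qed
qed

lemma weak_jacobian_matrix: "weak_jacobian (\<lambda>x. A *v x) (\<lambda>x. A)" for A :: "real^'n^'n"
  unfolding weak_jacobian_def
proof (intro conjI ballI allI)
  show "locally_integrable (\<lambda>x. A *v x)" by (rule sq_int_loc_int[OF matrix_vector_sq_int])
  show "locally_integrable (\<lambda>x::real^'n. A)" by (rule sq_int_loc_int) simp
  fix \<psi> :: "real^'n \<Rightarrow> real" and i j :: 'n assume \<psi>: "\<psi> \<in> test_functions"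
  have C: "Ck 1 (\<lambda>x::real^'n. A $ i \<bullet> x)"
    unfolding inner_vec_def inner_real_def by (intro Ck_sum Ck_cmult Ck_coord)
  have p: "pd j (\<lambda>x. A $ i \<bullet> x) = (\<lambda>x. A $ i $ j)"
    by (intro ext) (subst pd_has_derivative[of _ "\<lambda>v. A $ i \<bullet> v"], auto intro!: derivative_eq_intros simp: inner_axis)
  have "(\<integral>x. pd j \<psi> x * (A $ i \<bullet> x) \<partial>lborel) = - (\<integral>x. \<psi> x * pd j (\<lambda>x. A $ i \<bullet> x) x \<partial>lborel)"
    by (intro integral_by_parts C test_Ck test_bsupp \<psi>)
  then show "(\<integral>x. (A *v x) $ i * pd j \<psi> x \<partial>lborel) = - (\<integral>x. A $ i $ j * \<psi> x \<partial>lborel)"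
    by (simp add: matrix_vector_nth p mult.commute)
qed

lemma weak_jacobian_diff:
  fixes u v :: "real^'n \<Rightarrow> real^'n"
  assumes u: "weak_jacobian u G" and v: "weak_jacobian v H"
  shows "weak_jacobian (\<lambda>x. u x - v x) (\<lambda>x. G x - H x)"
  unfolding weak_jacobian_def
proof (intro conjI ballI allI)
  show "locally_integrable (\<lambda>x. u x - v x)" "locally_integrable (\<lambda>x. G x - H x)"
    using u v by (auto simp: weak_jacobian_def intro: locally_integrable_diff)
  fix \<psi> :: "real^'n \<Rightarrow> real" and i j :: 'n assume \<psi>: "\<psi> \<in> test_functions"
  have l: "locally_integrable (\<lambda>x. u x $ i)" "locally_integrable (\<lambda>x. v x $ i)"
      "locally_integrable (\<lambda>x. G x $ i $ j)" "locally_integrable (\<lambda>x. H x $ i $ j)"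
    using u v by (auto simp: weak_jacobian_def intro!: locally_integrable_nth)
  note i = loc_int_mult_continuous[OF _ test_continuous[OF \<psi>] test_bsupp[OF \<psi>]]
    and ip = loc_int_mult_continuous[OF _ test_continuous[OF test_pd[OF \<psi>]] test_bsupp[OF test_pd[OF \<psi>]]]
  show "(\<integral>x. (u x - v x) $ i * pd j \<psi> x \<partial>lborel) = - (\<integral>x. (G x - H x) $ i $ j * \<psi> x \<partial>lborel)"
    using u v \<psi> ip[OF l(1), of j] ip[OF l(2), of j] i[OF l(3)] i[OF l(4)]
    by (simp add: weak_jacobian_def left_diff_distrib)
qed

text \<open>\<open>weak_D\<close> of a difference is again an arbitrary choice and equals the
  difference of Jacobians only almost everywhere, which is all that \<open>L2sq\<close> sees. The
  infimum thus becomes one over constant skew matrices.\<close>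

lemma korn_INF:
  assumes u: "u \<in> H1 \<phi>"
  shows "(INF R\<in>rotations. L2sq \<phi> (weak_D (\<lambda>x. u x - R x)))
    = L2sq \<phi> (\<lambda>x. weak_D u x - proj_skew \<phi> (weak_D u) x)"
proof -
  note uD = H1_weak_D[OF u]
  have eq: "L2sq \<phi> (weak_D (\<lambda>x. u x - A *v x)) = L2sq \<phi> (\<lambda>x. weak_D u x - A)" for A :: "real^'n^'n"
  proof -
    have J: "weak_jacobian (\<lambda>x. u x - A *v x) (\<lambda>x. weak_D u x - A)"
      by (rule weak_jacobian_diff[OF uD(2) weak_jacobian_matrix])
    have "weak_jacobian (\<lambda>x. u x - A *v x) (weak_D (\<lambda>x. u x - A *v x))"
      unfolding weak_D_def by (rule someI[of "weak_jacobian (\<lambda>x. u x - A *v x)", OF J])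
    from weak_jacobian_unique[OF this J]
    have "AE x in M. weak_D (\<lambda>x. u x - A *v x) x = weak_D u x - A" by (simp add: AE_M)
    then show ?thesis unfolding L2sq_def
      by (intro nn_integral_cong_AE) (auto elim!: eventually_mono)
  qed
  have rot: "rotations = (\<lambda>A. (\<lambda>x::real^'n. A *v x)) ` skew" unfolding rotations_def by blast
  have "(INF R\<in>rotations. L2sq \<phi> (weak_D (\<lambda>x. u x - R x))) = (INF A\<in>skew. L2sq \<phi> (\<lambda>x. weak_D u x - A))"
    unfolding rot image_image eq ..
  then show ?thesis using proj_skew_INF[OF uD(3)] by (simp add: proj_skew_eq[OF uD(3)])
qed

section \<open>The Poincare-Korn inequalities\<close>

lemma wpd_affine_part:
  fixes u :: "real^'n \<Rightarrow> real^'n" and A :: "real^'n^'n"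
  assumes J: "weak_jacobian u G" and u: "sq_int M u" and G: "sq_int M G"
  shows "wpd j (\<lambda>x. (u x - m - A *v x) $ i) (\<lambda>x. (G x - A) $ i $ j)"
proof -
  have "wpd j (\<lambda>x. u x $ i - m $ i - A $ i \<bullet> x) (\<lambda>x. G x $ i $ j - 0 - A $ i $ j)"
    by (intro wpd_diff wpd_linear wpd_jacobian J u G wpd_const)
  then show ?thesis by (simp add: matrix_vector_nth)
qed

text \<open>A linear field has mean 0 for a centred measure, so the affine correction leaves a field
  of mean 0 and the Poincare inequality applies to each component.\<close>

lemma poincare_affine_part:
  fixes u :: "real^'n \<Rightarrow> real^'n" and A :: "real^'n^'n"
  assumes J: "weak_jacobian u G" and u: "sq_int M u" and G: "sq_int M G"
  shows "nsq M (\<lambda>x. u x - mean \<phi> u - A *v x) \<le> P * nsq M (\<lambda>x. G x - A)"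
proof -
  define v where "v x = u x - mean \<phi> u - A *v x" for x
  have sv: "sq_int M v" unfolding v_def by (intro sq_int_diff u sq_int_const matrix_vector_sq_int)
  have sG: "sq_int M (\<lambda>x. G x - A)" by (intro sq_int_diff G sq_int_const)
  have wv: "wpd j (\<lambda>x. v x $ i) (\<lambda>x. (G x - A) $ i $ j)" for i j
    unfolding v_def by (rule wpd_affine_part[OF J u G])
  have m0: "(\<integral>x. v x $ i \<partial>M) = 0" for i
  proof -
    have iu: "integrable M u" by (rule sq_int_imp_integrable[OF u])
    have iu': "integrable M (\<lambda>x. u x $ i)" by (rule integrable_bounded_linear[OF bounded_linear_vec_nth iu])
    have "(\<integral>x. u x $ i \<partial>M) = mean \<phi> u $ i"
      unfolding mean_eq by (rule integral_bounded_linear[OF bounded_linear_vec_nth iu])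
    then show ?thesis
      using iu' sq_int_imp_integrable[OF linear_sq_int[of "A $ i"]] linear_mean[of "A $ i"]
      by (simp add: v_def matrix_vector_nth)
  qed
  have "nsq M v = (\<Sum>i\<in>UNIV. nsq M (\<lambda>x. v x $ i))" by (rule nsq_vec[OF sv])
  also have "\<dots> \<le> (\<Sum>i\<in>UNIV. P * (\<Sum>j\<in>UNIV. nsq M (\<lambda>x. (G x - A) $ i $ j)))"
    using poincare_wpd[OF wv] by (intro sum_mono) (simp add: m0)
  also have "\<dots> = P * nsq M (\<lambda>x. G x - A)"
    by (simp add: nsq_matrix[OF sG] sum_distrib_left)
  finally show ?thesis unfolding v_def .
qed

text \<open>The field is corrected by the best rotation \<open>B\<close>, whereas Korn's inequality
  controls the Jacobian minus the best skew matrix \<open>A\<close>. Pythagoras for rotations and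
  \<open>poincare_affine_part\<close> bound the field (B - A) x together with \<open>v\<close>, and
  coercivity bounds the matrix A - B by that field.\<close>

lemma strong_estimate:
  fixes u :: "real^'n \<Rightarrow> real^'n"
  assumes growth: "growth_constants \<phi> C C'"
    and J: "weak_jacobian u G" and u: "sq_int M u" and G: "sq_int M G"
    and B: "B \<in> skew" "\<And>A. A \<in> skew \<Longrightarrow> nsq M (\<lambda>x. u x - mean \<phi> u - A *v x)
        = nsq M (\<lambda>x. u x - mean \<phi> u - B *v x) + nsq M (\<lambda>x. (B - A) *v x)"
  shows "sq_int M (\<lambda>x. sqrt (1 + (norm (grad \<phi> x))\<^sup>2) *\<^sub>R (u x - mean \<phi> u - B *v x))"
    and "nsq M (\<lambda>x. sqrt (1 + (norm (grad \<phi> x))\<^sup>2) *\<^sub>R (u x - mean \<phi> u - B *v x))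
      \<le> C * (1 + 4 * P) * nsq M (\<lambda>x. G x - skew_part (\<integral>y. G y \<partial>M))"
proof -
  define A where "A = skew_part (\<integral>y. G y \<partial>M)"
  define K where "K = nsq M (\<lambda>x. G x - A)"
  define v where "v x = u x - mean \<phi> u - B *v x" for x
  have C: "8 < C" using growth by (simp add: growth_constants_def)
  have A: "A \<in> skew" by (simp add: A_def skew_part_skew)
  have sv: "sq_int M v" unfolding v_def by (intro sq_int_diff u sq_int_const matrix_vector_sq_int)
  have vm: "v \<in> borel_measurable borel" using sq_int_measurable[OF sv] by simp
  have wv: "wpd j (\<lambda>x. v x $ i) (\<lambda>x. (G x - B) $ i $ j)" for i j
    unfolding v_def by (rule wpd_affine_part[OF J u G])
  note gw = grad_weight_wpd[OF growth wv]
  have sgv: "sq_int M (\<lambda>x. norm (grad \<phi> x) *\<^sub>R v x)"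
  proof -
    have "sq_int M (\<lambda>x. \<chi> i. norm (grad \<phi> x) * v x $ i)" by (intro sq_int_vec gw)
    also have "(\<lambda>x. \<chi> i. norm (grad \<phi> x) * v x $ i) = (\<lambda>x. norm (grad \<phi> x) *\<^sub>R v x)"
      by (simp add: fun_eq_iff vec_eq_iff)
    finally show ?thesis .
  qed
  have pt: "(norm (sqrt (1 + (norm (grad \<phi> x))\<^sup>2) *\<^sub>R v x))\<^sup>2 = (norm (v x))\<^sup>2 + (norm (norm (grad \<phi> x) *\<^sub>R v x))\<^sup>2" for x
    by (simp add: power_mult_distrib algebra_simps)
  have "(\<lambda>x. sqrt (1 + (norm (grad \<phi> x))\<^sup>2) *\<^sub>R v x) \<in> borel_measurable borel"
    using vm by measurable
  then show "sq_int M (\<lambda>x. sqrt (1 + (norm (grad \<phi> x))\<^sup>2) *\<^sub>R (u x - mean \<phi> u - B *v x))"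
    unfolding v_def[symmetric] sq_int_def pt
    using sq_int_integrable[OF sv] sq_int_integrable[OF sgv] by simp
  have sGB: "sq_int M (\<lambda>x. G x - B)" by (intro sq_int_diff G sq_int_const)
  have "nsq M (\<lambda>x. sqrt (1 + (norm (grad \<phi> x))\<^sup>2) *\<^sub>R v x) = nsq M v + nsq M (\<lambda>x. norm (grad \<phi> x) *\<^sub>R v x)"
    unfolding nsq_def pt using sq_int_integrable[OF sv] sq_int_integrable[OF sgv] by simp
  also have "nsq M (\<lambda>x. norm (grad \<phi> x) *\<^sub>R v x) = (\<Sum>i\<in>UNIV. nsq M (\<lambda>x. norm (grad \<phi> x) * v x $ i))"
    using nsq_vec[OF sgv] by simp
  also have "\<dots> \<le> (\<Sum>i\<in>UNIV. 8 * (\<Sum>j\<in>UNIV. nsq M (\<lambda>x. (G x - B) $ i $ j)) + (C - 1) / 2 * nsq M (\<lambda>x. v x $ i))"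
    by (intro sum_mono gw)
  also have "\<dots> = 8 * nsq M (\<lambda>x. G x - B) + (C - 1) / 2 * nsq M v"
    by (simp add: sum.distrib nsq_matrix[OF sGB] nsq_vec[OF sv] sum_distrib_left)
  finally have 1: "nsq M (\<lambda>x. sqrt (1 + (norm (grad \<phi> x))\<^sup>2) *\<^sub>R v x)
      \<le> 8 * nsq M (\<lambda>x. G x - B) + (C + 1) / 2 * nsq M v" by (simp add: field_simps)
  have 2: "nsq M (\<lambda>x. G x - B) = K + (norm (A - B))\<^sup>2"
  proof -
    have "nsq M (\<lambda>x. (G x - A) + (A - B)) = K + 2 * ip M (\<lambda>x. G x - A) (\<lambda>x. A - B) + nsq M (\<lambda>x. A - B)"
      unfolding K_def by (intro nsq_add sq_int_diff G sq_int_const)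
    moreover have "ip M (\<lambda>x. G x - A) (\<lambda>x. A - B) = 0"
      unfolding A_def by (intro proj_skew_orth G skew_diff skew_part_skew B)
    ultimately show ?thesis by (simp add: nsq_const)
  qed
  define d where "d = nsq M (\<lambda>x. (B - A) *v x)"
  have "coercive ((C - 1) / 2)" by (rule growth_coercive[OF growth])
  then have 3: "(norm (A - B))\<^sup>2 \<le> (C - 1) / 2 * d"
    unfolding coercive_def d_def by (metis norm_minus_commute)
  have 4: "nsq M v + d \<le> P * K"
    using B(2)[OF A] poincare_affine_part[OF J u G, of A] unfolding v_def d_def K_def by simp
  have nn: "0 \<le> nsq M v" "0 \<le> d" "0 \<le> K" by (simp_all add: d_def K_def)
  have "8 * nsq M (\<lambda>x. G x - B) + (C + 1) / 2 * nsq M v \<le> 8 * K + 4 * (C - 1) * d + (C + 1) / 2 * nsq M v"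
    using 2 3 by (simp add: algebra_simps)
  \<comment> \<open>With the common factor 4 C, the terms \<open>d\<close> and
    \<open>nsq M v\<close> can be estimated jointly by step \<open>4\<close>;
    \<open>8 * K \<le> C * K\<close> is the condition 8 < C.\<close>
  also have "\<dots> \<le> C * K + (4 * C) * d + (4 * C) * nsq M v"
  proof -
    have "8 * K \<le> C * K" using C nn by (intro mult_right_mono) auto
    moreover have "4 * (C - 1) * d \<le> (4 * C) * d" using nn by (intro mult_right_mono) auto
    moreover have "(C + 1) / 2 * nsq M v \<le> (4 * C) * nsq M v" using C nn by (intro mult_right_mono) auto
    ultimately show ?thesis by linarith
  qed
  also have "\<dots> = C * K + (4 * C) * (nsq M v + d)" by (simp add: algebra_simps)
  also have "\<dots> \<le> C * K + (4 * C) * (P * K)"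
    using C by (intro add_left_mono mult_left_mono 4) auto
  also have "\<dots> = C * (1 + 4 * P) * K" by (simp add: algebra_simps)
  finally show "nsq M (\<lambda>x. sqrt (1 + (norm (grad \<phi> x))\<^sup>2) *\<^sub>R (u x - mean \<phi> u - B *v x))
      \<le> C * (1 + 4 * P) * nsq M (\<lambda>x. G x - skew_part (\<integral>y. G y \<partial>M))"
    using 1 unfolding v_def K_def A_def by linarith
qed

lemma bounds_nonneg:
  assumes "growth_constants \<phi> C C'"
  shows "0 \<le> korn_bound P C C'" "0 \<le> poincare_korn_bound P C C'" "0 \<le> strong_poincare_korn_bound P C C'"
proof -
  have C: "8 < C" "C < C'" using assms by (auto simp: growth_constants_def)
  have "0 \<le> P * C'" using C P_nonneg by simp
  then show k: "0 \<le> korn_bound P C C'" by (simp add: korn_bound_def)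
  show "0 \<le> poincare_korn_bound P C C'" "0 \<le> strong_poincare_korn_bound P C C'"
    using k C P_nonneg by (simp_all add: poincare_korn_bound_def strong_poincare_korn_bound_def)
qed

lemma korn_all:
  assumes growth: "growth_constants \<phi> C C'"
  shows "korn \<phi> (korn_bound P C C')" "poincare_korn \<phi> (poincare_korn_bound P C C')"
    "strong_poincare_korn \<phi> (strong_poincare_korn_bound P C C')"
proof -
  note nn = bounds_nonneg[OF growth]
  have C: "8 < C" using growth by (simp add: growth_constants_def)
  have *: "L2sq \<phi> (\<lambda>x. weak_D u x - proj_skew \<phi> (weak_D u) x) \<le> ennreal (korn_bound P C C') * L2sq \<phi> (weak_Ds u)"
    "L2sq \<phi> (centred \<phi> u) \<le> ennreal (poincare_korn_bound P C C') * L2sq \<phi> (weak_Ds u)"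
    "L2sq \<phi> (\<lambda>x. sqrt (1 + (norm (grad \<phi> x))\<^sup>2) *\<^sub>R centred \<phi> u x)
       \<le> ennreal (strong_poincare_korn_bound P C C') * L2sq \<phi> (weak_Ds u)"
    if u: "u \<in> H1 \<phi>" for u
  proof -
    define D where "D = weak_D u"
    note uD = H1_weak_D[OF u, folded D_def]
    define A where "A = skew_part (\<integral>y. D y \<partial>M)"
    define S where "S = nsq M (\<lambda>x. sym_part (D x))"
    define K where "K = nsq M (\<lambda>x. D x - A)"
    have A: "A \<in> skew" by (simp add: A_def skew_part_skew)
    have LS: "L2sq \<phi> (weak_Ds u) = ennreal S"
      unfolding S_def weak_Ds_eq D_def[symmetric] by (rule L2sq_eq[OF sym_sq_int[OF uD(3)]])
    have K: "K \<le> korn_bound P C C' * S"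
      unfolding K_def S_def A_def by (rule korn_estimate[OF growth uD(2,3)])
    have LK: "L2sq \<phi> (\<lambda>x. weak_D u x - proj_skew \<phi> (weak_D u) x) = ennreal K"
      unfolding D_def[symmetric] proj_skew_eq[OF uD(3)] A_def[symmetric] K_def
      by (intro L2sq_eq sq_int_diff uD sq_int_const)
    show "L2sq \<phi> (\<lambda>x. weak_D u x - proj_skew \<phi> (weak_D u) x) \<le> ennreal (korn_bound P C C') * L2sq \<phi> (weak_Ds u)"
      unfolding LK LS using K nn by (simp add: ennreal_mult'[symmetric] ennreal_leI)
    obtain B where B: "B \<in> skew" "proj_rot \<phi> u = (\<lambda>x. B *v x)"
      "\<And>A. A \<in> skew \<Longrightarrow> nsq M (\<lambda>x. u x - mean \<phi> u - A *v x)
        = nsq M (\<lambda>x. u x - mean \<phi> u - B *v x) + nsq M (\<lambda>x. (B - A) *v x)"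
    proof (rule proj_rotE[OF growth_coercive[OF growth] uD(1)])
      fix B
      assume "B \<in> skew" "proj_rot \<phi> u = (\<lambda>x. B *v x)"
        "\<And>A. A \<in> skew \<Longrightarrow> nsq M (\<lambda>x. u x - mean \<phi> u - A *v x)
          = nsq M (\<lambda>x. u x - mean \<phi> u - B *v x) + nsq M (\<lambda>x. (B - A) *v x)"
      then show thesis by (rule that)
    qed
    have ce: "centred \<phi> u = (\<lambda>x. u x - mean \<phi> u - B *v x)" by (simp add: centred_def fun_eq_iff B)
    have sc: "sq_int M (centred \<phi> u)" unfolding ce by (intro sq_int_diff uD sq_int_const matrix_vector_sq_int)
    have "nsq M (centred \<phi> u) \<le> nsq M (\<lambda>x. u x - mean \<phi> u - A *v x)"
      using B(3)[OF A] nsq_nonneg[of M "\<lambda>x. (B - A) *v x"] unfolding ce by linarith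
    also have "\<dots> \<le> P * K" unfolding K_def by (rule poincare_affine_part[OF uD(2,1,3)])
    also have "\<dots> \<le> P * (korn_bound P C C' * S)" by (intro mult_left_mono K P_nonneg)
    finally have "nsq M (centred \<phi> u) \<le> poincare_korn_bound P C C' * S"
      by (simp add: poincare_korn_bound_def mult_ac)
    then show "L2sq \<phi> (centred \<phi> u) \<le> ennreal (poincare_korn_bound P C C') * L2sq \<phi> (weak_Ds u)"
      unfolding L2sq_eq[OF sc] LS using nn by (simp add: ennreal_mult'[symmetric] ennreal_leI)
    note st = strong_estimate[OF growth uD(2,1,3) B(1,3)]
    have "nsq M (\<lambda>x. sqrt (1 + (norm (grad \<phi> x))\<^sup>2) *\<^sub>R centred \<phi> u x) \<le> C * (1 + 4 * P) * K"
      unfolding ce K_def A_def by (rule st(2))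
    also have "\<dots> \<le> C * (1 + 4 * P) * (korn_bound P C C' * S)"
      using C P_nonneg by (intro mult_left_mono K) auto
    finally have "nsq M (\<lambda>x. sqrt (1 + (norm (grad \<phi> x))\<^sup>2) *\<^sub>R centred \<phi> u x) \<le> strong_poincare_korn_bound P C C' * S"
      by (simp add: strong_poincare_korn_bound_def mult_ac)
    moreover have "L2sq \<phi> (\<lambda>x. sqrt (1 + (norm (grad \<phi> x))\<^sup>2) *\<^sub>R centred \<phi> u x)
        = ennreal (nsq M (\<lambda>x. sqrt (1 + (norm (grad \<phi> x))\<^sup>2) *\<^sub>R centred \<phi> u x))"
      unfolding ce by (rule L2sq_eq[OF st(1)])
    ultimately show "L2sq \<phi> (\<lambda>x. sqrt (1 + (norm (grad \<phi> x))\<^sup>2) *\<^sub>R centred \<phi> u x)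
       \<le> ennreal (strong_poincare_korn_bound P C C') * L2sq \<phi> (weak_Ds u)"
      unfolding LS using nn by (simp add: ennreal_mult'[symmetric] ennreal_leI)
  qed
  show "korn \<phi> (korn_bound P C C')" "poincare_korn \<phi> (poincare_korn_bound P C C')"
    "strong_poincare_korn \<phi> (strong_poincare_korn_bound P C C')"
    using nn * by (auto simp: korn_def poincare_korn_def strong_poincare_korn_def)
qed

text \<open>Dividing by \<open>s\<close> makes X / s a lower bound of all constants and hence of
  their infimum. The case \<open>s = 0\<close>, where division is meaningless, gives X = 0
  directly.\<close>

lemma Inf_ennreal_bound:
  assumes "S \<noteq> {}" "\<And>K. K \<in> S \<Longrightarrow> 0 \<le> K \<and> X \<le> ennreal K * ennreal s" "0 \<le> s"
  shows "X \<le> ennreal (Inf S) * ennreal s"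
proof (cases "s = 0")
  case True
  then show ?thesis using assms by auto
next
  case False
  then have s: "0 < s" using assms(3) by simp
  obtain K0 where K0: "K0 \<in> S" using assms(1) by blast
  have "X \<le> ennreal (K0 * s)" using assms(2)[OF K0] assms(3) by (simp add: ennreal_mult')
  then obtain x where x: "X = ennreal x" "0 \<le> x" by (cases X) (auto simp: top_unique)
  have "x / s \<le> K" if "K \<in> S" for K
  proof -
    have "ennreal x \<le> ennreal (K * s)" using assms(2)[OF that] assms(3) x by (simp add: ennreal_mult')
    moreover have "0 \<le> K * s" using assms(2)[OF that] assms(3) by simp
    ultimately have "x \<le> K * s" by simp
    then show ?thesis using s by (simp add: divide_le_eq)
  qed
  then have i: "x / s \<le> Inf S" by (intro cInf_greatest assms(1))
  then have "x \<le> Inf S * s" using s by (simp add: divide_le_eq)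
  moreover have "0 \<le> Inf S" using i x s by (meson divide_nonneg_pos order_trans)
  ultimately show ?thesis unfolding x using assms(3) by (simp add: ennreal_mult'[symmetric] ennreal_leI)
qed

lemma finite_Ds:
  assumes "u \<in> H1 \<phi>"
  obtains s where "0 \<le> s" "L2sq \<phi> (weak_Ds u) = ennreal s"
  by (rule that[of "nsq M (\<lambda>x. sym_part (weak_D u x))"])
     (simp_all add: weak_Ds_eq L2sq_eq[OF sym_sq_int[OF H1_weak_D(3)[OF assms]]])

text \<open>A constant that works for one pair C, C' need not lie below the bounds of the other
  pairs. The infimum of all bounds does, and the inequality passes to it for each field separately
  because the right-hand side is finite.\<close>

lemma Inf_constants:
  assumes ne: "\<exists>C C'. growth_constants \<phi> C C'"
    and Q: "\<And>K. Q K \<longleftrightarrow> 0 \<le> K \<and> (\<forall>u\<in>H1 \<phi>. X u \<le> ennreal K * L2sq \<phi> (weak_Ds u))"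
    and b: "\<And>C C'. growth_constants \<phi> C C' \<Longrightarrow> Q (b C C')"
  shows "\<exists>K. Q K \<and> (\<forall>C C'. growth_constants \<phi> C C' \<longrightarrow> K \<le> b C C')"
proof -
  define S where "S = {b C C' |C C'. growth_constants \<phi> C C'}"
  have S: "S \<noteq> {}" using ne by (auto simp: S_def)
  have SQ: "Q K" if K: "K \<in> S" for K
  proof -
    obtain C C' where "growth_constants \<phi> C C'" "K = b C C'" using K unfolding S_def by blast
    then show ?thesis using b by simp
  qed
  have S0: "0 \<le> K" if "K \<in> S" for K using SQ[OF that] unfolding Q by (rule conjunct1)
  have bdd: "bdd_below S" by (rule bdd_belowI[of _ 0]) (rule S0)
  have "Q (Inf S)"
    unfolding Q
  proof (intro conjI ballI)
    show "0 \<le> Inf S" by (rule cInf_greatest[OF S S0])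
    fix u assume u: "u \<in> H1 \<phi>"
    obtain s where s: "0 \<le> s" "L2sq \<phi> (weak_Ds u) = ennreal s" by (rule finite_Ds[OF u])
    show "X u \<le> ennreal (Inf S) * L2sq \<phi> (weak_Ds u)"
      unfolding s(2)
    proof (rule Inf_ennreal_bound[OF S _ s(1)])
      show "0 \<le> K \<and> X u \<le> ennreal K * ennreal s" if "K \<in> S" for K
        using SQ[OF that] u unfolding Q s(2)[symmetric] by blast
    qed
  qed
  moreover have "Inf S \<le> b C C'" if "growth_constants \<phi> C C'" for C C'
    using that by (intro cInf_lower bdd) (auto simp: S_def)
  ultimately show ?thesis by blast
qed

lemma constants_exist:
  assumes ne: "\<exists>C C'. growth_constants \<phi> C C'"
  shows "\<exists>CK CPK CSPK. korn \<phi> CK \<and> poincare_korn \<phi> CPK \<and> strong_poincare_korn \<phi> CSPK \<and>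
    (\<forall>C C'. growth_constants \<phi> C C' \<longrightarrow> CK \<le> korn_bound P C C' \<and>
       CPK \<le> poincare_korn_bound P C C' \<and> CSPK \<le> strong_poincare_korn_bound P C C')"
proof -
  have "\<exists>CK. korn \<phi> CK \<and> (\<forall>C C'. growth_constants \<phi> C C' \<longrightarrow> CK \<le> korn_bound P C C')"
    by (rule Inf_constants[OF ne korn_def korn_all(1)])
  then obtain CK where CK: "korn \<phi> CK" "\<forall>C C'. growth_constants \<phi> C C' \<longrightarrow> CK \<le> korn_bound P C C'"
    by blast
  have "\<exists>CPK. poincare_korn \<phi> CPK \<and> (\<forall>C C'. growth_constants \<phi> C C' \<longrightarrow> CPK \<le> poincare_korn_bound P C C')"
    by (rule Inf_constants[OF ne poincare_korn_def korn_all(2)])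
  then obtain CPK where CPK: "poincare_korn \<phi> CPK" "\<forall>C C'. growth_constants \<phi> C C' \<longrightarrow> CPK \<le> poincare_korn_bound P C C'"
    by blast
  have "\<exists>CSPK. strong_poincare_korn \<phi> CSPK \<and> (\<forall>C C'. growth_constants \<phi> C C' \<longrightarrow> CSPK \<le> strong_poincare_korn_bound P C C')"
    by (rule Inf_constants[OF ne strong_poincare_korn_def korn_all(3)])
  then obtain CSPK where CSPK: "strong_poincare_korn \<phi> CSPK" "\<forall>C C'. growth_constants \<phi> C C' \<longrightarrow> CSPK \<le> strong_poincare_korn_bound P C C'"
    by blast
  show ?thesis using CK CPK CSPK by (intro exI[of _ CK] exI[of _ CPK] exI[of _ CSPK]) blast
qed

end

section \<open>The Gaussian measure\<close>

lemma prod_two: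
  fixes f :: "'n::finite \<Rightarrow> real"
  assumes "i \<noteq> j" "\<And>k. k \<noteq> i \<Longrightarrow> k \<noteq> j \<Longrightarrow> f k = 1"
  shows "(\<Prod>k\<in>UNIV. f k) = f i * f j"
proof -
  have "(\<Prod>k\<in>UNIV. f k) = (\<Prod>k\<in>{i, j}. f k)"
    using assms(2) by (intro prod.mono_neutral_right) auto
  then show ?thesis using assms(1) by simp
qed

lemma sum_two:
  fixes f :: "'n::finite \<Rightarrow> real"
  assumes "i \<noteq> j" "\<And>k. k \<noteq> i \<Longrightarrow> k \<noteq> j \<Longrightarrow> f k = 0"
  shows "(\<Sum>k\<in>UNIV. f k) = f i + f j"
proof -
  have "(\<Sum>k\<in>UNIV. f k) = (\<Sum>k\<in>{i, j}. f k)"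
    using assms(2) by (intro sum.mono_neutral_right) auto
  then show ?thesis using assms(1) by simp
qed

lemma exp_gaussian: "exp (- gaussian x) = (\<Prod>i\<in>UNIV. std_normal_density (x $ i))" for x :: "real^'n::finite"
proof -
  define y where "y = exp (- (ln (2 * pi) / 2))"
  have y: "1 / sqrt (2 * pi) = y"
  proof -
    have "sqrt (2 * pi) = exp (ln (sqrt (2 * pi)))" by simp
    also have "ln (sqrt (2 * pi)) = ln (2 * pi) / 2" by (simp add: ln_sqrt)
    finally show ?thesis by (simp add: y_def exp_minus inverse_eq_divide)
  qed
  have "exp (- gaussian x) = exp (real CARD('n) * (- (ln (2 * pi) / 2))) * exp (- (norm x)\<^sup>2 / 2)"
    by (simp add: gaussian_def exp_add[symmetric] algebra_simps)
  also have "exp (real CARD('n) * (- (ln (2 * pi) / 2))) = y ^ CARD('n)"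
    unfolding y_def by (rule exp_of_nat_mult)
  also have "exp (- (norm x)\<^sup>2 / 2) = (\<Prod>i\<in>UNIV. exp (- (x $ i)\<^sup>2 / 2))"
    by (simp add: norm_vec_sq exp_sum[symmetric] sum_negf sum_divide_distrib)
  also have "y ^ CARD('n) * \<dots> = (\<Prod>i\<in>UNIV. y * exp (- (x $ i)\<^sup>2 / 2))"
    by (simp add: prod.distrib)
  finally show ?thesis by (simp add: std_normal_density_def y)
qed

text \<open>The double factorial (2k - 1)!!, the moment of order 2k of the standard normal
  distribution.\<close>

definition normal_moment :: "nat \<Rightarrow> real" where
  "normal_moment k = fact (2 * k) / (2 ^ k * fact k)"

text \<open>Even exponents keep the integrand nonnegative, so it factorizes by Tonelli. The moments
  of order 1 and the mixed second moments come from integration by parts instead.\<close>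

lemma gaussian_moment:
  fixes a :: "'n::finite \<Rightarrow> nat"
  shows "has_bochner_integral lborel (\<lambda>x::real^'n. exp (- gaussian x) * (\<Prod>i\<in>UNIV. (x $ i) ^ (2 * a i)))
    (\<Prod>i\<in>UNIV. normal_moment (a i))"
proof (rule has_bochner_integral_nn_integral)
  \<comment> \<open>Products of integrals over the Euclidean space range over basis vectors, so the
    exponents are transported from indices to these.\<close>
  define e :: "real^'n \<Rightarrow> nat" where "e b = a (SOME i. b = axis i 1)" for b
  define F where "F b t = std_normal_density t * t ^ (2 * e b)" for b :: "real^'n" and t
  have ea: "e (axis i 1) = a i" for i by (simp add: e_def axis_eq_axis)
  have B: "Basis = (\<lambda>i. axis i (1::real)) ` (UNIV :: 'n set)" by (auto simp: Basis_vec_def)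
  have inj: "inj (\<lambda>i::'n. axis i (1::real))" by (auto simp: inj_def axis_eq_axis)
  have eq: "exp (- gaussian x) * (\<Prod>i\<in>UNIV. (x $ i) ^ (2 * a i)) = (\<Prod>b\<in>Basis. F b (x \<bullet> b))" for x :: "real^'n"
    unfolding B by (simp add: prod.reindex[OF inj] F_def ea inner_axis exp_gaussian prod.distrib)
  have F0: "0 \<le> F b t" for b t
    by (simp add: F_def power_mult)
  have Fm [measurable]: "F b \<in> borel_measurable borel" for b unfolding F_def by measurable
  have "continuous_on UNIV (gaussian :: real^'n \<Rightarrow> real)"
    unfolding gaussian_def[abs_def] by (intro continuous_intros) auto
  then have [measurable]: "gaussian \<in> borel_measurable (borel :: (real^'n) measure)"
    by (rule borel_measurable_continuous_onI)
  show "(\<lambda>x::real^'n. exp (- gaussian x) * (\<Prod>i\<in>UNIV. (x $ i) ^ (2 * a i))) \<in> borel_measurable lborel"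
    by measurable
  show "AE x in lborel. 0 \<le> exp (- gaussian x) * (\<Prod>i\<in>UNIV. (x $ i) ^ (2 * a i))"
    by (intro AE_I2 mult_nonneg_nonneg prod_nonneg) (auto simp: zero_le_even_power)
  show "0 \<le> (\<Prod>i\<in>UNIV. normal_moment (a i))"
    by (intro prod_nonneg) (simp add: normal_moment_def)
  have "(\<integral>\<^sup>+x. ennreal (exp (- gaussian x) * (\<Prod>i\<in>UNIV. (x $ i) ^ (2 * a i))) \<partial>lborel)
      = (\<integral>\<^sup>+x. (\<Prod>b\<in>Basis. ennreal (F b (x \<bullet> b))) \<partial>(lborel :: (real^'n) measure))"
    unfolding eq by (simp add: prod_ennreal F0)
  also have "\<dots> = (\<Prod>b\<in>Basis. \<integral>\<^sup>+t. ennreal (F b t) \<partial>lborel)"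
    by (rule nn_integral_lborel_prod) auto
  also have "\<dots> = (\<Prod>b\<in>Basis. ennreal (normal_moment (e b)))"
  proof (rule prod.cong[OF refl])
    fix b :: "real^'n"
    have "has_bochner_integral lborel (F b) (normal_moment (e b))"
      unfolding F_def[abs_def] normal_moment_def by (rule std_normal_moment_even)
    then show "(\<integral>\<^sup>+t. ennreal (F b t) \<partial>lborel) = ennreal (normal_moment (e b))"
      using F0 by (subst nn_integral_eq_integral) (auto simp: has_bochner_integral_iff)
  qed
  also have "\<dots> = ennreal (\<Prod>i\<in>UNIV. normal_moment (a i))"
    unfolding B by (simp add: prod.reindex[OF inj] ea prod_ennreal normal_moment_def)
  finally show "(\<integral>\<^sup>+x. ennreal (exp (- gaussian x) * (\<Prod>i\<in>UNIV. (x $ i) ^ (2 * a i))) \<partial>lborel)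
      = ennreal (\<Prod>i\<in>UNIV. normal_moment (a i))" .
qed

lemma normal_moment_values: "normal_moment 0 = 1" "normal_moment 1 = 1" "normal_moment 2 = 3"
  by (simp_all add: normal_moment_def fact_numeral)

lemma gaussian_moment_two:
  fixes i j :: "'n::finite"
  assumes "i \<noteq> j"
  shows "has_bochner_integral lborel (\<lambda>x::real^'n. exp (- gaussian x) * ((x $ i) ^ (2 * p) * (x $ j) ^ (2 * q)))
    (normal_moment p * normal_moment q)"
proof -
  define a where "a k = (if k = i then p else if k = j then q else 0)" for k
  have "(\<Prod>k\<in>UNIV. (x $ k) ^ (2 * a k)) = (x $ i) ^ (2 * p) * (x $ j) ^ (2 * q)" for x :: "real^'n"
    by (subst prod_two[OF assms]) (use assms in \<open>auto simp: a_def\<close>)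
  moreover have "(\<Prod>k\<in>UNIV. normal_moment (a k)) = normal_moment p * normal_moment q"
    by (subst prod_two[OF assms]) (use assms in \<open>auto simp: a_def normal_moment_values\<close>)
  ultimately show ?thesis using gaussian_moment[of a] by simp
qed

lemma pd_gaussian: "pd j gaussian = (\<lambda>x::real^'n::finite. x $ j)"
proof
  fix x :: "real^'n"
  have "(gaussian has_derivative (\<lambda>v. x \<bullet> v)) (at x)"
    unfolding gaussian_def[abs_def] power2_norm_eq_inner
    by (auto intro!: derivative_eq_intros simp: inner_commute)
  then show "pd j gaussian x = x $ j" by (simp add: pd_has_derivative inner_axis)
qed

lemma Ck_gaussian: "Ck k gaussian"
  unfolding gaussian_def[abs_def] divide_inverse by (intro Ck_add Ck_mult Ck_norm_sq Ck_const)

lemma gibbs_potential_gaussian: "gibbs_potential (gaussian :: real^'n::finite \<Rightarrow> real)"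
proof
  show "Ck 2 (gaussian :: real^'n \<Rightarrow> real)" by (rule Ck_gaussian)
  show "has_bochner_integral lborel (\<lambda>x::real^'n. exp (- gaussian x)) 1"
    using gaussian_moment[of "\<lambda>_::'n. 0"] by (simp add: normal_moment_values)
qed

context gibbs_potential
begin

text \<open>The Hessian of the potential is the identity matrix, so the Hessian form in
  \<open>nsq_LL\<close> is the gradient energy exactly.\<close>

lemma nsq_LL_gaussian:
  assumes \<phi>: "\<And>j. pd j \<phi> = (\<lambda>x. x $ j)" and h: "h \<in> test_functions"
  shows "nsq M (LL h) = XX h + (\<Sum>j\<in>UNIV. nsq M (pd j h))"
proof -
  have "(\<Sum>l\<in>UNIV. \<integral>x. pd j h x * pd l h x * pd l (pd j \<phi>) x \<partial>M) = nsq M (pd j h)" for j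
  proof -
    have "(\<integral>x. pd j h x * pd l h x * pd l (pd j \<phi>) x \<partial>M) = (if l = j then nsq M (pd j h) else 0)" for l
      by (simp add: \<phi> pd_coord nsq_def power2_eq_square)
    then show ?thesis by simp
  qed
  then show ?thesis using nsq_LL[OF h] by simp
qed

text \<open>Shows that the Gaussian is centred: there the derivative of the potential is the
  coordinate. The cutoff replaces the constant 1 as test function.\<close>

lemma integral_pd_phi:
  assumes "sq_int M (pd j \<phi>)"
  shows "(\<integral>x. pd j \<phi> x \<partial>M) = 0"
proof -
  define c where "c n = (cutoff (real (Suc n)) :: real^'n \<Rightarrow> real)" for n
  have c: "c n \<in> test_functions" for n unfolding c_def by (rule cutoff_test) simp
  have spc: "sq_int M (pd j (c n))" for n by (intro test_sq_int test_pd c)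
  have eq: "ip M (c n) (pd j \<phi>) = ip M (pd j (c n)) (\<lambda>x. 1)" for n
  proof -
    have "0 = (\<integral>x. dstar j (c n) x \<partial>M)"
      using integral_dstar[OF test_Ck[OF c] test_bsupp[OF c]] by simp
    also have "\<dots> = (\<integral>x. c n x * pd j \<phi> x - pd j (c n) x \<partial>M)" by (simp add: dstar_def)
    also have "\<dots> = ip M (c n) (pd j \<phi>) - ip M (pd j (c n)) (\<lambda>x. 1)"
      using sq_int_mult[OF test_sq_int[OF c] assms] sq_int_imp_integrable[OF spc] by (simp add: ip_def)
    finally show ?thesis by simp
  qed
  have "(\<lambda>n. ip M (c n) (pd j \<phi>)) \<longlonglongrightarrow> ip M (\<lambda>x. 1) (pd j \<phi>)"
  proof (rule nsq_tendsto_ip[OF test_sq_int[OF c] sq_int_const assms])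
    show "(\<lambda>n. nsq M (\<lambda>x. c n x - 1)) \<longlonglongrightarrow> 0"
      using cutoff_nsq(1) unfolding c_def by (subst nsq_minus_commute)
  qed
  moreover have "(\<lambda>n. ip M (pd j (c n)) (\<lambda>x. 1 :: real)) \<longlonglongrightarrow> ip M (\<lambda>x. 0) (\<lambda>x. 1 :: real)"
    by (rule nsq_tendsto_ip[OF spc sq_int_const sq_int_const])
       (use cutoff_nsq(2)[of j] in \<open>simp add: c_def del: of_nat_Suc\<close>)
  ultimately have "ip M (\<lambda>x. 1) (pd j \<phi>) = ip M (\<lambda>x. 0) (\<lambda>x. 1 :: real)"
    unfolding eq by (rule LIMSEQ_unique)
  then show ?thesis by (simp add: ip_def)
qed

text \<open>The Hessian term alone bounds the gradient energy of \<open>h\<close> by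
  \<open>nsq M (LL h)\<close>; duality turns this into the Poincare inequality with constant
  1.\<close>

lemma poincare_gaussian:
  assumes \<phi>: "\<And>j. pd j \<phi> = (\<lambda>x. x $ j)"
  shows "poincare \<phi> 1"
  unfolding poincare_def
proof
  fix f :: "real^'n \<Rightarrow> real" assume f: "f \<in> test_functions"
  define m where "m = (\<integral>x. f x \<partial>M)"
  define S where "S = (\<Sum>j\<in>UNIV. nsq M (pd j f))"
  have S0: "0 \<le> S" unfolding S_def by (intro sum_nonneg) simp
  have "(\<Sum>i\<in>{()}. nsq M (\<lambda>x. f x - m)) \<le> S"
  proof (rule LL_dual_bound)
    show "sq_int M (\<lambda>x. f x - m)" by (intro sq_int_diff test_sq_int f sq_int_const)
    show "(\<integral>x. f x - m \<partial>M) = 0" using sq_int_imp_integrable[OF test_sq_int[OF f]] by (simp add: m_def)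
    fix h :: "unit \<Rightarrow> real^'n \<Rightarrow> real" assume h: "\<And>i. h i \<in> test_functions"
    define k where "k = h ()"
    have k: "k \<in> test_functions" unfolding k_def by (rule h)
    have "ip M (\<lambda>x. f x - m) (LL k) = ip M f (LL k)"
      using ip_diff_left[OF test_sq_int[OF f] sq_int_const LL_sq_int[OF k], of m] integral_LL[OF k]
      by (simp add: ip_def)
    then have "(ip M (\<lambda>x. f x - m) (LL k))\<^sup>2 = (\<Sum>j\<in>UNIV. ip M (pd j f) (pd j k))\<^sup>2"
      by (simp add: ip_LL[OF k test_Ck[OF f]])
    also have "\<dots> \<le> S * (\<Sum>j\<in>UNIV. nsq M (pd j k))"
      unfolding S_def by (intro sum_ip_Cauchy_Schwarz test_sq_int test_pd f k)
    also have "\<dots> \<le> S * nsq M (LL k)"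
      using S0 unfolding nsq_LL_gaussian[OF \<phi> k]
      by (intro mult_left_mono) (auto simp: XX_def intro!: sum_nonneg)
    finally show "(\<Sum>i\<in>{()}. ip M (\<lambda>x. f x - m) (LL (h i)))\<^sup>2 \<le> S * (\<Sum>i\<in>{()}. nsq M (LL (h i)))"
      by (simp add: k_def)
  qed (use S0 in simp_all)
  moreover have "integrable M (\<lambda>x. (pd k f x)\<^sup>2)" for k
    using test_sq_int[OF test_pd[OF f]] by (simp add: sq_int_real_iff)
  ultimately show "(\<integral>x. (f x - mean \<phi> f)\<^sup>2 \<partial>M) \<le> 1 * (\<integral>x. (norm (grad f x))\<^sup>2 \<partial>M)"
    by (simp add: mean_eq norm_grad_sq nsq_def m_def S_def)
qed

end

locale gaussian_measure = gibbs_centred \<phi> P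
  for \<phi> :: "real^'n::finite \<Rightarrow> real" and P +
  assumes pd_phi: "\<And>j. pd j \<phi> = (\<lambda>x. x $ j)"
begin

lemma ip_linear_coord: "ip M (\<lambda>x. a \<bullet> x) (\<lambda>x. x $ j) = a $ j"
  using ip_linear_pd_phi[of j a] coord_sq_int[of j] by (simp add: pd_phi)

lemma ip_linear_linear: "ip M (\<lambda>x. a \<bullet> x) (\<lambda>x. b \<bullet> x) = a \<bullet> b"
proof -
  have "ip M (\<lambda>x. a \<bullet> x) (\<lambda>x. \<Sum>j\<in>UNIV. b $ j *\<^sub>R x $ j) = (\<Sum>j\<in>UNIV. b $ j * a $ j)"
    by (subst ip_sum_right[OF linear_sq_int sq_int_scaleR[OF coord_sq_int]])
       (simp only: ip_scaleR_right ip_linear_coord)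
  then show ?thesis by (simp add: inner_vec_def mult.commute)
qed

lemma nsq_linear: "nsq M (\<lambda>x. a \<bullet> x) = (norm a)\<^sup>2"
  by (simp add: nsq_eq_ip ip_linear_linear power2_norm_eq_inner)

lemma nsq_coord: "nsq M (\<lambda>x. x $ i) = 1"
  using nsq_linear[of "axis i 1"] by (simp add: inner_axis' norm_axis_1)

lemma coercive_1: "coercive 1"
  by (rule coerciveI) (simp_all add: nsq_linear)

lemma nsq_matrix_vector_eq: "nsq M (\<lambda>x. A *v x) = (norm A)\<^sup>2" for A :: "real^'n^'n"
  by (simp add: nsq_matrix_vector nsq_linear norm_vec_sq[of A])

lemma dstar_one: "dstar j (\<lambda>x. 1) = (\<lambda>x. x $ j)"
  by (simp add: dstar_def pd_phi fun_eq_iff)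

text \<open>A coordinate is the adjoint derivative of the constant 1. Neither function has bounded
  support, so the integration by parts is done for approximating test functions.\<close>

lemma ip_coord_wpd:
  assumes f: "\<And>j. wpd j f (F j)"
  shows "ip M f (\<lambda>x. x $ k) = (\<integral>x. F k x \<partial>M)"
proof (rule H1_approx[OF f])
  fix h assume h: "\<And>n::nat. h n \<in> test_functions"
    and lim: "(\<lambda>n. nsq M (\<lambda>x. h n x - f x)) \<longlonglongrightarrow> 0"
    and limj: "\<And>j. (\<lambda>n. nsq M (\<lambda>x. pd j (h n) x - F j x)) \<longlonglongrightarrow> 0"
  have eq: "ip M (h n) (\<lambda>x. x $ k) = ip M (pd k (h n)) (\<lambda>x. 1)" for n
    using dstar_adjoint[of "\<lambda>x. 1" "h n" k] test_Ck[OF h, of 1 n] test_bsupp[OF h, of n]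
    by (simp add: dstar_one ip_commute del: One_nat_def Ck.simps)
  have "(\<lambda>n. ip M (h n) (\<lambda>x. x $ k)) \<longlonglongrightarrow> ip M f (\<lambda>x. x $ k)"
    by (rule nsq_tendsto_ip[OF test_sq_int[OF h] wpd_sq_int(1)[OF f] coord_sq_int lim])
  moreover have "(\<lambda>n. ip M (pd k (h n)) (\<lambda>x. 1)) \<longlonglongrightarrow> ip M (F k) (\<lambda>x. 1)"
    by (rule nsq_tendsto_ip[OF test_sq_int[OF test_pd[OF h]] wpd_sq_int(2)[OF f] sq_int_const limj])
  ultimately show "ip M f (\<lambda>x. x $ k) = (\<integral>x. F k x \<partial>M)"
    unfolding eq ip_one by (rule LIMSEQ_unique)
qed

text \<open>The eigenvalue 2 beyond constants and linear functions. Applying the Poincare inequality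
  to the derivatives of \<open>h\<close> gives XX at least the gradient energy minus the squared
  means, so \<open>nsq M (LL h)\<close> contains the gradient energy twice up to these means. They
  tend to 0 because \<open>f\<close> is orthogonal to the coordinates.\<close>

lemma second_spectral_gap:
  assumes f: "\<And>j. wpd j f (F j)" and f0: "(\<integral>x. f x \<partial>M) = 0" and F0: "\<And>j. (\<integral>x. F j x \<partial>M) = 0"
  shows "2 * nsq M f \<le> (\<Sum>j\<in>UNIV. nsq M (F j))"
proof -
  define S where "S = (\<Sum>j\<in>UNIV. nsq M (F j))"
  have S0: "0 \<le> S" unfolding S_def by (intro sum_nonneg) simp
  have sf: "sq_int M f" by (rule wpd_sq_int(1)[OF f])
  obtain h where h: "\<And>n::nat. h n \<in> test_functions" and lim: "(\<lambda>n. nsq M (\<lambda>x. LL (h n) x - f x)) \<longlonglongrightarrow> 0"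
  proof (rule LL_dense[OF sf f0])
    fix h assume "\<And>n::nat. h n \<in> test_functions" "(\<lambda>n. nsq M (\<lambda>x. LL (h n) x - f x)) \<longlonglongrightarrow> 0"
    then show thesis by (rule that)
  qed
  \<comment> \<open>The mean of \<open>pd k (h n)\<close>, rewritten as a pairing with
    \<open>LL (h n)\<close>: this form has a limit, since \<open>LL (h n)\<close> converges while
    nothing is known about \<open>h n\<close>.\<close>
  define c where "c k n = ip M (LL (h n)) (\<lambda>x. x $ k)" for k n
  have c: "c k n = (\<integral>x. pd k (h n) x \<partial>M)" for k n
  proof -
    have "wpd j (\<lambda>x. x $ k) (\<lambda>x. axis k 1 $ j)" for j
      using wpd_linear[of j "axis k 1"] by (simp add: inner_axis')
    from wpd_LL[OF this h[of n]] have "c k n = (\<Sum>j\<in>UNIV. ip M (\<lambda>x. axis k 1 $ j) (pd j (h n)))"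
      by (simp add: c_def ip_commute)
    also have "\<dots> = (\<Sum>j\<in>UNIV. if j = k then (\<integral>x. pd k (h n) x \<partial>M) else 0)"
      by (intro sum.cong refl) (auto simp: axis_def ip_def)
    finally show ?thesis by simp
  qed
  have grad_le: "2 * (\<Sum>k\<in>UNIV. nsq M (pd k (h n))) \<le> nsq M (LL (h n)) + (\<Sum>k\<in>UNIV. (c k n)\<^sup>2)" for n
  proof -
    have "nsq M (pd k (h n)) - (c k n)\<^sup>2 \<le> (\<Sum>l\<in>UNIV. nsq M (pd l (pd k (h n))))" for k
    proof -
      have p: "poincare \<phi> 1" by (rule poincare_gaussian[OF pd_phi])
      \<comment> \<open>The locale parameter \<open>P\<close> is unspecified; the optimal value 1 is
        what produces the gap 2.\<close>
      interpret one: gibbs_poincare \<phi> 1 by unfold_locales (rule p)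
      show ?thesis
        using one.poincare_test[OF test_pd[OF h], of k n] nsq_centre[OF test_sq_int[OF test_pd[OF h]], of k n]
        by (simp add: c)
    qed
    from sum_mono[of UNIV, OF this] have "(\<Sum>k\<in>UNIV. nsq M (pd k (h n))) - (\<Sum>k\<in>UNIV. (c k n)\<^sup>2) \<le> XX (h n)"
      by (simp add: XX_def sum_subtractf)
    then show ?thesis using nsq_LL_gaussian[OF pd_phi h[of n]] by simp
  qed
  have each: "2 * (ip M (LL (h n)) f)\<^sup>2 \<le> S * (nsq M (LL (h n)) + (\<Sum>k\<in>UNIV. (c k n)\<^sup>2))" for n
  proof -
    have "(ip M (LL (h n)) f)\<^sup>2 = (\<Sum>k\<in>UNIV. ip M (F k) (pd k (h n)))\<^sup>2"
      by (simp add: ip_commute[of M _ f] wpd_LL[OF f h])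
    also have "\<dots> \<le> S * (\<Sum>k\<in>UNIV. nsq M (pd k (h n)))"
      unfolding S_def by (intro sum_ip_Cauchy_Schwarz wpd_sq_int(2)[OF f] test_sq_int test_pd h)
    finally have "2 * (ip M (LL (h n)) f)\<^sup>2 \<le> S * (2 * (\<Sum>k\<in>UNIV. nsq M (pd k (h n))))" by simp
    also have "\<dots> \<le> S * (nsq M (LL (h n)) + (\<Sum>k\<in>UNIV. (c k n)\<^sup>2))"
      by (intro mult_left_mono grad_le S0)
    finally show ?thesis .
  qed
  have "2 * (ip M f f)\<^sup>2 \<le> S * (nsq M f + (\<Sum>k\<in>UNIV. (ip M f (\<lambda>x. x $ k))\<^sup>2))"
  proof (rule LIMSEQ_le)
    show "(\<lambda>n. 2 * (ip M (LL (h n)) f)\<^sup>2) \<longlonglongrightarrow> 2 * (ip M f f)\<^sup>2"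
      by (intro tendsto_intros nsq_tendsto_ip[OF LL_sq_int[OF h] sf sf lim])
    show "(\<lambda>n. S * (nsq M (LL (h n)) + (\<Sum>k\<in>UNIV. (c k n)\<^sup>2)))
        \<longlonglongrightarrow> S * (nsq M f + (\<Sum>k\<in>UNIV. (ip M f (\<lambda>x. x $ k))\<^sup>2))"
      unfolding c_def
      by (intro tendsto_intros nsq_tendsto_nsq[OF LL_sq_int[OF h] sf lim]
          nsq_tendsto_ip[OF LL_sq_int[OF h] sf coord_sq_int lim])
  qed (use each in blast)
  moreover have "ip M f (\<lambda>x. x $ k) = 0" for k by (simp add: ip_coord_wpd[OF f] F0)
  ultimately have "nsq M f * (2 * nsq M f) \<le> nsq M f * S"
    by (simp add: nsq_eq_ip power2_eq_square mult_ac)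
  then show ?thesis
    unfolding S_def[symmetric] using S0 nsq_nonneg[of M f]
    by (cases "nsq M f = 0") (auto simp del: nsq_nonneg)
qed

text \<open>The right side is X + Q, where Q pairs the Jacobian with its transpose, and the squared
  norm T of the adjoint divergence is Q plus the squared norm of the field. T is at least the square
  of the mean vector, which yields variances instead of second moments.\<close>

lemma sym_lower_bound_test:
  assumes h: "\<And>i. h i \<in> test_functions"
  shows "(\<Sum>i\<in>UNIV. \<Sum>j\<in>UNIV. nsq M (pd j (h i))) - (\<Sum>i\<in>UNIV. nsq M (h i) - (\<integral>x. h i x \<partial>M)\<^sup>2)
    \<le> (\<Sum>i\<in>UNIV. \<Sum>j\<in>UNIV. nsq M (\<lambda>x. pd j (h i) x + pd i (h j) x)) / 2"
proof -
  define X where "X = (\<Sum>i\<in>UNIV. \<Sum>j\<in>UNIV. nsq M (pd j (h i)))"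
  define Q where "Q = (\<Sum>i\<in>UNIV. \<Sum>j\<in>UNIV. ip M (pd j (h i)) (pd i (h j)))"
  define T where "T = nsq M (\<lambda>x. \<Sum>j\<in>UNIV. dstar j (h j) x)"
  define c where "c = (\<chi> j. \<integral>x. h j x \<partial>M)"
  note d = dstar_sq_int[OF test_Ck[OF h] test_bsupp[OF h]]
  have "(\<Sum>i\<in>UNIV. \<Sum>j\<in>UNIV. nsq M (\<lambda>x. pd j (h i) x + pd i (h j) x))
     = (\<Sum>i\<in>UNIV. \<Sum>j\<in>UNIV. nsq M (pd j (h i)) + 2 * ip M (pd j (h i)) (pd i (h j)) + nsq M (pd i (h j)))"
    by (intro sum.cong refl nsq_add test_sq_int test_pd h)
  also have "\<dots> = X + 2 * Q + (\<Sum>i\<in>UNIV. \<Sum>j\<in>UNIV. nsq M (pd i (h j)))"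
    by (simp add: X_def Q_def sum.distrib sum_distrib_left)
  also have "(\<Sum>i\<in>UNIV. \<Sum>j\<in>UNIV. nsq M (pd i (h j))) = X" unfolding X_def by (rule sum.swap)
  finally have 1: "(\<Sum>i\<in>UNIV. \<Sum>j\<in>UNIV. nsq M (\<lambda>x. pd j (h i) x + pd i (h j) x)) / 2 = X + Q" by simp
  have "(\<Sum>l\<in>UNIV. \<integral>x. h j x * h l x * pd l (pd j \<phi>) x \<partial>M) = nsq M (h j)" for j
  proof -
    have "(\<integral>x. h j x * h l x * pd l (pd j \<phi>) x \<partial>M) = (if l = j then nsq M (h j) else 0)" for l
      by (simp add: pd_phi pd_coord nsq_def power2_eq_square)
    then show ?thesis by simp
  qed
  then have 2: "T = Q + (\<Sum>i\<in>UNIV. nsq M (h i))"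
    using nsq_divergence[of h, OF h] by (simp add: T_def Q_def)
  \<comment> \<open>The adjoint divergence paired with c . x integrates the field against the
    constant \<open>c\<close>; as c . x has squared norm equal to that of \<open>c\<close>,
    Cauchy-Schwarz bounds T from below.\<close>
  have "(norm c)\<^sup>2 = ip M (\<lambda>x. \<Sum>j\<in>UNIV. dstar j (h j) x) (\<lambda>x. c \<bullet> x)"
  proof -
    have "ip M (dstar j (h j)) (\<lambda>x. c \<bullet> x) = c $ j * c $ j" for j
    proof -
      have "ip M (dstar j (h j)) (\<lambda>x. c \<bullet> x) = ip M (\<lambda>x. c \<bullet> x) (dstar j (h j))"
        by (rule ip_commute)
      also have "\<dots> = ip M (\<lambda>x. c $ j) (h j)"
        by (rule wpdD[OF wpd_linear test_Ck[OF h] test_bsupp[OF h], symmetric])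
      also have "\<dots> = c $ j * c $ j" by (simp add: ip_def c_def)
      finally show ?thesis .
    qed
    then show ?thesis
      by (simp add: ip_sum_left[OF linear_sq_int d] power2_norm_eq_inner) (simp add: inner_vec_def)
  qed
  moreover have "(ip M (\<lambda>x. \<Sum>j\<in>UNIV. dstar j (h j) x) (\<lambda>x. c \<bullet> x))\<^sup>2 \<le> T * (norm c)\<^sup>2"
    unfolding T_def nsq_linear[symmetric] by (intro ip_Cauchy_Schwarz sq_int_sum d linear_sq_int)
  ultimately have "(norm c)\<^sup>2 * (norm c)\<^sup>2 \<le> T * (norm c)\<^sup>2" by (simp only: power2_eq_square)
  then have "(norm c)\<^sup>2 \<le> T"
  proof (cases "c = 0")
    case False
    then have "0 < (norm c)\<^sup>2" by simp
    then show ?thesis by (rule mult_right_le_imp_le[rotated]) fact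
  qed (simp add: T_def)
  then have 3: "(\<Sum>i\<in>UNIV. (\<integral>x. h i x \<partial>M)\<^sup>2) \<le> T"
    by (simp add: norm_vec_sq c_def)
  show ?thesis using 1 2 3 unfolding X_def[symmetric] sum_subtractf by linarith
qed

lemma sym_lower_bound:
  fixes u :: "real^'n \<Rightarrow> real^'n"
  assumes J: "weak_jacobian u G" and u: "sq_int M u" and G: "sq_int M G" and u0: "\<And>i. (\<integral>x. u x $ i \<partial>M) = 0"
  shows "nsq M G - nsq M u \<le> 2 * nsq M (\<lambda>x. sym_part (G x))"
proof -
  have wp: "wpd j (\<lambda>x. u x $ i) (\<lambda>x. G x $ i $ j)" for i j by (rule wpd_jacobian[OF J u G])
  have "\<forall>i. \<exists>h. (\<forall>n::nat. h n \<in> test_functions) \<and> (\<lambda>n. nsq M (\<lambda>x. h n x - u x $ i)) \<longlonglongrightarrow> 0 \<and>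
      (\<forall>j. (\<lambda>n. nsq M (\<lambda>x. pd j (h n) x - G x $ i $ j)) \<longlonglongrightarrow> 0)"
  proof
    fix i
    show "\<exists>h. (\<forall>n::nat. h n \<in> test_functions) \<and> (\<lambda>n. nsq M (\<lambda>x. h n x - u x $ i)) \<longlonglongrightarrow> 0 \<and>
      (\<forall>j. (\<lambda>n. nsq M (\<lambda>x. pd j (h n) x - G x $ i $ j)) \<longlonglongrightarrow> 0)"
    proof (rule H1_approx)
      show "wpd j (\<lambda>x. u x $ i) (\<lambda>x. G x $ i $ j)" for j by (rule wp)
      fix h assume "\<And>n::nat. h n \<in> test_functions" "(\<lambda>n. nsq M (\<lambda>x. h n x - u x $ i)) \<longlonglongrightarrow> 0"
        "\<And>j. (\<lambda>n. nsq M (\<lambda>x. pd j (h n) x - G x $ i $ j)) \<longlonglongrightarrow> 0"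
      then show ?thesis by (intro exI[of _ h] conjI allI)
    qed
  qed
  from choice[OF this] obtain h where h: "\<And>i n::nat. h i n \<in> test_functions"
    and lim: "\<And>i. (\<lambda>n. nsq M (\<lambda>x. h i n x - u x $ i)) \<longlonglongrightarrow> 0"
    and limj: "\<And>i j. (\<lambda>n. nsq M (\<lambda>x. pd j (h i n) x - G x $ i $ j)) \<longlonglongrightarrow> 0"
    by blast
  note su = sq_int_nth[OF u] and sG = matrix_sq_int[OF G]
  have sp: "sq_int M (pd j (h i n))" for i j n by (intro test_sq_int test_pd h)
  have l1: "(\<lambda>n. nsq M (pd j (h i n))) \<longlonglongrightarrow> nsq M (\<lambda>x. G x $ i $ j)" for i j
    by (rule nsq_tendsto_nsq[OF sp sG limj])
  have l2: "(\<lambda>n. nsq M (h i n)) \<longlonglongrightarrow> nsq M (\<lambda>x. u x $ i)" for i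
    by (rule nsq_tendsto_nsq[OF test_sq_int[OF h] su lim])
  have l3: "(\<lambda>n. (\<integral>x. h i n x \<partial>M)) \<longlonglongrightarrow> 0" for i
    using nsq_tendsto_ip[OF test_sq_int[OF h] su sq_int_const[of 1] lim, of i] by (simp add: ip_one u0)
  have l4: "(\<lambda>n. nsq M (\<lambda>x. pd j (h i n) x + pd i (h j n) x)) \<longlonglongrightarrow> nsq M (\<lambda>x. G x $ i $ j + G x $ j $ i)" for i j
  proof -
    have "(\<lambda>n. nsq M (pd j (h i n)) + 2 * ip M (pd j (h i n)) (pd i (h j n)) + nsq M (pd i (h j n)))
       \<longlonglongrightarrow> nsq M (\<lambda>x. G x $ i $ j) + 2 * ip M (\<lambda>x. G x $ i $ j) (\<lambda>x. G x $ j $ i) + nsq M (\<lambda>x. G x $ j $ i)"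
    proof (intro tendsto_intros l1)
      \<comment> \<open>Both factors of the cross term vary with \<open>n\<close>. \<open>D\<close>
        carries the error of the first factor; the remaining pairing has a fixed second
        factor.\<close>
      define D where "D n = ip M (\<lambda>x. pd j (h i n) x - G x $ i $ j) (pd i (h j n))" for n
      have "(\<lambda>n. sqrt (nsq M (\<lambda>x. pd j (h i n) x - G x $ i $ j)) * sqrt (nsq M (pd i (h j n))))
          \<longlonglongrightarrow> sqrt 0 * sqrt (nsq M (\<lambda>x. G x $ j $ i))"
        by (intro tendsto_intros limj l1)
      then have D0: "D \<longlonglongrightarrow> 0"
        by (intro Lim_null_comparison[of D, OF always_eventually])
           (auto simp: D_def intro!: ip_le sq_int_diff sp sG)
      have "(\<lambda>n. ip M (pd i (h j n)) (\<lambda>x. G x $ i $ j)) \<longlonglongrightarrow> ip M (\<lambda>x. G x $ j $ i) (\<lambda>x. G x $ i $ j)"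
        by (rule nsq_tendsto_ip[OF sp sG sG limj])
      moreover have "ip M (pd j (h i n)) (pd i (h j n)) = D n + ip M (pd i (h j n)) (\<lambda>x. G x $ i $ j)" for n
        unfolding D_def ip_diff_left[OF sp sG sp] by (simp add: ip_commute)
      ultimately show "(\<lambda>n. ip M (pd j (h i n)) (pd i (h j n))) \<longlonglongrightarrow> ip M (\<lambda>x. G x $ i $ j) (\<lambda>x. G x $ j $ i)"
        using tendsto_add[OF D0, of "\<lambda>n. ip M (pd i (h j n)) (\<lambda>x. G x $ i $ j)"]
        by (simp add: ip_commute[of M "\<lambda>x. G x $ i $ j" "\<lambda>x. G x $ j $ i"])
    qed
    then show ?thesis by (simp add: nsq_add[OF sp sp] nsq_add[OF sG sG])
  qed
  have "(\<Sum>i\<in>UNIV. \<Sum>j\<in>UNIV. nsq M (\<lambda>x. G x $ i $ j)) - (\<Sum>i\<in>UNIV. nsq M (\<lambda>x. u x $ i) - 0\<^sup>2)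
     \<le> (\<Sum>i\<in>UNIV. \<Sum>j\<in>UNIV. nsq M (\<lambda>x. G x $ i $ j + G x $ j $ i)) / 2"
  proof (rule LIMSEQ_le)
    show "(\<lambda>n. (\<Sum>i\<in>UNIV. \<Sum>j\<in>UNIV. nsq M (pd j (h i n))) - (\<Sum>i\<in>UNIV. nsq M (h i n) - (\<integral>x. h i n x \<partial>M)\<^sup>2))
      \<longlonglongrightarrow> (\<Sum>i\<in>UNIV. \<Sum>j\<in>UNIV. nsq M (\<lambda>x. G x $ i $ j)) - (\<Sum>i\<in>UNIV. nsq M (\<lambda>x. u x $ i) - 0\<^sup>2)"
      by (intro tendsto_intros l1 l2 l3)
    show "(\<lambda>n. (\<Sum>i\<in>UNIV. \<Sum>j\<in>UNIV. nsq M (\<lambda>x. pd j (h i n) x + pd i (h j n) x)) / 2)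
      \<longlonglongrightarrow> (\<Sum>i\<in>UNIV. \<Sum>j\<in>UNIV. nsq M (\<lambda>x. G x $ i $ j + G x $ j $ i)) / 2"
      by (intro tendsto_intros l4) simp
  qed (use sym_lower_bound_test[of "\<lambda>i. h i _", OF h] in blast)
  moreover have "nsq M (\<lambda>x. sym_part (G x)) = (\<Sum>i\<in>UNIV. \<Sum>j\<in>UNIV. nsq M (\<lambda>x. G x $ i $ j + G x $ j $ i)) / 4"
  proof -
    have "nsq M (\<lambda>x. sym_part (G x) $ i $ j) = nsq M (\<lambda>x. G x $ i $ j + G x $ j $ i) / 4" for i j
      using nsq_scaleR[of M "1/2" "\<lambda>x. G x $ i $ j + G x $ j $ i"] by (simp add: sym_part_nth power2_eq_square)
    then show ?thesis by (simp only: nsq_matrix[OF sym_sq_int[OF G]] sum_divide_distrib)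
  qed
  ultimately show ?thesis by (simp add: nsq_matrix[OF G] nsq_vec[OF u])
qed

text \<open>The pairing of a component with a coordinate is the mean of the corresponding
  derivative, so mean-free Jacobians make a field orthogonal to all linear fields.\<close>

lemma ip_matrix_vector_eq_0:
  fixes v :: "real^'n \<Rightarrow> real^'n"
  assumes J: "weak_jacobian v G" and v: "sq_int M v" and G: "sq_int M G"
    and G0: "\<And>i j. (\<integral>x. G x $ i $ j \<partial>M) = 0"
  shows "ip M v (\<lambda>x. S *v x) = 0"
proof -
  have wv: "wpd j (\<lambda>x. v x $ i) (\<lambda>x. G x $ i $ j)" for i j by (rule wpd_jacobian[OF J v G])
  have "ip M (\<lambda>x. v x $ i) (\<lambda>x. S $ i \<bullet> x) = 0" for i
  proof -
    have "ip M (\<lambda>x. v x $ i) (\<lambda>x. \<Sum>j\<in>UNIV. S $ i $ j *\<^sub>R x $ j) = 0"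
      by (subst ip_sum_right[OF sq_int_nth[OF v] sq_int_scaleR[OF coord_sq_int]])
         (simp only: ip_scaleR_right ip_coord_wpd[OF wv] G0 mult_zero_right sum.neutral_const)
    then show ?thesis by (simp add: inner_vec_def)
  qed
  then show ?thesis by (simp add: ip_vec[OF v matrix_vector_sq_int] matrix_vector_nth)
qed

text \<open>Subtracting the full mean \<open>B\<close> of the Jacobian, not only its skew part
  \<open>A\<close>, makes the spectral gap applicable. The symmetric part \<open>S\<close> of the
  mean is orthogonal to the rest and adds the same amount to all three squared norms, so the
  constants 4 and 2 persist.\<close>

lemma gaussian_estimates:
  fixes u :: "real^'n \<Rightarrow> real^'n"
  assumes J: "weak_jacobian u D" and u: "sq_int M u" and D: "sq_int M D"
  defines "A \<equiv> skew_part (\<integral>y. D y \<partial>M)"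
  shows "nsq M (\<lambda>x. D x - A) \<le> 4 * nsq M (\<lambda>x. sym_part (D x))"
    and "nsq M (\<lambda>x. u x - mean \<phi> u - A *v x) \<le> 2 * nsq M (\<lambda>x. sym_part (D x))"
proof -
  define B where "B = (\<integral>y. D y \<partial>M)"
  define S where "S = sym_part B"
  define G where "G x = D x - B" for x
  define v where "v x = u x - mean \<phi> u - B *v x" for x
  have BS: "B = S + A" unfolding S_def A_def B_def by (rule sym_plus_skew[symmetric])
  have sG: "sq_int M G" unfolding G_def by (intro sq_int_diff D sq_int_const)
  have sv: "sq_int M v" unfolding v_def by (intro sq_int_diff u sq_int_const matrix_vector_sq_int)
  have iu: "integrable M u" and iD: "integrable M D" by (intro sq_int_imp_integrable u D)+
  have G0: "(\<integral>x. G x \<partial>M) = 0" unfolding G_def using iD by (simp add: B_def)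
  have wv: "wpd j (\<lambda>x. v x $ i) (\<lambda>x. G x $ i $ j)" for i j
    unfolding v_def G_def by (rule wpd_affine_part[OF J u D])
  have Jv: "weak_jacobian v G"
  proof -
    have "weak_jacobian (\<lambda>x. mean \<phi> u) (\<lambda>x. 0)"
      unfolding weak_jacobian_def
    proof (intro conjI ballI allI)
      fix \<psi> :: "real^'n \<Rightarrow> real" and i j :: 'n assume \<psi>: "\<psi> \<in> test_functions"
      have "(\<integral>x. pd j \<psi> x \<partial>lborel) = 0" by (intro integral_pd_eq_0 test_Ck test_bsupp \<psi>)
      then show "(\<integral>x. mean \<phi> u $ i * pd j \<psi> x \<partial>lborel) = - (\<integral>x. 0 $ i $ j * \<psi> x \<partial>lborel)" by simp
    qed (rule sq_int_loc_int, simp)+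
    from weak_jacobian_diff[OF weak_jacobian_diff[OF J this] weak_jacobian_matrix[of B]]
    show ?thesis unfolding v_def[abs_def] G_def[abs_def] by simp
  qed
  have v0: "(\<integral>x. v x $ i \<partial>M) = 0" for i
  proof -
    have iu': "integrable M (\<lambda>x. u x $ i)" by (rule integrable_bounded_linear[OF bounded_linear_vec_nth iu])
    have "(\<integral>x. u x $ i \<partial>M) = mean \<phi> u $ i"
      unfolding mean_eq by (rule integral_bounded_linear[OF bounded_linear_vec_nth iu])
    then show ?thesis
      using iu' sq_int_imp_integrable[OF linear_sq_int[of "B $ i"]] linear_mean[of "B $ i"]
      by (simp add: v_def matrix_vector_nth)
  qed
  have G0': "(\<integral>x. G x $ i $ j \<partial>M) = 0" for i j
  proof -
    have iG: "integrable M G" by (rule sq_int_imp_integrable[OF sG])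
    have "(\<integral>x. G x $ i $ j \<partial>M) = (\<integral>x. G x $ i \<partial>M) $ j"
      by (rule integral_bounded_linear[OF bounded_linear_vec_nth
            integrable_bounded_linear[OF bounded_linear_vec_nth iG]])
    also have "(\<integral>x. G x $ i \<partial>M) = (\<integral>x. G x \<partial>M) $ i"
      by (rule integral_bounded_linear[OF bounded_linear_vec_nth iG])
    finally show ?thesis by (simp add: G0)
  qed
  have gap: "2 * nsq M v \<le> nsq M G"
  proof -
    have "2 * nsq M (\<lambda>x. v x $ i) \<le> (\<Sum>j\<in>UNIV. nsq M (\<lambda>x. G x $ i $ j))" for i
      by (rule second_spectral_gap[OF wv v0 G0'])
    from sum_mono[of UNIV, OF this] show ?thesis
      by (simp add: nsq_vec[OF sv] nsq_matrix[OF sG] sum_distrib_left)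
  qed
  define s where "s = nsq M (\<lambda>x. sym_part (G x))"
  have low: "nsq M G - nsq M v \<le> 2 * s"
    unfolding s_def by (rule sym_lower_bound[OF Jv sv sG v0])
  \<comment> \<open>From \<open>2 * nsq M v \<le> nsq M G\<close> and
    \<open>nsq M G - nsq M v \<le> 2 * s\<close>: half of \<open>nsq M G\<close> is at most 2 s, and
    then \<open>nsq M v\<close> is as well.\<close>
  have Gs: "nsq M G \<le> 4 * s" and vs: "nsq M v \<le> 2 * s" using gap low by linarith+
  define q where "q = (norm S)\<^sup>2"
  have q: "0 \<le> q" by (simp add: q_def)
  have cross: "ip M G (\<lambda>x. S) = 0" by (simp add: ip_const[OF sG] G0)
  have n1: "nsq M (\<lambda>x. D x - A) = nsq M G + (norm S)\<^sup>2"
  proof -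
    have "nsq M (\<lambda>x. G x + S) = nsq M G + 2 * ip M G (\<lambda>x. S) + nsq M (\<lambda>x. S)"
      by (rule nsq_add[OF sG sq_int_const])
    moreover have "G x + S = D x - A" for x by (simp add: G_def BS)
    ultimately show ?thesis by (simp add: cross nsq_const)
  qed
  have n2: "nsq M (\<lambda>x. sym_part (D x)) = s + (norm S)\<^sup>2"
  proof -
    have "nsq M (\<lambda>x. sym_part (G x) + S) = s + 2 * ip M (\<lambda>x. sym_part (G x)) (\<lambda>x. S) + nsq M (\<lambda>x. S)"
      unfolding s_def by (rule nsq_add[OF sym_sq_int[OF sG] sq_int_const])
    moreover have "sym_part (G x) + S = sym_part (D x)" for x
      by (simp add: vec_eq_iff sym_part_nth S_def G_def field_simps)
    moreover have "ip M (\<lambda>x. sym_part (G x)) (\<lambda>x. S) = 0"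
    proof -
      have bl: "bounded_linear (sym_part :: real^'n^'n \<Rightarrow> real^'n^'n)"
        by (rule linear_conv_bounded_linear[THEN iffD1], rule linearI)
           (simp_all add: vec_eq_iff sym_part_nth field_simps)
      have "(\<integral>x. sym_part (G x) \<partial>M) = sym_part (\<integral>x. G x \<partial>M)"
        by (rule integral_bounded_linear[OF bl sq_int_imp_integrable[OF sG]])
      also have "\<dots> = 0" by (simp add: G0 vec_eq_iff sym_part_nth)
      finally show ?thesis by (simp add: ip_const[OF sym_sq_int[OF sG]])
    qed
    ultimately show ?thesis by (simp add: nsq_const)
  qed
  show "nsq M (\<lambda>x. D x - A) \<le> 4 * nsq M (\<lambda>x. sym_part (D x))"
    unfolding n1 n2 q_def[symmetric]
  proof -
    have "q \<le> 4 * q" using q by linarith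
    from add_mono[OF Gs this] show "nsq M G + q \<le> 4 * (s + q)" by (simp only: distrib_left)
  qed
  have n3: "nsq M (\<lambda>x. u x - mean \<phi> u - A *v x) = nsq M v + (norm S)\<^sup>2"
  proof -
    have "nsq M (\<lambda>x. v x + S *v x) = nsq M v + 2 * ip M v (\<lambda>x. S *v x) + nsq M (\<lambda>x. S *v x)"
      by (rule nsq_add[OF sv matrix_vector_sq_int])
    moreover have "v x + S *v x = u x - mean \<phi> u - A *v x" for x
      by (simp add: v_def BS matrix_vector_mult_add_rdistrib)
    moreover have "ip M v (\<lambda>x. S *v x) = 0" by (rule ip_matrix_vector_eq_0[OF Jv sv sG G0'])
    ultimately show ?thesis by (simp add: nsq_matrix_vector_eq)
  qed
  show "nsq M (\<lambda>x. u x - mean \<phi> u - A *v x) \<le> 2 * nsq M (\<lambda>x. sym_part (D x))"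
    unfolding n3 n2 q_def[symmetric]
  proof -
    have "q \<le> 2 * q" using q by linarith
    from add_mono[OF vs this] show "nsq M v + q \<le> 2 * (s + q)" by (simp only: distrib_left)
  qed
qed

lemma gaussian_korn: "korn \<phi> 4" and gaussian_poincare_korn: "poincare_korn \<phi> 2"
proof -
  have "L2sq \<phi> (\<lambda>x. weak_D u x - proj_skew \<phi> (weak_D u) x) \<le> ennreal 4 * L2sq \<phi> (weak_Ds u) \<and>
    L2sq \<phi> (centred \<phi> u) \<le> ennreal 2 * L2sq \<phi> (weak_Ds u)" if u: "u \<in> H1 \<phi>" for u
  proof -
    define D where "D = weak_D u"
    note uD = H1_weak_D[OF u, folded D_def]
    define A where "A = skew_part (\<integral>y. D y \<partial>M)"
    define S where "S = nsq M (\<lambda>x. sym_part (D x))"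
    have A: "A \<in> skew" by (simp add: A_def skew_part_skew)
    have LS: "L2sq \<phi> (weak_Ds u) = ennreal S"
      unfolding S_def weak_Ds_eq D_def[symmetric] by (rule L2sq_eq[OF sym_sq_int[OF uD(3)]])
    have LK: "L2sq \<phi> (\<lambda>x. weak_D u x - proj_skew \<phi> (weak_D u) x) = ennreal (nsq M (\<lambda>x. D x - A))"
      unfolding D_def[symmetric] proj_skew_eq[OF uD(3)] A_def[symmetric]
      by (intro L2sq_eq sq_int_diff uD sq_int_const)
    have e: "nsq M (\<lambda>x. D x - A) \<le> 4 * S" "nsq M (\<lambda>x. u x - mean \<phi> u - A *v x) \<le> 2 * S"
      unfolding S_def A_def by (rule gaussian_estimates[OF uD(2,1,3)])+
    obtain B where B: "B \<in> skew" "proj_rot \<phi> u = (\<lambda>x. B *v x)"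
      "\<And>A. A \<in> skew \<Longrightarrow> nsq M (\<lambda>x. u x - mean \<phi> u - A *v x)
        = nsq M (\<lambda>x. u x - mean \<phi> u - B *v x) + nsq M (\<lambda>x. (B - A) *v x)"
    proof (rule proj_rotE[OF coercive_1 uD(1)])
      fix B
      assume "B \<in> skew" "proj_rot \<phi> u = (\<lambda>x. B *v x)"
        "\<And>A. A \<in> skew \<Longrightarrow> nsq M (\<lambda>x. u x - mean \<phi> u - A *v x)
          = nsq M (\<lambda>x. u x - mean \<phi> u - B *v x) + nsq M (\<lambda>x. (B - A) *v x)"
      then show thesis by (rule that)
    qed
    have ce: "centred \<phi> u = (\<lambda>x. u x - mean \<phi> u - B *v x)" by (simp add: centred_def fun_eq_iff B)
    have sc: "sq_int M (centred \<phi> u)" unfolding ce by (intro sq_int_diff uD sq_int_const matrix_vector_sq_int)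
    have "nsq M (centred \<phi> u) \<le> 2 * S"
      using B(3)[OF A] nsq_nonneg[of M "\<lambda>x. (B - A) *v x"] e(2) unfolding ce by linarith
    moreover have four: "ennreal 4 * ennreal S = ennreal (4 * S)" and two: "ennreal 2 * ennreal S = ennreal (2 * S)"
      by (simp_all only: ennreal_mult' zero_le_numeral)
    ultimately show ?thesis
      unfolding LK LS L2sq_eq[OF sc] four two using e(1) by (intro conjI ennreal_leI)
  qed
  then show "korn \<phi> 4" "poincare_korn \<phi> 2" by (simp_all add: korn_def poincare_korn_def)
qed

text \<open>Reduces optimality to numbers: the quotients 6 / (3/2) and 3 / (3/2) are the two
  constants. The means of \<open>u\<close> and of its Jacobian vanish, so nothing is subtracted from
  the Jacobian.\<close>

lemma extremal_field:
  fixes u :: "real^'n \<Rightarrow> real^'n"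
  assumes J: "weak_jacobian u G" and su: "sq_int M u" and sG: "sq_int M G"
    and u0: "\<And>k. (\<integral>x. u x $ k \<partial>M) = 0" and G0: "\<And>k l. (\<integral>x. G x $ k $ l \<partial>M) = 0"
    and nu: "nsq M u = 3" and nG: "nsq M G = 6" and ns: "nsq M (\<lambda>x. sym_part (G x)) = 3 / 2"
  shows "korn \<phi> C \<Longrightarrow> 4 \<le> C" and "poincare_korn \<phi> C \<Longrightarrow> 2 \<le> C"
proof -
  have u: "u \<in> H1 \<phi>" unfolding H1_def using J su sG by (auto simp: L2_iff)
  note uD = H1_weak_D[OF u]
  have ae: "AE x in M. weak_D u x = G x"
    using weak_jacobian_unique[OF uD(2) J] by (simp add: AE_M)
  have Gint: "(\<integral>x. G x \<partial>M) = 0"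
  proof -
    have iG: "integrable M G" by (rule sq_int_imp_integrable[OF sG])
    have "(\<integral>x. G x \<partial>M) $ k $ l = 0" for k l
    proof -
      have "(\<integral>x. G x $ k $ l \<partial>M) = (\<integral>x. G x $ k \<partial>M) $ l"
        by (rule integral_bounded_linear[OF bounded_linear_vec_nth
              integrable_bounded_linear[OF bounded_linear_vec_nth iG]])
      also have "(\<integral>x. G x $ k \<partial>M) = (\<integral>x. G x \<partial>M) $ k"
        by (rule integral_bounded_linear[OF bounded_linear_vec_nth iG])
      finally show ?thesis by (simp add: G0)
    qed
    then show ?thesis by (simp add: vec_eq_iff)
  qed
  have "(\<integral>x. weak_D u x \<partial>M) = (\<integral>x. G x \<partial>M)"
    by (rule integral_cong_AE[OF sq_int_measurable[OF uD(3)] sq_int_measurable[OF sG] ae])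
  then have ps: "proj_skew \<phi> (weak_D u) = (\<lambda>x. 0)"
    by (simp add: proj_skew_eq[OF uD(3)] Gint skew_part_def transpose_def vec_eq_iff fun_eq_iff)
  have "L2sq \<phi> (\<lambda>x. weak_D u x - proj_skew \<phi> (weak_D u) x) = L2sq \<phi> G"
    unfolding L2sq_def ps using ae by (intro nn_integral_cong_AE) (auto elim!: eventually_mono)
  then have LK: "L2sq \<phi> (\<lambda>x. weak_D u x - proj_skew \<phi> (weak_D u) x) = ennreal 6"
    by (simp only: L2sq_eq[OF sG] nG)
  have "L2sq \<phi> (weak_Ds u) = L2sq \<phi> (\<lambda>x. sym_part (G x))"
    unfolding L2sq_def weak_Ds_eq using ae by (intro nn_integral_cong_AE) (auto elim!: eventually_mono)
  then have LS: "L2sq \<phi> (weak_Ds u) = ennreal (3 / 2)"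
    by (simp only: L2sq_eq[OF sym_sq_int[OF sG]] ns)
  have bound: "a \<le> C * (3 / 2)" if "ennreal a \<le> ennreal C * ennreal (3 / 2)" "0 \<le> C" for a C
    using that by (simp only: ennreal_mult'[symmetric] ennreal_le_iff mult_nonneg_nonneg)
  {
    assume k: "korn \<phi> C"
    have "6 \<le> C * (3 / 2)" using k u LK LS by (intro bound) (auto simp only: korn_def)
    then show "4 \<le> C" by simp
  }
  assume k: "poincare_korn \<phi> C"
  obtain B where B: "B \<in> skew" "proj_rot \<phi> u = (\<lambda>x. B *v x)"
  proof (rule proj_rotE[OF coercive_1 su])
    fix B assume "B \<in> skew" "proj_rot \<phi> u = (\<lambda>x. B *v x)"
    then show thesis by (rule that)
  qed
  have "mean \<phi> u $ k = 0" for k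
    unfolding mean_eq integral_bounded_linear[OF bounded_linear_vec_nth sq_int_imp_integrable[OF su], symmetric]
    by (rule u0)
  then have "mean \<phi> u = 0" by (simp add: vec_eq_iff)
  then have ce: "centred \<phi> u = (\<lambda>x. u x - B *v x)" by (simp add: centred_def fun_eq_iff B)
  \<comment> \<open>The matrix \<open>B\<close> is not identified. Orthogonality of \<open>u\<close>
    to linear fields already shows that subtracting any rotation cannot decrease the norm.\<close>
  have "nsq M (centred \<phi> u) = nsq M u + nsq M (\<lambda>x. B *v x)"
    unfolding ce by (simp add: nsq_diff[OF su matrix_vector_sq_int] ip_matrix_vector_eq_0[OF J su sG G0])
  then have "3 \<le> nsq M (centred \<phi> u)" by (simp add: nu)
  moreover have "sq_int M (centred \<phi> u)" unfolding ce by (intro sq_int_diff su matrix_vector_sq_int)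
  ultimately have "ennreal 3 \<le> L2sq \<phi> (centred \<phi> u)" by (simp only: L2sq_eq ennreal_leI)
  then have "3 \<le> C * (3 / 2)"
    using k u LS by (intro bound) (auto simp only: poincare_korn_def intro: order_trans)
  then show "2 \<le> C" by simp
qed

end

text \<open>The product formula supplies second moments, these make the identity integrable, and its
  mean vanishes by \<open>integral_pd_phi\<close>.\<close>

lemma gaussian_measure_gaussian: "gaussian_measure (gaussian :: real^'n::finite \<Rightarrow> real) 1"
proof -
  interpret gibbs_potential "gaussian :: real^'n \<Rightarrow> real" by (rule gibbs_potential_gaussian)
  have sq: "sq_int M (\<lambda>x. x $ j)" for j
  proof -
    define a where "a k = (if k = j then 1 else 0 :: nat)" for k
    have "(\<Prod>k\<in>UNIV. (x $ k) ^ (2 * a k)) = (x $ j)\<^sup>2" for x :: "real^'n"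
    proof -
      have "(x $ k) ^ (2 * a k) = (if k = j then (x $ j)\<^sup>2 else 1)" for k by (simp add: a_def)
      then show ?thesis by simp
    qed
    then have "integrable lborel (\<lambda>x::real^'n. exp (- gaussian x) * (x $ j)\<^sup>2)"
      using gaussian_moment[of a] by (simp add: has_bochner_integral_iff)
    then show ?thesis by (simp add: sq_int_real_iff integrable_M w_def)
  qed
  have int: "integrable M (\<lambda>x. x)"
    using sq_int_imp_integrable[OF sq_int_vec[of M "\<lambda>j x. x $ j"]] sq by simp
  have "(\<integral>x. x \<partial>M) $ j = 0" for j
    using integral_pd_phi[of j] sq[of j] integral_bounded_linear[OF bounded_linear_vec_nth int, of j]
    by (simp add: pd_gaussian)
  then have "(\<integral>x. x \<partial>M) = 0" by (simp add: vec_eq_iff)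
  then have "(\<integral>x. w x *\<^sub>R x \<partial>lborel) = 0" by (simp only: integral_M[OF measurable_ident_sets[OF refl]])
  moreover have "integrable lborel (\<lambda>x. w x *\<^sub>R x)"
    by (rule iffD1[OF integrable_M[OF measurable_ident_sets[OF refl]] int])
  ultimately have centre: "has_bochner_integral lborel (\<lambda>x::real^'n. exp (- gaussian x) *\<^sub>R x) 0"
    unfolding w_def has_bochner_integral_iff by (rule conjI[rotated])
  show ?thesis
    by unfold_locales (rule poincare_gaussian[OF pd_gaussian] centre pd_gaussian)+
qed

lemma gaussian_moment_gibbs:
  fixes i j :: "'n::finite"
  assumes "i \<noteq> j"
  shows "has_bochner_integral (gibbs gaussian) (\<lambda>x::real^'n. (x $ i) ^ (2 * p) * (x $ j) ^ (2 * q))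
    (normal_moment p * normal_moment q)"
proof -
  interpret gibbs_potential "gaussian :: real^'n \<Rightarrow> real" by (rule gibbs_potential_gaussian)
  show ?thesis
    using gaussian_moment_two[OF assms, of p q]
    by (simp add: has_bochner_integral_iff integrable_M integral_M w_def)
qed

lemma gaussian_constants_ge:
  assumes "2 \<le> CARD('n::finite)"
  shows "korn (gaussian :: real^'n \<Rightarrow> real) C \<Longrightarrow> 4 \<le> C" and "poincare_korn (gaussian :: real^'n \<Rightarrow> real) C \<Longrightarrow> 2 \<le> C"
proof -
  interpret gaussian_measure "gaussian :: real^'n \<Rightarrow> real" 1 by (rule gaussian_measure_gaussian)
  obtain i j :: 'n where ij: "i \<noteq> j"
  proof -
    have "\<not> card (UNIV :: 'n set) \<le> Suc 0" using assms by simp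
    then show thesis using that by (auto simp: card_le_Suc0_iff_eq)
  qed
  \<comment> \<open>The components are Hermite polynomials of degree 2, for which the spectral gap
    is an equality, and the adjoint divergence x_i (x_j^2 - 1) + x_i - x_i x_j^2 is 0, so that the
    lower bound for the symmetric part is attained. Two distinct indices are where the dimension
    enters.\<close>
  define u :: "real^'n \<Rightarrow> real^'n" where
    "u x = (\<chi> k. if k = i then x $ j * x $ j - 1 else if k = j then (- 1) * (x $ i * x $ j) else 0)" for x
  define G :: "real^'n \<Rightarrow> real^'n^'n" where
    "G x = (\<chi> k l. if k = i \<and> l = j then 2 * x $ j else if k = j \<and> l = i then - x $ j
      else if k = j \<and> l = j then - x $ i else 0)" for x
  have jj: "has_bochner_integral M (\<lambda>x. (x $ j) ^ 4) 3"
    using gaussian_moment_gibbs[OF ij, of 0 2] by (simp add: normal_moment_values)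
  have mixed: "has_bochner_integral M (\<lambda>x. (x $ i)\<^sup>2 * (x $ j)\<^sup>2) 1"
    using gaussian_moment_gibbs[OF ij, of 1 1] normal_moment_values(2) by simp
  have sjj: "sq_int M (\<lambda>x. x $ j * x $ j)" and njj: "nsq M (\<lambda>x. x $ j * x $ j) = 3"
    using jj by (simp_all add: sq_int_real_iff nsq_def has_bochner_integral_iff power_mult_distrib flip: power_add)
  have sij: "sq_int M (\<lambda>x. x $ i * x $ j)" and nij: "nsq M (\<lambda>x. x $ i * x $ j) = 1"
    using mixed by (simp_all add: sq_int_real_iff nsq_def has_bochner_integral_iff power_mult_distrib)
  have ujj: "(\<integral>x. x $ j * x $ j \<partial>M) = 1"
    using nsq_coord[of j] by (simp add: nsq_def power2_eq_square)
  have uij: "(\<integral>x. x $ i * x $ j \<partial>M) = 0"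
  proof -
    have "axis i (1::real) $ j = 0" using ij by (simp add: axis_def)
    then show ?thesis using ip_linear_coord[of "axis i 1" j] by (simp add: ip_def inner_axis')
  qed
  have s1: "sq_int M (\<lambda>x. x $ j * x $ j - 1)" by (intro sq_int_diff sjj sq_int_const)
  have s2: "sq_int M (\<lambda>x. (- 1) * (x $ i * x $ j))" using sq_int_scaleR[OF sij, of "-1"] by simp
  have sk: "sq_int M (\<lambda>x. if k = i then x $ j * x $ j - 1 else if k = j then (- 1) * (x $ i * x $ j) else 0)" for k
    using s1 s2 by (cases "k = i"; cases "k = j") auto
  have su: "sq_int M u" unfolding u_def by (intro sq_int_vec sk)
  \<comment> \<open>The entries of the Jacobian are linear in \<open>x\<close>, so its square
    integrability follows from that of the identity.\<close>
  have bG: "bounded_linear G"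
  proof (rule linear_conv_bounded_linear[THEN iffD1], rule linearI)
    have "G (x + y) $ k $ l = G x $ k $ l + G y $ k $ l" and "G (c *\<^sub>R x) $ k $ l = c * G x $ k $ l"
      for x y c k l
      using ij by (cases "k = i"; cases "k = j"; cases "l = i"; cases "l = j"; simp add: G_def)+
    then show "G (x + y) = G x + G y" "G (c *\<^sub>R x) = c *\<^sub>R G x" for x y c
      by (simp_all only: vec_eq_iff vector_add_component vector_scaleR_component real_scaleR_def simp_thms)
  qed
  have sG: "sq_int M G"
  proof -
    obtain K where K: "\<And>x. norm (G x) \<le> norm x * K" using bounded_linear.bounded[OF bG] by blast
    have "G \<in> borel_measurable M" by (simp add: borel_measurable_continuous_onI linear_continuous_on[OF bG])
    then show ?thesis using K by (intro sq_int_bound[OF id_sq_int, of _ K]) (auto simp: mult.commute)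
  qed
  have u0: "(\<integral>x. u x $ k \<partial>M) = 0" for k
    using sq_int_imp_integrable[OF sjj] ij by (cases "k = i"; cases "k = j") (simp_all add: u_def ujj uij)
  have G0: "(\<integral>x. G x $ k $ l \<partial>M) = 0" for k l
    using ij by (cases "k = i"; cases "k = j"; cases "l = i"; cases "l = j") (simp_all add: G_def coord_mean)
  have "Ck 1 (\<lambda>x. u x $ k) \<and> pd l (\<lambda>x. u x $ k) x = G x $ k $ l" for k l x
  proof -
    note d = differentiable_coord
    have "Ck 1 (\<lambda>x::real^'n. x $ j * x $ j - 1)" "Ck 1 (\<lambda>x::real^'n. (- 1) * (x $ i * x $ j))"
      by (intro Ck_diff Ck_cmult Ck_mult Ck_coord Ck_const)+
    moreover have "pd l (\<lambda>x. x $ j * x $ j - 1) x = (if l = j then 2 * x $ j else 0)"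
      by (subst pd_diff) (auto intro!: derivative_intros d simp: pd_mult d pd_coord)
    moreover have "pd l (\<lambda>x. (- 1) * (x $ i * x $ j)) x = (if l = i then - x $ j else if l = j then - x $ i else 0)"
      by (subst pd_cmult) (use ij in \<open>auto intro!: derivative_intros d simp: pd_mult d pd_coord\<close>)
    ultimately show ?thesis
      using ij by (cases "k = i"; cases "k = j") (simp_all add: u_def G_def del: One_nat_def Ck.simps)
  qed
  then have C: "Ck 1 (\<lambda>x. u x $ k)" and p: "pd l (\<lambda>x. u x $ k) x = G x $ k $ l" for k l x by blast+
  have J: "weak_jacobian u G"
    unfolding weak_jacobian_def
  proof (intro conjI ballI allI)
    show "locally_integrable u" "locally_integrable G" by (rule sq_int_loc_int, fact)+
    fix \<psi> :: "real^'n \<Rightarrow> real" and k l assume \<psi>: "\<psi> \<in> test_functions"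
    have "(\<integral>x. pd l \<psi> x * u x $ k \<partial>lborel) = - (\<integral>x. \<psi> x * pd l (\<lambda>x. u x $ k) x \<partial>lborel)"
      by (intro integral_by_parts C test_Ck test_bsupp \<psi>)
    then show "(\<integral>x. u x $ k * pd l \<psi> x \<partial>lborel) = - (\<integral>x. G x $ k $ l * \<psi> x \<partial>lborel)"
      by (simp add: p mult.commute)
  qed
  have nc: "nsq M (\<lambda>x. c * x $ k) = c\<^sup>2" for c k
    using nsq_scaleR[of M c "\<lambda>x. x $ k"] by (simp add: nsq_coord)
  have nm: "nsq M (\<lambda>x. - x $ k) = 1" for k using nc[of "-1" k] by simp
  have nz: "nsq M (\<lambda>x::real^'n. 0 :: real) = 0" by (simp add: nsq_def)
  have nu: "nsq M u = 3"
  proof -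
    have "nsq M u = nsq M (\<lambda>x. u x $ i) + nsq M (\<lambda>x. u x $ j)"
      unfolding nsq_vec[OF su] by (rule sum_two[OF ij]) (simp add: u_def nz)
    also have "nsq M (\<lambda>x. u x $ j) = 1"
      using ij nij nsq_scaleR[of M "-1" "\<lambda>x. x $ i * x $ j"] by (simp add: u_def)
    also have "nsq M (\<lambda>x. u x $ i) = 2"
      using nsq_diff[OF sjj sq_int_const[of 1]] by (simp add: u_def njj nsq_const ip_const[OF sjj] ujj)
    finally show ?thesis by simp
  qed
  have nG: "nsq M G = 6"
  proof -
    have "nsq M G = (\<Sum>l\<in>UNIV. nsq M (\<lambda>x. G x $ i $ l)) + (\<Sum>l\<in>UNIV. nsq M (\<lambda>x. G x $ j $ l))"
      unfolding nsq_matrix[OF sG] by (rule sum_two[OF ij]) (simp add: G_def nz)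
    also have "(\<Sum>l\<in>UNIV. nsq M (\<lambda>x. G x $ i $ l)) = nsq M (\<lambda>x. G x $ i $ i) + nsq M (\<lambda>x. G x $ i $ j)"
      by (rule sum_two[OF ij]) (use ij in \<open>simp add: G_def nz\<close>)
    also have "\<dots> = 4" using ij by (simp add: G_def nz nc)
    also have "(\<Sum>l\<in>UNIV. nsq M (\<lambda>x. G x $ j $ l)) = nsq M (\<lambda>x. G x $ j $ i) + nsq M (\<lambda>x. G x $ j $ j)"
      by (rule sum_two[OF ij]) (use ij in \<open>simp add: G_def nz\<close>)
    also have "\<dots> = 2" using ij by (simp add: G_def nm)
    finally show ?thesis by simp
  qed
  have ns: "nsq M (\<lambda>x. sym_part (G x)) = 3 / 2"
  proof -
    let ?S = "\<lambda>k l x. sym_part (G x) $ k $ l"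
    have S: "?S i i = (\<lambda>x. 0)" "?S i j = (\<lambda>x. (1 / 2) * x $ j)" "?S j i = (\<lambda>x. (1 / 2) * x $ j)" "?S j j = (\<lambda>x. - x $ i)"
      using ij by (auto simp: sym_part_nth G_def fun_eq_iff)
    have "nsq M (\<lambda>x. sym_part (G x)) = (\<Sum>l\<in>UNIV. nsq M (?S i l)) + (\<Sum>l\<in>UNIV. nsq M (?S j l))"
      unfolding nsq_matrix[OF sym_sq_int[OF sG]]
      by (rule sum_two[OF ij]) (auto simp: sym_part_nth G_def nz intro!: sum.neutral)
    also have "(\<Sum>l\<in>UNIV. nsq M (?S i l)) = nsq M (?S i i) + nsq M (?S i j)"
      by (rule sum_two[OF ij]) (use ij in \<open>simp add: sym_part_nth G_def nz\<close>)
    also have "(\<Sum>l\<in>UNIV. nsq M (?S j l)) = nsq M (?S j i) + nsq M (?S j j)"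
      by (rule sum_two[OF ij]) (use ij in \<open>simp add: sym_part_nth G_def nz\<close>)
    finally show ?thesis unfolding S by (simp only: nc nm nz) (simp add: power2_eq_square)
  qed
  note * = extremal_field[OF J su sG u0 G0 nu nG ns]
  show "korn (gaussian :: real^'n \<Rightarrow> real) C \<Longrightarrow> 4 \<le> C" by (rule *(1))
  show "poincare_korn (gaussian :: real^'n \<Rightarrow> real) C \<Longrightarrow> 2 \<le> C" by (rule *(2))
qed

theorem theorem1:
  assumes "2 \<le> CARD('n::finite)"
  shows
    "(\<forall>(\<phi> :: real^'n \<Rightarrow> real) CP.
        normalized \<phi> \<and> regular_potential \<phi> \<and> optimal (poincare \<phi>) CP \<longrightarrow>
        (\<forall>u\<in>H1 \<phi>.
           (INF R\<in>rotations. L2sq \<phi> (weak_D (\<lambda>x. u x - R x)))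
             = L2sq \<phi> (\<lambda>x. weak_D u x - proj_skew \<phi> (weak_D u) x) \<and>
           (INF R\<in>rotations. L2sq \<phi> (\<lambda>x. u x - mean \<phi> u - R x))
             = L2sq \<phi> (\<lambda>x. u x - mean \<phi> u - proj_rot \<phi> u x)) \<and>
        (\<exists>CK CPK CSPK.
           korn \<phi> CK \<and> poincare_korn \<phi> CPK \<and> strong_poincare_korn \<phi> CSPK \<and>
           (\<forall>C C'. growth_constants \<phi> C C' \<longrightarrow>
              CK \<le> korn_bound CP C C' \<and>
              CPK \<le> poincare_korn_bound CP C C' \<and>
              CSPK \<le> strong_poincare_korn_bound CP C C'))) \<and>
     optimal (korn (gaussian :: real^'n \<Rightarrow> real)) 4 \<and>
     optimal (poincare_korn (gaussian :: real^'n \<Rightarrow> real)) 2"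
proof (intro conjI allI impI ballI)
  fix \<phi> :: "real^'n \<Rightarrow> real" and CP
  assume "normalized \<phi> \<and> regular_potential \<phi> \<and> optimal (poincare \<phi>) CP"
  then have n: "normalized \<phi>" and r: "regular_potential \<phi>" and P: "poincare \<phi> CP"
    by (auto simp: optimal_def)
  interpret gibbs_centred \<phi> CP
    using n r P by unfold_locales (auto simp only: normalized_def regular_potential_def)
  \<comment> \<open>One admissible pair is fixed here for its coercivity constant, on which the
    existence of the projection onto rotations rests.\<close>
  obtain C C' where growth: "growth_constants \<phi> C C'" using growth_constants_exist[OF r] by blast
  show "\<exists>CK CPK CSPK. korn \<phi> CK \<and> poincare_korn \<phi> CPK \<and> strong_poincare_korn \<phi> CSPK \<and>
      (\<forall>C C'. growth_constants \<phi> C C' \<longrightarrow> CK \<le> korn_bound CP C C' \<and>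
        CPK \<le> poincare_korn_bound CP C C' \<and> CSPK \<le> strong_poincare_korn_bound CP C C')"
    by (rule constants_exist[OF growth_constants_exist[OF r]])
  fix u assume u: "u \<in> H1 \<phi>"
  show "(INF R\<in>rotations. L2sq \<phi> (weak_D (\<lambda>x. u x - R x)))
      = L2sq \<phi> (\<lambda>x. weak_D u x - proj_skew \<phi> (weak_D u) x)"
    by (rule korn_INF[OF u])
  show "(INF R\<in>rotations. L2sq \<phi> (\<lambda>x. u x - mean \<phi> u - R x))
      = L2sq \<phi> (\<lambda>x. u x - mean \<phi> u - proj_rot \<phi> u x)"
  proof (rule proj_rotE[OF growth_coercive[OF growth] H1_weak_D(1)[OF u]])
    fix B
    assume "proj_rot \<phi> u = (\<lambda>x. B *v x)"
      "(INF R\<in>rotations. L2sq \<phi> (\<lambda>x. u x - mean \<phi> u - R x)) = L2sq \<phi> (\<lambda>x. u x - mean \<phi> u - B *v x)"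
    then show ?thesis by simp
  qed
next
  interpret gaussian_measure "gaussian :: real^'n \<Rightarrow> real" 1 by (rule gaussian_measure_gaussian)
  show "optimal (korn (gaussian :: real^'n \<Rightarrow> real)) 4"
    unfolding optimal_def using gaussian_korn gaussian_constants_ge(1)[OF assms] by blast
  show "optimal (poincare_korn (gaussian :: real^'n \<Rightarrow> real)) 2"
    unfolding optimal_def using gaussian_poincare_korn gaussian_constants_ge(2)[OF assms] by blast
qed

end
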